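(* Let $F$ be a field of characteristic $\neq2$ and let $\mathfrak f_4,\mathfrak e_6,\mathfrak e_7,\mathfrak e_8$ be the Lie algebras over $F$ described in the context, with their subalgebras $\mathfrak c_3\subset\mathfrak f_4$, $\mathfrak a_5\subset\mathfrak e_6$, $\mathfrak d_6\subset\mathfrak e_7$, $\mathfrak e_7\subset\mathfrak e_8$. Put $$\mathcal T_{\mathfrak e_8,\mathfrak e_7}=\bigoplus_{\sigma\in\mathcal S_{\mathfrak e_8}\setminus\mathcal S_{\mathfrak e_7}}V(\sigma\setminus\{8\}),\qquad \mathcal T_{\mathfrak e_7,\mathfrak d_6}=\bigoplus_{\sigma\in\mathcal S_{\mathfrak e_7}\setminus\mathcal S_{\mathfrak d_6}}V(\sigma\setminus\{4\}),$$ $$\mathcal T_{\mathfrak e_6,\mathfrak a_5}=\bigoplus_{\sigma\in\mathcal S_{\mathfrak f_4}\setminus\mathcal S_{\mathfrak c_3}}\tilde V(\sigma\setminus\{4\}),\qquad \mathcal T_{\mathfrak f_4,\mathfrak c_3}=\bigoplus_{\sigma\in\mathcal S_{\mathfrak f_4}\setminus\mathcal S_{\mathfrak c_3}}V(\sigma\setminus\{4\}),$$ where $\tilde V(\{1,2,3\})=V(\{1,2,3\})$ and $\tilde V(\{i\})=V_i\otimes E$. Then, moving the factor $V_8$ (resp. $V_4$) to the last position, there are $\mathbb Z_2$-gradings $$\mathfrak e_8=(\mathfrak e_7\oplus\mathfrak{sp}(V_8))\oplus(\mathcal T_{\mathfrak e_8,\mathfrak e_7}\otimes V_8),\quad \mathfrak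 e_7=(\mathfrak d_6\oplus\mathfrak{sp}(V_4))\oplus(\mathcal T_{\mathfrak e_7,\mathfrak d_6}\otimes V_4),$$ $$\mathfrak e_6=(\mathfrak a_5\oplus\mathfrak{sp}(V_4))\oplus(\mathcal T_{\mathfrak e_6,\mathfrak a_5}\otimes V_4),\quad \mathfrak f_4=(\mathfrak c_3\oplus\mathfrak{sp}(V_4))\oplus(\mathcal T_{\mathfrak f_4,\mathfrak c_3}\otimes V_4).$$ In each case, writing the decomposition as $(\mathfrak s\oplus\mathfrak{sp}(W))\oplus(\mathcal T\otimes W)$, the bracket of odd elements has the form $[x\otimes u,y\otimes v]=\langle u|v\rangle d_{x,y}+(x|y)\gamma_{u,v}$ for a nondegenerate alternating bilinear form $(\cdot|\cdot)$ on $\mathcal T$ and a symmetric bilinear map $d:\mathcal T\times\mathcal T\to\mathfrak s$, and $\mathcal T$ with $(\cdot|\cdot)$ and the triple product $xyz=d_{x,y}(z)-(x|z)y-(y|z)x$ is a simple Freudenthal triple system. The dimensions of $\mathcal T_{\mathfrak e_8,\mathfrak e_7},\mathcal T_{\mathfrak e_7,\mathfrak d_6},\mathcal T_{\mathfrak e_6,\mathfrak a_5},\mathcal T_{\mathfrak f_4,\mathfrak c_3}$ are $56,32,20,14$ respectively.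
   Context: Freudenthal triple system: a vector space $T$ with a nonzero alternating bilinear form $(\cdot|\cdot)$ and a trilinear product $xyz$ such that $xyz$ is symmetric in its arguments, $(x|yzt)$ is symmetric in its arguments, and $(xyy)xz+(yxx)yz+(xyy|z)x+(yxx|z)y+(x|z)xyy+(y|z)yxx=0$ for all $x,y,z,t$. It is simple if the triple product is nonzero and the only subspaces $J$ with $JTT\subseteq J$ are $0$ and $T$. $V$ is a two-dimensional $F$-vector space with a nonzero skew-symmetric bilinear form $\langle\cdot|\cdot\rangle$; $\mathfrak{sp}(V)=\mathfrak{sl}(V)$ is spanned by $\gamma_{a,b}=\langle a|\cdot\rangle b+\langle b|\cdot\rangle a$. For $n\in\mathbb N$, $\nu_i:\mathfrak{sp}(V)\to\mathfrak{sp}(V)^n$ is the inclusion as $i$-th component (its image is denoted $\mathfrak{sp}(V_i)$), $V_i$ is the $\mathfrak{sp}(V)^n$-module $V$ on which only the $i$-th component acts. For $\sigma\subseteq\{1,\dots,n\}$: $V(\emptyset)=\mathfrak{sp}(V)^n$, $V(\sigma)=V_{i_1}\otimes\cdots\otimes V_{i_r}$ if $\sigma=\{i_1<\dots<i_r\}$; $\sigma+\tau$ is the symmetric difference (subsets being identified with elements of $\mathbb Z_2^n$). $\varphi_{\sigma,\tau}:V(\sigma)\times V(\tau)\to V(\sigma+\tau)$ is: for $\sigma\ne\tau$ both nonempty, contraction by $\langle\cdot|\cdot\rangle$ (argument from $V(\sigma)$ on the left) in all indices of $\sigma\cap\tau$, remaining factors put in increasing order of index; $\varphi_{\emptyset,\emptyset}$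 the Lie bracket; $\varphi_{\emptyset,\sigma}=-\varphi_{\sigma,\emptyset}$ (arguments interchanged) the natural action; $\varphi_{\sigma,\sigma}(v_{i_1}\otimes\cdots\otimes v_{i_r},w_{i_1}\otimes\cdots\otimes w_{i_r})=-\frac12\sum_j\bigl(\prod_{k\ne j}\langle v_{i_k}|w_{i_k}\rangle\bigr)\nu_{i_j}(\gamma_{v_{i_j},w_{i_j}})$ for $\sigma\neq\emptyset$. $\mathfrak e_8$ ($n=8$): $\chi_4:\mathbb Z_2^4\to\mathbb Z_2^8$, $\chi_4(x)=(x_1+x_3+x_4,x_1+x_2+x_3+x_4,x_2+x_3+x_4,x_3+x_4,x_1+x_4,x_1+x_2+x_4,x_2+x_4,x_4)$, $\mathcal S_{\mathfrak e_8}=\chi_4(\mathbb Z_2^4\setminus\{(0,0,0,1)\})$, $g(x,y)=\sum_{1\le j\le i\le3}x_iy_j+x_3y_4+x_4y_3+x_1y_2y_3+x_2y_1y_3+x_3y_1y_2$; $\mathfrak e_8=\bigoplus_{\sigma\in\mathcal S_{\mathfrak e_8}}V(\sigma)$, $[x_\sigma,y_\tau]=(-1)^{g(\chi_4^{-1}(\sigma),\chi_4^{-1}(\tau))}\varphi_{\sigma,\tau}(x_\sigma,y_\tau)$ if $\sigma+\tau\in\mathcal S_{\mathfrak e_8}$, and $0$ if $\sigma+\tau=\{1,\dots,8\}$. $\mathfrak e_7$ ($n=7$): $\mathcal S_{\mathfrak e_7}=\{\emptyset,\{1,2,5,6\},\{2,3,6,7\},\{1,3,5,7\},\{1,2,3,4\},\{3,4,5,6\},\{1,4,6,7\},\{2,4,5,7\}\}=\{\sigma\in\mathcal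 S_{\mathfrak e_8}:8\notin\sigma\}$; $\mathfrak e_7=\bigoplus_{\sigma\in\mathcal S_{\mathfrak e_7}}V(\sigma)$ with the bracket restricted from $\mathfrak e_8$ (where $V(\emptyset)=\mathfrak{sp}(V)^7$ is the sum of the first seven copies). $\mathfrak d_6$: the subalgebra $\bigoplus_{\sigma\in\mathcal S_{\mathfrak d_6}}V(\sigma)$ of $\mathfrak e_7$, with $\mathcal S_{\mathfrak d_6}=\{\emptyset,\{1,2,5,6\},\{2,3,6,7\},\{1,3,5,7\}\}$ and $V(\emptyset)=\mathfrak{sp}(V)^6$ the sum of the copies with indices $1,2,3,5,6,7$. $\mathfrak f_4$ ($n=4$): $I=\{1,2,3,4\}$, $A=\{\{1,2\},\{2,3\},\{1,3\}\}$, $\bar\alpha=I\setminus\alpha$, $\mathcal S_{\mathfrak f_4}=\{\emptyset,I\}\cup A\cup\{\bar\alpha:\alpha\in A\}$; $\mathfrak f_4=\bigoplus_{\sigma\in\mathcal S_{\mathfrak f_4}}V(\sigma)$, $[x_\sigma,y_\tau]=\epsilon_{\mathfrak f_4}(\sigma,\tau)\varphi_{\sigma,\tau}(x_\sigma,y_\tau)$, where $\epsilon_{\mathfrak f_4}(\emptyset,\sigma)=\epsilon_{\mathfrak f_4}(\sigma,\emptyset)=1$; $\epsilon_{\mathfrak f_4}(I,I)=-1$; for $\alpha\in A$: $\epsilon_{\mathfrak f_4}(\alpha,I)=1$, $\epsilon_{\mathfrak f_4}(I,\alpha)=-1$, $\epsilon_{\mathfrak f_4}(I,\bar\alpha)=1$,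 $\epsilon_{\mathfrak f_4}(\bar\alpha,I)=-1$, $\epsilon_{\mathfrak f_4}(\alpha,\alpha)=\epsilon_{\mathfrak f_4}(\bar\alpha,\bar\alpha)=\epsilon_{\mathfrak f_4}(\alpha,\bar\alpha)=-2$, $\epsilon_{\mathfrak f_4}(\bar\alpha,\alpha)=2$; for $\alpha\ne\beta$ in $A$: $\epsilon_{\mathfrak f_4}(\alpha,\beta)=1$, $\epsilon_{\mathfrak f_4}(\alpha,\bar\beta)=\epsilon_{\mathfrak f_4}(\bar\alpha,\beta)=\epsilon_{\mathfrak f_4}(\bar\alpha,\bar\beta)=-1$. $\mathfrak c_3$: the subalgebra $\bigoplus_{\sigma\in\mathcal S_{\mathfrak c_3}}V(\sigma)$ with $\mathcal S_{\mathfrak c_3}=\{\emptyset\}\cup A$ and $V(\emptyset)=\mathfrak{sp}(V)^3$ (the first three copies). $\mathfrak e_6$: $\mathfrak t_2=\{(\alpha_0,\alpha_1,\alpha_2)\in F^3:\sum\alpha_i=0\}$ (abelian), $E=Fe^+\oplus Fe^-$; $\mathfrak e_6=\bigoplus_{\sigma\in\mathcal S_{\mathfrak f_4}}\tilde V(\sigma)$, $\tilde V(\emptyset)=\mathfrak{sp}(V)^4\oplus\mathfrak t_2$, $\tilde V(I)=V(I)$, $\tilde V(\sigma)=V(\sigma)\otimes E$ otherwise; $[x_\sigma,y_\tau]=\epsilon_{\mathfrak e_6}(\sigma,\tau)\tilde\varphi_{\sigma,\tau}(x_\sigma,y_\tau)$ with $\epsilon_{\mathfrak e_6}=\frac12\epsilon_{\mathfrak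 f_4}$ if $\sigma,\tau\notin\{\emptyset,I\}$ and $\tau\in\{\sigma,\bar\sigma\}$, $\epsilon_{\mathfrak e_6}=\epsilon_{\mathfrak f_4}$ otherwise. Here $a_\sigma=a_{\bar\sigma}$, $a_{\{1,2\}}=(1,-\frac12,-\frac12)$, $a_{\{2,3\}}=(-\frac12,1,-\frac12)$, $a_{\{1,3\}}=(-\frac12,-\frac12,1)$; the $\sigma$-action of $\mathfrak t_2$ on $E$ is $(\alpha_0,\alpha_1,\alpha_2).e^\pm=\pm\alpha_ie^\pm$ with $i=0$ for $\sigma=\{1,2\},\{3,4\}$, $i=1$ for $\{2,3\},\{1,4\}$, $i=2$ for $\{1,3\},\{2,4\}$. $\tilde\varphi_{\emptyset,\emptyset}$ is the bracket of the direct sum; $\tilde\varphi_{\emptyset,\sigma}=-\tilde\varphi_{\sigma,\emptyset}$ (arguments interchanged) is the action of $\mathfrak{sp}(V)^4\oplus\mathfrak t_2$ ($\mathfrak{sp}(V)^4$ on $V(\sigma)$; $\mathfrak t_2$ by the $\sigma$-action on $E$ if $\sigma\neq I$, trivially if $\sigma=I$); $\tilde\varphi_{I,I}=\varphi_{I,I}$; for $\sigma,\tau\ne\emptyset,I$ and $\nu,\nu'\in\{+,-\}$: $\tilde\varphi_{I,\sigma}(x,y\otimes e)=\varphi_{I,\sigma}(x,y)\otimes e=\tilde\varphi_{\sigma,I}(y\otimes e,x)$; $\tilde\varphi_{\sigma,\sigma}(v_i\otimes v_j\otimes e^\nu,w_i\otimes w_j\otimes e^{\nu'})=\delta_{\nu,-\nu'}(\varphi_{\sigma,\sigma}(v_i\otimes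 v_j,w_i\otimes w_j)+\nu\langle v_i|w_i\rangle\langle v_j|w_j\rangle a_\sigma)$ for $\sigma=\{i,j\}$; $\tilde\varphi_{\sigma,\bar\sigma}(x\otimes e^\nu,y\otimes e^{\nu'})=\delta_{\nu,-\nu'}\varphi_{\sigma,\bar\sigma}(x,y)$; $\tilde\varphi_{\sigma,\tau}(x\otimes e^\nu,y\otimes e^{\nu'})=\delta_{\nu,\nu'}\varphi_{\sigma,\tau}(x,y)\otimes e^{-\nu}$ if $\tau\ne\sigma,\bar\sigma$. $\mathfrak a_5$: the subalgebra $(\mathfrak{sp}(V)^3\oplus\mathfrak t_2)\oplus\bigoplus_{\alpha\in A}\tilde V(\alpha)$ (first three copies of $\mathfrak{sp}(V)$). All of these are Lie algebras. *)

theory Defs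
  imports Complex_Main "HOL-Library.Function_Algebras" "HOL-Library.Product_Plus"
begin

section \<open>The plane V and tensor products of copies of it\<close>

text \<open>The basis only serves to write down coordinates of tensors. It need not be symplectic:
  the value of the form on it is an arbitrary nonzero scalar.\<close>

record ('a, 'v) plane =
  scl :: "'a \<Rightarrow> 'v \<Rightarrow> 'v"
  form :: "'v \<Rightarrow> 'v \<Rightarrow> 'a"
  bas :: "bool \<Rightarrow> 'v"

definition symplectic_plane :: "('a::field, 'v::ab_group_add) plane \<Rightarrow> bool" where
  "symplectic_plane P \<longleftrightarrow>
     vector_space (scl P) \<and>
     inj (bas P) \<and> \<not> module.dependent (scl P) (range (bas P)) \<and>
     module.span (scl P) (range (bas P)) = UNIV \<and>
     (\<forall>u. Vector_Spaces.linear (scl P) (*) (\<lambda>v. form P u v)) \<and>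
     (\<forall>v. Vector_Spaces.linear (scl P) (*) (\<lambda>u. form P u v)) \<and>
     (\<forall>u v. form P u v = - form P v u) \<and>
     (\<exists>u v. form P u v \<noteq> 0)"

definition gam :: "('a::field, 'v::ab_group_add) plane \<Rightarrow> 'v \<Rightarrow> 'v \<Rightarrow> 'v \<Rightarrow> 'v" where
  "gam P a b = (\<lambda>v. scl P (form P a v) b + scl P (form P b v) a)"

definition sp :: "('a::field, 'v::ab_group_add) plane \<Rightarrow> ('v \<Rightarrow> 'v) set" where
  "sp P = module.span (\<lambda>c f v. scl P c (f v)) {gam P a b | a b. True}"

text \<open>Elements of powers of \<open>sp(V)\<close> are families indexed by \<open>nat\<close> that vanish outside the index set.\<close>

definition sps :: "('a, 'v) plane \<Rightarrow> 'a \<Rightarrow> (nat \<Rightarrow> 'v \<Rightarrow> 'v) \<Rightarrow> nat \<Rightarrow> 'v \<Rightarrow> 'v" where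
  "sps P c g = (\<lambda>i v. scl P c (g i v))"

definition nu :: "nat \<Rightarrow> ('v \<Rightarrow> 'v::zero) \<Rightarrow> nat \<Rightarrow> 'v \<Rightarrow> 'v" where
  "nu i f = (\<lambda>j. if j = i then f else 0)"

text \<open>A tensor in \<open>V(\<sigma>)\<close> is given by its coordinates with respect to the basis of pure tensors of
  basis vectors; a subset \<open>\<kappa>\<close> of \<open>\<sigma>\<close> stands for the pure tensor whose factor with index \<open>i\<close>
  is \<open>bas P (i \<in> \<kappa>)\<close>. The coordinates outside \<open>Pow \<sigma>\<close> are 0.\<close>

type_synonym 'a tensor = "nat set \<Rightarrow> 'a"

definition ts :: "'a::times \<Rightarrow> 'a tensor \<Rightarrow> 'a tensor" where
  "ts c x = (\<lambda>\<kappa>. c * x \<kappa>)"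

definition tensor_space :: "nat set \<Rightarrow> ('a::zero) tensor set" where
  "tensor_space \<sigma> = {x. \<forall>\<kappa>. \<not> \<kappa> \<subseteq> \<sigma> \<longrightarrow> x \<kappa> = 0}"

definition coord :: "('a::field, 'v::ab_group_add) plane \<Rightarrow> 'v \<Rightarrow> bool \<Rightarrow> 'a" where
  "coord P u j = module.representation (scl P) (range (bas P)) u (bas P j)"

definition pure :: "('a::field, 'v::ab_group_add) plane \<Rightarrow> nat set \<Rightarrow> (nat \<Rightarrow> 'v) \<Rightarrow> 'a tensor" where
  "pure P \<sigma> v = (\<lambda>\<kappa>. if \<kappa> \<subseteq> \<sigma> then \<Prod>i\<in>\<sigma>. coord P (v i) (i \<in> \<kappa>) else 0)"

definition bfam :: "('a, 'v) plane \<Rightarrow> nat set \<Rightarrow> nat \<Rightarrow> 'v" where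
  "bfam P \<kappa> = (\<lambda>i. bas P (i \<in> \<kappa>))"

text \<open>(Bi)linear extension of maps prescribed on pure tensors; \<open>s\<close> is the scalar multiplication
  of the target. The lemmas at the end of the next section show that the prescribed
  formulas then hold for all pure tensors.\<close>

definition linext :: "('a, 'v) plane \<Rightarrow> ('a \<Rightarrow> 'b \<Rightarrow> 'b::comm_monoid_add) \<Rightarrow> nat set \<Rightarrow>
    ((nat \<Rightarrow> 'v) \<Rightarrow> 'b) \<Rightarrow> 'a tensor \<Rightarrow> 'b" where
  "linext P s \<sigma> F x = (\<Sum>\<kappa>\<in>Pow \<sigma>. s (x \<kappa>) (F (bfam P \<kappa>)))"

definition bilext :: "('a, 'v) plane \<Rightarrow> ('a \<Rightarrow> 'b \<Rightarrow> 'b::comm_monoid_add) \<Rightarrow> nat set \<Rightarrow> nat set \<Rightarrow>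
    ((nat \<Rightarrow> 'v) \<Rightarrow> (nat \<Rightarrow> 'v) \<Rightarrow> 'b) \<Rightarrow> 'a tensor \<Rightarrow> 'a tensor \<Rightarrow> 'b" where
  "bilext P s \<sigma> \<tau> F x y = linext P s \<sigma> (\<lambda>v. linext P s \<tau> (F v) y) x"


section \<open>The maps \<open>\<phi>\<close>\<close>

definition sp_bracket :: "(nat \<Rightarrow> 'v \<Rightarrow> 'v::ab_group_add) \<Rightarrow> (nat \<Rightarrow> 'v \<Rightarrow> 'v) \<Rightarrow> nat \<Rightarrow> 'v \<Rightarrow> 'v" where
  "sp_bracket g h = (\<lambda>i v. g i (h i v) - h i (g i v))"

definition act :: "('a::field, 'v::ab_group_add) plane \<Rightarrow> nat set \<Rightarrow> (nat \<Rightarrow> 'v \<Rightarrow> 'v) \<Rightarrow>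
    'a tensor \<Rightarrow> 'a tensor" where
  "act P \<sigma> g = linext P ts \<sigma> (\<lambda>v. \<Sum>i\<in>\<sigma>. pure P \<sigma> (v(i := g i (v i))))"

definition contr :: "('a::field, 'v::ab_group_add) plane \<Rightarrow> nat set \<Rightarrow> nat set \<Rightarrow>
    'a tensor \<Rightarrow> 'a tensor \<Rightarrow> 'a tensor" where
  "contr P \<sigma> \<tau> = bilext P ts \<sigma> \<tau> (\<lambda>v w.
     ts (\<Prod>i\<in>\<sigma> \<inter> \<tau>. form P (v i) (w i)) (pure P (sym_diff \<sigma> \<tau>) (\<lambda>i. if i \<in> \<sigma> then v i else w i)))"

definition diag :: "('a::field, 'v::ab_group_add) plane \<Rightarrow> nat set \<Rightarrow>
    'a tensor \<Rightarrow> 'a tensor \<Rightarrow> nat \<Rightarrow> 'v \<Rightarrow> 'v" where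
  "diag P \<sigma> = bilext P (sps P) \<sigma> \<sigma> (\<lambda>v w.
     sps P (- (1 / 2)) (\<Sum>j\<in>\<sigma>. sps P (\<Prod>k\<in>\<sigma> - {j}. form P (v k) (w k)) (nu j (gam P (v j) (w j)))))"

definition tform :: "('a::field, 'v::ab_group_add) plane \<Rightarrow> nat set \<Rightarrow> 'a tensor \<Rightarrow> 'a tensor \<Rightarrow> 'a" where
  "tform P \<sigma> = bilext P (*) \<sigma> \<sigma> (\<lambda>v w. \<Prod>i\<in>\<sigma>. form P (v i) (w i))"

text \<open>The formulas prescribed on pure tensors hold for all of them, not only for tensor products
  of basis vectors.\<close>

lemma vs_ts: "vector_space (ts :: 'a::field \<Rightarrow> 'a tensor \<Rightarrow> 'a tensor)"
  by unfold_locales (auto simp: ts_def fun_eq_iff algebra_simps)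

lemma vs_sps: "symplectic_plane P \<Longrightarrow> vector_space (sps P)"
  unfolding symplectic_plane_def sps_def vector_space_def by (auto simp: fun_eq_iff)

lemma vs_mult: "vector_space ((*) :: 'a::field \<Rightarrow> 'a \<Rightarrow> 'a)"
  by unfold_locales (auto simp: algebra_simps)

lemma coord_expand:
  assumes P: "symplectic_plane P"
  shows "u = scl P (coord P u False) (bas P False) + scl P (coord P u True) (bas P True)"
proof -
  interpret vector_space "scl P" using P by (simp add: symplectic_plane_def)
  have "(\<Sum>b\<in>range (bas P). scl P (representation (range (bas P)) u b) b) = u"
    using P by (intro sum_representation_eq) (auto simp: symplectic_plane_def)
  moreover have "inj (bas P)" using P by (simp add: symplectic_plane_def)
  ultimately show ?thesis
    by (simp add: sum.reindex coord_def UNIV_bool)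
qed

lemma coord_linear:
  assumes P: "symplectic_plane P"
  shows "coord P (u + v) j = coord P u j + coord P v j" "coord P (scl P c u) j = c * coord P u j"
proof -
  interpret vector_space "scl P" using P by (simp add: symplectic_plane_def)
  show "coord P (u + v) j = coord P u j + coord P v j" "coord P (scl P c u) j = c * coord P u j"
    using P by (simp_all add: coord_def symplectic_plane_def representation_add representation_scale)
qed

lemma form_linear:
  assumes P: "symplectic_plane P"
  shows "form P (u + v) w = form P u w + form P v w" "form P (scl P c u) w = c * form P u w"
    "form P w (u + v) = form P w u + form P w v" "form P w (scl P c u) = c * form P w u"
proof -
  interpret A: Vector_Spaces.linear "scl P" "(*)" "\<lambda>u. form P u w"
    using P unfolding symplectic_plane_def by blast
  interpret B: Vector_Spaces.linear "scl P" "(*)" "\<lambda>u. form P w u"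
    using P unfolding symplectic_plane_def by blast
  show "form P (u + v) w = form P u w + form P v w" "form P (scl P c u) w = c * form P u w"
    "form P w (u + v) = form P w u + form P w v" "form P w (scl P c u) = c * form P w u"
    by (fact A.add A.scale B.add B.scale)+
qed

lemma linext_pure:
  fixes P :: "('a::field, 'v::ab_group_add) plane" and s :: "'a \<Rightarrow> 'b::ab_group_add \<Rightarrow> 'b"
  assumes P: "symplectic_plane P" and s: "vector_space s" and fin: "finite \<sigma>"
    and local: "\<And>v w. (\<And>i. i \<in> \<sigma> \<Longrightarrow> v i = w i) \<Longrightarrow> F v = F w"
    and add: "\<And>v i u u'. i \<in> \<sigma> \<Longrightarrow> F (v(i := u + u')) = F (v(i := u)) + F (v(i := u'))"
    and scale: "\<And>v i c u. i \<in> \<sigma> \<Longrightarrow> F (v(i := scl P c u)) = s c (F (v(i := u)))"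
  shows "linext P s \<sigma> F (pure P \<sigma> v) = F v"
proof -
  interpret vector_space s by (rule s)
  have "F v = (\<Sum>\<kappa>\<in>Pow \<rho>. s (\<Prod>i\<in>\<rho>. coord P (v i) (i \<in> \<kappa>))
                          (F (\<lambda>i. if i \<in> \<rho> then bas P (i \<in> \<kappa>) else v i)))" if "\<rho> \<subseteq> \<sigma>" for \<rho> v
    using finite_subset[OF that fin] that
  proof (induction \<rho> arbitrary: v rule: finite_induct)
    case empty
    then show ?case by simp
  next
    case (insert j \<rho>)
    define Q where "Q \<kappa> v = s (\<Prod>i\<in>\<rho>. coord P (v i) (i \<in> \<kappa>))
       (F (\<lambda>i. if i \<in> \<rho> then bas P (i \<in> \<kappa>) else v i))" for \<kappa> and v :: "nat \<Rightarrow> 'v"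
    define R where "R \<kappa> = s (\<Prod>i\<in>insert j \<rho>. coord P (v i) (i \<in> \<kappa>))
       (F (\<lambda>i. if i \<in> insert j \<rho> then bas P (i \<in> \<kappa>) else v i))" for \<kappa>
    have IH: "F v = (\<Sum>\<kappa>\<in>Pow \<rho>. Q \<kappa> v)" for v
      unfolding Q_def by (rule insert.IH) (use insert.prems in simp)
    have j: "j \<in> \<sigma>" using insert.prems by simp
    have "v = v(j := scl P (coord P (v j) False) (bas P False) + scl P (coord P (v j) True) (bas P True))"
      by (simp add: coord_expand[OF P, symmetric])
    then have "F v = F (v(j := scl P (coord P (v j) False) (bas P False) + scl P (coord P (v j) True) (bas P True)))"
      by (rule arg_cong)
    also have "\<dots> = s (coord P (v j) False) (F (v(j := bas P False)))
        + s (coord P (v j) True) (F (v(j := bas P True)))"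
      by (simp add: add[OF j] scale[OF j])
    also have "\<dots> = (\<Sum>\<kappa>\<in>Pow \<rho>. s (coord P (v j) False) (Q \<kappa> (v(j := bas P False))))
        + (\<Sum>\<kappa>\<in>Pow \<rho>. s (coord P (v j) True) (Q \<kappa> (v(j := bas P True))))"
      by (simp add: IH scale_sum_right del: fun_upd_apply)
    also have "(\<Sum>\<kappa>\<in>Pow \<rho>. s (coord P (v j) False) (Q \<kappa> (v(j := bas P False)))) = (\<Sum>\<kappa>\<in>Pow \<rho>. R \<kappa>)"
    proof (rule sum.cong[OF refl])
      fix \<kappa> assume "\<kappa> \<in> Pow \<rho>"
      then have jk: "j \<notin> \<kappa>" using insert.hyps by auto
      have p: "(\<Prod>i\<in>\<rho>. coord P ((v(j := bas P False)) i) (i \<in> \<kappa>)) = (\<Prod>i\<in>\<rho>. coord P (v i) (i \<in> \<kappa>))"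
        using insert.hyps by (intro prod.cong) auto
      have f: "(\<lambda>i. if i \<in> \<rho> then bas P (i \<in> \<kappa>) else (v(j := bas P False)) i)
          = (\<lambda>i. if i \<in> insert j \<rho> then bas P (i \<in> \<kappa>) else v i)"
        using insert.hyps jk by (auto simp: fun_eq_iff)
      show "s (coord P (v j) False) (Q \<kappa> (v(j := bas P False))) = R \<kappa>"
        unfolding Q_def R_def p f using insert.hyps jk by simp
    qed
    also have "(\<Sum>\<kappa>\<in>Pow \<rho>. s (coord P (v j) True) (Q \<kappa> (v(j := bas P True))))
        = (\<Sum>\<kappa>\<in>Pow \<rho>. R (insert j \<kappa>))"
    proof (rule sum.cong[OF refl])
      fix \<kappa> assume "\<kappa> \<in> Pow \<rho>"
      have p: "(\<Prod>i\<in>\<rho>. coord P ((v(j := bas P True)) i) (i \<in> \<kappa>))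
          = (\<Prod>i\<in>\<rho>. coord P (v i) (i \<in> insert j \<kappa>))"
        using insert.hyps by (intro prod.cong) auto
      have f: "(\<lambda>i. if i \<in> \<rho> then bas P (i \<in> \<kappa>) else (v(j := bas P True)) i)
          = (\<lambda>i. if i \<in> insert j \<rho> then bas P (i \<in> insert j \<kappa>) else v i)"
        using insert.hyps by (auto simp: fun_eq_iff intro!: arg_cong[of _ _ "bas P"])
      show "s (coord P (v j) True) (Q \<kappa> (v(j := bas P True))) = R (insert j \<kappa>)"
        unfolding Q_def R_def p f using insert.hyps by simp
    qed
    also have "(\<Sum>\<kappa>\<in>Pow \<rho>. R (insert j \<kappa>)) = (\<Sum>\<kappa>\<in>insert j ` Pow \<rho>. R \<kappa>)"
    proof -
      have "inj_on (insert j) (Pow \<rho>)"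
        using insert.hyps by (intro inj_onI) (metis PowD insert_ident subsetD)
      then show ?thesis by (simp add: sum.reindex)
    qed
    also have "(\<Sum>\<kappa>\<in>Pow \<rho>. R \<kappa>) + (\<Sum>\<kappa>\<in>insert j ` Pow \<rho>. R \<kappa>) = (\<Sum>\<kappa>\<in>Pow (insert j \<rho>). R \<kappa>)"
      unfolding Pow_insert using insert.hyps by (subst sum.union_disjoint) auto
    finally show ?case unfolding R_def .
  qed
  from this[OF order_refl, of v] have "F v = (\<Sum>\<kappa>\<in>Pow \<sigma>. s (\<Prod>i\<in>\<sigma>. coord P (v i) (i \<in> \<kappa>))
                          (F (\<lambda>i. if i \<in> \<sigma> then bas P (i \<in> \<kappa>) else v i)))" .
  also have "\<dots> = (\<Sum>\<kappa>\<in>Pow \<sigma>. s (pure P \<sigma> v \<kappa>) (F (bfam P \<kappa>)))"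
  proof (rule sum.cong[OF refl])
    fix \<kappa> assume k: "\<kappa> \<in> Pow \<sigma>"
    have "F (\<lambda>i. if i \<in> \<sigma> then bas P (i \<in> \<kappa>) else v i) = F (bfam P \<kappa>)"
      by (rule local) (simp add: bfam_def)
    then show "s (\<Prod>i\<in>\<sigma>. coord P (v i) (i \<in> \<kappa>)) (F (\<lambda>i. if i \<in> \<sigma> then bas P (i \<in> \<kappa>) else v i))
        = s (pure P \<sigma> v \<kappa>) (F (bfam P \<kappa>))"
      using k by (simp add: pure_def)
  qed
  finally show ?thesis by (simp add: linext_def)
qed

lemma prod_update:
  assumes "finite \<sigma>" "i \<in> \<sigma>"
  shows "(\<Prod>k\<in>\<sigma>. h k ((v(i := u)) k)) = h i u * (\<Prod>k\<in>\<sigma> - {i}. h k (v k) :: 'a::comm_monoid_mult)"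
  using assms by (subst prod.remove[of _ i]) (auto intro!: prod.cong arg_cong2[of _ _ _ _ "(*)"])

lemma pure_local: "(\<And>i. i \<in> \<sigma> \<Longrightarrow> v i = w i) \<Longrightarrow> pure P \<sigma> v = pure P \<sigma> w"
  unfolding pure_def by (auto simp: fun_eq_iff intro!: prod.cong)

lemma pure_linear:
  assumes P: "symplectic_plane P" and "finite \<sigma>" "i \<in> \<sigma>"
  shows "pure P \<sigma> (v(i := u + u')) = pure P \<sigma> (v(i := u)) + pure P \<sigma> (v(i := u'))"
    "pure P \<sigma> (v(i := scl P c u)) = ts c (pure P \<sigma> (v(i := u)))"
  unfolding pure_def ts_def
  using prod_update[OF assms(2,3), of "\<lambda>k x. coord P x (k \<in> _)" v]
  by (auto simp: fun_eq_iff coord_linear[OF P] algebra_simps)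

lemma bilext_pure:
  fixes P :: "('a::field, 'v::ab_group_add) plane" and s :: "'a \<Rightarrow> 'b::ab_group_add \<Rightarrow> 'b"
  assumes P: "symplectic_plane P" and s: "vector_space s" and fin: "finite \<sigma>" "finite \<tau>"
    and "\<And>v v' w. (\<And>i. i \<in> \<sigma> \<Longrightarrow> v i = v' i) \<Longrightarrow> F v w = F v' w"
    and "\<And>v w w'. (\<And>i. i \<in> \<tau> \<Longrightarrow> w i = w' i) \<Longrightarrow> F v w = F v w'"
    and "\<And>v w i u u'. i \<in> \<sigma> \<Longrightarrow> F (v(i := u + u')) w = F (v(i := u)) w + F (v(i := u')) w"
    and "\<And>v w i c u. i \<in> \<sigma> \<Longrightarrow> F (v(i := scl P c u)) w = s c (F (v(i := u)) w)"
    and "\<And>v w i u u'. i \<in> \<tau> \<Longrightarrow> F v (w(i := u + u')) = F v (w(i := u)) + F v (w(i := u'))"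
    and "\<And>v w i c u. i \<in> \<tau> \<Longrightarrow> F v (w(i := scl P c u)) = s c (F v (w(i := u)))"
  shows "bilext P s \<sigma> \<tau> F (pure P \<sigma> v) (pure P \<tau> w) = F v w"
proof -
  have "linext P s \<tau> (F v) (pure P \<tau> w) = F v w" for v
    by (rule linext_pure[OF P s fin(2)]) (fact assms)+
  moreover have "linext P s \<sigma> (\<lambda>v. F v w) (pure P \<sigma> v) = F v w"
    by (rule linext_pure[OF P s fin(1)]) (fact assms)+
  ultimately show ?thesis by (simp add: bilext_def)
qed

lemma tform_pure:
  assumes P: "symplectic_plane P" and fin: "finite \<sigma>"
  shows "tform P \<sigma> (pure P \<sigma> v) (pure P \<sigma> w) = (\<Prod>i\<in>\<sigma>. form P (v i) (w i))"
  unfolding tform_def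
proof (rule bilext_pure[OF P vs_mult fin fin])
  fix v w :: "nat \<Rightarrow> 'b" and i u u' c
  assume i: "i \<in> \<sigma>"
  note p = prod_update[OF fin i, of "\<lambda>k x. form P x (w k)" v]
    prod_update[OF fin i, of "\<lambda>k x. form P (v k) x" w]
  show "(\<Prod>k\<in>\<sigma>. form P ((v(i := u + u')) k) (w k)) =
      (\<Prod>k\<in>\<sigma>. form P ((v(i := u)) k) (w k)) + (\<Prod>k\<in>\<sigma>. form P ((v(i := u')) k) (w k))"
    "(\<Prod>k\<in>\<sigma>. form P ((v(i := scl P c u)) k) (w k)) = c * (\<Prod>k\<in>\<sigma>. form P ((v(i := u)) k) (w k))"
    "(\<Prod>k\<in>\<sigma>. form P (v k) ((w(i := u + u')) k)) =
      (\<Prod>k\<in>\<sigma>. form P (v k) ((w(i := u)) k)) + (\<Prod>k\<in>\<sigma>. form P (v k) ((w(i := u')) k))"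
    "(\<Prod>k\<in>\<sigma>. form P (v k) ((w(i := scl P c u)) k)) = c * (\<Prod>k\<in>\<sigma>. form P (v k) ((w(i := u)) k))"
    unfolding p by (simp_all add: form_linear[OF P] algebra_simps)
qed (auto intro!: prod.cong)

lemma contr_pure:
  assumes P: "symplectic_plane P" and fin: "finite \<sigma>" "finite \<tau>"
  shows "contr P \<sigma> \<tau> (pure P \<sigma> v) (pure P \<tau> w) =
    ts (\<Prod>i\<in>\<sigma> \<inter> \<tau>. form P (v i) (w i)) (pure P (sym_diff \<sigma> \<tau>) (\<lambda>i. if i \<in> \<sigma> then v i else w i))"
  unfolding contr_def
proof (rule bilext_pure[OF P vs_ts fin])
  let ?F = "\<lambda>v w. ts (\<Prod>i\<in>\<sigma> \<inter> \<tau>. form P (v i) (w i)) (pure P (sym_diff \<sigma> \<tau>) (\<lambda>i. if i \<in> \<sigma> then v i else w i))"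
  have finI: "finite (\<sigma> \<inter> \<tau>)" and finD: "finite (sym_diff \<sigma> \<tau>)" using fin by auto
  interpret vector_space "ts :: 'a \<Rightarrow> 'a tensor \<Rightarrow> 'a tensor" by (rule vs_ts)
  {
    fix v v' w :: "nat \<Rightarrow> 'b" assume "\<And>i. i \<in> \<sigma> \<Longrightarrow> v i = v' i"
    then show "?F v w = ?F v' w"
      by (intro arg_cong2[of _ _ _ _ ts] prod.cong pure_local) auto
  next
    fix v w w' :: "nat \<Rightarrow> 'b" assume "\<And>i. i \<in> \<tau> \<Longrightarrow> w i = w' i"
    then show "?F v w = ?F v w'"
      by (intro arg_cong2[of _ _ _ _ ts] prod.cong pure_local) auto
  next
    fix v w :: "nat \<Rightarrow> 'b" and i u u' c
    assume i: "i \<in> \<sigma>"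
    have "?F (v(i := u + u')) w = ?F (v(i := u)) w + ?F (v(i := u')) w \<and>
        ?F (v(i := scl P c u)) w = ts c (?F (v(i := u)) w)"
    proof (cases "i \<in> \<tau>")
      case True
      then have iI: "i \<in> \<sigma> \<inter> \<tau>" using i by simp
      have q: "pure P (sym_diff \<sigma> \<tau>) (\<lambda>k. if k \<in> \<sigma> then (v(i := x)) k else w k)
          = pure P (sym_diff \<sigma> \<tau>) (\<lambda>k. if k \<in> \<sigma> then v k else w k)" for x
        using True i by (intro pure_local) auto
      show ?thesis
        unfolding q prod_update[OF finI iI, of "\<lambda>k x. form P x (w k)" v]
        by (simp add: form_linear[OF P] algebra_simps)
    next
      case False
      then have iD: "i \<in> sym_diff \<sigma> \<tau>" using i by simp
      have p: "(\<Prod>k\<in>\<sigma> \<inter> \<tau>. form P ((v(i := x)) k) (w k)) = (\<Prod>k\<in>\<sigma> \<inter> \<tau>. form P (v k) (w k))" for x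
        using False by (intro prod.cong) auto
      have q: "(\<lambda>k. if k \<in> \<sigma> then (v(i := x)) k else w k) = (\<lambda>k. if k \<in> \<sigma> then v k else w k)(i := x)" for x
        using i by auto
      show ?thesis
        unfolding p q pure_linear[OF P finD iD] by (simp add: algebra_simps)
    qed
    then show "?F (v(i := u + u')) w = ?F (v(i := u)) w + ?F (v(i := u')) w"
      "?F (v(i := scl P c u)) w = ts c (?F (v(i := u)) w)" by blast+
  next
    fix v w :: "nat \<Rightarrow> 'b" and i u u' c
    assume i: "i \<in> \<tau>"
    have "?F v (w(i := u + u')) = ?F v (w(i := u)) + ?F v (w(i := u')) \<and>
        ?F v (w(i := scl P c u)) = ts c (?F v (w(i := u)))"
    proof (cases "i \<in> \<sigma>")
      case True
      then have iI: "i \<in> \<sigma> \<inter> \<tau>" using i by simp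
      have q: "pure P (sym_diff \<sigma> \<tau>) (\<lambda>k. if k \<in> \<sigma> then v k else (w(i := x)) k)
          = pure P (sym_diff \<sigma> \<tau>) (\<lambda>k. if k \<in> \<sigma> then v k else w k)" for x
        using True i by (intro pure_local) auto
      show ?thesis
        unfolding q prod_update[OF finI iI, of "\<lambda>k x. form P (v k) x" w]
        by (simp add: form_linear[OF P] algebra_simps)
    next
      case False
      then have iD: "i \<in> sym_diff \<sigma> \<tau>" using i by simp
      have p: "(\<Prod>k\<in>\<sigma> \<inter> \<tau>. form P (v k) ((w(i := x)) k)) = (\<Prod>k\<in>\<sigma> \<inter> \<tau>. form P (v k) (w k))" for x
        using False by (intro prod.cong) auto
      have q: "(\<lambda>k. if k \<in> \<sigma> then v k else (w(i := x)) k) = (\<lambda>k. if k \<in> \<sigma> then v k else w k)(i := x)" for x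
        using False by auto
      show ?thesis
        unfolding p q pure_linear[OF P finD iD] by (simp add: algebra_simps)
    qed
    then show "?F v (w(i := u + u')) = ?F v (w(i := u)) + ?F v (w(i := u'))"
      "?F v (w(i := scl P c u)) = ts c (?F v (w(i := u)))" by blast+
  }
qed

lemma gam_linear:
  assumes P: "symplectic_plane P"
  shows "gam P (a + b) x v = gam P a x v + gam P b x v" "gam P (scl P c a) x v = scl P c (gam P a x v)"
    "gam P x (a + b) v = gam P x a v + gam P x b v" "gam P x (scl P c a) v = scl P c (gam P x a v)"
proof -
  interpret vector_space "scl P" using P by (simp add: symplectic_plane_def)
  show "gam P (a + b) x v = gam P a x v + gam P b x v" "gam P (scl P c a) x v = scl P c (gam P a x v)"
    "gam P x (a + b) v = gam P x a v + gam P x b v" "gam P x (scl P c a) v = scl P c (gam P x a v)"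
    unfolding gam_def by (simp_all add: form_linear[OF P] algebra_simps)
qed

lemma diag_pure:
  assumes P: "symplectic_plane P" and fin: "finite \<sigma>"
  shows "diag P \<sigma> (pure P \<sigma> v) (pure P \<sigma> w) =
    sps P (- (1 / 2)) (\<Sum>j\<in>\<sigma>. sps P (\<Prod>k\<in>\<sigma> - {j}. form P (v k) (w k)) (nu j (gam P (v j) (w j))))"
  unfolding diag_def
proof (rule bilext_pure[OF P vs_sps[OF P] fin fin])
  let ?G = "\<lambda>v w j. sps P (\<Prod>k\<in>\<sigma> - {j}. form P (v k) (w k)) (nu j (gam P (v j) (w j)))"
  let ?F = "\<lambda>v w. sps P (- (1 / 2)) (\<Sum>j\<in>\<sigma>. ?G v w j)"
  interpret vector_space "sps P" by (rule vs_sps[OF P])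
  interpret V: vector_space "scl P" using P by (simp add: symplectic_plane_def)
  have nu_lin: "nu j (gam P (a + b) x) = nu j (gam P a x) + nu j (gam P b x)"
    "nu j (gam P (scl P c a) x) = sps P c (nu j (gam P a x))"
    "nu j (gam P x (a + b)) = nu j (gam P x a) + nu j (gam P x b)"
    "nu j (gam P x (scl P c a)) = sps P c (nu j (gam P x a))" for j a b x c
    by (auto simp: nu_def sps_def fun_eq_iff gam_linear[OF P])
  {
    fix v v' w :: "nat \<Rightarrow> 'b" assume "\<And>i. i \<in> \<sigma> \<Longrightarrow> v i = v' i"
    then have "?G v w j = ?G v' w j" if "j \<in> \<sigma>" for j
      using that by (intro arg_cong2[of _ _ _ _ "sps P"] prod.cong) auto
    then show "?F v w = ?F v' w" by simp
  next
    fix v w w' :: "nat \<Rightarrow> 'b" assume "\<And>i. i \<in> \<sigma> \<Longrightarrow> w i = w' i"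
    then have "?G v w j = ?G v w' j" if "j \<in> \<sigma>" for j
      using that by (intro arg_cong2[of _ _ _ _ "sps P"] prod.cong) auto
    then show "?F v w = ?F v w'" by simp
  next
    fix v w :: "nat \<Rightarrow> 'b" and i u u' c
    assume i: "i \<in> \<sigma>"
    have G: "?G (v(i := u + u')) w j = ?G (v(i := u)) w j + ?G (v(i := u')) w j \<and>
        ?G (v(i := scl P c u)) w j = sps P c (?G (v(i := u)) w j) \<and>
        ?G v (w(i := u + u')) j = ?G v (w(i := u)) j + ?G v (w(i := u')) j \<and>
        ?G v (w(i := scl P c u)) j = sps P c (?G v (w(i := u)) j)" if "j \<in> \<sigma>" for j
    proof (cases "j = i")
      case True
      have "(\<Prod>k\<in>\<sigma> - {i}. form P ((v(i := x)) k) (w k)) = (\<Prod>k\<in>\<sigma> - {i}. form P (v k) (w k))"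
        "(\<Prod>k\<in>\<sigma> - {i}. form P (v k) ((w(i := x)) k)) = (\<Prod>k\<in>\<sigma> - {i}. form P (v k) (w k))" for x
        by (auto intro!: prod.cong)
      then show ?thesis
        using True by (simp add: nu_lin algebra_simps)
    next
      case False
      then have "i \<in> \<sigma> - {j}" "finite (\<sigma> - {j})" using i fin by auto
      note p = prod_update[OF this(2,1), of "\<lambda>k x. form P x (w k)" v]
        prod_update[OF this(2,1), of "\<lambda>k x. form P (v k) x" w]
      show ?thesis
        unfolding p using False by (simp add: form_linear[OF P] algebra_simps)
    qed
    then show "?F (v(i := u + u')) w = ?F (v(i := u)) w + ?F (v(i := u')) w"
      "?F v (w(i := u + u')) = ?F v (w(i := u)) + ?F v (w(i := u'))"
      by (simp_all add: sum.distrib scale_right_distrib del: fun_upd_apply)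
    have "(\<Sum>j\<in>\<sigma>. ?G (v(i := scl P c u)) w j) = sps P c (\<Sum>j\<in>\<sigma>. ?G (v(i := u)) w j)"
      "(\<Sum>j\<in>\<sigma>. ?G v (w(i := scl P c u)) j) = sps P c (\<Sum>j\<in>\<sigma>. ?G v (w(i := u)) j)"
      unfolding scale_sum_right using G by (auto intro!: sum.cong simp del: fun_upd_apply)
    then show "?F (v(i := scl P c u)) w = sps P c (?F (v(i := u)) w)"
      "?F v (w(i := scl P c u)) = sps P c (?F v (w(i := u)))"
      by (simp_all only: scale_left_commute)
  }
qed

lemma act_pure:
  assumes P: "symplectic_plane P" and fin: "finite \<sigma>"
    and g: "\<And>i. i \<in> \<sigma> \<Longrightarrow> Vector_Spaces.linear (scl P) (scl P) (g i)"
  shows "act P \<sigma> g (pure P \<sigma> v) = (\<Sum>i\<in>\<sigma>. pure P \<sigma> (v(i := g i (v i))))"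
  unfolding act_def
proof (rule linext_pure[OF P vs_ts fin])
  let ?F = "\<lambda>v. \<Sum>i\<in>\<sigma>. pure P \<sigma> (v(i := g i (v i)))"
  interpret vector_space "ts :: 'a \<Rightarrow> 'a tensor \<Rightarrow> 'a tensor" by (rule vs_ts)
  show "?F v = ?F w" if "\<And>i. i \<in> \<sigma> \<Longrightarrow> v i = w i" for v w
    using that by (intro sum.cong refl pure_local) auto
  fix v :: "nat \<Rightarrow> 'b" and i u u' c
  assume i: "i \<in> \<sigma>"
  have F: "?F (v(i := x)) = pure P \<sigma> (v(i := g i x)) + (\<Sum>j\<in>\<sigma> - {i}. pure P \<sigma> ((v(j := g j (v j)))(i := x)))" for x
    by (subst sum.remove[OF fin i]) (auto intro!: sum.cong arg_cong[of _ _ "pure P \<sigma>"] simp: fun_upd_twist)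
  interpret G: Vector_Spaces.linear "scl P" "scl P" "g i" by (rule g[OF i])
  show "?F (v(i := u + u')) = ?F (v(i := u)) + ?F (v(i := u'))"
    unfolding F by (simp add: G.add pure_linear[OF P fin i] sum.distrib del: fun_upd_apply)
  show "?F (v(i := scl P c u)) = ts c (?F (v(i := u)))"
    unfolding F by (simp add: G.scale pure_linear[OF P fin i] scale_sum_right scale_right_distrib del: fun_upd_apply)
qed


section \<open>The algebras\<close>

text \<open>An element is a pair of its component in \<open>V(\<emptyset>)\<close> and the family of its components
  in the \<open>V(\<sigma>)\<close> with \<open>\<sigma>\<close> nonempty.\<close>

type_synonym ('a, 'v) elt = "(nat \<Rightarrow> 'v \<Rightarrow> 'v) \<times> (nat set \<Rightarrow> 'a tensor)"

definition es :: "('a::field, 'v) plane \<Rightarrow> 'a \<Rightarrow> ('a, 'v) elt \<Rightarrow> ('a, 'v) elt" where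
  "es P c X = (sps P c (fst X), \<lambda>\<sigma>. ts c (snd X \<sigma>))"

definition sp_power :: "('a::field, 'v::ab_group_add) plane \<Rightarrow> nat set \<Rightarrow> (nat \<Rightarrow> 'v \<Rightarrow> 'v) set" where
  "sp_power P N = {g. \<forall>i. g i \<in> (if i \<in> N then sp P else {0})}"

definition family_space :: "nat set set \<Rightarrow> (nat set \<Rightarrow> ('a::zero) tensor) set" where
  "family_space \<S> = {x. \<forall>\<sigma>. x \<sigma> \<in> (if \<sigma> \<in> \<S> then tensor_space \<sigma> else {0})}"

definition algebra_space :: "('a::field, 'v::ab_group_add) plane \<Rightarrow> nat set \<Rightarrow> nat set set \<Rightarrow>
    ('a, 'v) elt set" where
  "algebra_space P N \<S> = sp_power P N \<times> family_space (\<S> - {{}})"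

definition single :: "nat set \<Rightarrow> 'b \<Rightarrow> nat set \<Rightarrow> 'b::zero" where
  "single \<sigma> x = (\<lambda>\<rho>. if \<rho> = \<sigma> then x else 0)"

text \<open>\<open>phi P \<sigma> \<tau> X Y\<close> is \<open>\<phi>\<^sub>\<sigma>\<^sub>,\<^sub>\<tau>\<close> applied to the \<open>\<sigma>\<close>-component of \<open>X\<close> and the \<open>\<tau>\<close>-component of \<open>Y\<close>.\<close>

definition phi :: "('a::field, 'v::ab_group_add) plane \<Rightarrow> nat set \<Rightarrow> nat set \<Rightarrow>
    ('a, 'v) elt \<Rightarrow> ('a, 'v) elt \<Rightarrow> ('a, 'v) elt" where
  "phi P \<sigma> \<tau> X Y =
    (if \<sigma> = {} \<and> \<tau> = {} then (sp_bracket (fst X) (fst Y), 0)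
     else if \<sigma> = {} then (0, single \<tau> (act P \<tau> (fst X) (snd Y \<tau>)))
     else if \<tau> = {} then (0, single \<sigma> (- act P \<sigma> (fst Y) (snd X \<sigma>)))
     else if \<sigma> = \<tau> then (diag P \<sigma> (snd X \<sigma>) (snd Y \<sigma>), 0)
     else (0, single (sym_diff \<sigma> \<tau>) (contr P \<sigma> \<tau> (snd X \<sigma>) (snd Y \<tau>))))"

definition graded_bracket :: "('a::field, 'v::ab_group_add) plane \<Rightarrow> nat set set \<Rightarrow>
    (nat set \<Rightarrow> nat set \<Rightarrow> 'a) \<Rightarrow> ('a, 'v) elt \<Rightarrow> ('a, 'v) elt \<Rightarrow> ('a, 'v) elt" where
  "graded_bracket P \<S> \<epsilon> X Y =
    (\<Sum>\<sigma>\<in>\<S>. \<Sum>\<tau>\<in>\<S>. if sym_diff \<sigma> \<tau> \<in> \<S> then es P (\<epsilon> \<sigma> \<tau>) (phi P \<sigma> \<tau> X Y) else 0)"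


subsection \<open>\<open>e\<^sub>8\<close>, \<open>e\<^sub>7\<close> and \<open>d\<^sub>6\<close>\<close>

text \<open>Elements of powers of \<open>\<int>\<^sub>2\<close> are identified with subsets.\<close>

definition bit_of :: "nat set \<Rightarrow> nat \<Rightarrow> nat" where
  "bit_of x i = (if i \<in> x then 1 else 0)"

definition chi4 :: "nat set \<Rightarrow> nat set" where
  "chi4 x = (let x1 = bit_of x 1; x2 = bit_of x 2; x3 = bit_of x 3; x4 = bit_of x 4 in
     {i \<in> {1..8}. odd ([x1 + x3 + x4, x1 + x2 + x3 + x4, x2 + x3 + x4, x3 + x4,
                        x1 + x4, x1 + x2 + x4, x2 + x4, x4] ! (i - 1))})"

definition S_e8 :: "nat set set" where
  "S_e8 = chi4 ` (Pow {1..4} - {{4}})"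

definition g_e8 :: "nat set \<Rightarrow> nat set \<Rightarrow> nat" where
  "g_e8 x y = (let x' = bit_of x; y' = bit_of y in
     (\<Sum>i=1..3. \<Sum>j=1..i. x' i * y' j) + x' 3 * y' 4 + x' 4 * y' 3
     + x' 1 * y' 2 * y' 3 + x' 2 * y' 1 * y' 3 + x' 3 * y' 1 * y' 2)"

definition eps_e8 :: "nat set \<Rightarrow> nat set \<Rightarrow> 'a::field" where
  "eps_e8 \<sigma> \<tau> = (- 1) ^ g_e8 (inv_into (Pow {1..4}) chi4 \<sigma>) (inv_into (Pow {1..4}) chi4 \<tau>)"

definition e8 :: "('a::field, 'v::ab_group_add) plane \<Rightarrow> ('a, 'v) elt set" where
  "e8 P = algebra_space P {1..8} S_e8"

definition bracket_e8 :: "('a::field, 'v::ab_group_add) plane \<Rightarrow>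
    ('a, 'v) elt \<Rightarrow> ('a, 'v) elt \<Rightarrow> ('a, 'v) elt" where
  "bracket_e8 P = graded_bracket P S_e8 eps_e8"

definition S_e7 :: "nat set set" where
  "S_e7 = {{}, {1,2,5,6}, {2,3,6,7}, {1,3,5,7}, {1,2,3,4}, {3,4,5,6}, {1,4,6,7}, {2,4,5,7}}"

definition e7 :: "('a::field, 'v::ab_group_add) plane \<Rightarrow> ('a, 'v) elt set" where
  "e7 P = algebra_space P {1..7} S_e7"

definition S_d6 :: "nat set set" where
  "S_d6 = {{}, {1,2,5,6}, {2,3,6,7}, {1,3,5,7}}"

definition d6 :: "('a::field, 'v::ab_group_add) plane \<Rightarrow> ('a, 'v) elt set" where
  "d6 P = algebra_space P {1,2,3,5,6,7} S_d6"


subsection \<open>\<open>f\<^sub>4\<close> and \<open>c\<^sub>3\<close>\<close>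

definition I4 :: "nat set" where "I4 = {1,2,3,4}"

definition A4 :: "nat set set" where "A4 = {{1,2}, {2,3}, {1,3}}"

definition S_f4 :: "nat set set" where
  "S_f4 = {{}, I4} \<union> A4 \<union> (\<lambda>\<alpha>. I4 - \<alpha>) ` A4"

definition eps_f4 :: "nat set \<Rightarrow> nat set \<Rightarrow> 'a::field" where
  "eps_f4 \<sigma> \<tau> =
    (if \<sigma> = {} \<or> \<tau> = {} then 1
     else if \<sigma> = I4 \<and> \<tau> = I4 then - 1
     else if \<tau> = I4 then (if \<sigma> \<in> A4 then 1 else - 1)
     else if \<sigma> = I4 then (if \<tau> \<in> A4 then - 1 else 1)
     else if \<tau> = \<sigma> then - 2
     else if \<tau> = I4 - \<sigma> then (if \<sigma> \<in> A4 then - 2 else 2)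
     else if \<sigma> \<in> A4 \<and> \<tau> \<in> A4 then 1 else - 1)"

definition f4 :: "('a::field, 'v::ab_group_add) plane \<Rightarrow> ('a, 'v) elt set" where
  "f4 P = algebra_space P {1..4} S_f4"

definition bracket_f4 :: "('a::field, 'v::ab_group_add) plane \<Rightarrow>
    ('a, 'v) elt \<Rightarrow> ('a, 'v) elt \<Rightarrow> ('a, 'v) elt" where
  "bracket_f4 P = graded_bracket P S_f4 eps_f4"

definition S_c3 :: "nat set set" where "S_c3 = {{}} \<union> A4"

definition c3 :: "('a::field, 'v::ab_group_add) plane \<Rightarrow> ('a, 'v) elt set" where
  "c3 P = algebra_space P {1..3} S_c3"


subsection \<open>\<open>e\<^sub>6\<close> and \<open>a\<^sub>5\<close>\<close>

text \<open>A component in \<open>V(\<sigma>) \<otimes> E\<close> has its coefficients of \<open>e\<^sup>+\<close> and \<open>e\<^sup>-\<close> under the labels \<open>EP\<close> and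
  \<open>EM\<close>. A component in a space \<open>V(\<sigma>)\<close> without the factor \<open>E\<close> is stored under the label \<open>E0\<close>.\<close>

datatype elabel = E0 | EP | EM

fun eneg :: "elabel \<Rightarrow> elabel" where
  "eneg E0 = E0" | "eneg EP = EM" | "eneg EM = EP"

fun esgn :: "elabel \<Rightarrow> 'a::field" where
  "esgn E0 = 0" | "esgn EP = 1" | "esgn EM = - 1"

type_synonym ('a, 'v) elt6 =
  "(nat \<Rightarrow> 'v \<Rightarrow> 'v) \<times> ('a \<times> 'a \<times> 'a) \<times> (nat set \<Rightarrow> elabel \<Rightarrow> 'a tensor)"

definition sp_part :: "('a, 'v) elt6 \<Rightarrow> nat \<Rightarrow> 'v \<Rightarrow> 'v" where "sp_part X = fst X"
definition t2_part :: "('a, 'v) elt6 \<Rightarrow> 'a \<times> 'a \<times> 'a" where "t2_part X = fst (snd X)"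
definition tens_part :: "('a, 'v) elt6 \<Rightarrow> nat set \<Rightarrow> elabel \<Rightarrow> 'a tensor" where "tens_part X = snd (snd X)"

definition t2s :: "'a::times \<Rightarrow> 'a \<times> 'a \<times> 'a \<Rightarrow> 'a \<times> 'a \<times> 'a" where
  "t2s c = (\<lambda>(p, q, r). (c * p, c * q, c * r))"

definition es6 :: "('a::field, 'v) plane \<Rightarrow> 'a \<Rightarrow> ('a, 'v) elt6 \<Rightarrow> ('a, 'v) elt6" where
  "es6 P c X = (sps P c (sp_part X), t2s c (t2_part X), \<lambda>\<sigma> e. ts c (tens_part X \<sigma> e))"

definition t2 :: "('a::field \<times> 'a \<times> 'a) set" where
  "t2 = {(p, q, r). p + q + r = 0}"

definition elabels :: "nat set \<Rightarrow> elabel set" where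
  "elabels \<sigma> = (if \<sigma> = {1,2,3,4} \<or> \<sigma> = {1,2,3} then {E0} else {EP, EM})"

definition family_space6 :: "nat set set \<Rightarrow> (nat set \<Rightarrow> elabel \<Rightarrow> ('a::zero) tensor) set" where
  "family_space6 \<S> = {x. \<forall>\<sigma> e. x \<sigma> e \<in> (if \<sigma> \<in> \<S> \<and> e \<in> elabels \<sigma> then tensor_space \<sigma> else {0})}"

definition e6 :: "('a::field, 'v::ab_group_add) plane \<Rightarrow> ('a, 'v) elt6 set" where
  "e6 P = sp_power P {1..4} \<times> t2 \<times> family_space6 (S_f4 - {{}})"

definition a5 :: "('a::field, 'v::ab_group_add) plane \<Rightarrow> ('a, 'v) elt6 set" where
  "a5 P = sp_power P {1..3} \<times> t2 \<times> family_space6 A4"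

definition t2_coeff :: "nat set \<Rightarrow> 'a \<times> 'a \<times> 'a \<Rightarrow> 'a::field" where
  "t2_coeff \<sigma> = (\<lambda>(\<alpha>0, \<alpha>1, \<alpha>2).
     if \<sigma> = {1,2} \<or> \<sigma> = {3,4} then \<alpha>0
     else if \<sigma> = {2,3} \<or> \<sigma> = {1,4} then \<alpha>1
     else if \<sigma> = {1,3} \<or> \<sigma> = {2,4} then \<alpha>2 else 0)"

definition a_vec :: "nat set \<Rightarrow> 'a \<times> 'a \<times> 'a::field" where
  "a_vec \<sigma> =
    (if \<sigma> = {1,2} \<or> \<sigma> = {3,4} then (1, - (1 / 2), - (1 / 2))
     else if \<sigma> = {2,3} \<or> \<sigma> = {1,4} then (- (1 / 2), 1, - (1 / 2))
     else (- (1 / 2), - (1 / 2), 1))"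

definition eps_e6 :: "nat set \<Rightarrow> nat set \<Rightarrow> 'a::field" where
  "eps_e6 \<sigma> \<tau> =
    (if \<sigma> \<notin> {{}, I4} \<and> \<tau> \<notin> {{}, I4} \<and> \<tau> \<in> {\<sigma>, I4 - \<sigma>}
     then 1 / 2 * eps_f4 \<sigma> \<tau> else eps_f4 \<sigma> \<tau>)"

definition act6 :: "('a::field, 'v::ab_group_add) plane \<Rightarrow> nat set \<Rightarrow> ('a, 'v) elt6 \<Rightarrow>
    (elabel \<Rightarrow> 'a tensor) \<Rightarrow> elabel \<Rightarrow> 'a tensor" where
  "act6 P \<sigma> X y = (\<lambda>e. act P \<sigma> (sp_part X) (y e) + ts (esgn e * t2_coeff \<sigma> (t2_part X)) (y e))"

definition phi6 :: "('a::field, 'v::ab_group_add) plane \<Rightarrow> nat set \<Rightarrow> nat set \<Rightarrow>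
    ('a, 'v) elt6 \<Rightarrow> ('a, 'v) elt6 \<Rightarrow> ('a, 'v) elt6" where
  "phi6 P \<sigma> \<tau> X Y = (let x = tens_part X \<sigma>; y = tens_part Y \<tau> in
     if \<sigma> = {} \<and> \<tau> = {} then (sp_bracket (sp_part X) (sp_part Y), 0, 0)
     else if \<sigma> = {} then (0, 0, single \<tau> (act6 P \<tau> X y))
     else if \<tau> = {} then (0, 0, single \<sigma> (- act6 P \<sigma> Y x))
     else if \<sigma> = I4 \<and> \<tau> = I4 then (diag P I4 (x E0) (y E0), 0, 0)
     else if \<sigma> = I4 then (0, 0, single (I4 - \<tau>) (\<lambda>e. contr P I4 \<tau> (x E0) (y e)))
     else if \<tau> = I4 then (0, 0, single (I4 - \<sigma>) (\<lambda>e. contr P I4 \<sigma> (y E0) (x e)))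
     else if \<tau> = \<sigma> then
       (\<Sum>e\<in>{EP, EM}. diag P \<sigma> (x e) (y (eneg e)),
        \<Sum>e\<in>{EP, EM}. t2s (esgn e * tform P \<sigma> (x e) (y (eneg e))) (a_vec \<sigma>), 0)
     else if \<tau> = I4 - \<sigma> then
       (0, 0, single I4 (\<lambda>e. if e = E0 then \<Sum>f\<in>{EP, EM}. contr P \<sigma> \<tau> (x f) (y (eneg f)) else 0))
     else (0, 0, single (sym_diff \<sigma> \<tau>)
       (\<lambda>e. if e = E0 then 0 else contr P \<sigma> \<tau> (x (eneg e)) (y (eneg e)))))"

definition bracket_e6 :: "('a::field, 'v::ab_group_add) plane \<Rightarrow>
    ('a, 'v) elt6 \<Rightarrow> ('a, 'v) elt6 \<Rightarrow> ('a, 'v) elt6" where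
  "bracket_e6 P X Y = (\<Sum>\<sigma>\<in>S_f4. \<Sum>\<tau>\<in>S_f4. es6 P (eps_e6 \<sigma> \<tau>) (phi6 P \<sigma> \<tau> X Y))"


section \<open>The spaces T and the odd parts\<close>

definition fs :: "'a::times \<Rightarrow> (nat set \<Rightarrow> 'a tensor) \<Rightarrow> nat set \<Rightarrow> 'a tensor" where
  "fs c x = (\<lambda>\<sigma>. ts c (x \<sigma>))"

definition fs6 :: "'a::times \<Rightarrow> (nat set \<Rightarrow> elabel \<Rightarrow> 'a tensor) \<Rightarrow> nat set \<Rightarrow> elabel \<Rightarrow> 'a tensor" where
  "fs6 c x = (\<lambda>\<sigma> e. ts c (x \<sigma> e))"

definition T_e8_e7 :: "(nat set \<Rightarrow> 'a::field tensor) set" where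
  "T_e8_e7 = family_space ((\<lambda>\<sigma>. \<sigma> - {8}) ` (S_e8 - S_e7))"

definition T_e7_d6 :: "(nat set \<Rightarrow> 'a::field tensor) set" where
  "T_e7_d6 = family_space ((\<lambda>\<sigma>. \<sigma> - {4}) ` (S_e7 - S_d6))"

definition T_e6_a5 :: "(nat set \<Rightarrow> elabel \<Rightarrow> 'a::field tensor) set" where
  "T_e6_a5 = family_space6 ((\<lambda>\<sigma>. \<sigma> - {4}) ` (S_f4 - S_c3))"

definition T_f4_c3 :: "(nat set \<Rightarrow> 'a::field tensor) set" where
  "T_f4_c3 = family_space ((\<lambda>\<sigma>. \<sigma> - {4}) ` (S_f4 - S_c3))"

text \<open>The identification of \<open>V(\<sigma> \<setminus> {k}) \<otimes> V\<^sub>k\<close> with \<open>V(\<sigma>)\<close> for \<open>k \<in> \<sigma>\<close>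
  (the factor \<open>u \<in> V\<^sub>k\<close> is put in the position of index \<open>k\<close>).\<close>

definition join :: "('a::field, 'v::ab_group_add) plane \<Rightarrow> nat \<Rightarrow> 'a tensor \<Rightarrow> 'v \<Rightarrow> 'a tensor" where
  "join P k x u = (\<lambda>\<kappa>. x (\<kappa> - {k}) * coord P u (k \<in> \<kappa>))"

lemma join_pure:
  assumes "finite \<sigma>" "k \<in> \<sigma>"
  shows "join P k (pure P (\<sigma> - {k}) v) u = pure P \<sigma> (v(k := u))"
proof
  fix \<kappa>
  have "(\<Prod>i\<in>\<sigma>. coord P ((v(k := u)) i) (i \<in> \<kappa>)) =
      coord P u (k \<in> \<kappa>) * (\<Prod>i\<in>\<sigma> - {k}. coord P (v i) (i \<in> \<kappa>))"
    by (rule prod_update[OF assms, of "\<lambda>i x. coord P x (i \<in> \<kappa>)"])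
  moreover have "(\<Prod>i\<in>\<sigma> - {k}. coord P (v i) (i \<in> \<kappa> - {k})) = (\<Prod>i\<in>\<sigma> - {k}. coord P (v i) (i \<in> \<kappa>))"
    by (rule prod.cong) auto
  moreover have "\<kappa> - {k} \<subseteq> \<sigma> - {k} \<longleftrightarrow> \<kappa> \<subseteq> \<sigma>"
    using assms by auto
  ultimately show "join P k (pure P (\<sigma> - {k}) v) u \<kappa> = pure P \<sigma> (v(k := u)) \<kappa>"
    by (simp add: join_def pure_def)
qed

definition odd_elt :: "('a::field, 'v::ab_group_add) plane \<Rightarrow> nat \<Rightarrow> (nat set \<Rightarrow> 'a tensor) \<Rightarrow> 'v \<Rightarrow>
    ('a, 'v) elt" where
  "odd_elt P k x u = (0, \<lambda>\<sigma>. if k \<in> \<sigma> then join P k (x (\<sigma> - {k})) u else 0)"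

definition odd_elt6 :: "('a::field, 'v::ab_group_add) plane \<Rightarrow> nat \<Rightarrow>
    (nat set \<Rightarrow> elabel \<Rightarrow> 'a tensor) \<Rightarrow> 'v \<Rightarrow> ('a, 'v) elt6" where
  "odd_elt6 P k x u = (0, 0, \<lambda>\<sigma> e. if k \<in> \<sigma> then join P k (x (\<sigma> - {k}) e) u else 0)"

definition sp_elt :: "nat \<Rightarrow> ('v \<Rightarrow> 'v::zero) \<Rightarrow> ('a::zero, 'v) elt" where
  "sp_elt k f = (nu k f, 0)"

definition sp_elt6 :: "nat \<Rightarrow> ('v \<Rightarrow> 'v::zero) \<Rightarrow> ('a::zero, 'v) elt6" where
  "sp_elt6 k f = (nu k f, 0, 0)"


section \<open>Freudenthal triple systems\<close>

definition linear_from :: "('a \<Rightarrow> 'b \<Rightarrow> 'b::plus) \<Rightarrow> ('a \<Rightarrow> 'c \<Rightarrow> 'c::plus) \<Rightarrow> 'b set \<Rightarrow> ('b \<Rightarrow> 'c) \<Rightarrow> bool" where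
  "linear_from s1 s2 T f \<longleftrightarrow>
     (\<forall>x\<in>T. \<forall>y\<in>T. f (x + y) = f x + f y) \<and> (\<forall>c. \<forall>x\<in>T. f (s1 c x) = s2 c (f x))"

definition bilinear_from :: "('a \<Rightarrow> 'b \<Rightarrow> 'b::plus) \<Rightarrow> ('a \<Rightarrow> 'c \<Rightarrow> 'c::plus) \<Rightarrow> 'b set \<Rightarrow>
    ('b \<Rightarrow> 'b \<Rightarrow> 'c) \<Rightarrow> bool" where
  "bilinear_from s1 s2 T f \<longleftrightarrow>
     (\<forall>y\<in>T. linear_from s1 s2 T (\<lambda>x. f x y)) \<and> (\<forall>x\<in>T. linear_from s1 s2 T (f x))"

definition alternating_form :: "('a::field \<Rightarrow> 't \<Rightarrow> 't::ab_group_add) \<Rightarrow> 't set \<Rightarrow> ('t \<Rightarrow> 't \<Rightarrow> 'a) \<Rightarrow> bool" where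
  "alternating_form s T f \<longleftrightarrow> bilinear_from s (*) T f \<and> (\<forall>x\<in>T. f x x = 0)"

definition nondegenerate_form :: "'t::zero set \<Rightarrow> ('t \<Rightarrow> 't \<Rightarrow> 'a::zero) \<Rightarrow> bool" where
  "nondegenerate_form T f \<longleftrightarrow>
     (\<forall>x\<in>T. (\<forall>y\<in>T. f x y = 0) \<longrightarrow> x = 0) \<and> (\<forall>y\<in>T. (\<forall>x\<in>T. f x y = 0) \<longrightarrow> y = 0)"

definition freudenthal_triple_system :: "('a::field \<Rightarrow> 't \<Rightarrow> 't::ab_group_add) \<Rightarrow> 't set \<Rightarrow>
    ('t \<Rightarrow> 't \<Rightarrow> 'a) \<Rightarrow> ('t \<Rightarrow> 't \<Rightarrow> 't \<Rightarrow> 't) \<Rightarrow> bool" where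
  "freudenthal_triple_system s T f p \<longleftrightarrow>
     vector_space s \<and> module.subspace s T \<and>
     alternating_form s T f \<and> (\<exists>x\<in>T. \<exists>y\<in>T. f x y \<noteq> 0) \<and>
     (\<forall>x\<in>T. \<forall>y\<in>T. \<forall>z\<in>T. p x y z \<in> T) \<and>
     (\<forall>x\<in>T. bilinear_from s s T (p x)) \<and>
     (\<forall>y\<in>T. \<forall>z\<in>T. linear_from s s T (\<lambda>x. p x y z)) \<and>
     (\<forall>x\<in>T. \<forall>y\<in>T. \<forall>z\<in>T. p x y z = p y x z \<and> p x y z = p x z y) \<and>
     (\<forall>x\<in>T. \<forall>y\<in>T. \<forall>z\<in>T. \<forall>t\<in>T.
        f x (p y z t) = f y (p x z t) \<and> f x (p y z t) = f x (p z y t) \<and>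
        f x (p y z t) = f x (p y t z)) \<and>
     (\<forall>x\<in>T. \<forall>y\<in>T. \<forall>z\<in>T.
        p (p x y y) x z + p (p y x x) y z + s (f (p x y y) z) x + s (f (p y x x) z) y
        + s (f x z) (p x y y) + s (f y z) (p y x x) = 0)"

definition simple_freudenthal_triple_system :: "('a::field \<Rightarrow> 't \<Rightarrow> 't::ab_group_add) \<Rightarrow> 't set \<Rightarrow>
    ('t \<Rightarrow> 't \<Rightarrow> 'a) \<Rightarrow> ('t \<Rightarrow> 't \<Rightarrow> 't \<Rightarrow> 't) \<Rightarrow> bool" where
  "simple_freudenthal_triple_system s T f p \<longleftrightarrow>
     freudenthal_triple_system s T f p \<and>
     (\<exists>x\<in>T. \<exists>y\<in>T. \<exists>z\<in>T. p x y z \<noteq> 0) \<and>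
     (\<forall>J. module.subspace s J \<and> J \<subseteq> T \<and> (\<forall>x\<in>J. \<forall>y\<in>T. \<forall>z\<in>T. p x y z \<in> J) \<longrightarrow> J = {0} \<or> J = T)"


section \<open>Gradings\<close>

definition direct_sum :: "('a::field \<Rightarrow> 'b \<Rightarrow> 'b::ab_group_add) \<Rightarrow> 'b set \<Rightarrow> 'b set \<Rightarrow> 'b set \<Rightarrow> bool" where
  "direct_sum s U W L \<longleftrightarrow>
     module.subspace s U \<and> module.subspace s W \<and> module.subspace s L \<and>
     U \<inter> W = {0} \<and> L = {x + y | x y. x \<in> U \<and> y \<in> W}"

definition Z2_grading :: "('a::field \<Rightarrow> 'b \<Rightarrow> 'b::ab_group_add) \<Rightarrow> ('b \<Rightarrow> 'b \<Rightarrow> 'b) \<Rightarrow>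
    'b set \<Rightarrow> 'b set \<Rightarrow> 'b set \<Rightarrow> bool" where
  "Z2_grading s br L L0 L1 \<longleftrightarrow>
     direct_sum s L0 L1 L \<and>
     (\<forall>x\<in>L0. \<forall>y\<in>L0. br x y \<in> L0) \<and>
     (\<forall>x\<in>L0. \<forall>y\<in>L1. br x y \<in> L1 \<and> br y x \<in> L1) \<and>
     (\<forall>x\<in>L1. \<forall>y\<in>L1. br x y \<in> L0)"

text \<open>\<open>tensor_decomposition P s sT T t M\<close>: the bilinear map \<open>t\<close> identifies \<open>M\<close> with \<open>T \<otimes> V\<close>.\<close>

definition tensor_decomposition :: "('a::field, 'v::ab_group_add) plane \<Rightarrow>
    ('a \<Rightarrow> 'b \<Rightarrow> 'b::ab_group_add) \<Rightarrow> ('a \<Rightarrow> 't \<Rightarrow> 't::ab_group_add) \<Rightarrow> 't set \<Rightarrow>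
    ('t \<Rightarrow> 'v \<Rightarrow> 'b) \<Rightarrow> 'b set \<Rightarrow> bool" where
  "tensor_decomposition P s sT T t M \<longleftrightarrow>
     (\<forall>u. linear_from sT s T (\<lambda>x. t x u)) \<and>
     (\<forall>x\<in>T. linear_from (scl P) s UNIV (t x)) \<and>
     bij_betw (\<lambda>(x, y). t x (bas P False) + t y (bas P True)) (T \<times> T) M"

text \<open>The decomposition \<open>L = (S \<oplus> sp(W)) \<oplus> (T \<otimes> W)\<close> with the asserted properties. Here \<open>\<iota>\<close> is the
  inclusion of \<open>sp(W)\<close> in \<open>L\<close>, \<open>t x u\<close> is \<open>x \<otimes> u\<close>, and \<open>a D z\<close> is the action of \<open>D \<in> S\<close> on \<open>z \<in> T\<close>,
  which is determined by the bracket of \<open>L\<close>.\<close>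

definition freudenthal_decomposition :: "('a::field, 'v::ab_group_add) plane \<Rightarrow>
    ('a \<Rightarrow> 'b \<Rightarrow> 'b::ab_group_add) \<Rightarrow> ('b \<Rightarrow> 'b \<Rightarrow> 'b) \<Rightarrow> 'b set \<Rightarrow> 'b set \<Rightarrow> (('v \<Rightarrow> 'v) \<Rightarrow> 'b) \<Rightarrow>
    ('a \<Rightarrow> 't \<Rightarrow> 't::ab_group_add) \<Rightarrow> 't set \<Rightarrow> ('t \<Rightarrow> 'v \<Rightarrow> 'b) \<Rightarrow> bool" where
  "freudenthal_decomposition P s br L S \<iota> sT T t \<longleftrightarrow>
     (\<exists>L0 L1. direct_sum s S (\<iota> ` sp P) L0 \<and>
        (\<forall>x\<in>S. \<forall>y\<in>S. br x y \<in> S) \<and>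
        (\<forall>x\<in>S. \<forall>f\<in>sp P. br x (\<iota> f) = 0 \<and> br (\<iota> f) x = 0) \<and>
        tensor_decomposition P s sT T t L1 \<and>
        Z2_grading s br L L0 L1) \<and>
     (\<exists>f d a.
        alternating_form sT T f \<and> nondegenerate_form T f \<and>
        (\<forall>x\<in>T. \<forall>y\<in>T. d x y \<in> S \<and> d x y = d y x) \<and> bilinear_from sT s T d \<and>
        (\<forall>x\<in>T. \<forall>y\<in>T. \<forall>u v.
           br (t x u) (t y v) = s (form P u v) (d x y) + s (f x y) (\<iota> (gam P u v))) \<and>
        (\<forall>D\<in>S. \<forall>z\<in>T. a D z \<in> T \<and> (\<forall>u. br D (t z u) = t (a D z) u)) \<and>
        simple_freudenthal_triple_system sT T f
          (\<lambda>x y z. a (d x y) z - sT (f x z) y - sT (f y z) x))"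

end

(* Proof idea. The Jacobi identity of e8 for elements of which two have no sp-component reduces, by
   multilinearity, to pure tensors in three homogeneous components; there it is an identity between
   products of values of the symplectic form (Pluecker relations), and the signs enter only through
   parity conditions on bits. An abstract argument turns a decomposition (s + sp(V)) + (T (x) V) into a
   Freudenthal triple system: the axioms are Jacobi identities of odd elements, and simplicity follows
   since every nonzero ideal contains a strictly regular element, and an ideal that contains one is T.
   For e6 and f4 the Jacobi identity is pulled back from e7. The algebra e6 embeds into e7 modulo the
   one-dimensional centre of the centralizer of a torus of sp(V5) + sp(V6) + sp(V7): a component in
   V(sigma) (x) E becomes a combination of x (x) b1 (x) b0 and x (x) b0 (x) b1 with the two further
   factors in two of the planes 5, 6, 7; and f4 embeds into e6 by x |-> x (x) (e+ + e-). *)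

theory Submission
  imports Defs
begin

section \<open>The symplectic plane\<close>

text \<open>The axioms of the triple system draw on three facts. Jacobi for three odd elements gives
  the symmetry of xyz; Jacobi for one even and two odd elements makes the form invariant and d
  equivariant; the axiom of degree 5 is the vanishing of the bracket of \<open>d x y\<close> with
  itself, rewritten by this equivariance. Pure tensors are strictly regular because <v|v> = 0: when
  two factors remain beside the distinguished one, each summand of \<open>diag\<close> at (v, v)
  contains such a value. In f4 the odd components V_i have a single factor and the map
  \<open>gam P v v\<close> survives; an element supported there must first be moved by a triple
  product into the component with three factors. The planes 5, 6, 7 are chosen by weights. With h =
  1 on b1 and -1 on b0, the torus element with coefficients c5, c6, c7 acts on x (x) b1 (x) b0 by c5
  - c6, c6 - c7 or c7 - c5 for the pairs (5,6), (6,7), (7,5). These sum to zero like the entries of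
  \<open>t2\<close>, and they fix c up to h5 + h6 + h7, which spans the centre in question.
  Contracting the plane shared by consecutive pairs reverses the surviving pair, so e+ with e+
  yields e-.\<close>

locale sympl =
 fixes P :: "('a::field, 'v::ab_group_add) plane"
 assumes two: "(2::'a) ~= 0" and P: "symplectic_plane P"
begin

sublocale V: vector_space "scl P" using P by (simp add: symplectic_plane_def)
sublocale SPS: vector_space "sps P" by (rule vs_sps[OF P])

abbreviation b0 where "b0 \<equiv> bas P False"
abbreviation b1 where "b1 \<equiv> bas P True"

definition om :: 'a where "om = form P b0 b1"

lemmas form_add = form_linear(1,3)[OF P] and form_scl = form_linear(2,4)[OF P]

lemma form_skew: "form P u v = - form P v u"
 using P unfolding symplectic_plane_def by blast

lemma form_self [simp]: "form P u u = 0"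
proof -
 have "2 * form P u u = 0" using form_skew[of u u] by (simp add: eq_neg_iff_add_eq_0 flip: mult_2)
 then show ?thesis using two by simp
qed

lemma form_zero [simp]: "form P 0 u = 0" "form P u 0 = 0"
 using form_scl[of 0 0 u] by (metis V.scale_zero_left mult_zero_left form_scl(1), metis V.scale_zero_left mult_zero_left form_scl(2))

lemma form_uminus [simp]: "form P (- u) v = - form P u v" "form P u (- v) = - form P u v"
 using form_add[of u "- u" v] form_add(2)[of u v "- v"] by (simp_all add: add_eq_0_iff)

lemma coord_add: "coord P (u + v) j = coord P u j + coord P v j"
 and coord_scl: "coord P (scl P c u) j = c * coord P u j"
 by (rule coord_linear[OF P])+

lemma coord_0 [simp]: "coord P 0 j = 0"
 using coord_scl[of 0 0 j] by simp

lemma coord_bas [simp]: "coord P (bas P i) j = (if i = j then 1 else 0)"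
proof -
 have "inj (bas P)" "\<not> V.dependent (range (bas P))" using P unfolding symplectic_plane_def by blast+
 then show ?thesis
  unfolding coord_def by (auto simp: V.representation_basis inj_eq)
qed

lemma vec_eqI: "coord P u False = coord P v False ==> coord P u True = coord P v True ==> u = v"
 by (metis coord_expand[OF P])

lemma form_coord: "form P u v = om * (coord P u False * coord P v True - coord P u True * coord P v False)"
proof -
 have "form P u v = form P (scl P (coord P u False) b0 + scl P (coord P u True) b1)
  (scl P (coord P v False) b0 + scl P (coord P v True) b1)"
  by (rule arg_cong2[of _ _ _ _ "form P"]) (rule coord_expand[OF P])+
 also have "\<dots> = om * (coord P u False * coord P v True - coord P u True * coord P v False)"
  using form_skew[of b1 b0] by (simp add: form_add form_scl om_def[symmetric] algebra_simps)
 finally show ?thesis .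
qed

lemma om_nz: "om ~= 0"
proof
 assume "om = 0"
 then have "form P u v = 0" for u v by (simp add: form_coord)
 then show False using P unfolding symplectic_plane_def by blast
qed

lemma form_bas: "form P (bas P i) (bas P j) = (if i = j then 0 else if j then om else - om)"
 by (auto simp: form_coord)

lemma form_nondeg: "u ~= 0 ==> \<exists>i. form P u (bas P i) ~= 0"
proof (rule ccontr)
 assume "u ~= 0" and "\<nexists>i. form P u (bas P i) ~= 0"
 then have "form P u b0 = 0" "form P u b1 = 0" by auto
 then have "u = 0" using om_nz by (intro vec_eqI) (auto simp: form_coord)
 then show False using \<open>u ~= 0\<close> by simp
qed

text \<open>Three vectors of a plane are dependent: the left side is alternating in
  \<open>v\<close>, \<open>w\<close>, \<open>z\<close>, hence zero. Applied at single tensor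
  factors, this relation carries the Jacobi identity of contractions.\<close>

lemma plucker: "scl P (form P v w) z + scl P (form P w z) v + scl P (form P z v) w = 0"
 by (rule vec_eqI) (simp_all only: coord_add coord_scl coord_0 form_coord, simp_all add: algebra_simps)

lemma gam_commute: "gam P a b = gam P b a"
 by (simp add: gam_def add.commute)

lemmas gam_lin = gam_linear[OF P]

lemma coord_gam: "coord P (gam P a b z) j = form P a z * coord P b j + form P b z * coord P a j"
 by (simp add: gam_def coord_add coord_scl)

lemma vs_maps: "vector_space (%c (f::'v => 'v) v. scl P c (f v))"
 by unfold_locales (auto simp: fun_eq_iff algebra_simps)

lemma gam_sp [simp]: "gam P a b \<in> sp P"
 and sp_add: "f \<in> sp P ==> g \<in> sp P ==> f + g \<in> sp P"
 and sp_scl: "f \<in> sp P ==> (%v. scl P c (f v)) \<in> sp P"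
 and sp_0 [simp]: "0 \<in> sp P"
proof -
 interpret F: vector_space "%c (f::'v => 'v) v. scl P c (f v)" by (rule vs_maps)
 show "gam P a b \<in> sp P"
  unfolding sp_def by (rule F.span_base) auto
 show "f \<in> sp P ==> g \<in> sp P ==> f + g \<in> sp P" "0 \<in> sp P" "f \<in> sp P ==> (%v. scl P c (f v)) \<in> sp P"
  unfolding sp_def by (rule F.span_add F.span_zero F.span_scale; assumption?)+
qed

lemma sp_induct [consumes 1, case_names zero step]:
 assumes "f \<in> sp P" "Q 0" "\<And>c a b g. g \<in> sp P ==> Q g ==> Q ((%v. scl P c (gam P a b v)) + g)"
 shows "Q f"
proof -
 interpret F: vector_space "%c (f::'v => 'v) v. scl P c (f v)" by (rule vs_maps)
 have "f \<in> F.span {gam P a b |a b. True}" using assms(1) by (simp add: sp_def)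
 then have "f \<in> F.span {gam P a b |a b. True} \<and> Q f"
 proof (induction rule: F.span_induct_alt)
  case base
  show ?case using assms(2) F.span_zero by blast
 next
  case (step c x y)
  from step(1) obtain a b where x: "x = gam P a b" by auto
  have "y \<in> sp P" using step(2) by (simp add: sp_def)
  then have "Q ((%v. scl P c (x v)) + y)" and "(%v. scl P c (x v)) + y \<in> sp P"
   using assms(3) step(2) by (auto simp: x intro!: sp_add sp_scl)
  then show ?case unfolding sp_def by blast
 qed
 then show ?thesis ..
qed

lemma gam_skew: "form P (gam P a b u) v = - form P u (gam P a b v)"
 using form_skew[of u a] form_skew[of u b] by (simp add: gam_def form_add form_scl)

lemma sp_props:
 assumes "f \<in> sp P"
 shows sp_map_add: "f (u + v) = f u + f v" and sp_map_scl: "f (scl P c u) = scl P c (f u)"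
  and sp_skew: "form P (f u) v = - form P u (f v)"
proof -
 have gl: "gam P a b (u + v) = gam P a b u + gam P a b v" "gam P a b (scl P c u) = scl P c (gam P a b u)" for a b u v c
  by (simp_all add: gam_def form_add form_scl algebra_simps)
 have "(\<forall>u v. f (u + v) = f u + f v) \<and> (\<forall>c u. f (scl P c u) = scl P c (f u)) \<and> (\<forall>u v. form P (f u) v = - form P u (f v))"
  using assms
 proof (induction rule: sp_induct)
  case zero
  show ?case by simp
 next
  case (step c a b g)
  have s: "form P (g u) v = - form P u (g v)" and m: "g (u + v) = g u + g v" "g (scl P c u) = scl P c (g u)" for u v c
   using step by blast+
  show ?case
  proof (intro conjI allI)
   fix u v k
   show "((%v. scl P c (gam P a b v)) + g) (u + v) = ((%v. scl P c (gam P a b v)) + g) u + ((%v. scl P c (gam P a b v)) + g) v"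
    by (simp add: m gl algebra_simps)
   show "((%v. scl P c (gam P a b v)) + g) (scl P k u) = scl P k (((%v. scl P c (gam P a b v)) + g) u)"
    by (simp add: m gl algebra_simps)
   show "form P (((%v. scl P c (gam P a b v)) + g) u) v = - form P u (((%v. scl P c (gam P a b v)) + g) v)"
    using s[of u v] gam_skew[of a b u v] by (simp add: form_add form_scl)
  qed
 qed
 then show "f (u + v) = f u + f v" "f (scl P c u) = scl P c (f u)" "form P (f u) v = - form P u (f v)"
  by blast+
qed

lemma sp_linear: "f \<in> sp P ==> Vector_Spaces.linear (scl P) (scl P) f"
 by unfold_locales (simp_all add: sp_props)

lemma sp_map_0: "f \<in> sp P ==> f 0 = 0"
 using sp_map_scl[of f 0 0] by simp

lemma sp_map_minus: "f \<in> sp P ==> f (- u) = - f u"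
 using sp_map_add[of f u "- u"] by (simp add: sp_map_0 eq_neg_iff_add_eq_0 add.commute)

text \<open>Skewness of \<open>f\<close> for the form turns it into a derivation of
  \<open>gam\<close>. Both the closure of \<open>sp P\<close> under commutators and the equivariance
  of \<open>diag\<close> come from this.\<close>

lemma gam_equivariant:
 assumes f: "f \<in> sp P"
 shows "f (gam P a b z) - gam P a b (f z) = gam P (f a) b z + gam P a (f b) z"
 using sp_skew[OF f, of a z] sp_skew[OF f, of b z]
 by (simp add: gam_def sp_map_add[OF f] sp_map_scl[OF f] algebra_simps)

lemma sp_closed:
 assumes f: "f \<in> sp P" and "g \<in> sp P"
 shows "(%v. f (g v) - g (f v)) \<in> sp P"
 using assms(2)
proof (induction rule: sp_induct)
 case zero
 then show ?case using f sp_0 by (simp add: zero_fun_def sp_map_0)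
next
 case (step c a b g)
 have "(%v. scl P c ((gam P (f a) b + gam P a (f b)) v)) + (%v. f (g v) - g (f v)) \<in> sp P"
  by (intro sp_scl sp_add gam_sp step)
 moreover have "f (((%v. scl P c (gam P a b v)) + g) v) - ((%v. scl P c (gam P a b v)) + g) (f v)
   = scl P c (gam P (f a) b v + gam P a (f b) v) + (f (g v) - g (f v))" for v
  by (simp add: sp_map_add[OF f] sp_map_scl[OF f] gam_equivariant[OF f, symmetric] V.scale_right_diff_distrib)
 moreover have "(%v. scl P c ((gam P (f a) b + gam P a (f b)) v)) + (%v. f (g v) - g (f v)) =
  (%v. scl P c (gam P (f a) b v + gam P a (f b) v) + (f (g v) - g (f v)))"
  by (simp add: fun_eq_iff)
 ultimately show ?case by (simp del: plus_fun_apply)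
qed

end

section \<open>Tensors\<close>

lemma sum_apply: "(\<Sum>i\<in>I. F i) x = (\<Sum>i\<in>I. F i x :: 'b::comm_monoid_add)"
 by (induction I rule: infinite_finite_induct) auto

interpretation TS: vector_space "ts :: 'a::field => 'a tensor => 'a tensor"
 by (rule vs_ts)

lemma linext_add:
 assumes "vector_space s" shows "linext P s \<sigma> F (x + y) = linext P s \<sigma> F x + linext P s \<sigma> F y"
proof -
 interpret vector_space s by fact
 show ?thesis by (simp add: linext_def scale_left_distrib sum.distrib)
qed

lemma linext_scale:
 assumes "vector_space s" shows "linext P s \<sigma> F (ts c x) = s c (linext P s \<sigma> F x)"
proof -
 interpret vector_space s by fact
 show ?thesis by (simp add: linext_def scale_sum_right ts_def)
qed

lemma linext_map_add:
 assumes "vector_space s" shows "linext P s \<sigma> (%v. F v + G v) x = linext P s \<sigma> F x + linext P s \<sigma> G x"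
proof -
 interpret vector_space s by fact
 show ?thesis by (simp add: linext_def scale_right_distrib sum.distrib)
qed

lemma linext_map_scale:
 assumes "vector_space s" shows "linext P s \<sigma> (%v. s c (F v)) x = s c (linext P s \<sigma> F x)"
proof -
 interpret vector_space s by fact
 show ?thesis by (simp add: linext_def scale_sum_right mult.commute)
qed

lemma bilext_lin:
 assumes s: "vector_space s"
 shows "bilext P s \<sigma> \<tau> F (x + x') y = bilext P s \<sigma> \<tau> F x y + bilext P s \<sigma> \<tau> F x' y"
  "bilext P s \<sigma> \<tau> F x (y + y') = bilext P s \<sigma> \<tau> F x y + bilext P s \<sigma> \<tau> F x y'"
  "bilext P s \<sigma> \<tau> F (ts c x) y = s c (bilext P s \<sigma> \<tau> F x y)"
  "bilext P s \<sigma> \<tau> F x (ts c y) = s c (bilext P s \<sigma> \<tau> F x y)"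
 unfolding bilext_def
 by (simp_all add: linext_add[OF s] linext_scale[OF s] linext_map_add[OF s] linext_map_scale[OF s])

lemma ts_apply: "ts c x \<kappa> = c * x \<kappa>" by (simp add: ts_def)

lemma tensor_space_subspace: "TS.subspace (tensor_space \<sigma>)"
 by (auto simp: TS.subspace_def tensor_space_def ts_def)

lemma tensor_space_closed [simp]:
 "0 \<in> tensor_space \<sigma>"
 "x \<in> tensor_space \<sigma> ==> y \<in> tensor_space \<sigma> ==> x + y \<in> tensor_space \<sigma>"
 "x \<in> tensor_space \<sigma> ==> ts c x \<in> tensor_space \<sigma>"
 "x \<in> tensor_space \<sigma> ==> - x \<in> tensor_space \<sigma>"
 for x y :: "'a::field tensor"
 by (simp_all add: tensor_space_def ts_def)

lemma tensor_space_sum [simp]: "(\<And>i. i \<in> I ==> F i \<in> tensor_space \<sigma>) ==> sum F I \<in> tensor_space (\<sigma> :: nat set)"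
 for F :: "'i => 'a::field tensor"
 by (rule TS.subspace_sum[OF tensor_space_subspace])

lemma pure_in [simp]: "pure P \<sigma> v \<in> tensor_space \<sigma>"
 by (auto simp: pure_def tensor_space_def)

lemma linext_in [simp]: "(\<And>v. F v \<in> tensor_space \<tau>) ==> linext P ts \<sigma> F x \<in> tensor_space \<tau>"
 for x :: "'a::field tensor"
 by (simp add: linext_def)

lemma act_in [simp]: "act P \<sigma> g x \<in> tensor_space \<sigma>"
 by (simp add: act_def)

lemma contr_in [simp]: "contr P \<sigma> \<tau> x y \<in> tensor_space (sym_diff \<sigma> \<tau>)"
 unfolding contr_def bilext_def by (intro linext_in) simp

context sympl begin

lemma contr_lin:
 "contr P \<sigma> \<tau> (x + x') y = contr P \<sigma> \<tau> x y + contr P \<sigma> \<tau> x' y"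
 "contr P \<sigma> \<tau> x (y + y') = contr P \<sigma> \<tau> x y + contr P \<sigma> \<tau> x y'"
 "contr P \<sigma> \<tau> (ts c x) y = ts c (contr P \<sigma> \<tau> x y)"
 "contr P \<sigma> \<tau> x (ts c y) = ts c (contr P \<sigma> \<tau> x y)"
 unfolding contr_def by (rule bilext_lin[OF vs_ts])+

lemma diag_lin:
 "diag P \<sigma> (x + x') y = diag P \<sigma> x y + diag P \<sigma> x' y"
 "diag P \<sigma> x (y + y') = diag P \<sigma> x y + diag P \<sigma> x y'"
 "diag P \<sigma> (ts c x) y = sps P c (diag P \<sigma> x y)"
 "diag P \<sigma> x (ts c y) = sps P c (diag P \<sigma> x y)"
 unfolding diag_def by (rule bilext_lin[OF vs_sps[OF P]])+

lemma tform_lin: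
 "tform P \<sigma> (x + x') y = tform P \<sigma> x y + tform P \<sigma> x' y"
 "tform P \<sigma> x (y + y') = tform P \<sigma> x y + tform P \<sigma> x y'"
 "tform P \<sigma> (ts c x) y = c * (tform P \<sigma> x y)"
 "tform P \<sigma> x (ts c y) = c * (tform P \<sigma> x y)"
 unfolding tform_def by (rule bilext_lin[OF vs_mult])+

lemma act_lin:
 "act P \<sigma> g (x + x') = act P \<sigma> g x + act P \<sigma> g x'"
 "act P \<sigma> g (ts c x) = ts c (act P \<sigma> g x)"
 unfolding act_def by (rule linext_add[OF vs_ts] linext_scale[OF vs_ts])+

lemma zero_lin [simp]:
 "contr P \<sigma> \<tau> 0 y = 0" "contr P \<sigma> \<tau> x 0 = 0" "diag P \<sigma> 0 y = 0" "diag P \<sigma> x 0 = 0"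
 "tform P \<sigma> 0 y = 0" "tform P \<sigma> x 0 = 0" "act P \<sigma> g 0 = 0"
 using contr_lin(3)[of \<sigma> \<tau> 0 0 y] contr_lin(4)[of \<sigma> \<tau> x 0 0] diag_lin(3)[of \<sigma> 0 0 y]
  diag_lin(4)[of \<sigma> x 0 0] tform_lin(3)[of \<sigma> 0 0 y] tform_lin(4)[of \<sigma> x 0 0] act_lin(2)[of \<sigma> g 0 0]
 by (simp_all add: ts_def zero_fun_def)

lemmas pure_add = pure_linear(1)[OF P] and pure_scl = pure_linear(2)[OF P]

lemma pure_zero: "finite \<sigma> ==> i \<in> \<sigma> ==> pure P \<sigma> (v(i := 0)) = 0"
 using pure_scl[of \<sigma> i v 0 0] by simp

lemma act_lin_g:
 assumes "finite \<sigma>"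
 shows "act P \<sigma> (g + h) x = act P \<sigma> g x + act P \<sigma> h x"
  "act P \<sigma> (sps P c g) x = ts c (act P \<sigma> g x)"
proof -
 have "(\<Sum>i\<in>\<sigma>. pure P \<sigma> (v(i := (g + h) i (v i)))) =
  (\<Sum>i\<in>\<sigma>. pure P \<sigma> (v(i := g i (v i)))) + (\<Sum>i\<in>\<sigma>. pure P \<sigma> (v(i := h i (v i))))" for v
  by (simp add: pure_add[OF assms] sum.distrib)
 then show "act P \<sigma> (g + h) x = act P \<sigma> g x + act P \<sigma> h x"
  unfolding act_def by (simp only: linext_map_add[OF vs_ts])
 have "(\<Sum>i\<in>\<sigma>. pure P \<sigma> (v(i := sps P c g i (v i)))) =
  ts c (\<Sum>i\<in>\<sigma>. pure P \<sigma> (v(i := g i (v i))))" for v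
  by (simp add: sps_def pure_scl[OF assms] TS.scale_sum_right)
 then show "act P \<sigma> (sps P c g) x = ts c (act P \<sigma> g x)"
  unfolding act_def by (simp only: linext_map_scale[OF vs_ts])
qed

lemma act_cong: "(\<And>i. i \<in> \<sigma> ==> g i = h i) ==> act P \<sigma> g = act P \<sigma> h"
 unfolding act_def by simp

lemma act_zero: assumes "finite \<sigma>" "\<And>i. i \<in> \<sigma> ==> g i = 0" shows "act P \<sigma> g x = 0"
proof -
 have "act P \<sigma> g = act P \<sigma> (sps P 0 g)"
  by (rule act_cong) (simp add: assms(2) sps_def fun_eq_iff)
 then show ?thesis using act_lin_g(2)[OF assms(1), of 0 g x] by (simp only: TS.scale_zero_left)
qed

text \<open>Two different subsets of \<open>\<sigma>\<close> differ at some index, where one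
  coordinate factor is 0; so tensor products of basis vectors are unit coordinate families.\<close>

lemma pure_bfam: "finite \<sigma> ==> \<kappa> \<subseteq> \<sigma> ==> pure P \<sigma> (bfam P \<kappa>) = single \<kappa> 1"
proof
 fix \<kappa>' assume f: "finite \<sigma>" and k: "\<kappa> \<subseteq> \<sigma>"
 show "pure P \<sigma> (bfam P \<kappa>) \<kappa>' = single \<kappa> 1 \<kappa>'"
 proof (cases "\<kappa>' = \<kappa>")
  case True
  then show ?thesis using k by (simp add: pure_def bfam_def single_def)
 next
  case False
  show ?thesis
  proof (cases "\<kappa>' \<subseteq> \<sigma>")
   case True
   then obtain i where "i \<in> \<sigma>" "(i \<in> \<kappa>) ~= (i \<in> \<kappa>')" using False k by blast
   then have "(\<Prod>i\<in>\<sigma>. coord P (bas P (i \<in> \<kappa>)) (i \<in> \<kappa>')) = 0"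
    using f by (intro prod_zero) auto
   then show ?thesis using False True by (simp add: pure_def bfam_def single_def)
  qed (use False k in \<open>auto simp: pure_def single_def\<close>)
 qed
qed

lemma tensor_expand:
 assumes "finite \<sigma>" "x \<in> tensor_space \<sigma>"
 shows "x = (\<Sum>\<kappa>\<in>Pow \<sigma>. ts (x \<kappa>) (pure P \<sigma> (bfam P \<kappa>)))"
proof
 fix \<kappa>'
 have "(\<Sum>\<kappa>\<in>Pow \<sigma>. ts (x \<kappa>) (pure P \<sigma> (bfam P \<kappa>))) \<kappa>' = (\<Sum>\<kappa>\<in>Pow \<sigma>. if \<kappa>' = \<kappa> then x \<kappa>' else 0)"
  unfolding sum_apply
  using assms(1) by (intro sum.cong) (auto simp: pure_bfam ts_def single_def)
 also have "\<dots> = x \<kappa>'" using assms by (auto simp: tensor_space_def)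
 finally show "x \<kappa>' = (\<Sum>\<kappa>\<in>Pow \<sigma>. ts (x \<kappa>) (pure P \<sigma> (bfam P \<kappa>))) \<kappa>'" by simp
qed

lemma tensor_induct:
 assumes f: "finite \<sigma>" and x: "x \<in> tensor_space \<sigma>"
  and pure: "\<And>v. Q (pure P \<sigma> v)" and add: "\<And>x y. Q x ==> Q y ==> Q (x + y)"
  and scale: "\<And>c x. Q x ==> Q (ts c x)"
 shows "Q x"
proof -
 have 0: "Q 0" using scale[OF pure, of 0] by simp
 have "Q (\<Sum>\<kappa>\<in>K. ts (x \<kappa>) (pure P \<sigma> (bfam P \<kappa>)))" if "finite K" for K
  using that by (induction K rule: finite_induct) (simp_all only: sum.empty sum.insert not_False_eq_True 0 add scale pure)
 then show ?thesis using tensor_expand[OF f x] f by (metis finite_Pow_iff)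
qed

text \<open>Pure tensors span. An identity is phrased as the vanishing of one map
  \<open>\<Phi>\<close> and then checked on pure tensors only; the scalar multiplication
  \<open>s\<close> of the target is a parameter, since values lie in tensors, in powers of
  \<open>sp P\<close> or in the field.\<close>

lemma linear_zero:
 assumes s: "vector_space s" and f: "finite \<sigma>" and x: "x \<in> tensor_space \<sigma>"
  and add: "\<And>x y. \<Phi> (x + y) = \<Phi> x + \<Phi> y" and scale: "\<And>c x. \<Phi> (ts c x) = s c (\<Phi> x)"
  and pure: "\<And>v. \<Phi> (pure P \<sigma> v) = 0"
 shows "\<Phi> x = (0 :: 'b::ab_group_add)"
proof -
 interpret vector_space s by fact
 show ?thesis by (rule tensor_induct[OF f x]) (simp_all only: add scale pure add_0 scale_zero_right)
qed

lemma bilinear_zero: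
 assumes s: "vector_space s" and f: "finite \<sigma>" "finite \<tau>" and x: "x \<in> tensor_space \<sigma>" "y \<in> tensor_space \<tau>"
  and "\<And>x x' y. \<Phi> (x + x') y = \<Phi> x y + \<Phi> x' y" "\<And>c x y. \<Phi> (ts c x) y = s c (\<Phi> x y)"
  and "\<And>x y y'. \<Phi> x (y + y') = \<Phi> x y + \<Phi> x y'" "\<And>c x y. \<Phi> x (ts c y) = s c (\<Phi> x y)"
  and pure: "\<And>v w. \<Phi> (pure P \<sigma> v) (pure P \<tau> w) = 0"
 shows "\<Phi> x y = (0 :: 'b::ab_group_add)"
 by (rule linear_zero[where \<Phi> = "%x. \<Phi> x y", OF s f(1) x(1)], (fact assms)+,
   rule linear_zero[where \<Phi> = "%y. \<Phi> _ y", OF s f(2) x(2)]) (fact assms)+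

lemma trilinear_zero:
 assumes s: "vector_space s" and f: "finite \<sigma>" "finite \<tau>" "finite \<rho>"
  and x: "x \<in> tensor_space \<sigma>" "y \<in> tensor_space \<tau>" "z \<in> tensor_space \<rho>"
  and "\<And>x x' y z. \<Phi> (x + x') y z = \<Phi> x y z + \<Phi> x' y z" "\<And>c x y z. \<Phi> (ts c x) y z = s c (\<Phi> x y z)"
  and "\<And>x y y' z. \<Phi> x (y + y') z = \<Phi> x y z + \<Phi> x y' z" "\<And>c x y z. \<Phi> x (ts c y) z = s c (\<Phi> x y z)"
  and "\<And>x y z z'. \<Phi> x y (z + z') = \<Phi> x y z + \<Phi> x y z'" "\<And>c x y z. \<Phi> x y (ts c z) = s c (\<Phi> x y z)"
  and pure: "\<And>v w u. \<Phi> (pure P \<sigma> v) (pure P \<tau> w) (pure P \<rho> u) = 0"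
 shows "\<Phi> x y z = (0 :: 'b::ab_group_add)"
 by (rule linear_zero[where \<Phi> = "%x. \<Phi> x y z", OF s f(1) x(1)], (fact assms)+,
   rule bilinear_zero[where \<Phi> = "%y z. \<Phi> _ y z", OF s f(2,3) x(2,3)]) (fact assms)+

end

section \<open>Multilinear identities\<close>

context sympl begin

lemma ts_ts: "ts a (ts b x) = ts (a * b) (x :: 'a tensor)"
 by (simp add: ts_def mult.assoc)

lemma plucker_coord: "form P v w * coord P z j + form P w z * coord P v j + form P z v * coord P w j = 0"
 using arg_cong[OF plucker[of v w z], of "%x. coord P x j"] by (simp only: coord_add coord_scl coord_0)

lemma pure_uminus: "finite \<sigma> ==> i \<in> \<sigma> ==> pure P \<sigma> (v(i := - u)) = - pure P \<sigma> (v(i := u))"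
 using pure_scl[of \<sigma> i v "-1" u] by simp

lemma contr_sum: "contr P \<sigma> \<tau> (\<Sum>i\<in>I. F i) y = (\<Sum>i\<in>I. contr P \<sigma> \<tau> (F i) y)"
 "contr P \<sigma> \<tau> x (\<Sum>i\<in>I. F i) = (\<Sum>i\<in>I. contr P \<sigma> \<tau> x (F i))"
 by (induction I rule: infinite_finite_induct; simp only: sum.infinite sum.empty sum.insert zero_lin contr_lin not_False_eq_True)+

lemma diag_sum: "diag P \<sigma> (\<Sum>i\<in>I. F i) y = (\<Sum>i\<in>I. diag P \<sigma> (F i) y)"
 "diag P \<sigma> x (\<Sum>i\<in>I. F i) = (\<Sum>i\<in>I. diag P \<sigma> x (F i))"
 by (induction I rule: infinite_finite_induct; simp only: sum.infinite sum.empty sum.insert zero_lin diag_lin not_False_eq_True)+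

text \<open>The common index \<open>p\<close> is used up by the first contraction and reappears with
  the vector of the third tensor. Its scalar is put into the vector at \<open>p\<close>, so that the
  three rotations of this formula differ at the single index \<open>p\<close>.\<close>

lemma contr_contr_pure:
 assumes fin: "finite \<sigma>" "finite \<tau>" "finite \<rho>"
  and I: "\<sigma> \<inter> \<tau> = {p, a}" "\<sigma> \<inter> \<rho> = {p, b}" "\<tau> \<inter> \<rho> = {p, c}" "a ~: \<rho>" "b ~: \<tau>" "c ~: \<sigma>"
 shows "contr P (sym_diff \<sigma> \<tau>) \<rho> (contr P \<sigma> \<tau> (pure P \<sigma> v) (pure P \<tau> w)) (pure P \<rho> z) =
  ts (form P (v a) (w a) * form P (v b) (z b) * form P (w c) (z c))
   (pure P (sym_diff (sym_diff \<sigma> \<tau>) \<rho>)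
    ((%i. if i \<in> \<sigma> then v i else if i \<in> \<tau> then w i else z i)(p := scl P (form P (v p) (w p)) (z p))))"
proof -
 have m: "\<And>i. (i \<in> \<sigma> \<and> i \<in> \<tau>) = (i = p \<or> i = a)" "\<And>i. (i \<in> \<sigma> \<and> i \<in> \<rho>) = (i = p \<or> i = b)"
  "\<And>i. (i \<in> \<tau> \<and> i \<in> \<rho>) = (i = p \<or> i = c)"
  using I(1-3) by (simp_all only: set_eq_iff Int_iff insert_iff empty_iff simp_thms)
 have e: "p \<in> \<sigma>" "p \<in> \<tau>" "p \<in> \<rho>" "a \<in> \<sigma>" "a \<in> \<tau>" "b \<in> \<sigma>" "b \<in> \<rho>" "c \<in> \<tau>" "c \<in> \<rho>"
  using m by blast+
 have ne: "a ~= p" "b ~= p" "c ~= p" "b ~= c" using e I(4-6) by blast+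
 have J: "sym_diff \<sigma> \<tau> \<inter> \<rho> = {b, c}" using m e I(4-6) ne by auto
 have p: "p \<in> sym_diff (sym_diff \<sigma> \<tau>) \<rho>" "finite (sym_diff \<sigma> \<tau>)" "finite (sym_diff (sym_diff \<sigma> \<tau>) \<rho>)"
  using e fin by auto
 let ?M = "%i. if i \<in> \<sigma> then v i else if i \<in> \<tau> then w i else z i"
 have q: "pure P (sym_diff (sym_diff \<sigma> \<tau>) \<rho>) (%i. if i \<in> sym_diff \<sigma> \<tau> then if i \<in> \<sigma> then v i else w i else z i)
  = pure P (sym_diff (sym_diff \<sigma> \<tau>) \<rho>) (?M(p := z p))"
 proof (rule pure_local)
  fix i assume "i \<in> sym_diff (sym_diff \<sigma> \<tau>) \<rho>"
  then show "(if i \<in> sym_diff \<sigma> \<tau> then if i \<in> \<sigma> then v i else w i else z i) = (?M(p := z p)) i"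
   using m[of i] e I(4-6) ne by auto
 qed
 show ?thesis
  unfolding contr_pure[OF P fin(1,2)] contr_lin contr_pure[OF P p(2) fin(3)] q J I(1) ts_ts
  using ne e I(4-6) by (simp add: ts_ts pure_scl[OF p(3,1)] mult_ac del: fun_upd_apply)
qed

text \<open>The scalars from \<open>a\<close>, \<open>b\<close>, \<open>c\<close> agree in all three
  terms, since each of the two rotated terms reverses two forms. What differs is the vector at
  \<open>p\<close>, and the three vectors there sum to zero by \<open>plucker\<close>.\<close>

lemma contr_jacobi:
 assumes fin: "finite \<sigma>" "finite \<tau>" "finite \<rho>"
  and I: "\<sigma> \<inter> \<tau> = {p, a}" "\<sigma> \<inter> \<rho> = {p, b}" "\<tau> \<inter> \<rho> = {p, c}" "a ~: \<rho>" "b ~: \<tau>" "c ~: \<sigma>"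
  and x: "x \<in> tensor_space \<sigma>" "y \<in> tensor_space \<tau>" "z \<in> tensor_space \<rho>"
 shows "contr P (sym_diff \<sigma> \<tau>) \<rho> (contr P \<sigma> \<tau> x y) z
  + contr P (sym_diff \<tau> \<rho>) \<sigma> (contr P \<tau> \<rho> y z) x
  + contr P (sym_diff \<rho> \<sigma>) \<tau> (contr P \<rho> \<sigma> z x) y = 0"
proof -
 let ?\<Phi> = "%x y z. contr P (sym_diff \<sigma> \<tau>) \<rho> (contr P \<sigma> \<tau> x y) z
  + contr P (sym_diff \<tau> \<rho>) \<sigma> (contr P \<tau> \<rho> y z) x
  + contr P (sym_diff \<rho> \<sigma>) \<tau> (contr P \<rho> \<sigma> z x) y"
 show "?\<Phi> x y z = 0"
proof (rule trilinear_zero[where \<Phi> = ?\<Phi>, OF vs_ts fin x])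
 fix v w u :: "nat => 'v"
 let ?D = "sym_diff (sym_diff \<sigma> \<tau>) \<rho>"
 let ?M = "%i. if i \<in> \<sigma> then v i else if i \<in> \<tau> then w i else u i"
 let ?K = "form P (v a) (w a) * form P (v b) (u b) * form P (w c) (u c)"
 have m: "\<And>i. (i \<in> \<sigma> \<and> i \<in> \<tau>) = (i = p \<or> i = a)" "\<And>i. (i \<in> \<sigma> \<and> i \<in> \<rho>) = (i = p \<or> i = b)"
  "\<And>i. (i \<in> \<tau> \<and> i \<in> \<rho>) = (i = p \<or> i = c)"
  using I(1-3) by (simp_all only: set_eq_iff Int_iff insert_iff empty_iff simp_thms)
 have e: "p \<in> \<sigma>" "p \<in> \<tau>" "p \<in> \<rho>" "a \<in> \<sigma>" "a \<in> \<tau>" "b \<in> \<sigma>" "b \<in> \<rho>" "c \<in> \<tau>" "c \<in> \<rho>"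
  using m by blast+
 have ne: "a ~= p" "b ~= p" "c ~= p" "b ~= c" using e I(4-6) by blast+
 have p: "p \<in> ?D" "finite ?D" using e fin by auto
 have D: "sym_diff (sym_diff \<tau> \<rho>) \<sigma> = ?D" "sym_diff (sym_diff \<rho> \<sigma>) \<tau> = ?D" by auto
 have q2: "pure P ?D ((%i. if i \<in> \<tau> then w i else if i \<in> \<rho> then u i else v i)(p := X)) = pure P ?D (?M(p := X))"
  and q3: "pure P ?D ((%i. if i \<in> \<rho> then u i else if i \<in> \<sigma> then v i else w i)(p := X)) = pure P ?D (?M(p := X))" for X
  by (rule pure_local; rename_tac i, cut_tac i = i in m(1), cut_tac i = i in m(2), cut_tac i = i in m(3), use e ne I(4-6) in auto)+
 have K: "form P (w c) (u c) * form P (w a) (v a) * form P (u b) (v b) = ?K"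
  "form P (u b) (v b) * form P (u c) (w c) * form P (v a) (w a) = ?K"
  using form_skew[of "w a" "v a"] form_skew[of "u b" "v b"] form_skew[of "u c" "w c"] by simp_all
 have I': "\<tau> \<inter> \<sigma> = {p, a}" "\<rho> \<inter> \<sigma> = {p, b}" "\<rho> \<inter> \<tau> = {p, c}" using I(1-3) by (simp_all only: Int_commute)
 have "pure P ?D (?M(p := scl P (form P (v p) (w p)) (u p))) + pure P ?D (?M(p := scl P (form P (w p) (u p)) (v p)))
  + pure P ?D (?M(p := scl P (form P (u p) (v p)) (w p))) = 0"
  unfolding pure_add[OF p(2,1), symmetric] plucker by (rule pure_zero[OF p(2,1)])
 then show "?\<Phi> (pure P \<sigma> v) (pure P \<tau> w) (pure P \<rho> u) = 0"
  unfolding contr_contr_pure[OF fin I] contr_contr_pure[OF fin(2,3,1) I(3) I'(1,2) I(6,4,5)]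
   contr_contr_pure[OF fin(3,1,2) I'(2,3) I(1,5,6,4)] D q2 q3 K TS.scale_right_distrib[symmetric]
  by simp
qed (simp_all add: contr_lin TS.scale_right_distrib)
qed

text \<open>This serves complementary sets \<open>\<sigma>\<close>, \<open>\<tau>\<close>, for which
  the bracket of the two components is 0. The two remaining terms agree because passing from one to
  the other reverses the form at \<open>c\<close> and at \<open>d\<close>, an even number of
  times.\<close>

lemma contr_disjoint:
 assumes fin: "finite \<sigma>" "finite \<tau>" "finite \<rho>"
  and I: "\<sigma> \<inter> \<tau> = {}" "\<sigma> \<inter> \<rho> = {a, b}" "\<tau> \<inter> \<rho> = {c, d}" "a ~= b" "c ~= d"
  and x: "x \<in> tensor_space \<sigma>" "y \<in> tensor_space \<tau>" "z \<in> tensor_space \<rho>"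
 shows "contr P (sym_diff \<tau> \<rho>) \<sigma> (contr P \<tau> \<rho> y z) x = contr P (sym_diff \<rho> \<sigma>) \<tau> (contr P \<rho> \<sigma> z x) y"
proof -
 let ?\<Phi> = "%x y z. contr P (sym_diff \<tau> \<rho>) \<sigma> (contr P \<tau> \<rho> y z) x - contr P (sym_diff \<rho> \<sigma>) \<tau> (contr P \<rho> \<sigma> z x) y"
 have "?\<Phi> x y z = 0"
 proof (rule trilinear_zero[where \<Phi> = ?\<Phi>, OF vs_ts fin x])
  fix v w u :: "nat => 'v"
  have m: "\<And>i. \<not> (i \<in> \<sigma> \<and> i \<in> \<tau>)" "\<And>i. (i \<in> \<sigma> \<and> i \<in> \<rho>) = (i = a \<or> i = b)"
   "\<And>i. (i \<in> \<tau> \<and> i \<in> \<rho>) = (i = c \<or> i = d)"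
   using I(1-3) by (simp_all only: set_eq_iff Int_iff insert_iff empty_iff simp_thms)
  have e: "a \<in> \<sigma>" "b \<in> \<sigma>" "c \<in> \<tau>" "d \<in> \<tau>" "a \<in> \<rho>" "b \<in> \<rho>" "c \<in> \<rho>" "d \<in> \<rho>" "a ~: \<tau>" "b ~: \<tau>"
   using m by blast+
  have s: "sym_diff \<tau> \<rho> \<inter> \<sigma> = {a, b}" "sym_diff \<rho> \<sigma> \<inter> \<tau> = {c, d}" "\<rho> \<inter> \<sigma> = {a, b}"
   using m e by auto
  have fs: "finite (sym_diff \<tau> \<rho>)" "finite (sym_diff \<rho> \<sigma>)"
   using fin by auto
  have D: "sym_diff (sym_diff \<rho> \<sigma>) \<tau> = sym_diff (sym_diff \<tau> \<rho>) \<sigma>" by auto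
  have q: "pure P (sym_diff (sym_diff \<tau> \<rho>) \<sigma>) (%i. if i \<in> sym_diff \<rho> \<sigma> then if i \<in> \<rho> then u i else v i else w i)
   = pure P (sym_diff (sym_diff \<tau> \<rho>) \<sigma>) (%i. if i \<in> sym_diff \<tau> \<rho> then if i \<in> \<tau> then w i else u i else v i)"
   by (rule pure_local; rename_tac i, cut_tac i = i in m(1), cut_tac i = i in m(2), cut_tac i = i in m(3), use e in auto)
  show "?\<Phi> (pure P \<sigma> v) (pure P \<tau> w) (pure P \<rho> u) = 0"
   unfolding contr_pure[OF P fin(2,3)] contr_pure[OF P fin(3,1)] contr_lin contr_pure[OF P fs(1) fin(1)]
    contr_pure[OF P fs(2) fin(2)] q D s I(3) ts_ts
   using e I(4,5) form_skew[of "u c" "w c"] form_skew[of "u d" "w d"] by (simp add: mult_ac ts_ts)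
 qed (simp_all add: contr_lin TS.scale_right_diff_distrib)
 then show ?thesis by simp
qed

lemma diag_apply:
 assumes fin: "finite \<sigma>"
 shows "diag P \<sigma> (pure P \<sigma> v) (pure P \<sigma> w) i =
  (if i \<in> \<sigma> then (%z. scl P (- (1 / 2) * (\<Prod>k\<in>\<sigma> - {i}. form P (v k) (w k))) (gam P (v i) (w i) z)) else 0)"
proof -
 have "(\<Sum>j\<in>\<sigma>. sps P (\<Prod>k\<in>\<sigma> - {j}. form P (v k) (w k)) (nu j (gam P (v j) (w j)))) i z
  = (\<Sum>j\<in>\<sigma>. if i = j then scl P (\<Prod>k\<in>\<sigma> - {i}. form P (v k) (w k)) (gam P (v i) (w i) z) else 0)" for z
  unfolding sum_apply by (rule sum.cong) (auto simp: sps_def nu_def)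
 then show ?thesis
  by (auto simp: diag_pure[OF P fin] sps_def fun_eq_iff fin)
qed

lemma diag_sp: "finite \<sigma> ==> x \<in> tensor_space \<sigma> ==> y \<in> tensor_space \<sigma> ==>
  diag P \<sigma> x y i \<in> (if i \<in> \<sigma> then sp P else {0})"
proof -
 assume f: "finite \<sigma>" and x: "x \<in> tensor_space \<sigma>" and y: "y \<in> tensor_space \<sigma>"
 let ?S = "if i \<in> \<sigma> then sp P else {0}"
 have S: "f + g \<in> ?S" "(%z. scl P c (f z)) \<in> ?S" if "f \<in> ?S" "g \<in> ?S" for f g c
  using that by (auto split: if_splits intro: sp_add sp_scl simp: fun_eq_iff)
 have "diag P \<sigma> (pure P \<sigma> v) y i \<in> ?S" for v
 proof (rule tensor_induct[OF f y])
  show "diag P \<sigma> (pure P \<sigma> v) (pure P \<sigma> w) i \<in> ?S" for w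
   unfolding diag_apply[OF f] by (cases "i \<in> \<sigma>"; simp only: if_True if_False; rule sp_scl[OF gam_sp] insertI1)
  show "diag P \<sigma> (pure P \<sigma> v) (y + y') i \<in> ?S"
   if "diag P \<sigma> (pure P \<sigma> v) y i \<in> ?S" "diag P \<sigma> (pure P \<sigma> v) y' i \<in> ?S" for y y'
  proof -
   have "diag P \<sigma> (pure P \<sigma> v) (y + y') i = diag P \<sigma> (pure P \<sigma> v) y i + diag P \<sigma> (pure P \<sigma> v) y' i"
    unfolding diag_lin by (rule plus_fun_apply)
   then show ?thesis using S(1)[OF that] by (simp only:)
  qed
  show "diag P \<sigma> (pure P \<sigma> v) (ts c y) i \<in> ?S" if "diag P \<sigma> (pure P \<sigma> v) y i \<in> ?S" for c y
   unfolding diag_lin sps_def by (rule S(2)[OF that that])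
 qed
 then show "diag P \<sigma> x y i \<in> ?S"
 proof (rule tensor_induct[OF f x])
  show "diag P \<sigma> (x + x') y i \<in> ?S" if "diag P \<sigma> x y i \<in> ?S" "diag P \<sigma> x' y i \<in> ?S" for x x'
  proof -
   have "diag P \<sigma> (x + x') y i = diag P \<sigma> x y i + diag P \<sigma> x' y i"
    unfolding diag_lin by (rule plus_fun_apply)
   then show ?thesis using S(1)[OF that] by (simp only:)
  qed
  show "diag P \<sigma> (ts c x) y i \<in> ?S" if "diag P \<sigma> x y i \<in> ?S" for c x
   unfolding diag_lin sps_def by (rule S(2)[OF that that])
 qed
qed

lemma act_pure_sp:
 "finite \<sigma> ==> (\<And>i. i \<in> \<sigma> ==> g i \<in> sp P) ==> act P \<sigma> g (pure P \<sigma> v) = (\<Sum>i\<in>\<sigma>. pure P \<sigma> (v(i := g i (v i))))"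
 by (rule act_pure[OF P]) (auto intro: sp_linear)

lemma sp_if: "f \<in> (if b then sp P else {0}) ==> f \<in> sp P"
 by (auto split: if_splits)

text \<open>It will give the Jacobi identity for two elements of one component and one of another.
  Both sides change the third tensor at the shared indices \<open>p\<close>, \<open>r\<close> only;
  the indices \<open>a\<close>, \<open>b\<close> contribute the common scalar
  \<open>?X\<close>.\<close>

lemma act_diag:
 assumes fin: "finite \<sigma>" "finite \<tau>"
  and I: "\<sigma> \<inter> \<tau> = {p, r}" "p ~= r" "\<sigma> - \<tau> = {a, b}" "a ~= b"
  and x: "x \<in> tensor_space \<sigma>" "y \<in> tensor_space \<sigma>" "z \<in> tensor_space \<tau>"
 shows "act P \<tau> (diag P \<sigma> x y) z =
  contr P (sym_diff \<sigma> \<tau>) \<sigma> (contr P \<sigma> \<tau> y z) x - contr P (sym_diff \<tau> \<sigma>) \<sigma> (contr P \<tau> \<sigma> z x) y"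
proof -
 let ?\<Phi> = "%x y z. act P \<tau> (diag P \<sigma> x y) z -
  contr P (sym_diff \<sigma> \<tau>) \<sigma> (contr P \<sigma> \<tau> y z) x + contr P (sym_diff \<tau> \<sigma>) \<sigma> (contr P \<tau> \<sigma> z x) y"
 have "?\<Phi> x y z = 0"
 proof (rule trilinear_zero[where \<Phi> = ?\<Phi>, OF vs_ts fin(1,1,2) x])
  fix v w u :: "nat => 'v"
  let ?X = "form P (v a) (w a) * form P (v b) (w b)"
  have fd: "finite (sym_diff \<sigma> \<tau>)" "finite (sym_diff \<tau> \<sigma>)" using fin by auto
  have m: "\<And>i. (i \<in> \<sigma> \<and> i \<in> \<tau>) = (i = p \<or> i = r)" "\<And>i. (i \<in> \<sigma> \<and> i ~: \<tau>) = (i = a \<or> i = b)"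
   using I(1,3) by (simp_all only: set_eq_iff Int_iff Diff_iff insert_iff empty_iff simp_thms)
  have pr: "p \<in> \<sigma>" "r \<in> \<sigma>" "p \<in> \<tau>" "r \<in> \<tau>" "a ~: \<tau>" "b ~: \<tau>" "a \<in> \<sigma>" "b \<in> \<sigma>" using m by blast+
  have ne: "p ~= a" "p ~= b" "r ~= a" "r ~= b" using pr by auto
  have J: "sym_diff \<sigma> \<tau> \<inter> \<sigma> = {a, b}" "sym_diff \<tau> \<sigma> \<inter> \<sigma> = {a, b}" "\<tau> \<inter> \<sigma> = {p, r}"
   "sym_diff (sym_diff \<sigma> \<tau>) \<sigma> = \<tau>" "sym_diff (sym_diff \<tau> \<sigma>) \<sigma> = \<tau>" "\<sigma> = {p, r, a, b}"
   using m pr by auto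
  have s: "\<sigma> - {p} = {r, a, b}" "\<sigma> - {r} = {p, a, b}" using J(6) ne I(2) by auto
  have dd: "diag P \<sigma> (pure P \<sigma> v) (pure P \<sigma> w) i \<in> sp P" for i
   by (rule sp_if[OF diag_sp]) (auto simp: fin)
  have "act P \<tau> (diag P \<sigma> (pure P \<sigma> v) (pure P \<sigma> w)) (pure P \<tau> u) =
   (\<Sum>i\<in>\<tau>. pure P \<tau> (u(i := diag P \<sigma> (pure P \<sigma> v) (pure P \<sigma> w) i (u i))))"
   by (rule act_pure_sp) (auto simp: fin dd)
  also have "\<dots> = (\<Sum>i\<in>{p, r}. pure P \<tau> (u(i := diag P \<sigma> (pure P \<sigma> v) (pure P \<sigma> w) i (u i))))"
  proof (rule sum.mono_neutral_right)
   show "\<forall>i\<in>\<tau> - {p, r}. pure P \<tau> (u(i := diag P \<sigma> (pure P \<sigma> v) (pure P \<sigma> w) i (u i))) = 0"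
   proof
    fix i assume "i \<in> \<tau> - {p, r}"
    then have "i \<in> \<tau>" "i ~: \<sigma>" using m by blast+
    then show "pure P \<tau> (u(i := diag P \<sigma> (pure P \<sigma> v) (pure P \<sigma> w) i (u i))) = 0"
     by (simp add: diag_apply fin pure_zero)
   qed
  qed (use pr fin in auto)
  also have "\<dots> = ts (- (1 / 2) * (form P (v r) (w r) * ?X)) (pure P \<tau> (u(p := gam P (v p) (w p) (u p))))
   + ts (- (1 / 2) * (form P (v p) (w p) * ?X)) (pure P \<tau> (u(r := gam P (v r) (w r) (u r))))"
   using pr I(2,4) ne by (simp add: diag_apply fin s mult_ac pure_uminus flip: pure_scl[OF fin(2)] del: fun_upd_apply)
  finally have 1: "act P \<tau> (diag P \<sigma> (pure P \<sigma> v) (pure P \<sigma> w)) (pure P \<tau> u) = \<dots>" .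
  have 2: "contr P (sym_diff \<sigma> \<tau>) \<sigma> (contr P \<sigma> \<tau> (pure P \<sigma> w) (pure P \<tau> u)) (pure P \<sigma> v) =
   ts (form P (w p) (u p) * form P (w r) (u r) * ?X) (pure P \<tau> (u(p := v p, r := v r)))"
  proof -
   have q: "pure P \<tau> (%i. if i \<in> sym_diff \<sigma> \<tau> then if i \<in> \<sigma> then w i else u i else v i) = pure P \<tau> (u(p := v p, r := v r))"
    by (rule pure_local; rename_tac i, cut_tac i = i in m(1), cut_tac i = i in m(2), use pr in auto)
   show ?thesis
    unfolding contr_pure[OF P fin(1,2)] contr_lin contr_pure[OF P fd(1) fin(1)] J(4) q I(1) J(1) ts_ts
    using ne I(2,4) pr form_skew[of "v a" "w a"] form_skew[of "v b" "w b"] by (simp add: ts_ts mult_ac)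
  qed
  have 3: "contr P (sym_diff \<tau> \<sigma>) \<sigma> (contr P \<tau> \<sigma> (pure P \<tau> u) (pure P \<sigma> v)) (pure P \<sigma> w) =
   ts (form P (v p) (u p) * form P (v r) (u r) * ?X) (pure P \<tau> (u(p := w p, r := w r)))"
  proof -
   have q: "pure P \<tau> (%i. if i \<in> sym_diff \<tau> \<sigma> then if i \<in> \<tau> then u i else v i else w i) = pure P \<tau> (u(p := w p, r := w r))"
    by (rule pure_local; rename_tac i, cut_tac i = i in m(1), cut_tac i = i in m(2), use pr in auto)
   show ?thesis
    unfolding contr_pure[OF P fin(2,1)] contr_lin contr_pure[OF P fd(2) fin(1)] J(5) q J(3) J(2) ts_ts
    using ne I(2,4) pr form_skew[of "u p" "v p"] form_skew[of "u r" "v r"] by (simp add: ts_ts mult_ac)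
  qed
  have upd: "pure P \<tau> (u(p := A, r := B)) \<kappa> = (if \<kappa> \<subseteq> \<tau> then coord P A (p \<in> \<kappa>) * (coord P B (r \<in> \<kappa>) *
    (\<Prod>i\<in>\<tau> - {p, r}. coord P (u i) (i \<in> \<kappa>))) else 0)" for A B \<kappa>
  proof -
   have "\<tau> - {r} - {p} = \<tau> - {p, r}" by auto
   then show ?thesis
    using prod_update[OF fin(2) pr(4), of "%i x. coord P x (i \<in> \<kappa>)" "u(p := A)" B]
     prod_update[of "\<tau> - {r}" p "%i x. coord P x (i \<in> \<kappa>)" u A] fin pr I(2)
    by (simp add: pure_def del: fun_upd_apply)
  qed
  have p1: "pure P \<tau> (u(p := A)) = pure P \<tau> (u(p := A, r := u r))"
   and p2: "pure P \<tau> (u(r := A)) = pure P \<tau> (u(p := u p, r := A))" for A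
   by (rule pure_local; use I(2) in simp)+
  have "- (1 / 2) * (form P (v r) (w r)) * (coord P (gam P (v p) (w p) (u p)) i * coord P (u r) j)
   + - (1 / 2) * (form P (v p) (w p)) * (coord P (u p) i * coord P (gam P (v r) (w r) (u r)) j)
   - form P (w p) (u p) * form P (w r) (u r) * (coord P (v p) i * coord P (v r) j)
   + form P (v p) (u p) * form P (v r) (u r) * (coord P (w p) i * coord P (w r) j) = 0" for i j
  proof -
   \<comment> \<open>At index k let P = <v|u> w and Q = <w|u> v. Then <v|w> u is P - Q by Pluecker,
     while \<open>gam\<close> at u is P + Q. The sum (P_p + Q_p)(P_r - Q_r) + (P_p - Q_p)(P_r + Q_r)
     equals 2 (P_p P_r - Q_p Q_r), which explains the factor 1/2 in \<open>diag\<close>.\<close>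
   have A: "form P (v k) (w k) * coord P (u k) i = form P (v k) (u k) * coord P (w k) i - form P (w k) (u k) * coord P (v k) i" for k i
    using plucker_coord[of "v k" "w k" "u k" i] form_skew[of "u k" "v k"] by algebra
   have "- (1 / 2) * (form P (v r) (w r)) * (coord P (gam P (v p) (w p) (u p)) i * coord P (u r) j)
    + - (1 / 2) * (form P (v p) (w p)) * (coord P (u p) i * coord P (gam P (v r) (w r) (u r)) j)
    = - (1 / 2) * (coord P (gam P (v p) (w p) (u p)) i * (form P (v r) (w r) * coord P (u r) j)
     + coord P (gam P (v r) (w r) (u r)) j * (form P (v p) (w p) * coord P (u p) i))"
    by (simp add: algebra_simps)
   also have "\<dots> = form P (w p) (u p) * form P (w r) (u r) * (coord P (v p) i * coord P (v r) j)
    - form P (v p) (u p) * form P (v r) (u r) * (coord P (w p) i * coord P (w r) j)"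
    unfolding A coord_gam using two by (simp add: field_simps)
   finally show ?thesis by (simp add: algebra_simps)
  qed
  note * = this
  show "?\<Phi> (pure P \<sigma> v) (pure P \<sigma> w) (pure P \<tau> u) = 0"
  proof
   fix \<kappa>
   have "?X * (\<Prod>i\<in>\<tau> - {p, r}. coord P (u i) (i \<in> \<kappa>)) *
    (- (1 / 2) * (form P (v r) (w r)) * (coord P (gam P (v p) (w p) (u p)) (p \<in> \<kappa>) * coord P (u r) (r \<in> \<kappa>))
   + - (1 / 2) * (form P (v p) (w p)) * (coord P (u p) (p \<in> \<kappa>) * coord P (gam P (v r) (w r) (u r)) (r \<in> \<kappa>))
   - form P (w p) (u p) * form P (w r) (u r) * (coord P (v p) (p \<in> \<kappa>) * coord P (v r) (r \<in> \<kappa>))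
   + form P (v p) (u p) * form P (v r) (u r) * (coord P (w p) (p \<in> \<kappa>) * coord P (w r) (r \<in> \<kappa>))) = 0"
    unfolding * by simp
   then show "(act P \<tau> (diag P \<sigma> (pure P \<sigma> v) (pure P \<sigma> w)) (pure P \<tau> u) -
    contr P (sym_diff \<sigma> \<tau>) \<sigma> (contr P \<sigma> \<tau> (pure P \<sigma> w) (pure P \<tau> u)) (pure P \<sigma> v) +
    contr P (sym_diff \<tau> \<sigma>) \<sigma> (contr P \<tau> \<sigma> (pure P \<tau> u) (pure P \<sigma> v)) (pure P \<sigma> w)) \<kappa> = 0 \<kappa>"
    unfolding 1 2 3 p1 p2 plus_fun_apply minus_apply ts_apply upd zero_fun_apply
    by (simp add: algebra_simps)
  qed
 qed (simp_all add: contr_lin act_lin diag_lin act_lin_g fin TS.scale_right_distrib TS.scale_right_diff_distrib)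
 then show ?thesis by (simp add: algebra_simps)
qed

text \<open>Writing the value of \<open>gam\<close> through rotated products \<open>A\<close> makes
  the cyclic sum over v, w, u a polynomial expression in three families that add up to zero at every
  index.\<close>

lemma act_diag_coord:
 assumes fin: "finite \<sigma>"
 defines "A \<equiv> %v w u \<kappa> k. form P (v k) (w k) * coord P (u k) (k \<in> \<kappa>)"
 shows "act P \<sigma> (diag P \<sigma> (pure P \<sigma> v) (pure P \<sigma> w)) (pure P \<sigma> u) \<kappa> =
  (if \<kappa> \<subseteq> \<sigma> then - (1 / 2) * (\<Sum>i\<in>\<sigma>. (A w u v \<kappa> i - A u v w \<kappa> i) * (\<Prod>k\<in>\<sigma> - {i}. A v w u \<kappa> k)) else 0)"
proof -
 have dd: "diag P \<sigma> (pure P \<sigma> v) (pure P \<sigma> w) i \<in> sp P" for i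
  by (rule sp_if[OF diag_sp]) (auto simp: fin)
 have "act P \<sigma> (diag P \<sigma> (pure P \<sigma> v) (pure P \<sigma> w)) (pure P \<sigma> u) =
   (\<Sum>i\<in>\<sigma>. pure P \<sigma> (u(i := diag P \<sigma> (pure P \<sigma> v) (pure P \<sigma> w) i (u i))))"
  by (rule act_pure_sp) (auto simp: fin dd)
 also have "\<dots> = (\<Sum>i\<in>\<sigma>. ts (- (1 / 2) * (\<Prod>k\<in>\<sigma> - {i}. form P (v k) (w k))) (pure P \<sigma> (u(i := gam P (v i) (w i) (u i)))))"
  by (rule sum.cong) (simp_all only: diag_apply[OF fin] if_True pure_scl[OF fin])
 finally have "act P \<sigma> (diag P \<sigma> (pure P \<sigma> v) (pure P \<sigma> w)) (pure P \<sigma> u) \<kappa> =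
  (\<Sum>i\<in>\<sigma>. ts (- (1 / 2) * (\<Prod>k\<in>\<sigma> - {i}. form P (v k) (w k))) (pure P \<sigma> (u(i := gam P (v i) (w i) (u i))))) \<kappa>"
  by (rule arg_cong)
 also have "\<dots> = (\<Sum>i\<in>\<sigma>. if \<kappa> \<subseteq> \<sigma> then - (1 / 2) * ((A w u v \<kappa> i - A u v w \<kappa> i) * (\<Prod>k\<in>\<sigma> - {i}. A v w u \<kappa> k)) else 0)"
  unfolding sum_apply
 proof (rule sum.cong[OF refl])
  fix i assume i: "i \<in> \<sigma>"
  have "coord P (gam P (v i) (w i) (u i)) (i \<in> \<kappa>) = A w u v \<kappa> i - A u v w \<kappa> i"
   using form_skew[of "u i" "v i"] by (simp add: coord_gam A_def)
  then show "ts (- (1 / 2) * (\<Prod>k\<in>\<sigma> - {i}. form P (v k) (w k))) (pure P \<sigma> (u(i := gam P (v i) (w i) (u i)))) \<kappa>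
   = (if \<kappa> \<subseteq> \<sigma> then - (1 / 2) * ((A w u v \<kappa> i - A u v w \<kappa> i) * (\<Prod>k\<in>\<sigma> - {i}. A v w u \<kappa> k)) else 0)"
   using prod_update[OF fin i, of "%i x. coord P x (i \<in> \<kappa>)" u "gam P (v i) (w i) (u i)"]
   by (simp add: ts_apply pure_def A_def prod.distrib mult_ac)
 qed
 finally show ?thesis by (cases "\<kappa> \<subseteq> \<sigma>") (simp_all only: if_True if_False sum_distrib_left sum.neutral_const)
qed

text \<open>By Pluecker the three rotations of \<open>A\<close> sum to zero at each index.
  Eliminating one of them leaves a polynomial identity with two free variables at each of the four
  indices.\<close>

lemma act_diag_cyclic:
 assumes fin: "finite \<sigma>" and c: "card \<sigma> = 4"
  and x: "x \<in> tensor_space \<sigma>" "y \<in> tensor_space \<sigma>" "z \<in> tensor_space \<sigma>"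
 shows "act P \<sigma> (diag P \<sigma> x y) z + act P \<sigma> (diag P \<sigma> y z) x + act P \<sigma> (diag P \<sigma> z x) y = 0"
proof -
 let ?\<Phi> = "%x y z. act P \<sigma> (diag P \<sigma> x y) z + act P \<sigma> (diag P \<sigma> y z) x + act P \<sigma> (diag P \<sigma> z x) y"
 show "?\<Phi> x y z = 0"
 proof (rule trilinear_zero[where \<Phi> = ?\<Phi>, OF vs_ts fin fin fin x])
  fix v w u :: "nat => 'v"
  obtain p q r s where S: "\<sigma> = {p, q, r, s}" and ne: "p ~= q" "p ~= r" "p ~= s" "q ~= r" "q ~= s" "r ~= s"
   using c by (auto simp: card_Suc_eq numeral_eq_Suc)
  have S': "\<sigma> - {p} = {q, r, s}" "\<sigma> - {q} = {p, r, s}" "\<sigma> - {r} = {p, q, s}" "\<sigma> - {s} = {p, q, r}"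
   unfolding S using ne by auto
  show "?\<Phi> (pure P \<sigma> v) (pure P \<sigma> w) (pure P \<sigma> u) = 0"
  proof
   fix \<kappa>
   define A where "A = (%(v :: nat => 'v) (w :: nat => 'v) (u :: nat => 'v) k. form P (v k) (w k) * coord P (u k) (k \<in> \<kappa>))"
   have a: "A v w u k = - A w u v k - A u v w k" for k
    using plucker_coord[of "v k" "w k" "u k" "k \<in> \<kappa>"] unfolding A_def by algebra
   have su: "(\<Sum>i\<in>\<sigma>. F i * (\<Prod>k\<in>\<sigma> - {i}. G k)) = F p * (G q * G r * G s) + F q * (G p * G r * G s)
    + F r * (G p * G q * G s) + F s * (G p * G q * G r)" for F G :: "nat => 'a"
    using ne by (simp add: S[THEN arg_cong[of _ _ "sum _"]] S' mult.assoc)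
   have "(\<Sum>i\<in>\<sigma>. (A w u v i - A u v w i) * (\<Prod>k\<in>\<sigma> - {i}. A v w u k))
    + (\<Sum>i\<in>\<sigma>. (A u v w i - A v w u i) * (\<Prod>k\<in>\<sigma> - {i}. A w u v k))
    + (\<Sum>i\<in>\<sigma>. (A v w u i - A w u v i) * (\<Prod>k\<in>\<sigma> - {i}. A u v w k)) = 0"
    unfolding su a by algebra
   then have "- (1 / 2) * (\<Sum>i\<in>\<sigma>. (A w u v i - A u v w i) * (\<Prod>k\<in>\<sigma> - {i}. A v w u k))
    + - (1 / 2) * (\<Sum>i\<in>\<sigma>. (A u v w i - A v w u i) * (\<Prod>k\<in>\<sigma> - {i}. A w u v k))
    + - (1 / 2) * (\<Sum>i\<in>\<sigma>. (A v w u i - A w u v i) * (\<Prod>k\<in>\<sigma> - {i}. A u v w k)) = 0"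
    by (simp only: distrib_left[symmetric] mult_zero_right)
   then show "?\<Phi> (pure P \<sigma> v) (pure P \<sigma> w) (pure P \<sigma> u) \<kappa> = 0 \<kappa>"
    unfolding plus_fun_apply act_diag_coord[OF fin] zero_fun_apply A_def
    by (cases "\<kappa> \<subseteq> \<sigma>") (simp_all only: if_True if_False add_0)
  qed
 qed (simp_all add: act_lin diag_lin act_lin_g fin TS.scale_right_distrib)
qed

text \<open>Every index that occurs lies in exactly two of the sets \<open>\<sigma>\<close>,
  \<open>\<tau>\<close> and their sum. So two of the three terms contribute at it, with the same
  \<open>gam\<close> and the same product of forms up to sign, and they cancel.\<close>

lemma diag_contr_cyclic:
 assumes fin: "finite \<sigma>" "finite \<tau>"
  and I: "\<sigma> \<inter> \<tau> = {a, b}" "\<sigma> - \<tau> = {c, d}" "\<tau> - \<sigma> = {e, f}" "a ~= b" "c ~= d" "e ~= f"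
  and x: "x \<in> tensor_space \<sigma>" "y \<in> tensor_space \<tau>" "z \<in> tensor_space (sym_diff \<sigma> \<tau>)"
 shows "diag P (sym_diff \<sigma> \<tau>) (contr P \<sigma> \<tau> x y) z + diag P \<sigma> (contr P \<tau> (sym_diff \<sigma> \<tau>) y z) x
  + diag P \<tau> (contr P (sym_diff \<sigma> \<tau>) \<sigma> z x) y = 0"
proof -
 define \<rho> where "\<rho> = sym_diff \<sigma> \<tau>"
 let ?\<Phi> = "%x y z. diag P \<rho> (contr P \<sigma> \<tau> x y) z + diag P \<sigma> (contr P \<tau> \<rho> y z) x
  + diag P \<tau> (contr P \<rho> \<sigma> z x) y"
 have fr: "finite \<rho>" using fin by (simp add: \<rho>_def)
 have m: "\<And>i. (i \<in> \<sigma> \<and> i \<in> \<tau>) = (i = a \<or> i = b)" "\<And>i. (i \<in> \<sigma> \<and> i ~: \<tau>) = (i = c \<or> i = d)"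
  "\<And>i. (i \<in> \<tau> \<and> i ~: \<sigma>) = (i = e \<or> i = f)"
  using I(1,2,3) by (simp_all only: set_eq_iff Int_iff Diff_iff insert_iff empty_iff simp_thms)
 have e: "a \<in> \<sigma>" "a \<in> \<tau>" "b \<in> \<sigma>" "b \<in> \<tau>" "c \<in> \<sigma>" "c ~: \<tau>" "d \<in> \<sigma>" "d ~: \<tau>" "e \<in> \<tau>" "e ~: \<sigma>" "f \<in> \<tau>" "f ~: \<sigma>"
  using m by blast+
 have ne: "a ~= c" "a ~= d" "a ~= e" "a ~= f" "b ~= c" "b ~= d" "b ~= e" "b ~= f" "c ~= e" "c ~= f" "d ~= e" "d ~= f"
  using e by blast+
 have S: "\<sigma> = {a, b, c, d}" "\<tau> = {a, b, e, f}" "\<rho> = {c, d, e, f}"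
  unfolding \<rho>_def using m e by blast+
 have SD: "sym_diff \<tau> \<rho> = \<sigma>" "sym_diff \<rho> \<sigma> = \<tau>" and II: "\<tau> \<inter> \<rho> = {e, f}" "\<rho> \<inter> \<sigma> = {c, d}"
  unfolding \<rho>_def using m e by blast+
 have "?\<Phi> x y z = 0"
 proof (rule trilinear_zero[where \<Phi> = ?\<Phi>, OF vs_sps[OF P] fin(1,2) fr x(1,2)])
  show "z \<in> tensor_space \<rho>" using x(3) by (simp add: \<rho>_def)
  fix v w u :: "nat => 'v"
  have sk: "form P (u c) (v c) = - form P (v c) (u c)" "form P (u d) (v d) = - form P (v d) (u d)"
   "form P (u e) (w e) = - form P (w e) (u e)" "form P (u f) (w f) = - form P (w f) (u f)"
   "form P (w a) (v a) = - form P (v a) (w a)" "form P (w b) (v b) = - form P (v b) (w b)"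
   by (rule form_skew)+
  have gc: "gam P (u c) (v c) = gam P (v c) (u c)" "gam P (u d) (v d) = gam P (v d) (u d)"
   "gam P (u e) (w e) = gam P (w e) (u e)" "gam P (u f) (w f) = gam P (w f) (u f)"
   "gam P (w a) (v a) = gam P (v a) (w a)" "gam P (w b) (v b) = gam P (v b) (w b)"
   by (rule gam_commute)+
  show "?\<Phi> (pure P \<sigma> v) (pure P \<tau> w) (pure P \<rho> u) = 0"
  proof (intro ext)
   fix i z
   have "i = a \<or> i = b \<or> i = c \<or> i = d \<or> i = e \<or> i = f \<or> i ~: \<sigma> \<and> i ~: \<tau> \<and> i ~: \<rho>"
    using S by blast
   then show "?\<Phi> (pure P \<sigma> v) (pure P \<tau> w) (pure P \<rho> u) i z = 0 i z"
    unfolding contr_pure[OF P fin] contr_pure[OF P fin(2) fr] contr_pure[OF P fr fin(1)] SD I(1) II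
     \<rho>_def[symmetric] diag_lin plus_fun_apply sps_def diag_apply[OF fin(1)] diag_apply[OF fin(2)] diag_apply[OF fr]
    using ne I(4-6) ne[symmetric] I(4-6)[symmetric]
    by (elim disjE) (simp_all add: S insert_Diff_if sk gc mult_ac)
  qed
 qed (simp_all add: contr_lin diag_lin SPS.scale_right_distrib)
 then show ?thesis by (simp only: \<rho>_def)
qed

text \<open>Each \<open>g i\<close> is skew for the form, so the contributions at a contracted index
  cancel (\<open>LR\<close>). Those at the other indices make up the action on the contracted
  tensor.\<close>

lemma act_contr:
 assumes fin: "finite \<sigma>" "finite \<tau>" and g: "\<And>i. i \<in> \<sigma> \<union> \<tau> ==> g i \<in> sp P"
  and x: "x \<in> tensor_space \<sigma>" "y \<in> tensor_space \<tau>"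
 shows "act P (sym_diff \<sigma> \<tau>) g (contr P \<sigma> \<tau> x y) = contr P \<sigma> \<tau> (act P \<sigma> g x) y + contr P \<sigma> \<tau> x (act P \<tau> g y)"
proof -
 let ?D = "sym_diff \<sigma> \<tau>"
 let ?\<Phi> = "%x y. act P ?D g (contr P \<sigma> \<tau> x y) - (contr P \<sigma> \<tau> (act P \<sigma> g x) y + contr P \<sigma> \<tau> x (act P \<tau> g y))"
 have "?\<Phi> x y = 0"
 proof (rule bilinear_zero[where \<Phi> = ?\<Phi>, OF vs_ts fin x])
  fix v w :: "nat => 'v"
  have fI: "finite (\<sigma> \<inter> \<tau>)" and fD: "finite ?D" using fin by auto
  define c where "c = (\<Prod>k\<in>\<sigma> \<inter> \<tau>. form P (v k) (w k))"
  define M where "M = (%k. if k \<in> \<sigma> then v k else w k)"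
  define L where "L i = contr P \<sigma> \<tau> (pure P \<sigma> (v(i := g i (v i)))) (pure P \<tau> w)" for i
  define R where "R i = contr P \<sigma> \<tau> (pure P \<sigma> v) (pure P \<tau> (w(i := g i (w i))))" for i
  have L1: "L i = ts c (pure P ?D (M(i := g i (M i))))" if "i \<in> \<sigma> - \<tau>" for i
  proof -
   have p: "(\<Prod>k\<in>\<sigma> \<inter> \<tau>. form P ((v(i := g i (v i))) k) (w k)) = c"
    unfolding c_def using that by (intro prod.cong) auto
   have q: "(%k. if k \<in> \<sigma> then (v(i := g i (v i))) k else w k) = M(i := g i (M i))"
    using that by (auto simp: M_def)
   show ?thesis unfolding L_def contr_pure[OF P fin] p q ..
  qed
  have R1: "R i = ts c (pure P ?D (M(i := g i (M i))))" if "i \<in> \<tau> - \<sigma>" for i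
  proof -
   have p: "(\<Prod>k\<in>\<sigma> \<inter> \<tau>. form P (v k) ((w(i := g i (w i))) k)) = c"
    unfolding c_def using that by (intro prod.cong) auto
   have q: "(%k. if k \<in> \<sigma> then v k else (w(i := g i (w i))) k) = M(i := g i (M i))"
    using that by (auto simp: M_def)
   show ?thesis unfolding R_def contr_pure[OF P fin] p q ..
  qed
  have LR: "L i + R i = 0" if i: "i \<in> \<sigma> \<inter> \<tau>" for i
  proof -
   have q: "pure P ?D (%k. if k \<in> \<sigma> then (v(i := g i (v i))) k else w k) = pure P ?D M"
    "pure P ?D (%k. if k \<in> \<sigma> then v k else (w(i := g i (w i))) k) = pure P ?D M"
    by (rule pure_local, use i in \<open>auto simp: M_def\<close>)+
   have "form P (g i (v i)) (w i) = - form P (v i) (g i (w i))"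
    by (rule sp_skew[OF g]) (use i in auto)
   then show ?thesis
    unfolding L_def R_def contr_pure[OF P fin] q
     prod_update[OF fI i, of "%k x. form P x (w k)" v] prod_update[OF fI i, of "%k x. form P (v k) x" w]
    by simp
  qed
  have "contr P \<sigma> \<tau> (act P \<sigma> g (pure P \<sigma> v)) (pure P \<tau> w) + contr P \<sigma> \<tau> (pure P \<sigma> v) (act P \<tau> g (pure P \<tau> w))
   = (\<Sum>i\<in>\<sigma>. L i) + (\<Sum>i\<in>\<tau>. R i)"
   using g by (simp add: act_pure_sp fin contr_sum L_def R_def del: fun_upd_apply)
  also have "(\<Sum>i\<in>\<sigma>. L i) = (\<Sum>i\<in>\<sigma> - \<tau>. L i) + (\<Sum>i\<in>\<sigma> \<inter> \<tau>. L i)"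
   using sum.Int_Diff[OF fin(1), of L \<tau>] by (simp only: add.commute)
  also have "(\<Sum>i\<in>\<tau>. R i) = (\<Sum>i\<in>\<tau> - \<sigma>. R i) + (\<Sum>i\<in>\<sigma> \<inter> \<tau>. R i)"
   using sum.Int_Diff[OF fin(2), of R \<sigma>] by (simp only: add.commute Int_commute)
  also have "(\<Sum>i\<in>\<sigma> - \<tau>. L i) + (\<Sum>i\<in>\<sigma> \<inter> \<tau>. L i) + ((\<Sum>i\<in>\<tau> - \<sigma>. R i) + (\<Sum>i\<in>\<sigma> \<inter> \<tau>. R i))
   = (\<Sum>i\<in>\<sigma> - \<tau>. L i) + (\<Sum>i\<in>\<tau> - \<sigma>. R i) + (\<Sum>i\<in>\<sigma> \<inter> \<tau>. L i + R i)"
   by (simp only: sum.distrib add_ac)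
  also have "(\<Sum>i\<in>\<sigma> \<inter> \<tau>. L i + R i) = 0"
   by (rule sum.neutral) (use LR in blast)
  also have "(\<Sum>i\<in>\<sigma> - \<tau>. L i) = (\<Sum>i\<in>\<sigma> - \<tau>. ts c (pure P ?D (M(i := g i (M i)))))"
   by (rule sum.cong[OF refl L1])
  also have "(\<Sum>i\<in>\<tau> - \<sigma>. R i) = (\<Sum>i\<in>\<tau> - \<sigma>. ts c (pure P ?D (M(i := g i (M i)))))"
   by (rule sum.cong[OF refl R1])
  also have "(\<Sum>i\<in>\<sigma> - \<tau>. ts c (pure P ?D (M(i := g i (M i))))) + (\<Sum>i\<in>\<tau> - \<sigma>. ts c (pure P ?D (M(i := g i (M i))))) + 0
   = (\<Sum>i\<in>?D. ts c (pure P ?D (M(i := g i (M i)))))"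
   by (subst sum.union_disjoint) (use fin in auto)
  also have "\<dots> = act P ?D g (contr P \<sigma> \<tau> (pure P \<sigma> v) (pure P \<tau> w))"
   unfolding contr_pure[OF P fin] act_lin c_def[symmetric] M_def[symmetric]
   by (subst act_pure_sp[OF fD]) (use g in \<open>auto simp: TS.scale_sum_right\<close>)
  finally have "contr P \<sigma> \<tau> (act P \<sigma> g (pure P \<sigma> v)) (pure P \<tau> w) + contr P \<sigma> \<tau> (pure P \<sigma> v) (act P \<tau> g (pure P \<tau> w))
   = act P ?D g (contr P \<sigma> \<tau> (pure P \<sigma> v) (pure P \<tau> w))" .
  then show "?\<Phi> (pure P \<sigma> v) (pure P \<tau> w) = 0" by (simp only: diff_self)
 qed (simp_all add: contr_lin act_lin TS.scale_right_distrib TS.scale_right_diff_distrib)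
 then show ?thesis by simp
qed

text \<open>In the component at \<open>j\<close>, the maps \<open>g i\<close> with i different from
  j act on form values and cancel by skewness; \<open>g j\<close> acts on \<open>gam\<close> and
  contributes by \<open>gam_equivariant\<close>.\<close>

lemma bracket_diag:
 assumes fin: "finite \<sigma>" and g: "\<And>i. g i \<in> sp P"
  and x: "x \<in> tensor_space \<sigma>" "y \<in> tensor_space \<sigma>"
 shows "sp_bracket g (diag P \<sigma> x y) = diag P \<sigma> (act P \<sigma> g x) y + diag P \<sigma> x (act P \<sigma> g y)"
proof -
 let ?\<Phi> = "%x y. sp_bracket g (diag P \<sigma> x y) - (diag P \<sigma> (act P \<sigma> g x) y + diag P \<sigma> x (act P \<sigma> g y))"
 have sb: "sp_bracket g (h + h') = sp_bracket g h + sp_bracket g h'" "sp_bracket g (sps P c h) = sps P c (sp_bracket g h)" for h h' c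
  by (simp_all add: sp_bracket_def sps_def fun_eq_iff sp_map_add[OF g] sp_map_scl[OF g] V.scale_right_diff_distrib)
 have "?\<Phi> x y = 0"
 proof (rule bilinear_zero[where \<Phi> = ?\<Phi>, OF vs_sps[OF P] fin fin x])
  fix v w :: "nat => 'v"
  let ?v = "%i. v(i := g i (v i))" and ?w = "%i. w(i := g i (w i))"
  have "sp_bracket g (diag P \<sigma> (pure P \<sigma> v) (pure P \<sigma> w)) j z =
   (\<Sum>i\<in>\<sigma>. diag P \<sigma> (pure P \<sigma> (?v i)) (pure P \<sigma> w) j z + diag P \<sigma> (pure P \<sigma> v) (pure P \<sigma> (?w i)) j z)" for j z
  proof (cases "j \<in> \<sigma>")
   case False
   then show ?thesis by (simp add: sp_bracket_def diag_apply fin sp_map_0[OF g])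
  next
   case True
   let ?K = "- (1 / 2) * (\<Prod>k\<in>\<sigma> - {j}. form P (v k) (w k))"
   have "(\<Sum>i\<in>\<sigma> - {j}. diag P \<sigma> (pure P \<sigma> (?v i)) (pure P \<sigma> w) j z + diag P \<sigma> (pure P \<sigma> v) (pure P \<sigma> (?w i)) j z) = 0"
   proof (rule sum.neutral, rule ballI)
    fix i assume i: "i \<in> \<sigma> - {j}"
    have f: "finite (\<sigma> - {j})" using fin by simp
    have 1: "diag P \<sigma> (pure P \<sigma> (?v i)) (pure P \<sigma> w) j z =
     scl P (- (1 / 2) * (form P (g i (v i)) (w i) * (\<Prod>k\<in>\<sigma> - {j} - {i}. form P (v k) (w k)))) (gam P (v j) (w j) z)"
     unfolding diag_apply[OF fin] prod_update[OF f i, of "%k x. form P x (w k)" v] using i True by simp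
    have 2: "diag P \<sigma> (pure P \<sigma> v) (pure P \<sigma> (?w i)) j z =
     scl P (- (1 / 2) * (form P (v i) (g i (w i)) * (\<Prod>k\<in>\<sigma> - {j} - {i}. form P (v k) (w k)))) (gam P (v j) (w j) z)"
     unfolding diag_apply[OF fin] prod_update[OF f i, of "%k x. form P (v k) x" w] using i True by simp
    show "diag P \<sigma> (pure P \<sigma> (?v i)) (pure P \<sigma> w) j z + diag P \<sigma> (pure P \<sigma> v) (pure P \<sigma> (?w i)) j z = 0"
     unfolding 1 2 sp_skew[OF g] by simp
   qed
   moreover have "diag P \<sigma> (pure P \<sigma> (?v j)) (pure P \<sigma> w) j z + diag P \<sigma> (pure P \<sigma> v) (pure P \<sigma> (?w j)) j z
    = scl P ?K (gam P (g j (v j)) (w j) z + gam P (v j) (g j (w j)) z)"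
   proof -
    have "(\<Prod>k\<in>\<sigma> - {j}. form P (?v j k) (w k)) = (\<Prod>k\<in>\<sigma> - {j}. form P (v k) (w k))"
     "(\<Prod>k\<in>\<sigma> - {j}. form P (v k) (?w j k)) = (\<Prod>k\<in>\<sigma> - {j}. form P (v k) (w k))"
     by (rule prod.cong; auto)+
    then show ?thesis using True by (simp add: diag_apply fin V.scale_right_distrib)
   qed
   moreover have "sp_bracket g (diag P \<sigma> (pure P \<sigma> v) (pure P \<sigma> w)) j z =
    scl P ?K (gam P (g j (v j)) (w j) z + gam P (v j) (g j (w j)) z)"
    unfolding gam_equivariant[OF g, symmetric] sp_bracket_def diag_apply[OF fin] if_P[OF True]
    by (simp only: sp_map_scl[OF g] V.scale_right_diff_distrib)
   ultimately show ?thesis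
    unfolding sum.remove[OF fin True] by simp
  qed
  note * = this
  have "sp_bracket g (diag P \<sigma> (pure P \<sigma> v) (pure P \<sigma> w)) =
   (\<Sum>i\<in>\<sigma>. diag P \<sigma> (pure P \<sigma> (?v i)) (pure P \<sigma> w)) + (\<Sum>i\<in>\<sigma>. diag P \<sigma> (pure P \<sigma> v) (pure P \<sigma> (?w i)))"
   by (intro ext) (simp only: * plus_fun_apply sum_apply sum.distrib)
  then show "?\<Phi> (pure P \<sigma> v) (pure P \<sigma> w) = 0"
   by (simp only: act_pure_sp[OF fin g] diag_sum diff_self)
 qed (simp_all add: diag_lin act_lin sb SPS.scale_right_distrib SPS.scale_right_diff_distrib)
 then show ?thesis by simp
qed

end

section \<open>From brackets to Freudenthal triple systems\<close>

text \<open>\<open>t x u\<close> stands for x (x) u. Linearity is postulated for the bracket, for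
  \<open>\<iota>\<close> and for \<open>t\<close>; that of \<open>f\<close>, \<open>d\<close> and
  \<open>a\<close>, as well as the skewness of \<open>f\<close> and the symmetry of
  \<open>d\<close>, is derived, because all three can be read off from brackets with the two basis
  vectors. The Jacobi identity is postulated with two odd arguments, the form in which the proofs
  below apply it.\<close>

locale odd_part = sympl P for P :: "('a::field, 'v::ab_group_add) plane" +
 fixes s :: "'a => 'b => 'b::ab_group_add" and br :: "'b => 'b => 'b" and L S :: "'b set"
  and \<iota> :: "('v => 'v) => 'b" and sT :: "'a => 't => 't::ab_group_add" and T :: "'t set"
  and t :: "'t => 'v => 'b" and f :: "'t => 't => 'a" and d :: "'t => 't => 'b" and a :: "'b => 't => 't"
 assumes vs: "vector_space s" and vsT: "vector_space sT"
  and S_sub: "module.subspace s S" and T_sub: "module.subspace sT T"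
  and iota_add: "g \<in> sp P ==> h \<in> sp P ==> \<iota> (g + h) = \<iota> g + \<iota> h"
  and iota_scl: "g \<in> sp P ==> \<iota> (%v. scl P c (g v)) = s c (\<iota> g)"
  and iota_inj: "g \<in> sp P ==> \<iota> g = 0 ==> g = 0"
  and S_iota: "g \<in> sp P ==> \<iota> g \<in> S ==> \<iota> g = 0"
  and t_add1: "x \<in> T ==> y \<in> T ==> t (x + y) u = t x u + t y u"
  and t_scl1: "x \<in> T ==> t (sT c x) u = s c (t x u)"
  and t_add2: "x \<in> T ==> t x (u + v) = t x u + t x v"
  and t_scl2: "x \<in> T ==> t x (scl P c u) = s c (t x u)"
  and t_inj: "x \<in> T ==> y \<in> T ==> t x (bas P False) + t y (bas P True) = 0 ==> x = 0 \<and> y = 0"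
  and L_eq: "L = {p + \<iota> g + (t x (bas P False) + t y (bas P True)) | p g x y. p \<in> S \<and> g \<in> sp P \<and> x \<in> T \<and> y \<in> T}"
  and L_direct: "p \<in> S ==> g \<in> sp P ==> x \<in> T ==> y \<in> T ==>
   p + \<iota> g = t x (bas P False) + t y (bas P True) ==> p + \<iota> g = 0"
  and br_add: "X \<in> L ==> Y \<in> L ==> Z \<in> L ==> br (X + Y) Z = br X Z + br Y Z"
  and br_scl: "X \<in> L ==> Y \<in> L ==> br (s c X) Y = s c (br X Y)"
  and br_anti: "X \<in> L ==> Y \<in> L ==> br X Y = - br Y X"
  and S_closed: "D \<in> S ==> E \<in> S ==> br D E \<in> S"
  and S_sp: "D \<in> S ==> g \<in> sp P ==> br D (\<iota> g) = 0"
  and sp_sp: "g \<in> sp P ==> h \<in> sp P ==> br (\<iota> g) (\<iota> h) = \<iota> (%v. g (h v) - h (g v))"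
  and sp_T: "g \<in> sp P ==> z \<in> T ==> br (\<iota> g) (t z u) = t z (g u)"
  and a_T: "D \<in> S ==> z \<in> T ==> a D z \<in> T"
  and S_T: "D \<in> S ==> z \<in> T ==> br D (t z u) = t (a D z) u"
  and d_S: "x \<in> T ==> y \<in> T ==> d x y \<in> S"
  and T_T: "x \<in> T ==> y \<in> T ==>
   br (t x u) (t y v) = s (form P u v) (d x y) + s (f x y) (\<iota> (gam P u v))"
  and jacobi: "D \<in> S \<or> D \<in> {t x u | x u. x \<in> T} ==> y \<in> T ==> z \<in> T ==>
   br (br D (t y v)) (t z w) + br (br (t y v) (t z w)) D + br (br (t z w) D) (t y v) = 0"
  and f_nondeg: "x \<in> T ==> x ~= 0 ==> \<exists>y\<in>T. f x y ~= 0"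
  and T_nontrivial: "\<exists>x\<in>T. x ~= 0"
  \<comment> \<open>The elements \<open>r\<close> with \<open>d\<^sub>r\<^sub>,\<^sub>r = 0\<close> are the strictly regular ones: \<open>rrx = -2(r|x)r\<close> for all \<open>x\<close>.\<close>
  and regular: "x \<in> T ==> x ~= 0 ==> \<exists>r\<in>T. d r r = 0 \<and>
   (f r x ~= 0 \<or> (\<exists>y\<in>T. \<exists>z\<in>T. f r (a (d x y) z - sT (f x z) y - sT (f y z) x) ~= 0))"
begin

sublocale M: vector_space s by (rule vs)
sublocale N: vector_space sT by (rule vsT)

lemmas T_closed = N.subspace_add[OF T_sub] N.subspace_scale[OF T_sub] N.subspace_0[OF T_sub]
 N.subspace_diff[OF T_sub] N.subspace_neg[OF T_sub]
lemmas S_cl = M.subspace_add[OF S_sub] M.subspace_scale[OF S_sub] M.subspace_0[OF S_sub]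
 M.subspace_diff[OF S_sub] M.subspace_neg[OF S_sub]

lemma iota_0 [simp]: "\<iota> 0 = 0"
 using iota_scl[OF sp_0, of 0] by (simp add: zero_fun_def)

lemma t_0 [simp]: "t 0 u = 0" "x \<in> T ==> t x 0 = 0"
 using t_scl1[of 0 0 u] t_scl2[of x 0 0] T_closed(3) by simp_all

lemma t_neg: "x \<in> T ==> t (- x) u = - t x u"
 using t_scl1[of x "-1" u] by simp

lemma L_mem: "p \<in> S ==> g \<in> sp P ==> x \<in> T ==> y \<in> T ==> p + \<iota> g + (t x b0 + t y b1) \<in> L"
 unfolding L_eq by blast

lemma t_diff: "x \<in> T ==> y \<in> T ==> t (x - y) u = t x u - t y u"
 using t_add1[of x "- y" u] T_closed by (simp add: t_neg)

lemma S_L: "D \<in> S ==> D \<in> L"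
 using L_mem[of D 0 0 0] T_closed(3) by simp

lemma iota_L: "g \<in> sp P ==> \<iota> g \<in> L"
 using L_mem[of 0 g 0 0] T_closed(3) S_cl(3) by simp

lemma odd_L: "x \<in> T ==> y \<in> T ==> t x b0 + t y b1 \<in> L"
 using L_mem[of 0 0 x y] S_cl(3) by simp

lemma t_coord: "x \<in> T ==> t x u = t (sT (coord P u False) x) b0 + t (sT (coord P u True) x) b1"
 by (subst coord_expand[OF P, of u]) (simp add: t_add2 t_scl2 t_scl1)

lemma t_L: "x \<in> T ==> t x u \<in> L"
 by (subst t_coord) (auto intro!: odd_L T_closed)

lemma L_sub: "M.subspace L"
proof (rule M.subspaceI)
 show "0 \<in> L" using S_L[OF S_cl(3)] .
next
 fix X Y assume "X \<in> L" "Y \<in> L"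
 then obtain p g x y p' g' x' y' where
  X: "X = p + \<iota> g + (t x b0 + t y b1)" "p \<in> S" "g \<in> sp P" "x \<in> T" "y \<in> T" and
  Y: "Y = p' + \<iota> g' + (t x' b0 + t y' b1)" "p' \<in> S" "g' \<in> sp P" "x' \<in> T" "y' \<in> T"
  unfolding L_eq by auto
 have "X + Y = (p + p') + \<iota> (g + g') + (t (x + x') b0 + t (y + y') b1)"
  using X Y by (simp add: iota_add t_add1)
 then show "X + Y \<in> L" unfolding L_eq using X Y by (blast intro: T_closed S_cl sp_add)
next
 fix c X assume "X \<in> L"
 then obtain p g x y where
  X: "X = p + \<iota> g + (t x b0 + t y b1)" "p \<in> S" "g \<in> sp P" "x \<in> T" "y \<in> T"
  unfolding L_eq by auto
 have "s c X = s c p + \<iota> (%v. scl P c (g v)) + (t (sT c x) b0 + t (sT c y) b1)"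
  using X by (simp add: iota_scl t_scl1 M.scale_right_distrib)
 then show "s c X \<in> L" unfolding L_eq using X by (blast intro: T_closed S_cl sp_scl)
qed

lemmas L_cl = M.subspace_add[OF L_sub] M.subspace_scale[OF L_sub] M.subspace_0[OF L_sub]
 M.subspace_neg[OF L_sub]

lemma br_add2: "X \<in> L ==> Y \<in> L ==> Z \<in> L ==> br X (Y + Z) = br X Y + br X Z"
 using br_anti[of X "Y + Z"] br_anti[of X Y] br_anti[of X Z] br_add[of Y Z X] L_cl(1) by simp

lemma br_scl2: "X \<in> L ==> Y \<in> L ==> br X (s c Y) = s c (br X Y)"
 using br_anti[of X "s c Y"] br_anti[of X Y] br_scl[of Y X c] L_cl(2) by simp

lemma br_neg: "X \<in> L ==> Y \<in> L ==> br (- X) Y = - br X Y"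
 using br_scl[of X Y "-1"] by simp

lemma br_self: "X \<in> L ==> br X X = 0"
proof -
 assume X: "X \<in> L"
 have "s 2 (br X X) = br X X + br X X" using M.scale_left_distrib[of 1 1 "br X X"] by simp
 then have "s 2 (br X X) = 0" using br_anti[OF X X] by (metis add.right_inverse)
 then show ?thesis using two by simp
qed

lemma gam00: "gam P b0 b0 ~= 0"
proof
 assume "gam P b0 b0 = 0"
 then have "coord P (gam P b0 b0 b1) False = 0" by simp
 then have "om + om = 0" by (simp add: coord_gam form_bas)
 then have "2 * om = 0" by (simp only: mult_2)
 then show False using two om_nz by simp
qed

lemma iota_nz: "g \<in> sp P ==> g ~= 0 ==> s c (\<iota> g) = 0 ==> c = 0"
 using iota_inj[of g] by auto

text \<open>At a repeated vector the term with \<open>d\<close> disappears, so \<open>f\<close> can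
  be read off. This determines it since \<open>\<iota>\<close> is injective and
  \<open>gam P b0 b0\<close> is nonzero: it sends b1 to 2 \<open>om\<close> b0.\<close>

lemma f_eq: "x \<in> T ==> y \<in> T ==> br (t x b0) (t y b0) = s (f x y) (\<iota> (gam P b0 b0))"
 by (simp add: T_T)

lemma f_unique: "s c (\<iota> (gam P b0 b0)) = s c' (\<iota> (gam P b0 b0)) ==> c = c'"
 using iota_inj[OF gam_sp, of b0 b0] gam00 by auto

lemma f_lin: assumes "x \<in> T" "y \<in> T" "z \<in> T"
 shows "f (x + y) z = f x z + f y z" "f (sT c x) z = c * f x z"
  "f z (x + y) = f z x + f z y" "f z (sT c x) = c * f z x"
proof -
 let ?G = "\<iota> (gam P b0 b0)"
 note cl = T_closed(1)[OF assms(1,2)] T_closed(2)[OF assms(1)]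
 have "s (f (x + y) z) ?G = s (f x z + f y z) ?G"
  using f_eq[OF cl(1) assms(3)] f_eq[OF assms(1,3)] f_eq[OF assms(2,3)] assms
  by (simp only: t_add1 br_add t_L M.scale_left_distrib)
 then show "f (x + y) z = f x z + f y z" by (rule f_unique)
 have "s (f z (x + y)) ?G = s (f z x + f z y) ?G"
  using f_eq[OF assms(3) cl(1)] f_eq[OF assms(3,1)] f_eq[OF assms(3,2)] assms
  by (simp only: t_add1 br_add2 t_L M.scale_left_distrib)
 then show "f z (x + y) = f z x + f z y" by (rule f_unique)
 have "s (f (sT c x) z) ?G = s (c * f x z) ?G" for c
  using f_eq[OF T_closed(2)[OF assms(1)] assms(3), of c] f_eq[OF assms(1,3)] assms
  by (simp only: t_scl1 br_scl t_L M.scale_scale[symmetric])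
 then show "f (sT c x) z = c * f x z" by (rule f_unique)
 have "s (f z (sT c x)) ?G = s (c * f z x) ?G" for c
  using f_eq[OF assms(3) T_closed(2)[OF assms(1)], of c] f_eq[OF assms(3,1)] assms
  by (simp only: t_scl1 br_scl2 t_L M.scale_scale[symmetric])
 then show "f z (sT c x) = c * f z x" by (rule f_unique)
qed

lemma f_skew: "x \<in> T ==> y \<in> T ==> f x y = - f y x"
 by (rule f_unique) (use br_anti[OF t_L t_L, of x y b0 b0] in \<open>simp add: f_eq\<close>)

lemma f_self: "x \<in> T ==> f x x = 0"
proof -
 assume "x \<in> T"
 then have "f x x + f x x = 0" using f_skew[of x x] by (simp only: eq_neg_iff_add_eq_0)
 then have "2 * f x x = 0" by (simp only: mult_2)
 then show ?thesis using two by simp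
qed

text \<open>Once \<open>f\<close> is known, the bracket at b0, b1 yields \<open>d\<close>, because
  \<open>om\<close> is invertible.\<close>

lemma d_eq: "x \<in> T ==> y \<in> T ==> s om (d x y) = br (t x b0) (t y b1) - s (f x y) (\<iota> (gam P b0 b1))"
 by (simp add: T_T om_def)

lemma d_cancel: "s om X = s om Y ==> X = Y"
 using om_nz by simp

lemma d_lin: assumes "x \<in> T" "y \<in> T" "z \<in> T"
 shows "d (x + y) z = d x z + d y z" "d (sT c x) z = s c (d x z)"
  "d z (x + y) = d z x + d z y" "d z (sT c x) = s c (d z x)"
proof -
 note cl = T_closed(1)[OF assms(1,2)] T_closed(2)[OF assms(1)]
 have "s om (d (x + y) z) = s om (d x z + d y z)"
  unfolding M.scale_right_distrib d_eq[OF cl(1) assms(3)] d_eq[OF assms(1,3)] d_eq[OF assms(2,3)]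
  using assms by (simp add: t_add1 br_add t_L f_lin M.scale_left_distrib)
 then show "d (x + y) z = d x z + d y z" by (rule d_cancel)
 have "s om (d z (x + y)) = s om (d z x + d z y)"
  unfolding M.scale_right_distrib d_eq[OF assms(3) cl(1)] d_eq[OF assms(3,1)] d_eq[OF assms(3,2)]
  using assms by (simp add: t_add1 br_add2 t_L f_lin M.scale_left_distrib)
 then show "d z (x + y) = d z x + d z y" by (rule d_cancel)
 have "s om (d (sT c x) z) = s c (s om (d x z))"
  unfolding d_eq[OF cl(2) assms(3)] d_eq[OF assms(1,3)]
  using assms by (simp add: t_scl1 br_scl t_L f_lin M.scale_right_diff_distrib)
 also have "\<dots> = s om (s c (d x z))" by (rule M.scale_left_commute)
 finally show "d (sT c x) z = s c (d x z)" by (rule d_cancel)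
 have "s om (d z (sT c x)) = s c (s om (d z x))"
  unfolding d_eq[OF assms(3) cl(2)] d_eq[OF assms(3,1)]
  using assms by (simp add: t_scl1 br_scl2 t_L f_lin M.scale_right_diff_distrib)
 also have "\<dots> = s om (s c (d z x))" by (rule M.scale_left_commute)
 finally show "d z (sT c x) = s c (d z x)" by (rule d_cancel)
qed

lemma d_sym: assumes "x \<in> T" "y \<in> T" shows "d x y = d y x"
proof (rule d_cancel)
 have "br (t x b0) (t y b1) = - br (t y b1) (t x b0)" using assms by (intro br_anti t_L)
 also have "\<dots> = s om (d y x) + s (f x y) (\<iota> (gam P b0 b1))"
  using assms f_skew[of y x] form_skew[of b1 b0] by (simp add: T_T om_def gam_commute[of b1 b0])
 finally show "s om (d x y) = s om (d y x)" using assms by (simp add: d_eq)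
qed

lemma t_inj1: "x \<in> T ==> y \<in> T ==> t x b1 = t y b1 ==> x = y"
 using t_inj[of 0 "x - y"] t_add1[of x "- y" b1] T_closed by (simp add: t_neg)

lemma a_lin: assumes "D \<in> S" "E \<in> S" "x \<in> T" "y \<in> T"
 shows "a (D + E) x = a D x + a E x" "a (s c D) x = sT c (a D x)" "a D (x + y) = a D x + a D y" "a D (sT c x) = sT c (a D x)"
proof -
 note cl = S_cl(1)[OF assms(1,2)] S_cl(2)[OF assms(1)] T_closed(1)[OF assms(3,4)] T_closed(2)[OF assms(3)]
 have aT: "a D x \<in> T" "a E x \<in> T" "a D y \<in> T" using assms a_T by blast+
 have "t (a (D + E) x) b1 = t (a D x + a E x) b1"
  using S_T[OF cl(1) assms(3), of b1] S_T[OF assms(1,3), of b1] S_T[OF assms(2,3), of b1] assms aT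
  by (simp add: t_add1 br_add t_L S_L)
 then show "a (D + E) x = a D x + a E x" by (rule t_inj1[rotated 2]) (use cl assms aT T_closed a_T in auto)
 have "t (a (s c D) x) b1 = t (sT c (a D x)) b1"
  using S_T[OF cl(2) assms(3), of c b1] S_T[OF assms(1,3), of b1] assms aT
  by (simp add: t_scl1 br_scl t_L S_L)
 then show "a (s c D) x = sT c (a D x)" by (rule t_inj1[rotated 2]) (use cl assms aT T_closed a_T in auto)
 have "t (a D (x + y)) b1 = t (a D x + a D y) b1"
  using S_T[OF assms(1) cl(3), of b1] S_T[OF assms(1,3), of b1] S_T[OF assms(1,4), of b1] assms aT
  by (simp add: t_add1 br_add2 t_L S_L)
 then show "a D (x + y) = a D x + a D y" by (rule t_inj1[rotated 2]) (use cl assms aT T_closed a_T in auto)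
 have "t (a D (sT c x)) b1 = t (sT c (a D x)) b1"
  using S_T[OF assms(1) cl(4), of c b1] S_T[OF assms(1,3), of b1] assms aT
  by (simp add: t_scl1 br_scl2 t_L S_L)
 then show "a D (sT c x) = sT c (a D x)" by (rule t_inj1[rotated 2]) (use cl assms aT T_closed a_T in auto)
qed

lemma a_scl1: "D \<in> S ==> x \<in> T ==> a (s c D) x = sT c (a D x)"
 and a_add2: "D \<in> S ==> x \<in> T ==> y \<in> T ==> a D (x + y) = a D x + a D y"
 and a_scl2: "D \<in> S ==> x \<in> T ==> a D (sT c x) = sT c (a D x)"
 using a_lin(2-4)[of D D x x] a_lin(3)[of D D x y] by auto

lemma a_0: "x \<in> T ==> a 0 x = 0"
 using a_scl1[of 0 x 0] S_cl(3) by simp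

text \<open>This is the Jacobi identity for x (x) b0, y (x) b1, z (x) b1. Its right side is what the
  correction terms of \<open>tp\<close> are made for: it becomes the symmetry of \<open>tp\<close>
  in the last two arguments.\<close>

lemma jacobi_T:
 assumes T: "x \<in> T" "y \<in> T" "z \<in> T"
 shows "a (d x y) z - a (d x z) y = sT (2 * f y z) x - sT (f x y) z - sT (f z x) y"
proof -
 have B: "br (br (t x u) (t y v)) (t z w) = t (sT (form P u v) (a (d x y) z)) w + t (sT (f x y) z) (gam P u v w)"
  if "x \<in> T" "y \<in> T" "z \<in> T" for x y z u v w
  using that by (simp add: T_T br_add br_scl L_cl S_L iota_L t_L d_S S_T sp_T t_scl1 a_T)
 \<comment> \<open>With this choice of basis vectors every term of the Jacobi identity lies in T (x)
   b1, so a single equation in \<open>T\<close> remains.\<close>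
 have g: "gam P b0 b1 b1 = scl P om b1" "gam P b1 b1 b0 = scl P (- 2 * om) b1" "gam P b1 b0 b1 = scl P om b1"
  using V.scale_left_distrib[of "- om" "- om" b1] by (simp_all add: gam_def form_bas)
 have "t x b0 \<in> {t x u | x u. x \<in> T}" using T by blast
 then have "br (br (t x b0) (t y b1)) (t z b1) + br (br (t y b1) (t z b1)) (t x b0) + br (br (t z b1) (t x b0)) (t y b1) = 0"
  using T by (intro jacobi) auto
 then have "t (sT om (a (d x y) z) + sT (f x y * om) z + (sT (f y z * (- 2 * om)) x + (sT (- om) (a (d z x) y) + sT (f z x * om) y))) b1 = 0"
  using T by (simp only: B g form_bas t_scl2 T_closed) (simp add: t_add1 t_diff t_scl1 T_closed a_T d_S t_neg algebra_simps)
 then have "sT om (a (d x y) z) + sT (f x y * om) z + (sT (f y z * (- 2 * om)) x + (sT (- om) (a (d z x) y) + sT (f z x * om) y)) = 0"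
  using t_inj[of 0 "sT om (a (d x y) z) + sT (f x y * om) z + (sT (f y z * (- 2 * om)) x + (sT (- om) (a (d z x) y) + sT (f z x * om) y))"] T
  by (simp add: T_closed a_T d_S)
 then have "sT om (a (d x y) z + sT (f x y) z - sT (2 * f y z) x - a (d z x) y + sT (f z x) y) = 0"
  by (simp add: algebra_simps)
 then have "a (d x y) z + sT (f x y) z - sT (2 * f y z) x - a (d x z) y + sT (f z x) y = 0"
  using om_nz d_sym[OF T(3,1)] by simp
 then show ?thesis by (simp add: algebra_simps)
qed

text \<open>Jacobi for \<open>D\<close>, x (x) u, y (x) v. The choice u = v = b0 isolates the form;
  u = b0, v = b1 then isolates the part in \<open>S\<close>, the part in sp having dropped out by
  the first claim.\<close>

lemma jacobi_S:
 assumes D: "D \<in> S" and T: "x \<in> T" "y \<in> T"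
 shows "f (a D x) y + f x (a D y) = 0" "br D (d x y) = d (a D x) y + d x (a D y)"
proof -
 have L: "br D X = - br X D" if "X \<in> L" for X using br_anti[OF S_L[OF D] that] .
 have e: "br (br (t x u) (t y v)) D = - s (form P u v) (br D (d x y))" for u v
 proof -
  have "br (\<iota> (gam P u v)) D = 0" using br_anti[OF iota_L[OF gam_sp] S_L[OF D], of u v] S_sp[OF D gam_sp, of u v] by simp
  then show ?thesis using T D br_anti[OF S_L[OF d_S[OF T]] S_L[OF D]]
   by (simp add: T_T br_add br_scl L_cl S_L iota_L d_S)
 qed
 have "br (br (t y v) D) (t x u) = br (t x u) (t (a D y) v)" for u v
 proof -
  have "br (t y v) D = - t (a D y) v" using br_anti[OF t_L[OF T(2)] S_L[OF D], of v] S_T[OF D T(2), of v] by simp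
  moreover have "br (t (a D y) v) (t x u) = - br (t x u) (t (a D y) v)" using T D by (intro br_anti t_L a_T)
  ultimately show ?thesis using T D by (simp add: br_neg t_L a_T)
 qed
 moreover have "br (br D (t x u)) (t y v) + br (br (t x u) (t y v)) D + br (br (t y v) D) (t x u) = 0" for u v
  using D T by (intro jacobi) auto
 ultimately have J: "br (t (a D x) u) (t y v) - s (form P u v) (br D (d x y)) + br (t x u) (t (a D y) v) = 0" for u v
  using D T by (simp add: e S_T)
 have "s (f (a D x) y + f x (a D y)) (\<iota> (gam P b0 b0)) = 0"
  using J[of b0 b0] T D by (simp add: f_eq a_T M.scale_left_distrib)
 then show f0: "f (a D x) y + f x (a D y) = 0" using iota_nz[OF gam_sp gam00] by blast
 then have f1: "f x (a D y) = - f (a D x) y" by (simp add: eq_neg_iff_add_eq_0 add.commute)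
 have "s om (d (a D x) y) + s om (d x (a D y)) - s om (br D (d x y)) = 0"
  using J[of b0 b1] T D unfolding T_T[OF a_T[OF D T(1)] T(2)] T_T[OF T(1) a_T[OF D T(2)]] f1
  by (simp add: om_def[symmetric] algebra_simps)
 then have "s om (d (a D x) y + d x (a D y) - br D (d x y)) = 0"
  by (simp add: M.scale_right_distrib M.scale_right_diff_distrib)
 then show "br D (d x y) = d (a D x) y + d x (a D y)" using om_nz by simp
qed

definition tp :: "'t => 't => 't => 't" where
 "tp x y z = a (d x y) z - sT (f x z) y - sT (f y z) x"

lemma tp_regular: assumes "r \<in> T" "d r r = 0" "x \<in> T" shows "tp r r x = sT (- 2 * f r x) r"
proof -
 have "sT (- f r x + - f r x) r = tp r r x"
  unfolding N.scale_left_distrib using assms by (simp add: tp_def a_0)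
 moreover have "- f r x + - f r x = - 2 * f r x" by simp
 ultimately show ?thesis by simp
qed

lemma tp_T: "x \<in> T ==> y \<in> T ==> z \<in> T ==> tp x y z \<in> T"
 by (simp add: tp_def T_closed a_T d_S)

lemma tp_sym1: "x \<in> T ==> y \<in> T ==> tp x y z = tp y x z"
 by (simp add: tp_def d_sym[of x y] algebra_simps)

lemma tp_sym2: assumes "x \<in> T" "y \<in> T" "z \<in> T" shows "tp x y z = tp x z y"
proof -
 have "a (d x y) z = a (d x z) y + (sT (f y z) x + sT (f y z) x) - sT (f x y) z + sT (f x z) y"
  using jacobi_T[OF assms] f_skew[OF assms(3,1)] unfolding mult_2 N.scale_left_distrib
  by (simp add: algebra_simps)
 then show ?thesis
  using f_skew[OF assms(3,2)] by (simp add: tp_def algebra_simps)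
qed

lemma tp_lin:
 assumes T: "x \<in> T" "x' \<in> T" "y \<in> T" "z \<in> T"
 shows "tp (x + x') y z = tp x y z + tp x' y z" "tp (sT c x) y z = sT c (tp x y z)"
  "tp y (x + x') z = tp y x z + tp y x' z" "tp y (sT c x) z = sT c (tp y x z)"
  "tp y z (x + x') = tp y z x + tp y z x'" "tp y z (sT c x) = sT c (tp y z x)"
 using T by (simp_all add: tp_def d_lin f_lin a_lin(1) a_scl1 a_add2 a_scl2 d_S T_closed N.scale_left_distrib N.scale_right_distrib
   N.scale_right_diff_distrib algebra_simps)

text \<open>By symmetry of \<open>tp\<close> the outer argument may be exchanged with the last one.
  There \<open>d z w\<close> acts, which is skew for \<open>f\<close> by \<open>jacobi_S\<close>,
  and the correction terms match by skewness of \<open>f\<close>.\<close>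

lemma f_tp: assumes T: "x \<in> T" "y \<in> T" "z \<in> T" "w \<in> T"
 shows "f x (tp y z w) = f y (tp x z w)"
proof -
 have f_sub: "f x (u - v) = f x u - f x v" if "u \<in> T" "v \<in> T" "x \<in> T" for u v x
  using f_lin(3)[of u "- v" x] f_lin(4)[of v 0 x "-1"] that T_closed by simp
 have "tp y z w = tp z w y" "tp x z w = tp z w x"
  using T tp_sym1 tp_sym2 by metis+
 moreover have "f x (a (d z w) y) = f y (a (d z w) x)"
  using jacobi_S(1)[OF d_S[OF T(3,4)] T(1,2)] f_skew[OF a_T[OF d_S[OF T(3,4)] T(1)] T(2)] by simp
 ultimately show ?thesis
  using T f_skew[of w y] f_skew[of w x] f_skew[of z y] f_skew[of z x]
  by (simp add: tp_def f_sub f_lin T_closed a_T d_S)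
qed

text \<open>The bracket of \<open>d x y\<close> with itself is 0. By \<open>jacobi_S\<close> it is
  also computed by applying \<open>d x y\<close> to x and to y, which gives yxx and xyy up to
  multiples of x and y that cancel. Hence d_{xyy,x} + d_{yxx,y} = 0, and applying this to z is the
  axiom.\<close>

lemma tp_axiom:
 assumes T: "x \<in> T" "y \<in> T" "z \<in> T"
 shows "tp (tp x y y) x z + tp (tp y x x) y z + sT (f (tp x y y) z) x + sT (f (tp y x x) z) y
    + sT (f x z) (tp x y y) + sT (f y z) (tp y x x) = 0"
proof -
 let ?D = "d x y"
 have D: "?D \<in> S" using T by (simp add: d_S)
 have pT: "tp x y y \<in> T" "tp y x x \<in> T" using T by (simp_all add: tp_T)
 have ax: "a ?D x = tp y x x + sT (f y x) x" and ay: "a ?D y = tp x y y + sT (f x y) y"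
  using T by (simp_all add: tp_def f_self d_sym[of y x])
 have "0 = br ?D ?D" using br_self[OF S_L[OF D]] by simp
 also have "\<dots> = d (tp y x x) y + d x (tp x y y) + (s (f y x + f x y) (d x y))"
  unfolding jacobi_S(2)[OF D T(1,2)] ax ay using T pT by (simp add: d_lin T_closed M.scale_left_distrib algebra_simps)
 finally have "d (tp x y y) x + d (tp y x x) y = 0"
  using f_skew[OF T(1,2)] d_sym[OF T(1) pT(1)] by (simp add: add.commute)
 then have "a (d (tp x y y) x) z + a (d (tp y x x) y) z = 0"
  using a_lin(1)[OF d_S[OF pT(1) T(1)] d_S[OF pT(2) T(2)] T(3,3)] a_0[OF T(3)] by simp
 then show ?thesis by (simp add: tp_def[of "tp x y y"] tp_def[of "tp y x x"] algebra_simps)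
qed

text \<open>A strictly regular r satisfies rrx = -2(r|x)r, so r enters every ideal containing some
  x' with (r|x') nonzero; the assumption \<open>regular\<close> supplies such an r, with x' either
  the given element or a triple product of it. From r, every y with (r|y) nonzero is then
  recovered.\<close>

lemma simple:
 assumes J: "N.subspace J" "J \<subseteq> T" and id: "\<And>x y z. x \<in> J ==> y \<in> T ==> z \<in> T ==> tp x y z \<in> J"
  and nz: "J ~= {0}"
 shows "J = T"
proof -
 note J_cl = N.subspace_add[OF J(1)] N.subspace_scale[OF J(1)] N.subspace_diff[OF J(1)]
 have J_div: "y \<in> J" if "c ~= 0" "sT c y \<in> J" for c y
  using J_cl(2)[OF that(2), of "inverse c"] that(1) by simp
 from nz J_cl(2) N.subspace_0[OF J(1)] obtain x where x: "x \<in> J" "x ~= 0" by blast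
 then obtain r where r: "r \<in> T" "d r r = 0" and
  "f r x ~= 0 \<or> (\<exists>y\<in>T. \<exists>z\<in>T. f r (tp x y z) ~= 0)"
  using regular[of x] J(2) unfolding tp_def by blast
 then obtain x' where x': "x' \<in> J" "f r x' ~= 0" using x id by blast
 have xT: "x' \<in> T" using x' J by blast
 have "tp r r x' = tp x' r r" using r xT tp_sym1 tp_sym2 by metis
 then have "sT (- 2 * f r x') r \<in> J" using id[OF x'(1) r(1,1)] tp_regular[OF r xT] by simp
 then have rJ: "r \<in> J" by (rule J_div[rotated]) (use x'(2) two in simp)
 have y: "y \<in> J" if y: "y \<in> T" "f r y ~= 0" for y
 proof -
  have t1: "tp y r r = sT (- 2 * f r y) r" using tp_regular[OF r y(1)] tp_sym1 tp_sym2 y r by metis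
  let ?z = "y"
  have pJ: "tp r y y \<in> J" using id rJ y by blast
  have tJ: "tp (tp r y y) r y \<in> J" using id[OF pJ] r y by blast
  have qJ: "tp (tp y r r) y y \<in> J" unfolding t1 using id[OF J_cl(2)[OF rJ]] y by blast
  have A: "tp (tp r y y) r y + tp (tp y r r) y y + sT (f (tp r y y) y) r + sT (f r y) (tp r y y) \<in> J"
   by (intro J_cl(1,2) tJ pJ rJ qJ)
  \<comment> \<open>The axiom at (r, y, y). Its term in y has coefficient (yrr|y) = -2(r|y)(r|y),
    the term with (y|y) is 0, and all others lie in the ideal because r does.\<close>
  have "sT (f (tp y r r) y) y = - (tp (tp r y y) r y + tp (tp y r r) y y + sT (f (tp r y y) y) r + sT (f r y) (tp r y y))"
   using tp_axiom[OF r(1) y(1) y(1)] f_self[OF y(1)] by (simp add: eq_neg_iff_add_eq_0 algebra_simps)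
  then have "sT (f (tp y r r) y) y \<in> J" using N.subspace_neg[OF J(1) A] by simp
  then have "sT (- 2 * f r y * f r y) y \<in> J" unfolding t1 f_lin(2)[OF r(1) r(1) y(1)] .
  then show ?thesis by (rule J_div[rotated]) (use y(2) two in simp)
 qed
 show "J = T"
 proof
  show "T \<subseteq> J"
  proof
   fix w assume w: "w \<in> T"
   show "w \<in> J"
   proof (cases "f r w = 0")
    case True
    \<comment> \<open>An element orthogonal to r is shifted by x', which lies in \<open>J\<close>
      and is not orthogonal to r.\<close>
    have "f r (w + x') ~= 0" using True x' xT w r by (simp add: f_lin)
    then have "w + x' \<in> J" using y w xT T_closed by blast
    then show ?thesis using J_cl(3)[OF _ x'(1), of "w + x'"] by simp
   qed (use y w in blast)
  qed
 qed (rule J)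
qed

lemma freudenthal: "simple_freudenthal_triple_system sT T f tp"
proof -
 have bil: "bilinear_from sT (*) T f"
  by (simp add: bilinear_from_def linear_from_def f_lin)
 have 1: "\<exists>x\<in>T. \<exists>y\<in>T. f x y ~= 0"
  using T_nontrivial f_nondeg by blast
 have 2: "\<exists>x\<in>T. \<exists>y\<in>T. \<exists>z\<in>T. tp x y z ~= 0"
 proof -
  from T_nontrivial obtain x where x: "x \<in> T" "x ~= 0" by blast
  from regular[OF this] obtain r where r: "r \<in> T" "d r r = 0" and
   rx: "f r x ~= 0 \<or> (\<exists>y\<in>T. \<exists>z\<in>T. f r (tp x y z) ~= 0)" unfolding tp_def by blast
  have "f r 0 = 0" using f_lin(4)[of 0 0 r 0] r T_closed(3) by simp
  then show ?thesis using rx r x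
  proof (elim disjE)
   assume "f r x ~= 0"
   moreover have "tp r r x = sT (- 2 * f r x) r"
    using tp_regular r x by blast
   moreover have "r ~= 0" using calculation(1) f_lin(2)[of 0 0 x 0] x T_closed(3) by auto
   ultimately have "tp r r x ~= 0" using two by simp
   then show ?thesis using r x by blast
  qed (metis)
 qed
 have 3: "\<forall>x\<in>T. f x x = 0" using f_self by blast
 have 4: "\<forall>x\<in>T. \<forall>y\<in>T. \<forall>z\<in>T. tp x y z \<in> T" using tp_T by blast
 have 5: "\<forall>x\<in>T. bilinear_from sT sT T (tp x)" "\<forall>y\<in>T. \<forall>z\<in>T. linear_from sT sT T (%x. tp x y z)"
  using tp_lin by (auto simp: bilinear_from_def linear_from_def)
 have 6: "\<forall>x\<in>T. \<forall>y\<in>T. \<forall>z\<in>T. tp x y z = tp y x z \<and> tp x y z = tp x z y"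
  using tp_sym1 tp_sym2 by blast
 have 7: "\<forall>x\<in>T. \<forall>y\<in>T. \<forall>z\<in>T. \<forall>w\<in>T. f x (tp y z w) = f y (tp x z w) \<and> f x (tp y z w) = f x (tp z y w) \<and>
    f x (tp y z w) = f x (tp y w z)"
  using f_tp tp_sym1 tp_sym2 by metis
 have 8: "\<forall>x\<in>T. \<forall>y\<in>T. \<forall>z\<in>T.
    tp (tp x y y) x z + tp (tp y x x) y z + sT (f (tp x y y) z) x + sT (f (tp y x x) z) y
    + sT (f x z) (tp x y y) + sT (f y z) (tp y x x) = 0"
  using tp_axiom by blast
 have 9: "\<forall>J. N.subspace J \<and> J \<subseteq> T \<and> (\<forall>x\<in>J. \<forall>y\<in>T. \<forall>z\<in>T. tp x y z \<in> J) \<longrightarrow> J = {0} \<or> J = T"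
  using simple by blast
 show ?thesis
  unfolding simple_freudenthal_triple_system_def freudenthal_triple_system_def alternating_form_def
  by (intro conjI; (fact | rule vsT T_sub))
qed

theorem decomposition: "freudenthal_decomposition P s br L S \<iota> sT T t"
proof -
 let ?O = "{t x b0 + t y b1 | x y. x \<in> T \<and> y \<in> T}"
 let ?E = "{D + \<iota> g | D g. D \<in> S \<and> g \<in> sp P}"
 have subE: "M.subspace ?E"
 proof (rule M.subspaceI)
  have "0 = 0 + \<iota> 0" by simp
  then show "0 \<in> ?E" using S_cl(3) sp_0 by blast
  show "X + Y \<in> ?E" if "X \<in> ?E" "Y \<in> ?E" for X Y
  proof -
   from that obtain D g D' g' where "X = D + \<iota> g" "Y = D' + \<iota> g'" "D \<in> S" "D' \<in> S" "g \<in> sp P" "g' \<in> sp P" by blast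
   then have "X + Y = (D + D') + \<iota> (g + g')" "D + D' \<in> S" "g + g' \<in> sp P"
    by (simp_all add: iota_add S_cl sp_add)
   then show ?thesis by blast
  qed
  show "s c X \<in> ?E" if "X \<in> ?E" for c X
  proof -
   from that obtain D g where "X = D + \<iota> g" "D \<in> S" "g \<in> sp P" by blast
   then have "s c X = s c D + \<iota> (%v. scl P c (g v))" "s c D \<in> S" "(%v. scl P c (g v)) \<in> sp P"
    by (simp_all add: iota_scl S_cl sp_scl M.scale_right_distrib)
   then show ?thesis by blast
  qed
 qed
 have subO: "M.subspace ?O"
 proof (rule M.subspaceI)
  have "0 = t 0 b0 + t 0 b1" by simp
  then show "0 \<in> ?O" using T_closed(3) by blast
  show "X + Y \<in> ?O" if "X \<in> ?O" "Y \<in> ?O" for X Y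
  proof -
   from that obtain x y x' y' where "X = t x b0 + t y b1" "Y = t x' b0 + t y' b1" "x \<in> T" "y \<in> T" "x' \<in> T" "y' \<in> T" by blast
   then have "X + Y = t (x + x') b0 + t (y + y') b1" "x + x' \<in> T" "y + y' \<in> T"
    by (simp_all add: t_add1 T_closed)
   then show ?thesis by blast
  qed
  show "s c X \<in> ?O" if "X \<in> ?O" for c X
  proof -
   from that obtain x y where "X = t x b0 + t y b1" "x \<in> T" "y \<in> T" by blast
   then have "s c X = t (sT c x) b0 + t (sT c y) b1" "sT c x \<in> T" "sT c y \<in> T"
    by (simp_all add: t_scl1 T_closed M.scale_right_distrib)
   then show ?thesis by blast
  qed
 qed
 have tO: "t x u \<in> ?O" if "x \<in> T" for x u
  using t_coord[OF that, of u] T_closed(2)[OF that] by blast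
 have OL: "X \<in> L" if "X \<in> ?O" for X using that odd_L by blast
 have EL: "X \<in> L" if "X \<in> ?E" for X using that L_cl(1) S_L iota_L by blast
 have subI: "M.subspace (\<iota> ` sp P)"
 proof (rule M.subspaceI)
  show "0 \<in> \<iota> ` sp P" using iota_0 sp_0 by (metis imageI)
  show "X + Y \<in> \<iota> ` sp P" if "X \<in> \<iota> ` sp P" "Y \<in> \<iota> ` sp P" for X Y
  proof -
   from that obtain g h where "g \<in> sp P" "h \<in> sp P" "X = \<iota> g" "Y = \<iota> h" by blast
   then show ?thesis using iota_add[of g h] sp_add[of g h] by (metis imageI)
  qed
  show "s c X \<in> \<iota> ` sp P" if "X \<in> \<iota> ` sp P" for c X
  proof -
   from that obtain g where "g \<in> sp P" "X = \<iota> g" by blast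
   then show ?thesis using iota_scl[of g c] sp_scl[of g c] by (metis imageI)
  qed
 qed
 have dirE: "direct_sum s S (\<iota> ` sp P) ?E"
  unfolding direct_sum_def using S_sub subI subE S_iota S_cl(3) M.subspace_0[OF subI] by blast
 have Sp_S: "br (\<iota> g) D = 0" if "D \<in> S" "g \<in> sp P" for D g
  using S_sp[OF that] br_anti[OF iota_L[OF that(2)] S_L[OF that(1)]] by simp
 have dirL: "direct_sum s ?E ?O L"
 proof -
  have "?E \<inter> ?O = {0}"
   using L_direct M.subspace_0[OF subE] M.subspace_0[OF subO] by blast
  moreover have "L = {x + y |x y. x \<in> ?E \<and> y \<in> ?O}" unfolding L_eq by blast
  ultimately show ?thesis unfolding direct_sum_def using subE subO L_sub by blast
 qed
 have EE: "br X Y \<in> ?E" if "X \<in> ?E" "Y \<in> ?E" for X Y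
 proof -
  from that obtain D g D' g' where X: "X = D + \<iota> g" "Y = D' + \<iota> g'" "D \<in> S" "D' \<in> S" "g \<in> sp P" "g' \<in> sp P" by blast
  then have "br X Y = br D D' + \<iota> (%v. g (g' v) - g' (g v))"
   by (simp add: br_add br_add2 S_L iota_L L_cl S_sp Sp_S sp_sp)
  then show ?thesis using X S_closed sp_closed by blast
 qed
 have EO: "br X Y \<in> ?O" if X: "X \<in> ?E" and Y: "Y \<in> ?O" for X Y
 proof -
  from X obtain D g where D: "X = D + \<iota> g" "D \<in> S" "g \<in> sp P" by blast
  have *: "br X (t z u) \<in> ?O" if "z \<in> T" for z u
  proof -
   have "br X (t z u) = t (a D z) u + t z (g u)"
    using D that by (simp add: br_add S_L iota_L t_L S_T sp_T)
   then show ?thesis using M.subspace_add[OF subO tO tO] a_T D that by simp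
  qed
  from Y obtain x y where "Y = t x b0 + t y b1" "x \<in> T" "y \<in> T" by blast
  then show ?thesis using M.subspace_add[OF subO * *] EL[OF X] by (simp add: br_add2 t_L)
 qed
 have OE: "br Y X \<in> ?O" if X: "X \<in> ?E" and Y: "Y \<in> ?O" for X Y
  using M.subspace_neg[OF subO EO[OF X Y]] br_anti[OF OL[OF Y] EL[OF X]] by simp
 have OO: "br X Y \<in> ?E" if X: "X \<in> ?O" and Y: "Y \<in> ?O" for X Y
 proof -
  have *: "br (t x u) (t y v) \<in> ?E" if "x \<in> T" "y \<in> T" for x y u v
  proof -
   have "br (t x u) (t y v) = s (form P u v) (d x y) + \<iota> (%w. scl P (f x y) (gam P u v w))"
    using that by (simp add: T_T iota_scl)
   moreover have "s (form P u v) (d x y) \<in> S" using that by (simp add: S_cl d_S)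
   moreover have "(%w. scl P (f x y) (gam P u v w)) \<in> sp P" by (rule sp_scl[OF gam_sp])
   ultimately show ?thesis by blast
  qed
  from X Y obtain x y x' y' where "X = t x b0 + t y b1" "Y = t x' b0 + t y' b1" "x \<in> T" "y \<in> T" "x' \<in> T" "y' \<in> T" by blast
  then have "br X Y = (br (t x b0) (t x' b0) + br (t y b1) (t x' b0)) + (br (t x b0) (t y' b1) + br (t y b1) (t y' b1))"
   and "x \<in> T" "y \<in> T" "x' \<in> T" "y' \<in> T"
   by (simp_all add: br_add br_add2 t_L L_cl)
  then show ?thesis by (simp only:) (intro M.subspace_add[OF subE] *)
 qed
 have tdec: "tensor_decomposition P s sT T t ?O"
  unfolding tensor_decomposition_def
 proof (intro conjI)
  show "\<forall>u. linear_from sT s T (%x. t x u)" by (simp add: linear_from_def t_add1 t_scl1)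
  show "\<forall>x\<in>T. linear_from (scl P) s UNIV (t x)" by (simp add: linear_from_def t_add2 t_scl2)
  have "x = x' \<and> y = y'" if "x \<in> T" "y \<in> T" "x' \<in> T" "y' \<in> T" "t x b0 + t y b1 = t x' b0 + t y' b1" for x y x' y'
  proof -
   have "t (x - x') b0 + t (y - y') b1 = 0"
    using that by (simp add: t_diff algebra_simps)
   then show ?thesis using t_inj[of "x - x'" "y - y'"] that T_closed by simp
  qed
  then show "bij_betw (%(x, y). t x b0 + t y b1) (T \<times> T) ?O"
   unfolding bij_betw_def inj_on_def by (auto simp: image_iff)
 qed
 have grad: "Z2_grading s br L ?E ?O"
  unfolding Z2_grading_def by (intro conjI ballI dirL; (rule EE EO OE OO; assumption))
 have part1: "\<exists>L0 L1. direct_sum s S (\<iota> ` sp P) L0 \<and>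
    (\<forall>x\<in>S. \<forall>y\<in>S. br x y \<in> S) \<and>
    (\<forall>x\<in>S. \<forall>f\<in>sp P. br x (\<iota> f) = 0 \<and> br (\<iota> f) x = 0) \<and>
    tensor_decomposition P s sT T t L1 \<and> Z2_grading s br L L0 L1"
  by (intro exI[of _ ?E] exI[of _ ?O] conjI; (rule dirE tdec grad | blast intro: S_closed S_sp Sp_S))
 have alt: "alternating_form sT T f"
  by (simp add: alternating_form_def bilinear_from_def linear_from_def f_lin f_self)
 have nd: "nondegenerate_form T f"
  unfolding nondegenerate_form_def using f_nondeg f_skew by (metis neg_equal_0_iff_equal)
 have dbil: "bilinear_from sT s T d"
  by (simp add: bilinear_from_def linear_from_def d_lin)
 have "simple_freudenthal_triple_system sT T f (%x y z. a (d x y) z - sT (f x z) y - sT (f y z) x)"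
  using freudenthal unfolding tp_def[abs_def] .
 then show ?thesis
  unfolding freudenthal_decomposition_def
  by (intro conjI part1 exI[of _ f] exI[of _ d] exI[of _ a] alt nd dbil; blast intro: d_S d_sym T_T a_T S_T)
qed

end

section \<open>Graded brackets\<close>

lemma single_add: "single \<sigma> (x + y) = single \<sigma> x + single \<sigma> (y :: 'b::monoid_add)"
 by (auto simp: single_def fun_eq_iff)

lemma single_0 [simp]: "single \<sigma> 0 = 0"
 by (auto simp: single_def fun_eq_iff)

lemma single_same [simp]: "single \<sigma> x \<sigma> = x" by (simp add: single_def)
lemma single_other [simp]: "\<rho> ~= \<sigma> ==> single \<sigma> x \<rho> = 0" by (simp add: single_def)

lemma single_uminus: "single \<sigma> (- x) = - single \<sigma> (x :: 'b::group_add)"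
 by (auto simp: single_def fun_eq_iff)

lemma vs_fs: "vector_space (fs :: 'a::field => _)"
 by unfold_locales (auto simp: fs_def ts_def fun_eq_iff algebra_simps)

lemma fs_single: "fs c (single \<sigma> x) = single \<sigma> (ts (c::'a::field) x)"
 by (auto simp: fs_def single_def ts_def fun_eq_iff)

lemma tensor_zero: "x \<in> tensor_space \<sigma> ==> \<not> \<kappa> \<subseteq> \<sigma> ==> x \<kappa> = 0"
 by (simp add: tensor_space_def)

lemma family_spaceD: "x \<in> family_space S ==> x \<sigma> \<in> tensor_space \<sigma>" "x \<in> family_space S ==> \<sigma> ~: S ==> x \<sigma> = 0"
 for x :: "nat set => 'a::field tensor"
 unfolding family_space_def using tensor_space_closed(1) by (fastforce split: if_splits)+

lemma family_spaceI: "(\<And>\<sigma>. \<sigma> \<in> S ==> x \<sigma> \<in> tensor_space \<sigma>) ==> (\<And>\<sigma>. \<sigma> ~: S ==> x \<sigma> = 0) ==> x \<in> family_space S"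
 by (auto simp: family_space_def)

lemma fs_apply: "fs c x \<sigma> = ts c (x \<sigma>)" by (simp add: fs_def)

lemma family_subspace: "module.subspace fs (family_space S :: (nat set => 'a::field tensor) set)"
proof -
 interpret vector_space "fs :: 'a => _" by (rule vs_fs)
 show ?thesis
 proof (rule subspaceI; (intro family_spaceI)?)
  fix x y :: "nat set => 'a tensor" and c \<sigma> assume x: "x \<in> family_space S"
  show "fs c x \<sigma> \<in> tensor_space \<sigma>" using family_spaceD(1)[OF x] by (simp add: fs_apply)
  show "fs c x \<sigma> = 0" if "\<sigma> ~: S" by (simp only: fs_apply family_spaceD(2)[OF x that] TS.scale_zero_right)
  assume y: "y \<in> family_space S"
  show "(x + y) \<sigma> \<in> tensor_space \<sigma>" using family_spaceD(1)[OF x] family_spaceD(1)[OF y] by simp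
  show "(x + y) \<sigma> = 0" if "\<sigma> ~: S" by (simp only: plus_fun_apply family_spaceD(2)[OF x that] family_spaceD(2)[OF y that] add_0)
 qed simp_all
qed

lemma single_family: "\<sigma> \<in> S ==> x \<in> tensor_space \<sigma> ==> single \<sigma> x \<in> family_space S"
 by (auto simp: single_def intro!: family_spaceI)

context sympl begin

lemma vs_es: "vector_space (es P)"
 by unfold_locales (simp_all add: es_def prod_eq_iff fun_eq_iff sps_def ts_def algebra_simps)

sublocale ES: vector_space "es P" by (rule vs_es)

lemma es_simps [simp]: "fst (es P c X) = sps P c (fst X)" "snd (es P c X) = fs c (snd X)"
 by (simp_all add: es_def fs_def)

section \<open>Contraction, diagonal map and action when one tensor factor is split off\<close>

lemma join_lin:
 "join P k (x + y) u = join P k x u + join P k y u" "join P k (ts c x) u = ts c (join P k x u)"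
 "join P k x (u + v) = join P k x u + join P k x v" "join P k x (scl P c u) = ts c (join P k x u)"
 by (simp_all add: join_def ts_def fun_eq_iff coord_add coord_scl algebra_simps)

lemma join_0 [simp]: "join P k 0 u = 0" "join P k x 0 = 0"
 by (simp_all add: join_def fun_eq_iff)

lemma join_in: "k \<in> \<sigma> ==> x \<in> tensor_space (\<sigma> - {k}) ==> join P k x u \<in> tensor_space \<sigma>"
proof -
 assume k: "k \<in> \<sigma>" and x: "x \<in> tensor_space (\<sigma> - {k})"
 have "x (\<kappa> - {k}) = 0" if "\<not> \<kappa> \<subseteq> \<sigma>" for \<kappa>
  by (rule tensor_zero[OF x]) (use that k in blast)
 then show ?thesis by (simp add: join_def tensor_space_def)
qed

lemma sd_Diff: "k \<in> \<sigma> ==> k \<in> \<tau> ==> sym_diff (\<sigma> - {k}) (\<tau> - {k}) = sym_diff \<sigma> \<tau>"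
 "k ~: \<sigma> ==> k \<in> \<tau> ==> sym_diff \<sigma> (\<tau> - {k}) = sym_diff \<sigma> \<tau> - {k}"
 by auto

lemma contr_join:
 assumes fin: "finite \<sigma>" "finite \<tau>" and k: "k \<in> \<sigma>" "k \<in> \<tau>"
  and x: "x \<in> tensor_space (\<sigma> - {k})" "y \<in> tensor_space (\<tau> - {k})"
 shows "contr P \<sigma> \<tau> (join P k x u) (join P k y v) = ts (form P u v) (contr P (\<sigma> - {k}) (\<tau> - {k}) x y)"
proof -
 let ?\<Phi> = "%x y. contr P \<sigma> \<tau> (join P k x u) (join P k y v) - ts (form P u v) (contr P (\<sigma> - {k}) (\<tau> - {k}) x y)"
 have f: "finite (\<sigma> - {k})" "finite (\<tau> - {k})" using fin by auto
 have "?\<Phi> x y = 0"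
 proof (rule bilinear_zero[where \<Phi> = ?\<Phi>, OF vs_ts f x])
  fix v' w' :: "nat => 'v"
  have kI: "k \<in> \<sigma> \<inter> \<tau>" "finite (\<sigma> \<inter> \<tau>)" using k fin by auto
  have 1: "(\<Prod>i\<in>\<sigma> \<inter> \<tau>. form P ((v'(k := u)) i) ((w'(k := v)) i)) = form P u v * (\<Prod>i\<in>(\<sigma> - {k}) \<inter> (\<tau> - {k}). form P (v' i) (w' i))"
  proof -
   have "\<sigma> \<inter> \<tau> - {k} = (\<sigma> - {k}) \<inter> (\<tau> - {k})" by auto
   then have "(\<Prod>i\<in>\<sigma> \<inter> \<tau> - {k}. form P ((v'(k := u)) i) ((w'(k := v)) i)) = (\<Prod>i\<in>(\<sigma> - {k}) \<inter> (\<tau> - {k}). form P (v' i) (w' i))"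
    by (intro prod.cong) auto
   then show ?thesis unfolding prod.remove[OF kI(2,1)] by simp
  qed
  have 2: "pure P (sym_diff \<sigma> \<tau>) (%i. if i \<in> \<sigma> then (v'(k := u)) i else (w'(k := v)) i)
   = pure P (sym_diff \<sigma> \<tau>) (%i. if i \<in> \<sigma> - {k} then v' i else w' i)"
   by (rule pure_local) (use k in auto)
  show "?\<Phi> (pure P (\<sigma> - {k}) v') (pure P (\<tau> - {k}) w') = 0"
   unfolding join_pure[OF fin(1) k(1)] join_pure[OF fin(2) k(2)] contr_pure[OF P fin] contr_pure[OF P f] sd_Diff(1)[OF k] 1 2 ts_ts
   by simp
 qed (simp_all add: contr_lin join_lin TS.scale_right_distrib TS.scale_right_diff_distrib TS.scale_left_commute)
 then show ?thesis by simp
qed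

lemma contr_join_right:
 assumes fin: "finite \<sigma>" "finite \<tau>" and k: "k ~: \<sigma>" "k \<in> \<tau>"
  and x: "x \<in> tensor_space \<sigma>" "y \<in> tensor_space (\<tau> - {k})"
 shows "contr P \<sigma> \<tau> x (join P k y u) = join P k (contr P \<sigma> (\<tau> - {k}) x y) u"
proof -
 let ?\<Phi> = "%x y. contr P \<sigma> \<tau> x (join P k y u) - join P k (contr P \<sigma> (\<tau> - {k}) x y) u"
 have f: "finite (\<tau> - {k})" using fin by auto
 have "?\<Phi> x y = 0"
 proof (rule bilinear_zero[where \<Phi> = ?\<Phi>, OF vs_ts fin(1) f x])
  fix v w :: "nat => 'v"
  have kD: "k \<in> sym_diff \<sigma> \<tau>" "finite (sym_diff \<sigma> \<tau>)" using k fin by auto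
  have 1: "(\<Prod>i\<in>\<sigma> \<inter> \<tau>. form P (v i) ((w(k := u)) i)) = (\<Prod>i\<in>\<sigma> \<inter> (\<tau> - {k}). form P (v i) (w i))"
   using k by (intro prod.cong) auto
  have 2: "(%i. if i \<in> \<sigma> then v i else (w(k := u)) i) = (%i. if i \<in> \<sigma> then v i else w i)(k := u)"
   using k by auto
  show "?\<Phi> (pure P \<sigma> v) (pure P (\<tau> - {k}) w) = 0"
   unfolding join_pure[OF fin(2) k(2)] contr_pure[OF P fin] contr_pure[OF P fin(1) f] sd_Diff(2)[OF k] join_lin
    join_pure[OF kD(2,1)] 1 2 by simp
 qed (simp_all add: contr_lin join_lin TS.scale_right_distrib TS.scale_right_diff_distrib)
 then show ?thesis by simp
qed

lemma nu_lin: "nu k (f + g) = nu k f + (nu k g :: nat => 'v => 'v)" "nu k (%v. scl P c (f v)) = sps P c (nu k f)"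
 by (auto simp: nu_def sps_def fun_eq_iff)

text \<open>A summand of \<open>diag\<close> at an index other than \<open>k\<close> contains the
  factor \<open>form P u v\<close>; the summand at \<open>k\<close> contains all forms of the
  remaining factors. Already this has the shape of the bracket of odd elements, and both d and the
  form on \<open>T\<close> originate here.\<close>

lemma diag_join:
 assumes fin: "finite \<sigma>" and k: "k \<in> \<sigma>"
  and x: "x \<in> tensor_space (\<sigma> - {k})" "y \<in> tensor_space (\<sigma> - {k})"
 shows "diag P \<sigma> (join P k x u) (join P k y v) = sps P (form P u v) (diag P (\<sigma> - {k}) x y)
  + sps P (- (1 / 2) * tform P (\<sigma> - {k}) x y) (nu k (gam P u v))"
proof -
 let ?\<Phi> = "%x y. diag P \<sigma> (join P k x u) (join P k y v) - sps P (form P u v) (diag P (\<sigma> - {k}) x y)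
  - sps P (- (1 / 2) * tform P (\<sigma> - {k}) x y) (nu k (gam P u v))"
 have f: "finite (\<sigma> - {k})" using fin by auto
 have "?\<Phi> x y = 0"
 proof (rule bilinear_zero[where \<Phi> = ?\<Phi>, OF vs_sps[OF P] f f x])
  fix v' w :: "nat => 'v"
  show "?\<Phi> (pure P (\<sigma> - {k}) v') (pure P (\<sigma> - {k}) w) = 0"
  proof (intro ext)
   fix i z
   have 1: "(\<Prod>i\<in>\<sigma> - {i}. form P ((v'(k := u)) i) ((w(k := v)) i)) = form P u v * (\<Prod>i\<in>\<sigma> - {k} - {i}. form P (v' i) (w i))" if "i ~= k"
   proof -
    have "\<sigma> - {i} - {k} = \<sigma> - {k} - {i}" by auto
    then have "(\<Prod>j\<in>\<sigma> - {i} - {k}. form P ((v'(k := u)) j) ((w(k := v)) j)) = (\<Prod>j\<in>\<sigma> - {k} - {i}. form P (v' j) (w j))"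
     by (intro prod.cong) auto
    moreover have "k \<in> \<sigma> - {i}" "finite (\<sigma> - {i})" using that k fin by auto
    ultimately show ?thesis by (simp only: prod.remove[of "\<sigma> - {i}" k] fun_upd_same)
   qed
   have 2: "(\<Prod>i\<in>\<sigma> - {k}. form P ((v'(k := u)) i) ((w(k := v)) i)) = (\<Prod>i\<in>\<sigma> - {k}. form P (v' i) (w i))"
    by (rule prod.cong) auto
   show "?\<Phi> (pure P (\<sigma> - {k}) v') (pure P (\<sigma> - {k}) w) i z = 0 i z"
    unfolding join_pure[OF fin k] minus_apply diag_apply[OF fin] diag_apply[OF f] tform_pure[OF P f] sps_def nu_def
    using 1 2 k by (cases "i = k") (simp_all add: mult_ac)
  qed
 qed (simp_all add: diag_lin tform_lin join_lin SPS.scale_right_distrib SPS.scale_right_diff_distrib SPS.scale_left_distrib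
    SPS.scale_left_diff_distrib diff_divide_distrib add_divide_distrib distrib_left mult.commute)
 then show ?thesis by (simp add: algebra_simps)
qed

lemma act_join:
 assumes fin: "finite \<tau>" and k: "k \<in> \<tau>" and g: "\<And>i. i \<in> \<tau> ==> g i \<in> sp P" and y: "y \<in> tensor_space (\<tau> - {k})"
 shows "act P \<tau> g (join P k y u) = join P k (act P (\<tau> - {k}) g y) u + join P k y (g k u)"
proof -
 let ?\<Phi> = "%y. act P \<tau> g (join P k y u) - (join P k (act P (\<tau> - {k}) g y) u + join P k y (g k u))"
 have f: "finite (\<tau> - {k})" using fin by auto
 have js: "join P k (\<Sum>i\<in>I. F i) u = (\<Sum>i\<in>I. join P k (F i) u)" for I :: "nat set" and F
  by (induction I rule: infinite_finite_induct) (simp_all only: sum.infinite sum.empty sum.insert join_0 join_lin not_False_eq_True)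
 have "?\<Phi> y = 0"
 proof (rule linear_zero[where \<Phi> = ?\<Phi>, OF vs_ts f y])
  fix w :: "nat => 'v"
  have "act P \<tau> g (pure P \<tau> (w(k := u))) = (\<Sum>i\<in>\<tau>. pure P \<tau> ((w(k := u))(i := g i ((w(k := u)) i))))"
   by (rule act_pure_sp[OF fin g])
  also have "\<dots> = pure P \<tau> (w(k := g k u)) + (\<Sum>i\<in>\<tau> - {k}. pure P \<tau> ((w(i := g i (w i)))(k := u)))"
   by (subst sum.remove[OF fin k]) (auto intro!: sum.cong arg_cong[of _ _ "pure P \<tau>"])
  also have "(\<Sum>i\<in>\<tau> - {k}. pure P \<tau> ((w(i := g i (w i)))(k := u))) = join P k (act P (\<tau> - {k}) g (pure P (\<tau> - {k}) w)) u"
  proof -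
   have "act P (\<tau> - {k}) g (pure P (\<tau> - {k}) w) = (\<Sum>i\<in>\<tau> - {k}. pure P (\<tau> - {k}) (w(i := g i (w i))))"
    by (rule act_pure_sp[OF f]) (use g in auto)
   then show ?thesis by (simp only: js join_pure[OF fin k])
  qed
  finally show "?\<Phi> (pure P (\<tau> - {k}) w) = 0"
   by (simp only: join_pure[OF fin k] add.commute diff_self)
 qed (simp_all add: act_lin join_lin TS.scale_right_distrib TS.scale_right_diff_distrib)
 then show ?thesis by simp
qed

lemma prod_skew: "(\<Prod>i\<in>I. form P (w i) (v i)) = (- 1) ^ card I * (\<Prod>i\<in>I. form P (v i) (w i))"
proof -
 have "(\<Prod>i\<in>I. form P (w i) (v i)) = (\<Prod>i\<in>I. - 1 * form P (v i) (w i))"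
 proof (rule prod.cong[OF refl])
  show "form P (w i) (v i) = - 1 * form P (v i) (w i)" for i
   using form_skew[of "w i" "v i"] by simp
 qed
 then show ?thesis by (simp only: prod.distrib prod_constant)
qed

text \<open>Each contracted index reverses one value of the skew form; the tensor that is left does
  not depend on the order.\<close>

lemma contr_commute:
 assumes fin: "finite \<sigma>" "finite \<tau>" and x: "x \<in> tensor_space \<sigma>" "y \<in> tensor_space \<tau>"
 shows "contr P \<tau> \<sigma> y x = ts ((- 1) ^ card (\<sigma> \<inter> \<tau>)) (contr P \<sigma> \<tau> x y)"
proof -
 let ?\<Phi> = "%x y. contr P \<tau> \<sigma> y x - ts ((- 1) ^ card (\<sigma> \<inter> \<tau>)) (contr P \<sigma> \<tau> x y)"
 have "?\<Phi> x y = 0"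
 proof (rule bilinear_zero[where \<Phi> = ?\<Phi>, OF vs_ts fin x])
  fix v w :: "nat => 'v"
  have 1: "sym_diff \<tau> \<sigma> = sym_diff \<sigma> \<tau>" "\<tau> \<inter> \<sigma> = \<sigma> \<inter> \<tau>" by auto
  have 2: "pure P (sym_diff \<sigma> \<tau>) (%i. if i \<in> \<tau> then w i else v i) = pure P (sym_diff \<sigma> \<tau>) (%i. if i \<in> \<sigma> then v i else w i)"
   by (rule pure_local) auto
  show "?\<Phi> (pure P \<sigma> v) (pure P \<tau> w) = 0"
   unfolding contr_pure[OF P fin] contr_pure[OF P fin(2,1)] 1 2 ts_ts prod_skew[of w v] by simp
 qed (simp_all add: contr_lin TS.scale_right_distrib TS.scale_right_diff_distrib TS.scale_left_commute)
 then show ?thesis by simp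
qed

text \<open>Beside \<open>gam\<close>, which is symmetric, each summand contains one form value less
  than \<open>\<sigma>\<close> has elements, hence an odd number of sign changes.\<close>

lemma diag_commute:
 assumes fin: "finite \<sigma>" and x: "x \<in> tensor_space \<sigma>" "y \<in> tensor_space \<sigma>" and ev: "even (card \<sigma>)"
 shows "diag P \<sigma> y x = - diag P \<sigma> x y"
proof -
 let ?\<Phi> = "%x y. diag P \<sigma> y x + diag P \<sigma> x y"
 have "?\<Phi> x y = 0"
 proof (rule bilinear_zero[where \<Phi> = ?\<Phi>, OF vs_sps[OF P] fin fin x])
  fix v w :: "nat => 'v"
  have 1: "(\<Prod>k\<in>\<sigma> - {i}. form P (w k) (v k)) = - (\<Prod>k\<in>\<sigma> - {i}. form P (v k) (w k))" if "i \<in> \<sigma>" for i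
  proof -
   have "card \<sigma> > 0" using that fin by (auto simp: card_gt_0_iff)
   then have "odd (card (\<sigma> - {i}))" using ev that fin by (simp only: card_Diff_singleton) presburger
   then show ?thesis unfolding prod_skew[of w v] by simp
  qed
  show "?\<Phi> (pure P \<sigma> v) (pure P \<sigma> w) = 0"
  proof (intro ext)
   fix i z
   show "?\<Phi> (pure P \<sigma> v) (pure P \<sigma> w) i z = 0 i z"
    unfolding plus_fun_apply diag_apply[OF fin] using gam_commute[of "w i" "v i"] 1[of i] by simp
  qed
 qed (simp_all add: diag_lin SPS.scale_right_distrib)
 then show ?thesis by (simp add: eq_neg_iff_add_eq_0)
qed

text \<open>A basis vector pairs nontrivially only with the other basis vector. So the basis tensor
  of the complementary subset picks out the coordinate at \<open>\<kappa>\<close>, up to a product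
  of values \<open>om\<close> and \<open>- om\<close>.\<close>

lemma tform_delta:
 assumes fin: "finite \<rho>" and x: "x \<in> tensor_space \<rho>" and k: "\<kappa> \<subseteq> \<rho>"
 shows "\<exists>c. c ~= 0 \<and> tform P \<rho> (single (\<rho> - \<kappa>) 1) x = c * x \<kappa>"
proof -
 let ?b = "%\<kappa>. bfam P \<kappa>"
 have "tform P \<rho> (single (\<rho> - \<kappa>) 1) x = (\<Sum>\<mu>\<in>Pow \<rho>. single (\<rho> - \<kappa>) 1 \<mu> * (\<Sum>\<mu>'\<in>Pow \<rho>. x \<mu>' * (\<Prod>i\<in>\<rho>. form P (?b \<mu> i) (?b \<mu>' i))))"
  by (simp add: tform_def bilext_def linext_def)
 also have "\<dots> = (\<Sum>\<mu>\<in>Pow \<rho>. if \<mu> = \<rho> - \<kappa> then (\<Sum>\<mu>'\<in>Pow \<rho>. x \<mu>' * (\<Prod>i\<in>\<rho>. form P (?b \<mu> i) (?b \<mu>' i))) else 0)"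
  by (rule sum.cong) (auto simp: single_def)
 also have "\<dots> = (\<Sum>\<mu>'\<in>Pow \<rho>. x \<mu>' * (\<Prod>i\<in>\<rho>. form P (?b (\<rho> - \<kappa>) i) (?b \<mu>' i)))"
  using fin by simp
 also have "\<dots> = (\<Sum>\<mu>'\<in>Pow \<rho>. if \<mu>' = \<kappa> then x \<kappa> * (\<Prod>i\<in>\<rho>. form P (?b (\<rho> - \<kappa>) i) (?b \<kappa> i)) else 0)"
 proof (rule sum.cong[OF refl])
  fix \<mu>' assume "\<mu>' \<in> Pow \<rho>"
  show "x \<mu>' * (\<Prod>i\<in>\<rho>. form P (?b (\<rho> - \<kappa>) i) (?b \<mu>' i)) = (if \<mu>' = \<kappa> then x \<kappa> * (\<Prod>i\<in>\<rho>. form P (?b (\<rho> - \<kappa>) i) (?b \<kappa> i)) else 0)"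
  proof (cases "\<mu>' = \<kappa>")
   case False
   then obtain i where "i \<in> \<rho>" "(i \<in> \<rho> - \<kappa>) = (i \<in> \<mu>')" using k \<open>\<mu>' \<in> Pow \<rho>\<close> by blast
   then have "(\<Prod>i\<in>\<rho>. form P (?b (\<rho> - \<kappa>) i) (?b \<mu>' i)) = 0"
    using fin by (intro prod_zero bexI[of _ i]) (simp_all add: bfam_def)
   then show ?thesis using False by simp
  qed simp
 qed
 also have "\<dots> = (\<Prod>i\<in>\<rho>. form P (?b (\<rho> - \<kappa>) i) (?b \<kappa> i)) * x \<kappa>" using fin k by (simp add: mult.commute)
 finally have "tform P \<rho> (single (\<rho> - \<kappa>) 1) x = (\<Prod>i\<in>\<rho>. form P (?b (\<rho> - \<kappa>) i) (?b \<kappa> i)) * x \<kappa>" .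
 moreover have "(\<Prod>i\<in>\<rho>. form P (?b (\<rho> - \<kappa>) i) (?b \<kappa> i)) ~= 0"
  using fin om_nz by (auto simp: bfam_def form_bas)
 ultimately show ?thesis by blast
qed

end

interpretation FS: vector_space "fs :: 'a::field => (nat set => 'a tensor) => nat set => 'a tensor"
 by (rule vs_fs)

lemma single_diff: "single \<sigma> (x - y) = single \<sigma> x - single \<sigma> (y :: 'b::ab_group_add)"
 by (auto simp: single_def fun_eq_iff)

context sympl begin

text \<open>Linearity of \<open>phi\<close> in one argument rests on the sp-components of the other
  argument being linear maps.\<close>

definition lin :: "('a, 'v) elt => bool" where
 "lin X \<longleftrightarrow> (\<forall>i. fst X i \<in> sp P)"

lemma lin_add: "lin X ==> lin Y ==> lin (X + Y)"
 and lin_scl: "lin X ==> lin (es P c X)"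
 by (auto simp: lin_def sps_def intro: sp_add sp_scl)

lemma lin_0 [simp]: "lin (0, x)" "lin 0" by (simp_all add: lin_def)

lemma sp_bracket_lin:
 "(\<And>i. h i \<in> sp P) ==> sp_bracket (g + g') h = sp_bracket g h + sp_bracket g' h"
 "(\<And>i. h i \<in> sp P) ==> sp_bracket (sps P c g) h = sps P c (sp_bracket g h)"
 "(\<And>i. h i \<in> sp P) ==> sp_bracket h (g + g') = sp_bracket h g + sp_bracket h g'"
 "(\<And>i. h i \<in> sp P) ==> sp_bracket h (sps P c g) = sps P c (sp_bracket h g)"
 by (simp_all add: sp_bracket_def sps_def fun_eq_iff sp_map_add sp_map_scl V.scale_right_diff_distrib)

lemma sp_bracket_0 [simp]: "(\<And>i. h i \<in> sp P) ==> sp_bracket 0 h = 0" "(\<And>i. h i \<in> sp P) ==> sp_bracket h 0 = 0"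
 using sp_bracket_lin(2,4)[of h 0 0] by simp_all

lemma sp_bracket_skew: "sp_bracket g h = - sp_bracket h g"
 by (simp add: sp_bracket_def fun_eq_iff)

lemma phi_lin:
 assumes fin: "finite \<sigma>" "finite \<tau>" and Y: "lin Y"
 shows "phi P \<sigma> \<tau> (X + X') Y = phi P \<sigma> \<tau> X Y + phi P \<sigma> \<tau> X' Y"
  "phi P \<sigma> \<tau> (es P c X) Y = es P c (phi P \<sigma> \<tau> X Y)"
  "phi P \<sigma> \<tau> Y (X + X') = phi P \<sigma> \<tau> Y X + phi P \<sigma> \<tau> Y X'"
  "phi P \<sigma> \<tau> Y (es P c X) = es P c (phi P \<sigma> \<tau> Y X)"
 using Y unfolding lin_def
 by (auto simp: phi_def prod_eq_iff sp_bracket_lin act_lin act_lin_g fin contr_lin diag_lin single_add single_diff single_uminus fs_apply fs_single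
   TS.scale_minus_right FS.scale_minus_right)

end

text \<open>The data needed for a bilinear and anticommutative bracket. Exchanging the arguments of
  a contraction costs one sign per common index, which \<open>eps_skew\<close> compensates;
  \<open>card_even\<close> makes \<open>diag\<close> skew. The Jacobi identity is left to the
  individual algebras.\<close>

locale graded = sympl P for P :: "('a::field, 'v::ab_group_add) plane" +
 fixes G :: "nat set set" and \<epsilon> :: "nat set => nat set => 'a"
 assumes finG: "finite G" and fin_G: "\<sigma> \<in> G ==> finite \<sigma>" and empty_G: "{} \<in> G"
  and eps_empty: "\<tau> \<in> G ==> \<epsilon> {} \<tau> = 1" "\<tau> \<in> G ==> \<epsilon> \<tau> {} = 1"
  and eps_skew: "\<sigma> \<in> G ==> \<tau> \<in> G ==> \<sigma> ~= {} ==> \<tau> ~= {} ==> \<sigma> ~= \<tau> ==> sym_diff \<sigma> \<tau> \<in> G ==>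
   \<epsilon> \<tau> \<sigma> * (- 1) ^ card (\<sigma> \<inter> \<tau>) = - \<epsilon> \<sigma> \<tau>"
  and card_even: "\<sigma> \<in> G ==> even (card \<sigma>)"
begin

abbreviation br where "br \<equiv> graded_bracket P G \<epsilon>"

lemma br_sum: "br X Y = (\<Sum>(\<sigma>, \<tau>)\<in>G \<times> G. if sym_diff \<sigma> \<tau> \<in> G then es P (\<epsilon> \<sigma> \<tau>) (phi P \<sigma> \<tau> X Y) else 0)"
 by (simp add: graded_bracket_def sum.cartesian_product)

lemma br_lin:
 assumes Y: "lin Y"
 shows "br (X + X') Y = br X Y + br X' Y" "br (es P c X) Y = es P c (br X Y)"
  "br Y (X + X') = br Y X + br Y X'" "br Y (es P c X) = es P c (br Y X)"
 unfolding br_sum sum.distrib[symmetric] ES.scale_sum_right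
 by (auto intro!: sum.cong simp: phi_lin[OF fin_G fin_G Y] ES.scale_right_distrib ES.scale_left_commute)

lemma br_closed:
 assumes A: "module.subspace (es P) A" and "\<And>\<sigma> \<tau>. \<sigma> \<in> G ==> \<tau> \<in> G ==> sym_diff \<sigma> \<tau> \<in> G ==> phi P \<sigma> \<tau> X Y \<in> A"
 shows "br X Y \<in> A"
 unfolding br_sum
proof (rule ES.subspace_sum[OF A])
 fix q assume "q \<in> G \<times> G"
 then obtain \<sigma> \<tau> where q: "q = (\<sigma>, \<tau>)" "\<sigma> \<in> G" "\<tau> \<in> G" by blast
 show "(case q of (\<sigma>, \<tau>) => if sym_diff \<sigma> \<tau> \<in> G then es P (\<epsilon> \<sigma> \<tau>) (phi P \<sigma> \<tau> X Y) else 0) \<in> A"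
  using ES.subspace_scale[OF A assms(2)[OF q(2,3)]] ES.subspace_0[OF A] by (simp add: q)
qed

lemma br_eq:
 assumes "\<And>\<sigma> \<tau>. \<sigma> \<in> G ==> \<tau> \<in> G ==> (if sym_diff \<sigma> \<tau> \<in> G then es P (\<epsilon> \<sigma> \<tau>) (phi P \<sigma> \<tau> X Y) else 0) = F \<sigma> \<tau>"
 shows "br X Y = (\<Sum>(\<sigma>, \<tau>)\<in>G \<times> G. F \<sigma> \<tau>)"
 unfolding br_sum by (rule sum.cong) (use assms in auto)

lemma br_single:
 assumes m: "\<sigma> \<in> G" "\<tau> \<in> G" "sym_diff \<sigma> \<tau> \<in> G"
  and "\<And>\<sigma>' \<tau>'. \<sigma>' \<in> G ==> \<tau>' \<in> G ==> (\<sigma>', \<tau>') ~= (\<sigma>, \<tau>) ==> phi P \<sigma>' \<tau>' X Y = 0"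
 shows "br X Y = es P (\<epsilon> \<sigma> \<tau>) (phi P \<sigma> \<tau> X Y)"
proof -
 have "br X Y = (\<Sum>q\<in>G \<times> G. if q = (\<sigma>, \<tau>) then es P (\<epsilon> \<sigma> \<tau>) (phi P \<sigma> \<tau> X Y) else 0)"
  unfolding br_sum
 proof (rule sum.cong[OF refl])
  fix q assume "q \<in> G \<times> G"
  then obtain a b where q: "q = (a, b)" "a \<in> G" "b \<in> G" by blast
  show "(case q of (\<sigma>, \<tau>) => if sym_diff \<sigma> \<tau> \<in> G then es P (\<epsilon> \<sigma> \<tau>) (phi P \<sigma> \<tau> X Y) else 0)
   = (if q = (\<sigma>, \<tau>) then es P (\<epsilon> \<sigma> \<tau>) (phi P \<sigma> \<tau> X Y) else 0)"
   using assms(4)[OF q(2,3)] m(3) by (cases "(a, b) = (\<sigma>, \<tau>)") (simp_all add: q)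
 qed
 then show ?thesis using finG m by simp
qed

lemma br_zero:
 assumes "\<And>\<sigma>' \<tau>'. \<sigma>' \<in> G ==> \<tau>' \<in> G ==> sym_diff \<sigma>' \<tau>' \<in> G ==> phi P \<sigma>' \<tau>' X Y = 0"
 shows "br X Y = 0"
 unfolding br_sum by (rule sum.neutral) (use assms in auto)

lemma es_single: "es P c (0, single \<sigma> x) = (0, single \<sigma> (ts c x))"
 by (simp add: es_def single_def fun_eq_iff ts_def)

lemma es_fst: "es P c (g, 0) = (sps P c g, 0)"
 by (simp add: es_def fun_eq_iff ts_def)

lemma phi_0:
 assumes "\<sigma> \<in> G" "\<tau> \<in> G" "lin X" "lin Y"
  and "\<sigma> ~= {} ==> \<tau> ~= {} ==> snd X \<sigma> = 0 \<or> snd Y \<tau> = 0"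
  and "\<sigma> = {} ==> \<tau> ~= {} ==> fst X = 0 \<or> snd Y \<tau> = 0"
  and "\<sigma> ~= {} ==> \<tau> = {} ==> fst Y = 0 \<or> snd X \<sigma> = 0"
  and "\<sigma> = {} ==> \<tau> = {} ==> fst X = 0 \<or> fst Y = 0"
 shows "phi P \<sigma> \<tau> X Y = 0"
proof -
 have l: "\<And>i. fst X i \<in> sp P" "\<And>i. fst Y i \<in> sp P" using assms(3,4) by (auto simp: lin_def)
 show ?thesis
  using assms(5-8) fin_G[OF assms(1)] fin_G[OF assms(2)]
  by (cases "\<sigma> = {}"; cases "\<tau> = {}") (auto simp: phi_def act_zero l zero_prod_def)
qed

lemma br_hom:
 assumes "\<sigma> \<in> G" "\<sigma> ~= {}" "\<tau> \<in> G" "\<tau> ~= {}"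
 shows "br (0, single \<sigma> x) (0, single \<tau> y) =
  (if \<sigma> = \<tau> then (sps P (\<epsilon> \<sigma> \<sigma>) (diag P \<sigma> x y), 0)
   else if sym_diff \<sigma> \<tau> \<in> G then (0, single (sym_diff \<sigma> \<tau>) (ts (\<epsilon> \<sigma> \<tau>) (contr P \<sigma> \<tau> x y))) else 0)"
proof -
 have z: "phi P \<sigma>' \<tau>' (0, single \<sigma> x) (0, single \<tau> y) = 0" if "\<sigma>' \<in> G" "\<tau>' \<in> G" "(\<sigma>', \<tau>') ~= (\<sigma>, \<tau>)" for \<sigma>' \<tau>'
 proof -
  have "\<sigma>' ~= \<sigma> \<or> \<tau>' ~= \<tau>" using that by blast
  then show ?thesis by (elim disjE) (rule phi_0; simp add: that)+
 qed
 show ?thesis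
 proof (cases "sym_diff \<sigma> \<tau> \<in> G")
  case True
  have "br (0, single \<sigma> x) (0, single \<tau> y) = es P (\<epsilon> \<sigma> \<tau>) (phi P \<sigma> \<tau> (0, single \<sigma> x) (0, single \<tau> y))"
   by (rule br_single) (use assms True z in auto)
  then show ?thesis using assms True by (simp add: phi_def es_single es_fst)
 next
  case False
  then have "\<sigma> ~= \<tau>" using empty_G by auto
  moreover have "br (0, single \<sigma> x) (0, single \<tau> y) = 0"
  proof (rule br_zero)
   fix \<sigma>' \<tau>' assume a: "\<sigma>' \<in> G" "\<tau>' \<in> G" "sym_diff \<sigma>' \<tau>' \<in> G"
   then have "(\<sigma>', \<tau>') ~= (\<sigma>, \<tau>)" using False by auto
   then show "phi P \<sigma>' \<tau>' (0, single \<sigma> x) (0, single \<tau> y) = 0" by (rule z[OF a(1,2)])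
  qed
  ultimately show ?thesis using False by simp
 qed
qed

lemma br_sp_hom:
 assumes "\<tau> \<in> G" "\<tau> ~= {}" and g: "\<And>i. g i \<in> sp P"
 shows "br (g, 0) (0, single \<tau> y) = (0, single \<tau> (act P \<tau> g y))"
  "br (0, single \<tau> y) (g, 0) = (0, single \<tau> (- act P \<tau> g y))"
proof -
 have l: "lin (g, 0)" using g by (simp add: lin_def)
 have "br (g, 0) (0, single \<tau> y) = es P (\<epsilon> {} \<tau>) (phi P {} \<tau> (g, 0) (0, single \<tau> y))"
 proof (rule br_single)
  fix \<sigma>' \<tau>' assume m: "\<sigma>' \<in> G" "\<tau>' \<in> G" "(\<sigma>', \<tau>') ~= ({}, \<tau>)"
  then have "\<sigma>' ~= {} \<or> \<tau>' ~= \<tau>" by blast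
  then show "phi P \<sigma>' \<tau>' (g, 0) (0, single \<tau> y) = 0"
   by (elim disjE) (rule phi_0; simp add: m l)+
 qed (use assms empty_G in auto)
 then show "br (g, 0) (0, single \<tau> y) = (0, single \<tau> (act P \<tau> g y))"
  using assms by (simp add: phi_def eps_empty es_single)
 have "br (0, single \<tau> y) (g, 0) = es P (\<epsilon> \<tau> {}) (phi P \<tau> {} (0, single \<tau> y) (g, 0))"
 proof (rule br_single)
  fix \<sigma>' \<tau>' assume m: "\<sigma>' \<in> G" "\<tau>' \<in> G" "(\<sigma>', \<tau>') ~= (\<tau>, {})"
  then have "\<sigma>' ~= \<tau> \<or> \<tau>' ~= {}" by blast
  then show "phi P \<sigma>' \<tau>' (0, single \<tau> y) (g, 0) = 0"
   by (elim disjE) (rule phi_0; simp add: m l)+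
 qed (use assms empty_G in auto)
 then show "br (0, single \<tau> y) (g, 0) = (0, single \<tau> (- act P \<tau> g y))"
  using assms by (simp add: phi_def eps_empty es_single)
qed

lemma phi_skew:
 assumes m: "\<sigma> \<in> G" "\<tau> \<in> G" "sym_diff \<sigma> \<tau> \<in> G"
  and X: "snd X \<sigma> \<in> tensor_space \<sigma>" and Y: "snd Y \<tau> \<in> tensor_space \<tau>"
 shows "es P (\<epsilon> \<tau> \<sigma>) (phi P \<tau> \<sigma> Y X) = - es P (\<epsilon> \<sigma> \<tau>) (phi P \<sigma> \<tau> X Y)"
proof -
 have sd: "sym_diff \<tau> \<sigma> = sym_diff \<sigma> \<tau>" by auto
 consider "\<sigma> = {}" "\<tau> = {}" | "\<sigma> = {}" "\<tau> ~= {}" | "\<sigma> ~= {}" "\<tau> = {}" | "\<sigma> ~= {}" "\<tau> = \<sigma>" | "\<sigma> ~= {}" "\<tau> ~= {}" "\<sigma> ~= \<tau>"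
  by blast
 then show ?thesis
 proof cases
  case 1
  then show ?thesis using empty_G sp_bracket_skew[of "fst Y" "fst X"] by (simp add: phi_def eps_empty)
 next
  case 4
  then have "diag P \<sigma> (snd Y \<sigma>) (snd X \<sigma>) = - diag P \<sigma> (snd X \<sigma>) (snd Y \<sigma>)"
   using X Y m fin_G card_even by (intro diag_commute) auto
  then show ?thesis using 4 by (simp add: phi_def es_fst)
 next
  case 5
  have "contr P \<tau> \<sigma> (snd Y \<tau>) (snd X \<sigma>) = ts ((- 1) ^ card (\<sigma> \<inter> \<tau>)) (contr P \<sigma> \<tau> (snd X \<sigma>) (snd Y \<tau>))"
   by (rule contr_commute) (use X Y m fin_G in auto)
  then show ?thesis using 5 eps_skew[OF m(1,2) 5 m(3)]
   by (simp add: phi_def es_single sd ts_ts single_uminus)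
 qed (use m in \<open>simp_all add: phi_def eps_empty es_single single_uminus\<close>)
qed

lemma br_skew:
 assumes X: "\<And>\<sigma>. snd X \<sigma> \<in> tensor_space \<sigma>" and Y: "\<And>\<sigma>. snd Y \<sigma> \<in> tensor_space \<sigma>"
 shows "br X Y = - br Y X"
proof -
 have "br Y X = (\<Sum>(\<sigma>, \<tau>)\<in>G \<times> G. if sym_diff \<tau> \<sigma> \<in> G then es P (\<epsilon> \<tau> \<sigma>) (phi P \<tau> \<sigma> Y X) else 0)"
  unfolding br_sum by (rule sum.reindex_bij_witness[of _ prod.swap prod.swap]) auto
 also have "\<dots> = (\<Sum>q\<in>G \<times> G. - (case q of (\<sigma>, \<tau>) => if sym_diff \<sigma> \<tau> \<in> G then es P (\<epsilon> \<sigma> \<tau>) (phi P \<sigma> \<tau> X Y) else 0))"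
 proof (rule sum.cong[OF refl], clarsimp simp del: Un_iff split del: if_split)
  fix \<sigma> \<tau> assume m: "\<sigma> \<in> G" "\<tau> \<in> G"
  have sd: "sym_diff \<tau> \<sigma> = sym_diff \<sigma> \<tau>" by auto
  show "(if sym_diff \<tau> \<sigma> \<in> G then es P (\<epsilon> \<tau> \<sigma>) (phi P \<tau> \<sigma> Y X) else 0) =
   - (if sym_diff \<sigma> \<tau> \<in> G then es P (\<epsilon> \<sigma> \<tau>) (phi P \<sigma> \<tau> X Y) else 0)"
   unfolding sd using phi_skew[OF m _ X Y] by simp
 qed
 finally show ?thesis by (simp only: sum_negf br_sum minus_minus)
qed

end

context sympl begin

lemma tform_commute:
 assumes fin: "finite \<sigma>" and x: "x \<in> tensor_space \<sigma>" "y \<in> tensor_space \<sigma>"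
 shows "tform P \<sigma> y x = (- 1) ^ card \<sigma> * tform P \<sigma> x y"
proof -
 let ?\<Phi> = "%x y. tform P \<sigma> y x - (- 1) ^ card \<sigma> * tform P \<sigma> x y"
 have "?\<Phi> x y = 0"
 proof (rule bilinear_zero[where \<Phi> = ?\<Phi>, OF vs_mult fin fin x])
  show "?\<Phi> (pure P \<sigma> v) (pure P \<sigma> w) = 0" for v w
   unfolding tform_pure[OF P fin] prod_skew[of w v] by simp
 qed (simp_all add: tform_lin algebra_simps)
 then show ?thesis by simp
qed

lemma diag_pure_self:
 assumes "finite \<sigma>" "card \<sigma> \<ge> 2"
 shows "diag P \<sigma> (pure P \<sigma> v) (pure P \<sigma> v) = 0"
proof (intro ext)
 fix i z
 have "(\<Prod>k\<in>\<sigma> - {i}. form P (v k) (v k)) = 0" if "i \<in> \<sigma>"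
 proof -
  have "card (\<sigma> - {i}) ~= 0" using that assms by (simp only: card_Diff_singleton)
  then have "\<sigma> - {i} ~= {}" by force
  then show ?thesis using assms(1) by (auto intro!: prod_zero)
 qed
 then show "diag P \<sigma> (pure P \<sigma> v) (pure P \<sigma> v) i z = 0 i z"
  by (simp add: diag_apply[OF assms(1)])
qed

lemma alg_iff: "X \<in> algebra_space P N S \<longleftrightarrow>
  (\<forall>i. fst X i \<in> (if i \<in> N then sp P else {0})) \<and> snd X \<in> family_space (S - {{}})"
 by (cases X) (simp add: algebra_space_def sp_power_def)

lemma alg_sub: "module.subspace (es P) (algebra_space P N S)"
proof (rule ES.subspaceI)
 note F = FS.subspace_add[OF family_subspace] FS.subspace_scale[OF family_subspace] FS.subspace_0[OF family_subspace]
 have a: "f + g \<in> (if i \<in> N then sp P else {0})" "(%v. scl P c (f v)) \<in> (if i \<in> N then sp P else {0})"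
  if "f \<in> (if i \<in> N then sp P else {0})" "g \<in> (if i \<in> N then sp P else {0})" for i c f g
  using that by (auto simp: fun_eq_iff intro: sp_add sp_scl)
 show "0 \<in> algebra_space P N S" by (simp add: alg_iff F)
 show "X + Y \<in> algebra_space P N S" if "X \<in> algebra_space P N S" "Y \<in> algebra_space P N S" for X Y
  unfolding alg_iff
 proof (intro conjI allI)
  show "fst (X + Y) i \<in> (if i \<in> N then sp P else {0})" for i
   using a(1)[of "fst X i" i "fst Y i"] that unfolding alg_iff by (simp only: fst_add plus_fun_apply)
  show "snd (X + Y) \<in> family_space (S - {{}})" using that unfolding alg_iff snd_add by (blast intro: F)
 qed
 show "es P c X \<in> algebra_space P N S" if "X \<in> algebra_space P N S" for c X
  unfolding alg_iff
 proof (intro conjI allI)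
  show "fst (es P c X) i \<in> (if i \<in> N then sp P else {0})" for i
   using a(2)[of "fst X i" i "fst X i" c] that unfolding alg_iff by (simp only: es_simps sps_def)
  show "snd (es P c X) \<in> family_space (S - {{}})" using that unfolding alg_iff es_simps by (blast intro: F)
 qed
qed

lemma algD:
 assumes "X \<in> algebra_space P N S"
 shows alg_lin: "lin X" and alg_fst: "fst X i \<in> sp P" and alg_fst0: "i ~: N ==> fst X i = 0"
  and alg_snd: "snd X \<sigma> \<in> tensor_space \<sigma>" and alg_snd0: "\<sigma> ~: S ==> snd X \<sigma> = 0"
  and alg_snd_empty: "snd X {} = 0"
proof -
 have "fst X i \<in> (if i \<in> N then sp P else {0})" for i using assms unfolding alg_iff by blast
 then have "(i \<in> N \<longrightarrow> fst X i \<in> sp P) \<and> (i ~: N \<longrightarrow> fst X i = 0)" for i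
  by (metis singletonD)
 then show f: "fst X i \<in> sp P" and "i ~: N ==> fst X i = 0" for i
  using sp_0 by metis+
 then show "lin X" by (simp add: lin_def)
 have "snd X \<in> family_space (S - {{}})" using assms unfolding alg_iff by blast
 then show "snd X \<sigma> \<in> tensor_space \<sigma>" "\<sigma> ~: S ==> snd X \<sigma> = 0" "snd X {} = 0"
  using family_spaceD[of "snd X" "S - {{}}"] by blast+
qed

lemma alg_single: "\<sigma> \<in> S ==> \<sigma> ~= {} ==> x \<in> tensor_space \<sigma> ==> (0, single \<sigma> x) \<in> algebra_space P N S"
 by (simp add: alg_iff single_family)

lemma alg_fst_mem: "(\<And>i. g i \<in> (if i \<in> N then sp P else {0})) ==> (g, 0) \<in> algebra_space P N S"
 by (simp only: alg_iff fst_conv snd_conv FS.subspace_0[OF family_subspace]) blast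

end

context graded begin

lemma phi_in:
 assumes S: "S \<subseteq> G" and cl: "\<And>\<sigma> \<tau>. \<sigma> \<in> S ==> \<tau> \<in> S ==> sym_diff \<sigma> \<tau> \<in> G ==> sym_diff \<sigma> \<tau> \<in> S"
  and N: "\<And>\<sigma>. \<sigma> \<in> S ==> \<sigma> \<subseteq> N"
  and X: "X \<in> algebra_space P N S" and Y: "Y \<in> algebra_space P N S"
  and m: "\<sigma> \<in> G" "\<tau> \<in> G" "sym_diff \<sigma> \<tau> \<in> G"
 shows "phi P \<sigma> \<tau> X Y \<in> algebra_space P N S"
proof (cases "(\<sigma> ~= {} \<and> \<sigma> ~: S) \<or> (\<tau> ~= {} \<and> \<tau> ~: S)")
 case True
 then have "phi P \<sigma> \<tau> X Y = 0"
  using alg_snd0[OF X, of \<sigma>] alg_snd0[OF Y, of \<tau>] alg_lin[OF X] alg_lin[OF Y] m by (intro phi_0) blast+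
 then show ?thesis using ES.subspace_0[OF alg_sub] by simp
next
 case False
 then have S\<sigma>: "\<sigma> = {} \<or> \<sigma> \<in> S" and S\<tau>: "\<tau> = {} \<or> \<tau> \<in> S" by auto
 consider "\<sigma> = {}" "\<tau> = {}" | "\<sigma> = {}" "\<tau> ~= {}" | "\<sigma> ~= {}" "\<tau> = {}" | "\<sigma> ~= {}" "\<tau> = \<sigma>" | "\<sigma> ~= {}" "\<tau> ~= {}" "\<sigma> ~= \<tau>"
  by blast
 then show ?thesis
 proof cases
  case 1
  have "sp_bracket (fst X) (fst Y) i \<in> (if i \<in> N then sp P else {0})" for i
  proof (cases "i \<in> N")
   case True
   then show ?thesis using sp_closed[OF alg_fst[OF X] alg_fst[OF Y], of i i] by (simp add: sp_bracket_def)
  next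
   case False
   then show ?thesis using alg_fst0[OF X False] alg_fst0[OF Y False] by (simp add: sp_bracket_def zero_fun_def)
  qed
  then show ?thesis using 1 alg_fst_mem by (simp add: phi_def)
 next
  case 2
  then show ?thesis using S\<tau> by (auto simp: phi_def intro!: alg_single)
 next
  case 3
  then show ?thesis using S\<sigma> by (auto simp: phi_def intro!: alg_single)
 next
  case 4
  have "diag P \<sigma> (snd X \<sigma>) (snd Y \<sigma>) i \<in> (if i \<in> N then sp P else {0})" for i
   using diag_sp[OF fin_G[OF m(1)] alg_snd[OF X] alg_snd[OF Y], of i] N[of \<sigma>] S\<sigma> 4
   by (cases "i \<in> \<sigma>") (force intro: sp_0 split: if_splits)+
  then show ?thesis using 4 alg_fst_mem by (simp add: phi_def)
 next
  case 5
  then have "sym_diff \<sigma> \<tau> \<in> S" "sym_diff \<sigma> \<tau> ~= {}" using cl m S\<sigma> S\<tau> by blast+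
  then have "(0, single (sym_diff \<sigma> \<tau>) (contr P \<sigma> \<tau> (snd X \<sigma>) (snd Y \<tau>))) \<in> algebra_space P N S"
   by (intro alg_single contr_in)
  moreover have "phi P \<sigma> \<tau> X Y = (0, single (sym_diff \<sigma> \<tau>) (contr P \<sigma> \<tau> (snd X \<sigma>) (snd Y \<tau>)))"
   using 5 by (simp only: phi_def simp_thms if_False)
  ultimately show ?thesis by (simp only:)
 qed
qed

end

text \<open>\<open>S\<close> may be smaller than \<open>G\<close>: then the algebra with index sets
  \<open>S\<close>, such as e7, keeps the bracket and the signs of the ambient algebra. The index
  \<open>k\<close> defines the parity, and \<open>jac\<close> asks for the Jacobi identity in the
  form in which \<open>odd_part\<close> consumes it, odd elements having no sp-component.\<close>

locale graded_odd = graded P G \<epsilon> for P :: "('a::field, 'v::ab_group_add) plane" and G and \<epsilon> :: "nat set => nat set => 'a" +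
 fixes S :: "nat set set" and k :: nat and N :: "nat set"
 assumes S_G: "S \<subseteq> G" and closed: "\<sigma> \<in> S ==> \<tau> \<in> S ==> sym_diff \<sigma> \<tau> \<in> G ==> sym_diff \<sigma> \<tau> \<in> S"
  and S_N: "\<sigma> \<in> S ==> \<sigma> \<subseteq> N" and k_N: "k \<in> N"
  and eps_diag: "\<sigma> \<in> S ==> \<epsilon> \<sigma> \<sigma> ~= 0"
  and ex_odd: "\<exists>\<sigma>\<in>S. k \<in> \<sigma>"
  and jac: "X \<in> algebra_space P N S ==> Y \<in> algebra_space P N S ==> Z \<in> algebra_space P N S ==>
   fst Y = 0 ==> fst Z = 0 ==> br (br X Y) Z + br (br Y Z) X + br (br Z X) Y = 0"
begin

definition "L = algebra_space P N S"
definition "S0 = {\<sigma> \<in> S. k ~: \<sigma>}"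
definition "A = algebra_space P (N - {k}) S0"
definition T :: "(nat set => 'a tensor) set" where "T = family_space ((%\<sigma>. \<sigma> - {k}) ` {\<sigma> \<in> S. k \<in> \<sigma>})"

abbreviation t where "t \<equiv> odd_elt P k"
abbreviation \<iota> :: "('v => 'v) => ('a, 'v) elt" where "\<iota> \<equiv> sp_elt k"

text \<open>The coefficient of \<open>gam P u v\<close> produced by \<open>diag_join\<close>,
  weighted with the sign of the component.\<close>

definition fT :: "(nat set => 'a tensor) => (nat set => 'a tensor) => 'a" where
 "fT x y = (\<Sum>\<sigma>\<in>G. if \<sigma> \<in> S \<and> k \<in> \<sigma> then - (1 / 2) * \<epsilon> \<sigma> \<sigma> * tform P (\<sigma> - {k}) (x (\<sigma> - {k})) (y (\<sigma> - {k})) else 0)"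

text \<open>\<open>dterm\<close> and, below, \<open>aterm\<close> are what a pair of components
  contributes after the factor at \<open>k\<close> has been split off. With them the brackets of odd
  elements can be compared summand by summand over all pairs in \<open>G\<close>.\<close>

definition dterm where
 "dterm x y \<sigma> \<tau> = (if sym_diff \<sigma> \<tau> \<in> G \<and> k \<in> \<sigma> \<and> k \<in> \<tau> then
   es P (\<epsilon> \<sigma> \<tau>) (if \<sigma> = \<tau> then (diag P (\<sigma> - {k}) (x (\<sigma> - {k})) (y (\<sigma> - {k})), 0)
    else (0, single (sym_diff \<sigma> \<tau>) (contr P (\<sigma> - {k}) (\<tau> - {k}) (x (\<sigma> - {k})) (y (\<tau> - {k}))))) else 0)"

definition "dT x y = (\<Sum>(\<sigma>, \<tau>)\<in>G \<times> G. dterm x y \<sigma> \<tau>)"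

definition aterm where
 "aterm D z \<sigma> \<tau> = (if sym_diff \<sigma> \<tau> \<in> G \<and> k ~: \<sigma> \<and> k \<in> \<tau> then
   fs (\<epsilon> \<sigma> \<tau>) (if \<sigma> = {} then single (\<tau> - {k}) (act P (\<tau> - {k}) (fst D) (z (\<tau> - {k})))
    else single (sym_diff \<sigma> \<tau> - {k}) (contr P \<sigma> (\<tau> - {k}) (snd D \<sigma>) (z (\<tau> - {k})))) else 0)"

definition "aT D z = (\<Sum>(\<sigma>, \<tau>)\<in>G \<times> G. aterm D z \<sigma> \<tau>)"

lemma Diff_eq: "k \<in> \<sigma> ==> k \<in> \<tau> ==> \<sigma> - {k} = \<tau> - {k} \<longleftrightarrow> \<sigma> = \<tau>"
 by (metis insert_Diff)

lemma T_mem: assumes "x \<in> T" "k \<in> \<sigma>" shows "x (\<sigma> - {k}) \<in> tensor_space (\<sigma> - {k})" "\<sigma> ~: S ==> x (\<sigma> - {k}) = 0"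
proof -
 show "x (\<sigma> - {k}) \<in> tensor_space (\<sigma> - {k})" using assms family_spaceD(1) unfolding T_def by blast
 assume "\<sigma> ~: S"
 then have "\<sigma> - {k} ~: (%\<sigma>. \<sigma> - {k}) ` {\<sigma> \<in> S. k \<in> \<sigma>}" using Diff_eq[OF assms(2)] by blast
 then show "x (\<sigma> - {k}) = 0" using assms family_spaceD(2) unfolding T_def by blast
qed

lemma T_single: "\<sigma> \<in> S ==> k \<in> \<sigma> ==> x \<in> tensor_space (\<sigma> - {k}) ==> single (\<sigma> - {k}) x \<in> T"
 unfolding T_def by (rule single_family) auto

lemma T_sub: "FS.subspace T" unfolding T_def by (rule family_subspace)

lemma fst_t [simp]: "fst (t x u) = 0" by (simp add: odd_elt_def)
lemma snd_t: "snd (t x u) \<sigma> = (if k \<in> \<sigma> then join P k (x (\<sigma> - {k})) u else 0)" by (simp add: odd_elt_def)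

lemma lin_t [simp]: "lin (t x u)" by (simp add: lin_def)

lemma t_lin: "t (x + y) u = t x u + t y u" "t (fs c x) u = es P c (t x u)"
 "t x (u + v) = t x u + t x v" "t x (scl P c u) = es P c (t x u)"
 by (simp_all add: prod_eq_iff fun_eq_iff[of "snd _"] snd_t join_lin fs_apply)

lemma t_zero: "t 0 u = 0"
 by (simp add: prod_eq_iff fun_eq_iff[of "snd _"] snd_t)

lemma t_sum: "t (\<Sum>i\<in>I. F i) u = (\<Sum>i\<in>I. t (F i) u)"
 by (induction I rule: infinite_finite_induct) (simp_all only: sum.infinite sum.empty sum.insert t_zero t_lin not_False_eq_True)

lemma t_single: "k \<in> \<tau> ==> t (single (\<tau> - {k}) w) u = (0, single \<tau> (join P k w u))"
proof -
 assume k: "k \<in> \<tau>"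
 have "snd (t (single (\<tau> - {k}) w) u) \<sigma> = single \<tau> (join P k w u) \<sigma>" for \<sigma>
  using Diff_eq[OF _ k, of \<sigma>] k by (cases "k \<in> \<sigma>") (auto simp: snd_t single_def simp del: Diff_eq_empty_iff)
 then show ?thesis by (simp add: prod_eq_iff fun_eq_iff[of "snd _"])
qed

lemma A_0: "D \<in> A ==> k \<in> \<sigma> ==> snd D \<sigma> = 0" "D \<in> A ==> fst D k = 0"
 unfolding A_def by (simp_all add: alg_snd0 alg_fst0 S0_def)

text \<open>Elements of \<open>A\<close> have no factor and no sp-component at \<open>k\<close>, so
  action and contraction commute with \<open>join\<close> at \<open>k\<close>. Pairs of components
  outside \<open>S\<close> contribute 0 because the coordinates vanish there.\<close>

lemma A_T:
 assumes D: "D \<in> A" and z: "z \<in> T"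
 shows "aT D z \<in> T" "br D (t z u) = t (aT D z) u"
proof -
 note D' = D[unfolded A_def]
 have "aterm D z \<sigma> \<tau> \<in> T" if m: "\<sigma> \<in> G" "\<tau> \<in> G" for \<sigma> \<tau>
 proof (cases "sym_diff \<sigma> \<tau> \<in> G \<and> k ~: \<sigma> \<and> k \<in> \<tau> \<and> \<tau> \<in> S \<and> (\<sigma> = {} \<or> \<sigma> \<in> S)")
  case True
  then have "sym_diff \<sigma> \<tau> \<in> S" "k \<in> sym_diff \<sigma> \<tau>" using closed by auto
  moreover have "contr P \<sigma> (\<tau> - {k}) (snd D \<sigma>) (z (\<tau> - {k})) \<in> tensor_space (sym_diff \<sigma> \<tau> - {k})"
   using contr_in[of P \<sigma> "\<tau> - {k}"] sd_Diff(2)[of k \<sigma> \<tau>] True by simp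
  ultimately show ?thesis using True unfolding aterm_def
   by (auto intro!: FS.subspace_scale[OF T_sub] T_single simp del: Un_iff)
 next
  case False
  have "aterm D z \<sigma> \<tau> = 0"
  proof (cases "sym_diff \<sigma> \<tau> \<in> G \<and> k ~: \<sigma> \<and> k \<in> \<tau>")
   case True
   then have "\<tau> ~: S \<or> (\<sigma> ~= {} \<and> \<sigma> ~: S)" using False by blast
   then have "z (\<tau> - {k}) = 0 \<or> (\<sigma> ~= {} \<and> snd D \<sigma> = 0)"
    using T_mem(2)[OF z] alg_snd0[OF D'] True by (auto simp: S0_def)
   then show ?thesis by (auto simp: aterm_def)
  qed (simp only: aterm_def if_False)
  then show ?thesis using FS.subspace_0[OF T_sub] by (simp only:)
 qed
 then show "aT D z \<in> T" unfolding aT_def by (intro FS.subspace_sum[OF T_sub]) auto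
 show "br D (t z u) = t (aT D z) u"
  unfolding aT_def t_sum case_prod_beta[of aterm] unfolding case_prod_beta'
 proof (subst br_eq[where F = "%\<sigma> \<tau>. t (aterm D z \<sigma> \<tau>) u"])
  fix \<sigma> \<tau> assume m: "\<sigma> \<in> G" "\<tau> \<in> G"
  show "(if sym_diff \<sigma> \<tau> \<in> G then es P (\<epsilon> \<sigma> \<tau>) (phi P \<sigma> \<tau> D (t z u)) else 0) = t (aterm D z \<sigma> \<tau>) u"
  proof (cases "sym_diff \<sigma> \<tau> \<in> G \<and> k ~: \<sigma> \<and> k \<in> \<tau>")
   case False
   have "phi P \<sigma> \<tau> D (t z u) = 0" if "sym_diff \<sigma> \<tau> \<in> G"
    by (rule phi_0) (use that False m alg_lin[OF D'] A_0(1)[OF D, of \<sigma>] in \<open>auto simp: snd_t\<close>)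
   then show ?thesis using False by (auto simp: aterm_def t_zero)
  next
   case True
   then have kt: "k \<in> \<tau>" "k ~: \<sigma>" "\<tau> ~= {}" by auto
   have z': "z (\<tau> - {k}) \<in> tensor_space (\<tau> - {k})" by (rule T_mem[OF z kt(1)])
   show ?thesis
   proof (cases "\<sigma> = {}")
    case s: True
    have "act P \<tau> (fst D) (join P k (z (\<tau> - {k})) u) = join P k (act P (\<tau> - {k}) (fst D) (z (\<tau> - {k}))) u"
     using act_join[OF fin_G[OF m(2)] kt(1) _ z', of "fst D" u] alg_fst[OF D'] A_0(2)[OF D] by simp
    then show ?thesis
     using True s kt by (simp add: aterm_def phi_def snd_t fs_single t_single es_single join_lin)
   next
    case s: False
    have "contr P \<sigma> \<tau> (snd D \<sigma>) (join P k (z (\<tau> - {k})) u) = join P k (contr P \<sigma> (\<tau> - {k}) (snd D \<sigma>) (z (\<tau> - {k}))) u"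
     by (rule contr_join_right[OF fin_G[OF m(1)] fin_G[OF m(2)] kt(2,1) alg_snd[OF D'] z'])
    moreover have "k \<in> sym_diff \<sigma> \<tau>" "\<sigma> ~= \<tau>" using kt by auto
    ultimately show ?thesis
     using True s kt by (simp add: aterm_def phi_def snd_t fs_single t_single es_single join_lin del: Un_iff)
   qed
  qed
 qed (simp add: case_prod_beta')
qed

lemma T_T:
 assumes x: "x \<in> T" and y: "y \<in> T"
 shows "dT x y \<in> A" "br (t x u) (t y v) = es P (form P u v) (dT x y) + es P (fT x y) (\<iota> (gam P u v))"
proof -
 have sub: "ES.subspace A" unfolding A_def by (rule alg_sub)
 have "dterm x y \<sigma> \<tau> \<in> A" if m: "\<sigma> \<in> G" "\<tau> \<in> G" for \<sigma> \<tau>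
 proof (cases "sym_diff \<sigma> \<tau> \<in> G \<and> k \<in> \<sigma> \<and> k \<in> \<tau> \<and> \<sigma> \<in> S \<and> \<tau> \<in> S")
  case True
  have d: "(diag P (\<sigma> - {k}) (x (\<sigma> - {k})) (y (\<sigma> - {k})), 0) \<in> A"
  proof -
   have f: "finite (\<sigma> - {k})" using fin_G[OF m(1)] by simp
   have "diag P (\<sigma> - {k}) (x (\<sigma> - {k})) (y (\<sigma> - {k})) i \<in> (if i \<in> N - {k} then sp P else {0})" for i
    using diag_sp[OF f T_mem(1)[OF x] T_mem(1)[OF y], of i] True S_N[of \<sigma>]
    by (cases "i \<in> \<sigma> - {k}") (force intro: sp_0 split: if_splits)+
   then show ?thesis unfolding A_def by (rule alg_fst_mem)
  qed
  have c: "(0, single (sym_diff \<sigma> \<tau>) (contr P (\<sigma> - {k}) (\<tau> - {k}) (x (\<sigma> - {k})) (y (\<tau> - {k})))) \<in> A" if "\<sigma> ~= \<tau>"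
  proof -
   have "sym_diff \<sigma> \<tau> \<in> S0" "sym_diff \<sigma> \<tau> ~= {}" using closed True that unfolding S0_def by blast+
   then show ?thesis unfolding A_def
    using contr_in[of P "\<sigma> - {k}" "\<tau> - {k}"] sd_Diff(1)[of k \<sigma> \<tau>] True by (intro alg_single) simp_all
  qed
  show ?thesis unfolding dterm_def using True c d
   by (auto intro!: ES.subspace_scale[OF sub] simp del: Un_iff)
 next
  case False
  have "dterm x y \<sigma> \<tau> = 0"
  proof (cases "sym_diff \<sigma> \<tau> \<in> G \<and> k \<in> \<sigma> \<and> k \<in> \<tau>")
   case True
   then have "x (\<sigma> - {k}) = 0 \<or> y (\<tau> - {k}) = 0"
    using False T_mem(2)[OF x] T_mem(2)[OF y] by blast
   then show ?thesis by (auto simp: dterm_def zero_prod_def[symmetric])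
  qed (simp only: dterm_def if_False)
  then show ?thesis using ES.subspace_0[OF sub] by (simp only:)
 qed
 then show "dT x y \<in> A" unfolding dT_def by (intro ES.subspace_sum[OF sub]) auto
 \<comment> \<open>The single sum \<open>fT\<close> is spread over all pairs, with zeros off the
   diagonal, so that it can be added to the double sum \<open>dT\<close> termwise.\<close>
 define fterm where "fterm \<sigma> \<tau> = (if \<sigma> = \<tau> then (if \<sigma> \<in> S \<and> k \<in> \<sigma> then - (1 / 2) * \<epsilon> \<sigma> \<sigma> * tform P (\<sigma> - {k}) (x (\<sigma> - {k})) (y (\<sigma> - {k})) else 0) else 0)" for \<sigma> \<tau>
 have f: "fT x y = (\<Sum>(\<sigma>, \<tau>)\<in>G \<times> G. fterm \<sigma> \<tau>)"
 proof -
  have "(\<Sum>(\<sigma>, \<tau>)\<in>G \<times> G. fterm \<sigma> \<tau>) = (\<Sum>\<sigma>\<in>G. \<Sum>\<tau>\<in>G. fterm \<sigma> \<tau>)" by (rule sum.cartesian_product[symmetric])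
  also have "\<dots> = fT x y" unfolding fT_def fterm_def using finG by (intro sum.cong) simp_all
  finally show ?thesis ..
 qed
 have "br (t x u) (t y v) = (\<Sum>(\<sigma>, \<tau>)\<in>G \<times> G. es P (form P u v) (dterm x y \<sigma> \<tau>) + es P (fterm \<sigma> \<tau>) (\<iota> (gam P u v)))"
 proof (rule br_eq)
  fix \<sigma> \<tau> assume m: "\<sigma> \<in> G" "\<tau> \<in> G"
  show "(if sym_diff \<sigma> \<tau> \<in> G then es P (\<epsilon> \<sigma> \<tau>) (phi P \<sigma> \<tau> (t x u) (t y v)) else 0) =
   es P (form P u v) (dterm x y \<sigma> \<tau>) + es P (fterm \<sigma> \<tau>) (\<iota> (gam P u v))"
  proof (cases "sym_diff \<sigma> \<tau> \<in> G \<and> k \<in> \<sigma> \<and> k \<in> \<tau>")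
   case False
   have "phi P \<sigma> \<tau> (t x u) (t y v) = 0" if "sym_diff \<sigma> \<tau> \<in> G"
    by (rule phi_0) (use that False m in \<open>auto simp: snd_t\<close>)
   moreover have "fterm \<sigma> \<tau> = 0" using False empty_G by (auto simp: fterm_def)
   ultimately show ?thesis using False by (auto simp: dterm_def)
  next
   case True
   then have ne: "\<sigma> ~= {}" "\<tau> ~= {}" by auto
   have x': "x (\<sigma> - {k}) \<in> tensor_space (\<sigma> - {k})" and y': "y (\<tau> - {k}) \<in> tensor_space (\<tau> - {k})"
    using T_mem(1) x y True by auto
   show ?thesis
   proof (cases "\<sigma> = \<tau>")
    case st: True
    have "fterm \<sigma> \<sigma> = - (1 / 2) * \<epsilon> \<sigma> \<sigma> * tform P (\<sigma> - {k}) (x (\<sigma> - {k})) (y (\<sigma> - {k}))"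
     using True T_mem(2)[OF x, of \<sigma>] by (auto simp: fterm_def)
    moreover have "diag P \<sigma> (join P k (x (\<sigma> - {k})) u) (join P k (y (\<sigma> - {k})) v) = sps P (form P u v) (diag P (\<sigma> - {k}) (x (\<sigma> - {k})) (y (\<sigma> - {k})))
     + sps P (- (1 / 2) * tform P (\<sigma> - {k}) (x (\<sigma> - {k})) (y (\<sigma> - {k}))) (nu k (gam P u v))"
     by (rule diag_join) (use fin_G m True st x' y' in auto)
    ultimately show ?thesis
     using True st ne by (simp add: dterm_def phi_def snd_t es_fst sp_elt_def SPS.scale_right_diff_distrib mult_ac)
   next
    case st: False
    then have "contr P \<sigma> \<tau> (join P k (x (\<sigma> - {k})) u) (join P k (y (\<tau> - {k})) v) = ts (form P u v) (contr P (\<sigma> - {k}) (\<tau> - {k}) (x (\<sigma> - {k})) (y (\<tau> - {k})))"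
     by (intro contr_join) (use fin_G m True x' y' in auto)
    then show ?thesis
     using True st ne by (simp add: dterm_def phi_def snd_t es_single fterm_def mult_ac del: Un_iff)
   qed
  qed
 qed
 also have "\<dots> = es P (form P u v) (dT x y) + es P (fT x y) (\<iota> (gam P u v))"
  unfolding f dT_def by (simp add: case_prod_beta' sum.distrib ES.scale_sum_right ES.scale_sum_left)
 finally show "br (t x u) (t y v) = es P (form P u v) (dT x y) + es P (fT x y) (\<iota> (gam P u v))" .
qed

lemma iota_fst: "\<iota> g = (nu k g, 0)" by (simp add: sp_elt_def)

lemma nu_sp: "g \<in> sp P ==> nu k g i \<in> sp P" by (simp add: nu_def)

lemma lin_iota: "g \<in> sp P ==> lin (\<iota> g)"
 by (simp add: lin_def iota_fst nu_sp)

lemma iota_lin: "\<iota> (g + h) = \<iota> g + \<iota> h" "\<iota> (%v. scl P c (g v)) = es P c (\<iota> g)"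
 by (simp_all add: iota_fst nu_lin es_fst)

lemma iota_inj: "\<iota> g = 0 ==> g = 0"
proof -
 assume "\<iota> g = 0"
 then have "nu k g k = 0" by (simp add: iota_fst zero_prod_def)
 then show ?thesis by (simp add: nu_def)
qed

lemma t_inj:
 assumes x: "x \<in> T" and y: "y \<in> T" and eq: "t x b0 + t y b1 = 0"
 shows "x = 0 \<and> y = 0"
proof -
 have e: "x (\<sigma> - {k}) (\<kappa> - {k}) * (if k \<in> \<kappa> then 0 else 1) + y (\<sigma> - {k}) (\<kappa> - {k}) * (if k \<in> \<kappa> then 1 else 0) = 0" if "k \<in> \<sigma>" for \<sigma> \<kappa>
 proof -
  have "snd (t x b0 + t y b1) \<sigma> \<kappa> = 0" by (simp add: eq)
  then show ?thesis using that by (cases "k \<in> \<kappa>") (simp_all add: snd_t join_def)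
 qed
 have z: "x \<rho> \<kappa> = 0 \<and> y \<rho> \<kappa> = 0" for \<rho> \<kappa>
 proof (cases "\<rho> \<in> (%\<sigma>. \<sigma> - {k}) ` {\<sigma> \<in> S. k \<in> \<sigma>}")
  case False
  then have "x \<rho> = 0" "y \<rho> = 0"
   using family_spaceD(2)[OF x[unfolded T_def]] family_spaceD(2)[OF y[unfolded T_def]] by blast+
  then show ?thesis by simp
 next
  case True
  then obtain \<sigma> where s: "\<rho> = \<sigma> - {k}" "k \<in> \<sigma>" by blast
  show ?thesis
  proof (cases "k \<in> \<kappa>")
   case True
   then have "\<not> \<kappa> \<subseteq> \<sigma> - {k}" by blast
   then show ?thesis using T_mem(1)[OF x s(2)] T_mem(1)[OF y s(2)] by (simp add: s tensor_zero)
  next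
   case False
   then have "insert k \<kappa> - {k} = \<kappa>" "\<kappa> - {k} = \<kappa>" by auto
   then show ?thesis using e[OF s(2), of \<kappa>] e[OF s(2), of "insert k \<kappa>"] False by (simp add: s)
  qed
 qed
 then show ?thesis by (simp add: fun_eq_iff)
qed

lemma t_L: assumes x: "x \<in> T" shows "t x u \<in> L"
 unfolding L_def alg_iff
proof (intro conjI allI)
 show "fst (t x u) i \<in> (if i \<in> N then sp P else {0})" for i by simp
 show "snd (t x u) \<in> family_space (S - {{}})"
 proof (rule family_spaceI)
  show "snd (t x u) \<sigma> \<in> tensor_space \<sigma>" for \<sigma>
   using T_mem(1)[OF x, of \<sigma>] by (simp add: snd_t join_in)
  show "snd (t x u) \<sigma> = 0" if "\<sigma> ~: S - {{}}" for \<sigma>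
   using T_mem(2)[OF x, of \<sigma>] that by (auto simp: snd_t)
 qed
qed

lemma iota_L: "g \<in> sp P ==> \<iota> g \<in> L"
 unfolding L_def iota_fst by (rule alg_fst_mem) (auto simp: nu_def k_N)

lemma A_L: "D \<in> A ==> D \<in> L"
 unfolding L_def A_def alg_iff
 by (auto intro!: family_spaceI simp: family_spaceD S0_def split: if_splits)

lemma L_eq: "L = {p + \<iota> g + (t x b0 + t y b1) | p g x y. p \<in> A \<and> g \<in> sp P \<and> x \<in> T \<and> y \<in> T}"
proof (intro equalityI subsetI)
 fix X assume "X \<in> {p + \<iota> g + (t x b0 + t y b1) | p g x y. p \<in> A \<and> g \<in> sp P \<and> x \<in> T \<and> y \<in> T}"
 then obtain p g x y where X: "X = p + \<iota> g + (t x b0 + t y b1)" "p \<in> A" "g \<in> sp P" "x \<in> T" "y \<in> T" by blast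
 have L: "ES.subspace L" unfolding L_def by (rule alg_sub)
 show "X \<in> L" unfolding X(1) by (intro ES.subspace_add[OF L] A_L iota_L t_L X)
next
 fix X assume "X \<in> L"
 note XL = this[unfolded L_def]
 \<comment> \<open>The even part outside index \<open>k\<close> is obtained by erasing everything at
   \<open>k\<close>. In a component containing \<open>k\<close>, coordinates at subsets without
   \<open>k\<close> belong to the factor b0 and go to \<open>x\<close>, those at subsets with
   \<open>k\<close> belong to b1 and go to \<open>y\<close>.\<close>
 define p where "p = ((fst X)(k := 0), %\<sigma>. if k \<in> \<sigma> then 0 else snd X \<sigma>)"
 define x where "x \<rho> = (if k ~: \<rho> then (%\<kappa>. if k \<in> \<kappa> then 0 else snd X (insert k \<rho>) \<kappa>) else 0)" for \<rho>
 define y where "y \<rho> = (if k ~: \<rho> then (%\<kappa>. if k \<in> \<kappa> then 0 else snd X (insert k \<rho>) (insert k \<kappa>)) else 0)" for \<rho>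
 have ten: "snd X \<sigma> \<kappa> = 0" if "\<not> \<kappa> \<subseteq> \<sigma>" for \<sigma> \<kappa>
  using tensor_zero[OF alg_snd[OF XL] that] .
 have out: "snd X (insert k \<rho>) = 0" if "k ~: \<rho>" "\<rho> ~: (%\<sigma>. \<sigma> - {k}) ` {\<sigma> \<in> S. k \<in> \<sigma>}" for \<rho>
 proof -
  have "\<rho> = insert k \<rho> - {k}" using that(1) by auto
  then have "insert k \<rho> ~: S" using that(2) by blast
  then show ?thesis by (rule alg_snd0[OF XL])
 qed
 have xT: "x \<in> T"
  unfolding T_def
 proof (rule family_spaceI)
  show "x \<rho> \<in> tensor_space \<rho>" for \<rho>
  proof -
   have "x \<rho> \<kappa> = 0" if "\<not> \<kappa> \<subseteq> \<rho>" for \<kappa>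
    using that ten[of \<kappa> "insert k \<rho>"] by (cases "k \<in> \<kappa>") (auto simp: x_def subset_insert)
   then show ?thesis by (simp add: tensor_space_def)
  qed
  show "x \<rho> = 0" if "\<rho> ~: (%\<sigma>. \<sigma> - {k}) ` {\<sigma> \<in> S. k \<in> \<sigma>}" for \<rho>
   using out[OF _ that] by (auto simp: x_def fun_eq_iff)
 qed
 have yT: "y \<in> T"
  unfolding T_def
 proof (rule family_spaceI)
  show "y \<rho> \<in> tensor_space \<rho>" for \<rho>
  proof -
   have "y \<rho> \<kappa> = 0" if "\<not> \<kappa> \<subseteq> \<rho>" for \<kappa>
    using that ten[of "insert k \<kappa>" "insert k \<rho>"] by (cases "k \<in> \<kappa>") (auto simp: y_def subset_insert)
   then show ?thesis by (simp add: tensor_space_def)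
  qed
  show "y \<rho> = 0" if "\<rho> ~: (%\<sigma>. \<sigma> - {k}) ` {\<sigma> \<in> S. k \<in> \<sigma>}" for \<rho>
   using out[OF _ that] by (auto simp: y_def fun_eq_iff)
 qed
 have pA: "p \<in> A"
  unfolding A_def alg_iff p_def fst_conv snd_conv
 proof (intro conjI allI family_spaceI)
  show "((fst X)(k := 0)) i \<in> (if i \<in> N - {k} then sp P else {0})" for i
   using alg_fst[OF XL, of i] alg_fst0[OF XL, of i] by auto
  show "(if k \<in> \<sigma> then 0 else snd X \<sigma>) \<in> tensor_space \<sigma>" for \<sigma>
   using alg_snd[OF XL] by simp
  show "(if k \<in> \<sigma> then 0 else snd X \<sigma>) = 0" if "\<sigma> ~: S0 - {{}}" for \<sigma>
   using that alg_snd0[OF XL, of \<sigma>] alg_snd_empty[OF XL] by (auto simp: S0_def)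
 qed
 have "X = p + \<iota> (fst X k) + (t x b0 + t y b1)"
 proof (rule prod_eqI)
  show "fst X = fst (p + \<iota> (fst X k) + (t x b0 + t y b1))"
   by (auto simp: p_def iota_fst nu_def fun_eq_iff)
  show "snd X = snd (p + \<iota> (fst X k) + (t x b0 + t y b1))"
  proof (intro ext)
   fix \<sigma> \<kappa>
   have "insert k (\<sigma> - {k}) = \<sigma>" if "k \<in> \<sigma>" using that by auto
   moreover have "insert k (\<kappa> - {k}) = \<kappa>" if "k \<in> \<kappa>" using that by auto
   ultimately show "snd X \<sigma> \<kappa> = snd (p + \<iota> (fst X k) + (t x b0 + t y b1)) \<sigma> \<kappa>"
    by (cases "k \<in> \<sigma>"; cases "k \<in> \<kappa>") (simp_all add: p_def iota_fst snd_t join_def x_def y_def)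
  qed
 qed
 then show "X \<in> {p + \<iota> g + (t x b0 + t y b1) | p g x y. p \<in> A \<and> g \<in> sp P \<and> x \<in> T \<and> y \<in> T}"
  using pA xT yT alg_fst[OF XL] by blast
qed

lemma L_direct:
 assumes "p \<in> A" "g \<in> sp P" "x \<in> T" "y \<in> T" and eq: "p + \<iota> g = t x b0 + t y b1"
 shows "p + \<iota> g = 0"
proof (rule prod_eqI)
 have "fst (p + \<iota> g) = fst (t x b0 + t y b1)" by (rule arg_cong[OF eq])
 then show "fst (p + \<iota> g) = fst 0" by simp
 show "snd (p + \<iota> g) = snd 0"
 proof
  fix \<sigma>
  show "snd (p + \<iota> g) \<sigma> = snd 0 \<sigma>"
  proof (cases "k \<in> \<sigma>")
   case True
   then show ?thesis using A_0(1)[OF assms(1)] by (simp add: iota_fst)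
  next
   case False
   then show ?thesis unfolding eq by (simp add: snd_t)
  qed
 qed
qed

lemma A_closed: "D \<in> A ==> E \<in> A ==> br D E \<in> A"
 unfolding A_def
proof (rule br_closed[OF alg_sub], rule phi_in)
 show "S0 \<subseteq> G" using S_G by (auto simp: S0_def)
 show "sym_diff \<sigma> \<tau> \<in> S0" if "\<sigma> \<in> S0" "\<tau> \<in> S0" "sym_diff \<sigma> \<tau> \<in> G" for \<sigma> \<tau>
  using that closed[of \<sigma> \<tau>] by (simp add: S0_def)
 show "\<sigma> \<subseteq> N - {k}" if "\<sigma> \<in> S0" for \<sigma> using that S_N by (auto simp: S0_def)
qed auto

lemma A_sp:
 assumes D: "D \<in> A" and g: "g \<in> sp P"
 shows "br D (\<iota> g) = 0"
proof (rule br_zero)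
 fix \<sigma> \<tau> assume m: "\<sigma> \<in> G" "\<tau> \<in> G"
 note D' = D[unfolded A_def]
 consider "\<tau> ~= {}" | "\<tau> = {}" "\<sigma> = {}" | "\<tau> = {}" "\<sigma> ~= {}" by blast
 then show "phi P \<sigma> \<tau> D (\<iota> g) = 0"
 proof cases
  case 1
  show ?thesis by (rule phi_0) (use 1 m alg_lin[OF D'] lin_iota[OF g] in \<open>auto simp: iota_fst\<close>)
 next
  case 2
  have "sp_bracket (fst D) (nu k g) = 0"
   using A_0(2)[OF D] sp_map_0[OF alg_fst[OF D']] sp_map_0[OF g] by (auto simp: sp_bracket_def nu_def fun_eq_iff)
  then show ?thesis using 2 by (simp add: phi_def iota_fst zero_prod_def)
 next
  case 3
  have "act P \<sigma> (nu k g) (snd D \<sigma>) = 0"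
  proof (cases "k \<in> \<sigma>")
   case False
   then show ?thesis using fin_G[OF m(1)] by (intro act_zero) (auto simp: nu_def)
  qed (simp add: A_0(1)[OF D])
  then show ?thesis using 3 by (simp add: phi_def iota_fst zero_prod_def)
 qed
qed

lemma sp_sp:
 assumes g: "g \<in> sp P" and h: "h \<in> sp P"
 shows "br (\<iota> g) (\<iota> h) = \<iota> (%v. g (h v) - h (g v))"
proof -
 have "br (\<iota> g) (\<iota> h) = es P (\<epsilon> {} {}) (phi P {} {} (\<iota> g) (\<iota> h))"
 proof (rule br_single)
  fix \<sigma> \<tau> assume m: "\<sigma> \<in> G" "\<tau> \<in> G" "(\<sigma>, \<tau>) ~= ({}, {})"
  then have "\<sigma> ~= {} \<or> \<tau> ~= {}" by blast
  then show "phi P \<sigma> \<tau> (\<iota> g) (\<iota> h) = 0"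
   by (intro phi_0) (use m lin_iota g h in \<open>auto simp: iota_fst\<close>)
 qed (use empty_G in auto)
 also have "\<dots> = (sp_bracket (nu k g) (nu k h), 0)"
  using empty_G by (simp add: eps_empty phi_def iota_fst)
 also have "\<dots> = \<iota> (%v. g (h v) - h (g v))"
  unfolding iota_fst by (auto simp: sp_bracket_def nu_def fun_eq_iff)
 finally show ?thesis .
qed

lemma sp_T:
 assumes g: "g \<in> sp P" and z: "z \<in> T"
 shows "br (\<iota> g) (t z u) = t z (g u)"
proof -
 have "br (\<iota> g) (t z u) = (\<Sum>(\<sigma>, \<tau>)\<in>G \<times> G. if \<sigma> = {} then (0, single \<tau> (snd (t z (g u)) \<tau>)) else 0)"
 proof (rule br_eq)
  fix \<sigma> \<tau> assume m: "\<sigma> \<in> G" "\<tau> \<in> G"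
  show "(if sym_diff \<sigma> \<tau> \<in> G then es P (\<epsilon> \<sigma> \<tau>) (phi P \<sigma> \<tau> (\<iota> g) (t z u)) else 0)
   = (if \<sigma> = {} then (0, single \<tau> (snd (t z (g u)) \<tau>)) else 0)"
  proof (cases "\<sigma> = {} \<and> k \<in> \<tau>")
   case True
   have "act P \<tau> (nu k g) (join P k (z (\<tau> - {k})) u) = join P k (act P (\<tau> - {k}) (nu k g) (z (\<tau> - {k}))) u + join P k (z (\<tau> - {k})) (nu k g k u)"
    by (rule act_join) (use True fin_G m nu_sp g T_mem[OF z] in auto)
   moreover have "act P (\<tau> - {k}) (nu k g) (z (\<tau> - {k})) = 0"
    by (rule act_zero) (use fin_G m in \<open>auto simp: nu_def\<close>)
   ultimately have "act P \<tau> (nu k g) (join P k (z (\<tau> - {k})) u) = join P k (z (\<tau> - {k})) (nu k g k u)"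
    by (simp only: join_0 add_0)
   then show ?thesis using True m by (auto simp: phi_def iota_fst snd_t eps_empty es_single nu_def)
  next
   case False
   have "phi P \<sigma> \<tau> (\<iota> g) (t z u) = 0"
    by (rule phi_0) (use False m lin_iota[OF g] in \<open>auto simp: iota_fst snd_t\<close>)
   moreover have "\<sigma> = {} ==> snd (t z (g u)) \<tau> = 0" using False by (auto simp: snd_t)
   moreover have "(0 :: nat => 'v => 'v, single \<tau> (0 :: 'a tensor)) = 0" by (simp add: zero_prod_def)
   ultimately show ?thesis by (cases "\<sigma> = {}") simp_all
  qed
 qed
 also have "\<dots> = (\<Sum>\<sigma>\<in>G. if \<sigma> = {} then (\<Sum>\<tau>\<in>G. (0, single \<tau> (snd (t z (g u)) \<tau>))) else 0)"
  unfolding sum.cartesian_product[symmetric] by (intro sum.cong) auto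
 also have "\<dots> = (\<Sum>\<tau>\<in>G. (0, single \<tau> (snd (t z (g u)) \<tau>)))"
  using finG empty_G by simp
 also have "\<dots> = t z (g u)"
 proof (rule prod_eqI)
  have "fst (\<Sum>\<tau>\<in>G. (0, single \<tau> (snd (t z (g u)) \<tau>))) = (\<Sum>\<tau>\<in>G. 0 :: nat => 'v => 'v)"
   unfolding fst_sum by simp
  then show "fst (\<Sum>\<tau>\<in>G. (0, single \<tau> (snd (t z (g u)) \<tau>))) = fst (t z (g u))" by simp
  show "snd (\<Sum>\<tau>\<in>G. (0 :: nat => 'v => 'v, single \<tau> (snd (t z (g u)) \<tau>))) = snd (t z (g u))"
  proof
   fix \<rho>
   have "snd (\<Sum>\<tau>\<in>G. (0 :: nat => 'v => 'v, single \<tau> (snd (t z (g u)) \<tau>))) \<rho> = (\<Sum>\<tau>\<in>G. if \<rho> = \<tau> then snd (t z (g u)) \<rho> else 0)"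
   proof -
    have "snd (\<Sum>\<tau>\<in>G. (0 :: nat => 'v => 'v, single \<tau> (snd (t z (g u)) \<tau>))) \<rho> = (\<Sum>\<tau>\<in>G. single \<tau> (snd (t z (g u)) \<tau>) \<rho>)"
     by (simp only: snd_sum snd_conv) (rule sum_apply)
    also have "\<dots> = (\<Sum>\<tau>\<in>G. if \<rho> = \<tau> then snd (t z (g u)) \<rho> else 0)"
     by (rule sum.cong) (auto simp: single_def)
    finally show ?thesis .
   qed
   also have "\<dots> = snd (t z (g u)) \<rho>"
    using finG alg_snd0[OF t_L[OF z, unfolded L_def], of \<rho> "g u"] S_G by auto
   finally show "snd (\<Sum>\<tau>\<in>G. (0 :: nat => 'v => 'v, single \<tau> (snd (t z (g u)) \<tau>))) \<rho> = snd (t z (g u)) \<rho>" .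
  qed
 qed
 finally show ?thesis .
qed

lemma fT_single:
 assumes s: "\<sigma> \<in> S" "k \<in> \<sigma>"
 shows "fT (single (\<sigma> - {k}) w) x = - (1 / 2) * \<epsilon> \<sigma> \<sigma> * tform P (\<sigma> - {k}) w (x (\<sigma> - {k}))"
  "fT x (single (\<sigma> - {k}) w) = - (1 / 2) * \<epsilon> \<sigma> \<sigma> * tform P (\<sigma> - {k}) (x (\<sigma> - {k})) w"
proof -
 let ?c = "- (1 / 2) * \<epsilon> \<sigma> \<sigma> * tform P (\<sigma> - {k}) w (x (\<sigma> - {k}))"
 let ?c' = "- (1 / 2) * \<epsilon> \<sigma> \<sigma> * tform P (\<sigma> - {k}) (x (\<sigma> - {k})) w"
 have z: "single (\<sigma> - {k}) w (\<rho> - {k}) = (if \<rho> = \<sigma> then w else 0)" if "k \<in> \<rho>" for \<rho>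
  using Diff_eq[OF that s(2)] by (simp add: single_def)
 have "fT (single (\<sigma> - {k}) w) x = (\<Sum>\<rho>\<in>G. if \<rho> = \<sigma> then ?c else 0)"
  unfolding fT_def by (rule sum.cong) (use s in \<open>simp_all add: z\<close>)
 then show "fT (single (\<sigma> - {k}) w) x = ?c" using finG S_G s by (simp add: subset_iff)
 have "fT x (single (\<sigma> - {k}) w) = (\<Sum>\<rho>\<in>G. if \<rho> = \<sigma> then ?c' else 0)"
  unfolding fT_def by (rule sum.cong) (use s in \<open>simp_all add: z\<close>)
 then show "fT x (single (\<sigma> - {k}) w) = ?c'" using finG S_G s by (simp add: subset_iff)
qed

lemma T_coord:
 assumes x: "x \<in> T" "x ~= 0"
 obtains \<sigma> \<kappa> where "\<sigma> \<in> S" "k \<in> \<sigma>" "\<kappa> \<subseteq> \<sigma> - {k}" "x (\<sigma> - {k}) \<kappa> ~= 0"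
proof -
 obtain \<rho> \<kappa> where n: "x \<rho> \<kappa> ~= 0" using x(2) by (auto simp: fun_eq_iff)
 then have "x \<rho> ~= 0" by auto
 then have "\<rho> \<in> (%\<sigma>. \<sigma> - {k}) ` {\<sigma> \<in> S. k \<in> \<sigma>}"
  using family_spaceD(2)[OF x(1)[unfolded T_def]] by blast
 then obtain \<sigma> where s: "\<sigma> \<in> S" "k \<in> \<sigma>" "\<rho> = \<sigma> - {k}" by blast
 moreover have "\<kappa> \<subseteq> \<sigma> - {k}" using tensor_zero[OF T_mem(1)[OF x(1) s(2)]] n s by blast
 ultimately show ?thesis using that n by blast
qed

lemma delta_in: "\<kappa> \<subseteq> \<rho> ==> single \<kappa> 1 \<in> tensor_space \<rho>"
 by (auto simp: tensor_space_def single_def)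

lemma fT_nondeg:
 assumes x: "x \<in> T" "x ~= 0"
 shows "\<exists>y\<in>T. fT x y ~= 0"
proof -
 obtain \<sigma> \<kappa> where s: "\<sigma> \<in> S" "k \<in> \<sigma>" "\<kappa> \<subseteq> \<sigma> - {k}" "x (\<sigma> - {k}) \<kappa> ~= 0"
  using T_coord[OF x] .
 have f: "finite (\<sigma> - {k})" using fin_G S_G s by blast
 have d: "single (\<sigma> - {k} - \<kappa>) 1 \<in> tensor_space (\<sigma> - {k})" by (rule delta_in) blast
 from tform_delta[OF f T_mem(1)[OF x(1) s(2)] s(3)]
 have "tform P (\<sigma> - {k}) (single (\<sigma> - {k} - \<kappa>) 1) (x (\<sigma> - {k})) ~= 0" using s(4) by auto
 then have "tform P (\<sigma> - {k}) (x (\<sigma> - {k})) (single (\<sigma> - {k} - \<kappa>) 1) ~= 0"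
  unfolding tform_commute[OF f T_mem(1)[OF x(1) s(2)] d] by simp
 then have "fT x (single (\<sigma> - {k}) (single (\<sigma> - {k} - \<kappa>) 1)) ~= 0"
  unfolding fT_single(2)[OF s(1,2)] using two eps_diag[OF s(1)] by simp
 then show ?thesis using T_single[OF s(1,2) d] by blast
qed

text \<open>At least two factors remain beside the one at \<open>k\<close>, so each summand of
  \<open>diag\<close> contains a value <v|v> = 0. Off-diagonal terms vanish because only one
  component is present.\<close>

lemma dT_pure:
 assumes s: "\<sigma> \<in> S" "k \<in> \<sigma>" and c: "card \<sigma> \<ge> 3"
 shows "dT (single (\<sigma> - {k}) (pure P (\<sigma> - {k}) v)) (single (\<sigma> - {k}) (pure P (\<sigma> - {k}) v)) = 0"
proof -
 have f: "finite (\<sigma> - {k})" "card (\<sigma> - {k}) \<ge> 2" using fin_G S_G s c by auto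
 have z: "single (\<sigma> - {k}) w (\<rho> - {k}) = (if \<rho> = \<sigma> then w else 0)" if "k \<in> \<rho>" for \<rho> and w :: "'a tensor"
  using Diff_eq[OF that s(2)] by (simp add: single_def)
 have "dterm (single (\<sigma> - {k}) (pure P (\<sigma> - {k}) v)) (single (\<sigma> - {k}) (pure P (\<sigma> - {k}) v)) \<rho> \<tau> = 0" for \<rho> \<tau>
 proof (cases "k \<in> \<rho> \<and> k \<in> \<tau>")
  case True
  then show ?thesis
   by (cases "\<rho> = \<sigma>"; cases "\<tau> = \<sigma>") (simp_all add: dterm_def z diag_pure_self[OF f] zero_prod_def[symmetric])
 next
  case False
  then show ?thesis unfolding dterm_def by auto
 qed
 then show ?thesis unfolding dT_def by (intro sum.neutral) (simp add: case_prod_beta)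
qed

text \<open>The basis tensor of the complementary subset is pure, hence strictly regular, and by
  \<open>tform_delta\<close> it sees the given nonzero coordinate of \<open>x\<close>. The element
  is made explicit because for e6 it will have to be located in the image of the embedding into
  e7.\<close>

lemma delta_regular:
 assumes x: "x \<in> T" and s: "\<sigma> \<in> S" "k \<in> \<sigma>" and c: "card \<sigma> \<ge> 3" and k: "\<kappa> \<subseteq> \<sigma> - {k}" "x (\<sigma> - {k}) \<kappa> ~= 0"
 defines "r \<equiv> single (\<sigma> - {k}) (single (\<sigma> - {k} - \<kappa>) (1::'a))"
 shows "dT r r = 0" "fT r x ~= 0"
proof -
 have f: "finite (\<sigma> - {k})" using fin_G S_G s by blast
 have p: "pure P (\<sigma> - {k}) (bfam P (\<sigma> - {k} - \<kappa>)) = single (\<sigma> - {k} - \<kappa>) 1" by (rule pure_bfam[OF f]) blast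
 from tform_delta[OF f T_mem(1)[OF x s(2)] k(1)]
 have "tform P (\<sigma> - {k}) (single (\<sigma> - {k} - \<kappa>) 1) (x (\<sigma> - {k})) ~= 0" using k(2) by auto
 then show "fT r x ~= 0"
  unfolding r_def fT_single(1)[OF s(1,2)] using two eps_diag[OF s(1)] by simp
 show "dT r r = 0"
  using dT_pure[OF s c, of "bfam P (\<sigma> - {k} - \<kappa>)"] unfolding r_def by (simp only: p)
qed

lemma regular_pure:
 assumes x: "x \<in> T" and s: "\<sigma> \<in> S" "k \<in> \<sigma>" and c: "card \<sigma> \<ge> 3" and k: "\<kappa> \<subseteq> \<sigma> - {k}" "x (\<sigma> - {k}) \<kappa> ~= 0"
 shows "\<exists>r\<in>T. dT r r = 0 \<and> fT r x ~= 0"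
proof -
 have "single (\<sigma> - {k}) (single (\<sigma> - {k} - \<kappa>) (1::'a)) \<in> T" by (rule T_single[OF s delta_in]) blast
 with delta_regular[OF assms] show ?thesis by blast
qed

lemma odd_part:
 assumes "\<And>x. x \<in> T ==> x ~= 0 ==> \<exists>r\<in>T. dT r r = 0 \<and>
   (fT r x ~= 0 \<or> (\<exists>y\<in>T. \<exists>z\<in>T. fT r (aT (dT x y) z - fs (fT x z) y - fs (fT y z) x) ~= 0))"
 shows "odd_part P (es P) br L A \<iota> fs T t fT dT aT"
proof (rule odd_part.intro[OF sympl_axioms odd_part_axioms.intro])
 have Llin: "lin X" "\<And>\<sigma>. snd X \<sigma> \<in> tensor_space \<sigma>" if "X \<in> L" for X
  using that unfolding L_def by (auto intro: alg_lin alg_snd)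
 show "vector_space (es P)" "vector_space (fs :: 'a => _)" by (rule vs_es vs_fs)+
 show "ES.subspace A" unfolding A_def by (rule alg_sub)
 show "FS.subspace T" by (rule T_sub)
 show "\<iota> (g + h) = \<iota> g + \<iota> h" "\<iota> (%v. scl P c (g v)) = es P c (\<iota> g)" for g h c by (rule iota_lin)+
 show "\<iota> g = 0 ==> g = 0" for g by (rule iota_inj)
 show "\<iota> g = 0" if "\<iota> g \<in> A" for g
 proof -
  have "nu k g k = 0" using A_0(2)[OF that] by (simp add: iota_fst)
  then have "g = 0" by (simp add: nu_def)
  then show ?thesis by (simp add: iota_fst nu_def zero_prod_def fun_eq_iff)
 qed
 show "t (x + y) u = t x u + t y u" "t (fs c x) u = es P c (t x u)"
  "t x (u + v) = t x u + t x v" "t x (scl P c u) = es P c (t x u)" for x y u v c by (rule t_lin)+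
 show "x \<in> T ==> y \<in> T ==> t x b0 + t y b1 = 0 ==> x = 0 \<and> y = 0" for x y by (rule t_inj)
 show "L = {p + \<iota> g + (t x b0 + t y b1) |p g x y. p \<in> A \<and> g \<in> sp P \<and> x \<in> T \<and> y \<in> T}" by (rule L_eq)
 show "p + \<iota> g = 0" if "p \<in> A" "g \<in> sp P" "x \<in> T" "y \<in> T" "p + \<iota> g = t x b0 + t y b1" for p g x y
  using L_direct[OF that] .
 show "br (X + Y) Z = br X Z + br Y Z" if "X \<in> L" "Y \<in> L" "Z \<in> L" for X Y Z
  by (rule br_lin(1)[OF Llin(1)[OF that(3)]])
 show "br (es P c X) Y = es P c (br X Y)" if "X \<in> L" "Y \<in> L" for X Y c
  by (rule br_lin(2)[OF Llin(1)[OF that(2)]])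
 show "br X Y = - br Y X" if "X \<in> L" "Y \<in> L" for X Y
  by (rule br_skew) (use Llin that in blast)+
 show "br D E \<in> A" if "D \<in> A" "E \<in> A" for D E by (rule A_closed[OF that])
 show "br D (\<iota> g) = 0" if "D \<in> A" "g \<in> sp P" for D g by (rule A_sp[OF that])
 show "br (\<iota> g) (\<iota> h) = \<iota> (%v. g (h v) - h (g v))" if "g \<in> sp P" "h \<in> sp P" for g h by (rule sp_sp[OF that])
 show "br (\<iota> g) (t z u) = t z (g u)" if "g \<in> sp P" "z \<in> T" for g z u by (rule sp_T[OF that])
 show "aT D z \<in> T" "br D (t z u) = t (aT D z) u" if "D \<in> A" "z \<in> T" for D z u by (rule A_T[OF that])+
 show "dT x y \<in> A" "br (t x u) (t y v) = es P (form P u v) (dT x y) + es P (fT x y) (\<iota> (gam P u v))"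
  if "x \<in> T" "y \<in> T" for x y u v by (rule T_T[OF that])+
 show "br (br D (t y v)) (t z w) + br (br (t y v) (t z w)) D + br (br (t z w) D) (t y v) = 0"
  if "D \<in> A \<or> D \<in> {t x u |x u. x \<in> T}" "y \<in> T" "z \<in> T" for D y z v w
 proof (rule jac)
  show "D \<in> algebra_space P N S" using that(1) A_L t_L unfolding L_def by blast
  show "t y v \<in> algebra_space P N S" "t z w \<in> algebra_space P N S" using that t_L unfolding L_def by blast+
 qed simp_all
 show "\<exists>y\<in>T. fT x y ~= 0" if "x \<in> T" "x ~= 0" for x by (rule fT_nondeg[OF that])
 show "\<exists>x\<in>T. x ~= 0"
 proof -
  from ex_odd obtain \<sigma> where s: "\<sigma> \<in> S" "k \<in> \<sigma>" by blast
  have "single (\<sigma> - {k}) (single {} 1) \<in> T" by (rule T_single[OF s delta_in]) simp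
  moreover have "single (\<sigma> - {k}) (single {} (1::'a)) (\<sigma> - {k}) {} ~= 0" by simp
  ultimately show ?thesis by (metis zero_fun_apply)
 qed
 show "\<exists>r\<in>T. dT r r = 0 \<and> (fT r x ~= 0 \<or> (\<exists>y\<in>T. \<exists>z\<in>T. fT r (aT (dT x y) z - fs (fT x z) y - fs (fT y z) x) ~= 0))"
  if "x \<in> T" "x ~= 0" for x using assms[OF that] .
qed

text \<open>The bound holds for e8 and e7, whose odd sets have four elements. The sets {i, 4} of f4
  violate it, and f4 supplies regular elements by a separate argument.\<close>

lemma decomposition_card:
 assumes "\<And>\<sigma>. \<sigma> \<in> S ==> k \<in> \<sigma> ==> card \<sigma> \<ge> 3"
 shows "freudenthal_decomposition P (es P) br L A \<iota> fs T t"
proof (rule odd_part.decomposition[OF odd_part])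
 fix x assume x: "x \<in> T" "x ~= 0"
 from T_coord[OF x] obtain \<sigma> \<kappa> where "\<sigma> \<in> S" "k \<in> \<sigma>" "\<kappa> \<subseteq> \<sigma> - {k}" "x (\<sigma> - {k}) \<kappa> ~= 0" .
 then show "\<exists>r\<in>T. dT r r = 0 \<and> (fT r x ~= 0 \<or> (\<exists>y\<in>T. \<exists>z\<in>T. fT r (aT (dT x y) z - fs (fT x z) y - fs (fT y z) x) ~= 0))"
  using regular_pure[OF x(1)] assms by blast
qed

end

section \<open>The signs of \<open>e\<^sub>8\<close>\<close>

type_synonym bits = "bool \<times> bool \<times> bool \<times> bool"

text \<open>Subsets of {1,2,3,4} are replaced by quadruples of truth values, so that all statements
  on index sets and signs of e8 become finite and can be settled by evaluation.\<close>

definition bits_set :: "bits => nat set" where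
 "bits_set = (%(p, q, r, s). {i. i = 1 \<and> p \<or> i = 2 \<and> q \<or> i = 3 \<and> r \<or> i = 4 \<and> s})"

fun bxor :: "bits => bits => bits" where
 "bxor (p, q, r, s) (p', q', r', s') = (p ~= p', q ~= q', r ~= r', s ~= s')"

text \<open>The exponent \<open>g_e8\<close> modulo 2: sums become exclusive or, and the terms are
  grouped by the entries of the first argument, the cubic ones last.\<close>

fun gpar :: "bits => bits => bool" where
 "gpar (p, q, r, s) (p', q', r', s') = ((p \<and> p') ~= ((q \<and> (p' ~= q')) ~= ((r \<and> (p' ~= (q' ~= (r' ~= s')))) ~= ((s \<and> r') ~=
   ((p \<and> q' \<and> r') ~= ((q \<and> p' \<and> r') ~= (r \<and> p' \<and> q')))))))"

fun chi_bits :: "bits => bool list" where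
 "chi_bits (p, q, r, s) = [p ~= (r ~= s), p ~= (q ~= (r ~= s)), q ~= (r ~= s), r ~= s, p ~= s, p ~= (q ~= s), q ~= s, s]"

definition chi_set :: "bits => nat set" where
 "chi_set x = {i \<in> {1..8}. chi_bits x ! (i - 1)}"

lemma le8: "{1..8} = {1, 2, 3, 4, 5, 6, 7, 8 :: nat}" by auto

lemma card_chi: "card {i \<in> {1..8 :: nat}. R (i - 1)} = (\<Sum>i\<leftarrow>[0, 1, 2, 3, 4, 5, 6, 7]. of_bool (R i))"
proof -
 have "card {i \<in> {1..8 :: nat}. R (i - 1)} = (\<Sum>i\<in>{1..8 :: nat}. of_bool (R (i - 1)))"
  by (simp add: of_bool_def sum.If_cases Int_def)
 then show ?thesis unfolding le8 by simp
qed

lemma chi4_bits: "chi4 (bits_set x) = chi_set x"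
proof -
 obtain p q r s where x: "x = (p, q, r, s)" by (cases x) auto
 have b: "bit_of (bits_set x) 1 = of_bool p" "bit_of (bits_set x) 2 = of_bool q" "bit_of (bits_set x) 3 = of_bool r" "bit_of (bits_set x) 4 = of_bool s"
  by (auto simp: bit_of_def bits_set_def x)
 have "odd ([of_bool p + of_bool r + of_bool s, of_bool p + of_bool q + of_bool r + of_bool s, of_bool q + of_bool r + of_bool s,
   of_bool r + of_bool s, of_bool p + of_bool s, of_bool p + of_bool q + of_bool s, of_bool q + of_bool s, of_bool s] ! (i - 1) :: nat)
  = chi_bits x ! (i - 1)" if "i \<in> {1..8}" for i
  using that unfolding le8 by (cases p; cases q; cases r; cases s) (auto simp: x)
 then show ?thesis unfolding chi4_def chi_set_def Let_def b by blast
qed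

lemma g_bits: "odd (g_e8 (bits_set x) (bits_set y)) = gpar x y"
proof -
 obtain p q r s p' q' r' s' where x: "x = (p, q, r, s)" "y = (p', q', r', s')" by (cases x, cases y) auto
 have b: "bit_of (bits_set x) 1 = of_bool p" "bit_of (bits_set x) 2 = of_bool q" "bit_of (bits_set x) 3 = of_bool r" "bit_of (bits_set x) 4 = of_bool s"
  "bit_of (bits_set x) (Suc 0) = of_bool p" "bit_of (bits_set y) (Suc 0) = of_bool p'"
  "bit_of (bits_set y) 1 = of_bool p'" "bit_of (bits_set y) 2 = of_bool q'" "bit_of (bits_set y) 3 = of_bool r'" "bit_of (bits_set y) 4 = of_bool s'"
  by (auto simp: bit_of_def bits_set_def x)
 have s: "(\<Sum>i=1..3. \<Sum>j=1..i. F i j) = F 1 1 + (F 2 1 + F 2 2) + (F 3 1 + F 3 2 + F 3 3)" for F :: "nat => nat => nat"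
  by (simp add: eval_nat_numeral)
 show ?thesis unfolding g_e8_def Let_def s b
  by (cases p; cases q; cases r; cases s; simp add: x; argo)
qed

lemma range_bits: "Pow {1..4} = range bits_set"
proof (intro equalityI subsetI)
 fix A :: "nat set" assume "A \<in> Pow {1..4}"
 then have "A \<subseteq> {1, 2, 3, 4}" by auto
 then have "A = bits_set (1 \<in> A, 2 \<in> A, 3 \<in> A, 4 \<in> A)" by (auto simp: bits_set_def)
 then show "A \<in> range bits_set" by blast
qed (auto simp: bits_set_def)

lemma bits_set_4: "bits_set x = {4} \<longleftrightarrow> x = (False, False, False, True)"
proof
 assume "bits_set x = {4}"
 then have m: "i \<in> bits_set x \<longleftrightarrow> i = 4" for i by simp
 show "x = (False, False, False, True)"
  using m[of 1] m[of 2] m[of 3] m[of 4] by (cases x) (simp add: bits_set_def)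
qed (auto simp: bits_set_def)

lemma inj_chi_set: "chi_set x = chi_set y \<longleftrightarrow> x = y"
proof
 assume e: "chi_set x = chi_set y"
 have m: "i \<in> {1..8} ==> chi_bits x ! (i - 1) = chi_bits y ! (i - 1)" for i
  using e unfolding chi_set_def set_eq_iff by blast
 show "x = y"
  using m[of 1] m[of 2] m[of 3] m[of 4] m[of 5] m[of 6] m[of 7] m[of 8]
  by (cases x; cases y) (simp; argo)
qed simp

lemma S_e8_bits: "S_e8 = chi_set ` (UNIV - {(False, False, False, True)})"
proof -
 have "Pow {1..4} - {{4}} = bits_set ` (UNIV - {(False, False, False, True)})"
  unfolding range_bits using bits_set_4 by blast
 then show ?thesis unfolding S_e8_def by (simp add: image_image chi4_bits)
qed

lemma eps_bits: "eps_e8 (chi_set x) (chi_set y) = (if gpar x y then - 1 else 1 :: 'a::field)"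
proof -
 have "inj_on chi4 (Pow {1..4})"
  unfolding range_bits inj_on_def using chi4_bits inj_chi_set by auto
 moreover have "bits_set x \<in> Pow {1..4}" for x unfolding range_bits by (rule rangeI)
 ultimately have "inv_into (Pow {1..4}) chi4 (chi_set x) = bits_set x" for x
  using inv_into_f_f[of chi4 "Pow {1..4}" "bits_set x"] by (simp only: chi4_bits)
 then show ?thesis unfolding eps_e8_def by (simp add: g_bits flip: g_bits)
qed

lemma chi_xor: "chi_set (bxor x y) = sym_diff (chi_set x) (chi_set y)"
proof -
 have "chi_bits (bxor x y) ! (i - 1) = (chi_bits x ! (i - 1) ~= chi_bits y ! (i - 1))" if "i \<in> {1..8}" for i
  using that unfolding le8 by (cases x; cases y) (simp; elim disjE; simp; argo)
 then show ?thesis unfolding chi_set_def by auto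
qed

definition bits_list :: "bits list" where
 "bits_list = List.product [True, False] (List.product [True, False] (List.product [True, False] [True, False]))"

lemma all_bits: "(\<forall>x :: bits. Q x) \<longleftrightarrow> list_all Q bits_list"
proof -
 have "set [True, False] = UNIV" by auto
 then have "set bits_list = UNIV" by (simp only: bits_list_def set_product UNIV_Times_UNIV)
 then show ?thesis by (simp only: list_all_iff ball_UNIV)
qed

abbreviation "one8 \<equiv> (False, False, False, True)"
abbreviation "zero8 \<equiv> (False, False, False, False)"

lemma card_bits: "\<forall>x. x ~= zero8 \<longrightarrow> x ~= one8 \<longrightarrow> card (chi_set x) = 4"
 unfolding all_bits chi_set_def card_chi[of "%i. chi_bits _ ! i"] by code_simp

lemma card_int_bits: "\<forall>x y. x ~= zero8 \<longrightarrow> x ~= one8 \<longrightarrow> y ~= zero8 \<longrightarrow> y ~= one8 \<longrightarrow> x ~= y \<longrightarrow> bxor x y ~= one8 \<longrightarrow>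
 card (chi_set x \<inter> chi_set y) = 2"
proof -
 have i: "chi_set x \<inter> chi_set y = {i \<in> {1..8}. chi_bits x ! (i - 1) \<and> chi_bits y ! (i - 1)}" for x y
  by (auto simp: chi_set_def)
 show ?thesis
  unfolding all_bits i card_chi[of "%i. chi_bits _ ! i \<and> chi_bits _ ! i"] by code_simp
qed

text \<open>The excluded quadruples are the empty set and the sum of complementary sets. The sign is
  -1 on the diagonal, changes under exchange, and is invariant under rotation of x, y and x + y;
  \<open>diag_contr_cyclic\<close> and \<open>act_diag\<close> are identities for exactly such
  signs.\<close>

lemma sign_bits2: "\<forall>x y. x ~= zero8 \<longrightarrow> x ~= one8 \<longrightarrow> y ~= zero8 \<longrightarrow> y ~= one8 \<longrightarrow> x ~= y \<longrightarrow> bxor x y ~= one8 \<longrightarrow>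
 gpar x x \<and> gpar y x ~= gpar x y \<and> gpar (bxor x y) x = gpar x y \<and> gpar y (bxor x y) = gpar x y"
 unfolding all_bits by code_simp

text \<open>Adding (0,0,0,1) means taking the complement. For complementary components two double
  brackets survive with equal contractions by \<open>contr_disjoint\<close>, so their total signs
  have to be opposite.\<close>

lemma sign_bits4: "\<forall>x z. x ~= zero8 \<longrightarrow> x ~= one8 \<longrightarrow> z ~= zero8 \<longrightarrow> z ~= one8 \<longrightarrow> x ~= z \<longrightarrow> bxor x z ~= one8 \<longrightarrow>
 (gpar (bxor x one8) z ~= gpar (bxor (bxor x one8) z) x) ~= (gpar z x ~= gpar (bxor z x) (bxor x one8))"
 unfolding all_bits by code_simp

text \<open>For a generic triple, the total sign of a double bracket must be the same in all three
  rotations, so that \<open>contr_jacobi\<close> applies.\<close>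

lemma sign_bits3: "\<forall>x y z. x ~= zero8 \<longrightarrow> x ~= one8 \<longrightarrow> y ~= zero8 \<longrightarrow> y ~= one8 \<longrightarrow> z ~= zero8 \<longrightarrow> z ~= one8 \<longrightarrow>
 x ~= y \<longrightarrow> bxor x y ~= one8 \<longrightarrow> y ~= z \<longrightarrow> bxor y z ~= one8 \<longrightarrow> z ~= x \<longrightarrow> bxor z x ~= one8 \<longrightarrow>
 bxor x y ~= z \<longrightarrow> bxor (bxor x y) z ~= one8 \<longrightarrow>
 (gpar x y ~= gpar (bxor x y) z) = (gpar y z ~= gpar (bxor y z) x)"
 unfolding all_bits by code_simp

subsection \<open>Index sets and signs\<close>

lemma S_e8E:
 assumes "\<sigma> \<in> S_e8" "\<sigma> ~= {}"
 obtains x where "\<sigma> = chi_set x" "x ~= zero8" "x ~= one8"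
proof -
 from assms(1) obtain x where x: "\<sigma> = chi_set x" "x ~= one8" unfolding S_e8_bits by blast
 have "chi_set zero8 = {}" unfolding chi_set_def le8 by auto
 then show ?thesis using that x assms(2) by metis
qed

lemma chi_S_e8: "chi_set x \<in> S_e8 \<longleftrightarrow> x ~= one8"
 unfolding S_e8_bits using inj_chi_set by blast

lemma chi_set_one8: "chi_set one8 = {1..8}"
 unfolding chi_set_def le8 by auto

lemma chi_set_zero8: "chi_set zero8 = {}"
 unfolding chi_set_def le8 by auto

lemma S_e8_sub: "\<sigma> \<in> S_e8 ==> \<sigma> \<subseteq> {1..8}"
 unfolding S_e8_bits chi_set_def by blast

lemma S_e8_finite: "\<sigma> \<in> S_e8 ==> finite \<sigma>"
 using S_e8_sub finite_subset by blast

lemma finite_S_e8: "finite S_e8"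
 unfolding S_e8_bits by simp

lemma empty_S_e8: "{} \<in> S_e8"
 using chi_S_e8[of zero8] by (simp add: chi_set_zero8)

lemma e8_card:
 assumes "\<sigma> \<in> S_e8" "\<sigma> ~= {}" shows "card \<sigma> = 4"
proof -
 obtain x where x: "\<sigma> = chi_set x" "x ~= zero8" "x ~= one8" using assms by (rule S_e8E)
 show ?thesis unfolding x(1) using card_bits x(2,3) by blast
qed

lemma e8_card_int:
 assumes "\<sigma> \<in> S_e8" "\<sigma> ~= {}" "\<tau> \<in> S_e8" "\<tau> ~= {}" "\<sigma> ~= \<tau>" "sym_diff \<sigma> \<tau> \<in> S_e8"
 shows "card (\<sigma> \<inter> \<tau>) = 2"
proof -
 obtain x where x: "\<sigma> = chi_set x" "x ~= zero8" "x ~= one8" using assms(1,2) by (rule S_e8E)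
 obtain y where y: "\<tau> = chi_set y" "y ~= zero8" "y ~= one8" using assms(3,4) by (rule S_e8E)
 have xy: "x ~= y" "bxor x y ~= one8" using assms(5,6) unfolding x(1) y(1) chi_xor[symmetric] chi_S_e8 by auto
 show ?thesis unfolding x(1) y(1) using card_int_bits x(2,3) y(2,3) xy by blast
qed

text \<open>The quadruple (0,0,0,1) is the only one left out of \<open>S_e8\<close>, and it
  corresponds to the full set; a sum outside \<open>S_e8\<close> therefore means complementary
  sets.\<close>

lemma e8_compl: assumes "\<sigma> \<in> S_e8" "\<tau> \<in> S_e8" "sym_diff \<sigma> \<tau> ~: S_e8"
 shows "sym_diff \<sigma> \<tau> = {1..8}" "\<sigma> \<inter> \<tau> = {}" "\<tau> = {1..8} - \<sigma>"
proof -
 from assms obtain x y where x: "\<sigma> = chi_set x" "\<tau> = chi_set y" unfolding S_e8_bits by blast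
 then have "bxor x y = one8" using assms(3) chi_S_e8 chi_xor by metis
 then show s: "sym_diff \<sigma> \<tau> = {1..8}" using x chi_set_one8 chi_xor by metis
 show "\<sigma> \<inter> \<tau> = {}"  "\<tau> = {1..8} - \<sigma>" using s S_e8_sub[OF assms(1)] S_e8_sub[OF assms(2)] by blast+
qed

lemma e8_eps_diag: "\<sigma> \<in> S_e8 ==> \<sigma> ~= {} ==> eps_e8 \<sigma> \<sigma> = (- 1 :: 'a::field)"
proof -
 assume "\<sigma> \<in> S_e8" "\<sigma> ~= {}"
 then obtain x where x: "\<sigma> = chi_set x" "x ~= zero8" "x ~= one8" by (rule S_e8E)
 have "\<forall>x. x ~= zero8 \<longrightarrow> x ~= one8 \<longrightarrow> gpar x x" unfolding all_bits by code_simp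
 then have "gpar x x" using x by blast
 then show ?thesis unfolding x(1) eps_bits by (rule if_P)
qed

lemma e8_eps_empty: "\<tau> \<in> S_e8 ==> eps_e8 {} \<tau> = (1 :: 'a::field)" "\<tau> \<in> S_e8 ==> eps_e8 \<tau> {} = (1 :: 'a::field)"
proof -
 assume "\<tau> \<in> S_e8"
 then obtain y where y: "\<tau> = chi_set y" unfolding S_e8_bits by blast
 have "\<forall>x. \<not> gpar zero8 x \<and> \<not> gpar x zero8" unfolding all_bits by code_simp
 then have "\<not> gpar zero8 y" "\<not> gpar y zero8" by blast+
 then show "eps_e8 {} \<tau> = (1 :: 'a::field)" "eps_e8 \<tau> {} = (1 :: 'a::field)"
  unfolding y chi_set_zero8[symmetric] eps_bits by (simp_all only: if_False)
qed

lemma e8_eps: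
 assumes "\<sigma> \<in> S_e8" "\<sigma> ~= {}" "\<tau> \<in> S_e8" "\<tau> ~= {}" "\<sigma> ~= \<tau>" "sym_diff \<sigma> \<tau> \<in> S_e8"
 shows "eps_e8 \<tau> \<sigma> = - (eps_e8 \<sigma> \<tau> :: 'a::field)" "eps_e8 (sym_diff \<sigma> \<tau>) \<sigma> = (eps_e8 \<sigma> \<tau> :: 'a)"
  "eps_e8 \<tau> (sym_diff \<sigma> \<tau>) = (eps_e8 \<sigma> \<tau> :: 'a)"
proof -
 obtain x where x: "\<sigma> = chi_set x" "x ~= zero8" "x ~= one8" using assms(1,2) by (rule S_e8E)
 obtain y where y: "\<tau> = chi_set y" "y ~= zero8" "y ~= one8" using assms(3,4) by (rule S_e8E)
 have xy: "x ~= y" "bxor x y ~= one8" using assms(5,6) unfolding x y chi_xor[symmetric] chi_S_e8 by auto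
 have "gpar y x ~= gpar x y" "gpar (bxor x y) x = gpar x y" "gpar y (bxor x y) = gpar x y"
  using sign_bits2 x(2,3) y(2,3) xy by blast+
 then show "eps_e8 \<tau> \<sigma> = - (eps_e8 \<sigma> \<tau> :: 'a)" "eps_e8 (sym_diff \<sigma> \<tau>) \<sigma> = (eps_e8 \<sigma> \<tau> :: 'a)"
  "eps_e8 \<tau> (sym_diff \<sigma> \<tau>) = (eps_e8 \<sigma> \<tau> :: 'a)"
  unfolding x y chi_xor[symmetric] eps_bits by auto
qed

lemma e8_eps_cyclic:
 assumes s: "\<sigma> \<in> S_e8" "\<sigma> ~= {}" and t: "\<tau> \<in> S_e8" "\<tau> ~= {}" and r: "\<rho> \<in> S_e8" "\<rho> ~= {}"
  and d: "\<sigma> ~= \<tau>" "\<tau> ~= \<rho>" "\<rho> ~= \<sigma>" "sym_diff \<sigma> \<tau> \<in> S_e8" "sym_diff \<tau> \<rho> \<in> S_e8" "sym_diff \<rho> \<sigma> \<in> S_e8"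
  "sym_diff \<sigma> \<tau> ~= \<rho>" "sym_diff (sym_diff \<sigma> \<tau>) \<rho> \<in> S_e8"
 shows "eps_e8 \<sigma> \<tau> * eps_e8 (sym_diff \<sigma> \<tau>) \<rho> = (eps_e8 \<tau> \<rho> * eps_e8 (sym_diff \<tau> \<rho>) \<sigma> :: 'a::field)"
proof -
 obtain x where x: "\<sigma> = chi_set x" "x ~= zero8" "x ~= one8" using s by (rule S_e8E)
 obtain y where y: "\<tau> = chi_set y" "y ~= zero8" "y ~= one8" using t by (rule S_e8E)
 obtain z where z: "\<rho> = chi_set z" "z ~= zero8" "z ~= one8" using r by (rule S_e8E)
 have "x ~= y" "bxor x y ~= one8" "y ~= z" "bxor y z ~= one8" "z ~= x" "bxor z x ~= one8" "bxor x y ~= z" "bxor (bxor x y) z ~= one8"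
  using d unfolding x y z chi_xor[symmetric] chi_S_e8 inj_chi_set by auto
 then have "(gpar x y ~= gpar (bxor x y) z) = (gpar y z ~= gpar (bxor y z) x)"
  using sign_bits3 x(2,3) y(2,3) z(2,3) by blast
 then show ?thesis unfolding x y z chi_xor[symmetric] eps_bits by (auto split: if_splits)
qed

lemma e8_eps_compl:
 assumes s: "\<sigma> \<in> S_e8" "\<sigma> ~= {}" and t: "\<tau> \<in> S_e8" "\<tau> ~= {}" and r: "\<rho> \<in> S_e8" "\<rho> ~= {}"
  and d: "sym_diff \<sigma> \<tau> ~: S_e8" "\<rho> ~= \<sigma>" "\<rho> ~= \<tau>"
 shows "eps_e8 \<tau> \<rho> * eps_e8 (sym_diff \<tau> \<rho>) \<sigma> + eps_e8 \<rho> \<sigma> * eps_e8 (sym_diff \<rho> \<sigma>) \<tau> = (0 :: 'a::field)"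
proof -
 obtain x where x: "\<sigma> = chi_set x" "x ~= zero8" "x ~= one8" using s by (rule S_e8E)
 obtain z where z: "\<rho> = chi_set z" "z ~= zero8" "z ~= one8" using r by (rule S_e8E)
 obtain y where y: "\<tau> = chi_set y" "y ~= zero8" "y ~= one8" using t by (rule S_e8E)
 have "bxor x y = one8" using d(1) unfolding x y chi_xor[symmetric] chi_S_e8 by simp
 then have y': "y = bxor x one8" by (cases x; cases y) auto
 have "bxor x z ~= one8"
 proof
  assume "bxor x z = one8"
  then have "z = bxor x one8" by (cases x; cases z) auto
  then show False using d(3) y z y' by simp
 qed
 moreover have "x ~= z" using d x z by auto
 ultimately have "(gpar (bxor x one8) z ~= gpar (bxor (bxor x one8) z) x) ~= (gpar z x ~= gpar (bxor z x) (bxor x one8))"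
  using sign_bits4 x(2,3) z(2,3) by blast
 then show ?thesis unfolding x y(1) z y' chi_xor[symmetric] eps_bits by (auto split: if_splits)
qed

section \<open>The Jacobi identity\<close>

context graded begin

definition "jac X Y Z = br (br X Y) Z + br (br Y Z) X + br (br Z X) Y"

lemma jac_cyclic: "jac X Y Z = jac Y Z X" "jac X Y Z = jac Z X Y"
 by (simp_all add: jac_def add_ac)

lemma alg_sum:
 assumes "finite S" and X: "X \<in> algebra_space P N S"
 shows "X = (fst X, 0) + (\<Sum>\<sigma>\<in>S - {{}}. (0, single \<sigma> (snd X \<sigma>)))"
proof (rule prod_eqI)
 show "fst X = fst ((fst X, 0) + (\<Sum>\<sigma>\<in>S - {{}}. (0, single \<sigma> (snd X \<sigma>))))"
  by (simp add: fst_sum)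
 show "snd X = snd ((fst X, 0) + (\<Sum>\<sigma>\<in>S - {{}}. (0 :: nat => 'v => 'v, single \<sigma> (snd X \<sigma>))))"
 proof
  fix \<rho>
  have "snd ((fst X, 0) + (\<Sum>\<sigma>\<in>S - {{}}. (0 :: nat => 'v => 'v, single \<sigma> (snd X \<sigma>)))) \<rho>
   = (\<Sum>\<sigma>\<in>S - {{}}. single \<sigma> (snd X \<sigma>) \<rho>)"
   by (simp only: snd_add snd_conv add_0 snd_sum) (rule sum_apply)
  also have "\<dots> = (\<Sum>\<sigma>\<in>S - {{}}. if \<rho> = \<sigma> then snd X \<rho> else 0)"
   by (rule sum.cong) (auto simp: single_def)
  also have "\<dots> = snd X \<rho>"
   using alg_snd0[OF X, of \<rho>] alg_snd_empty[OF X] assms(1) by (cases "\<rho> \<in> S - {{}}") auto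
  finally show "snd X \<rho> = snd ((fst X, 0) + (\<Sum>\<sigma>\<in>S - {{}}. (0 :: nat => 'v => 'v, single \<sigma> (snd X \<sigma>)))) \<rho>" ..
 qed
qed

lemma alg_induct_odd:
 assumes S: "finite S" and X: "X \<in> algebra_space P N S" "fst X = 0"
  and hom: "\<And>\<sigma> x. \<sigma> \<in> S ==> \<sigma> ~= {} ==> x \<in> tensor_space \<sigma> ==> Q (0, single \<sigma> x)"
  and zero: "Q 0"
  and add: "\<And>X Y. X \<in> algebra_space P N S ==> Y \<in> algebra_space P N S ==> Q X ==> Q Y ==> Q (X + Y)"
 shows "Q X"
proof -
 have "(\<Sum>\<sigma>\<in>K. (0, single \<sigma> (snd X \<sigma>))) \<in> algebra_space P N S \<and> Q (\<Sum>\<sigma>\<in>K. (0, single \<sigma> (snd X \<sigma>)))"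
  if "finite K" "K \<subseteq> S - {{}}" for K
  using that
 proof (induction K rule: finite_induct)
  case empty
  show ?case using zero ES.subspace_0[OF alg_sub] by (simp only: sum.empty)
 next
  case (insert \<sigma> K)
  have "(0, single \<sigma> (snd X \<sigma>)) \<in> algebra_space P N S" "Q (0, single \<sigma> (snd X \<sigma>))"
   using insert.prems alg_snd[OF X(1)] by (auto intro: alg_single hom)
  moreover have "(\<Sum>\<sigma>\<in>K. (0, single \<sigma> (snd X \<sigma>))) \<in> algebra_space P N S" "Q (\<Sum>\<sigma>\<in>K. (0, single \<sigma> (snd X \<sigma>)))"
   using insert.IH insert.prems by blast+
  ultimately show ?case
   unfolding sum.insert[OF insert.hyps] using add ES.subspace_add[OF alg_sub] by blast
 qed
 from this[of "S - {{}}"] have "Q (\<Sum>\<sigma>\<in>S - {{}}. (0, single \<sigma> (snd X \<sigma>)))" using S by blast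
 moreover have "(fst X, 0) = (0 :: ('a, 'v) elt)" using X(2) by (simp add: zero_prod_def)
 ultimately show ?thesis using alg_sum[OF S X(1)] by (simp only: add_0)
qed

text \<open>\<open>alg_induct_odd\<close> decomposes one argument at a time, and cyclic invariance
  of \<open>jac\<close> brings each argument to the first place. Closure of the algebra under the
  bracket ensures that the inner brackets are again \<open>lin\<close>, as additivity of the outer
  brackets requires.\<close>

lemma jac_induct:
 assumes S: "S \<subseteq> G" and cl: "\<And>\<sigma> \<tau>. \<sigma> \<in> S ==> \<tau> \<in> S ==> sym_diff \<sigma> \<tau> \<in> G ==> sym_diff \<sigma> \<tau> \<in> S"
  and N: "\<And>\<sigma>. \<sigma> \<in> S ==> \<sigma> \<subseteq> N"
  and hom0: "\<And>g \<sigma> \<tau> x y. (\<And>i. g i \<in> sp P) ==> \<sigma> \<in> S ==> \<sigma> ~= {} ==> \<tau> \<in> S ==> \<tau> ~= {} ==>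
   x \<in> tensor_space \<sigma> ==> y \<in> tensor_space \<tau> ==> jac (g, 0) (0, single \<sigma> x) (0, single \<tau> y) = 0"
  and hom: "\<And>\<rho> \<sigma> \<tau> x y z. \<rho> \<in> S ==> \<rho> ~= {} ==> \<sigma> \<in> S ==> \<sigma> ~= {} ==> \<tau> \<in> S ==> \<tau> ~= {} ==>
   z \<in> tensor_space \<rho> ==> x \<in> tensor_space \<sigma> ==> y \<in> tensor_space \<tau> ==>
   jac (0, single \<rho> z) (0, single \<sigma> x) (0, single \<tau> y) = 0"
  and X: "X \<in> algebra_space P N S" and Y: "Y \<in> algebra_space P N S" "fst Y = 0"
  and Z: "Z \<in> algebra_space P N S" "fst Z = 0"
 shows "jac X Y Z = 0"
proof -
 let ?L = "algebra_space P N S"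
 have fS: "finite S" using S finG by (rule finite_subset)
 have cl': "br U V \<in> ?L" if "U \<in> ?L" "V \<in> ?L" for U V
  by (rule br_closed[OF alg_sub], rule phi_in) (use S cl N that in auto)
 have add: "jac (U + U') V W = jac U V W + jac U' V W" if "U \<in> ?L" "U' \<in> ?L" "V \<in> ?L" "W \<in> ?L" for U U' V W
  using that by (simp add: jac_def br_lin alg_lin[OF cl'] alg_lin)
 have zero: "jac 0 V W = 0" if "V \<in> ?L" "W \<in> ?L" for V W
  using add[of 0 0 V W] that ES.subspace_0[OF alg_sub] by simp
 have L0: "0 \<in> ?L" by (rule ES.subspace_0[OF alg_sub])
 have H: "(0, single \<sigma> x) \<in> ?L" if "\<sigma> \<in> S" "\<sigma> ~= {}" "x \<in> tensor_space \<sigma>" for \<sigma> x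
  by (rule alg_single[OF that])
 have XL: "(fst X, 0) \<in> ?L" using X unfolding alg_iff by (simp add: FS.subspace_0[OF family_subspace])
 have X': "(0, snd X) \<in> ?L" using X unfolding alg_iff by simp
 have s1: "jac U V W = 0" if U: "U = (fst X, 0) \<or> (\<exists>\<rho> z. \<rho> \<in> S \<and> \<rho> ~= {} \<and> z \<in> tensor_space \<rho> \<and> U = (0, single \<rho> z))"
  and V: "V \<in> ?L" "fst V = 0" and W: "W \<in> ?L" "fst W = 0" for U V W
 proof -
  have UL: "U \<in> ?L" using U XL H by blast
  have 1: "jac U (0, single \<sigma> x) (0, single \<tau> y) = 0" if "\<sigma> \<in> S" "\<sigma> ~= {}" "x \<in> tensor_space \<sigma>" "\<tau> \<in> S" "\<tau> ~= {}" "y \<in> tensor_space \<tau>" for \<sigma> \<tau> x y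
   using U that hom hom0 alg_fst[OF X] by blast
  have 2: "jac V' W' U = 0" if "V' \<in> ?L" "fst V' = 0" "\<exists>\<tau> y. \<tau> \<in> S \<and> \<tau> ~= {} \<and> y \<in> tensor_space \<tau> \<and> W' = (0, single \<tau> y)" for V' W'
  proof -
   have W'L: "W' \<in> ?L" using that(3) H by blast
   show ?thesis
   proof (rule alg_induct_odd[OF fS that(1,2), where Q = "%V. jac V W' U = 0"])
    show "jac (0, single \<sigma> x) W' U = 0" if "\<sigma> \<in> S" "\<sigma> ~= {}" "x \<in> tensor_space \<sigma>" for \<sigma> x
     using 1 that \<open>\<exists>\<tau> y. _ \<tau> y\<close> unfolding jac_cyclic(2)[of _ W' U] by blast
    show "jac 0 W' U = 0" by (rule zero[OF W'L UL])
    show "jac (A + B) W' U = 0" if "A \<in> ?L" "B \<in> ?L" "jac A W' U = 0" "jac B W' U = 0" for A B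
     using add[OF that(1,2) W'L UL] that by simp
   qed
  qed
  have "jac W U V = 0"
  proof (rule alg_induct_odd[OF fS W, where Q = "%W. jac W U V = 0"])
   show "jac (0, single \<tau> y) U V = 0" if "\<tau> \<in> S" "\<tau> ~= {}" "y \<in> tensor_space \<tau>" for \<tau> y
    using 2[OF V] that unfolding jac_cyclic(2)[of _ U V] by blast
   show "jac 0 U V = 0" by (rule zero[OF UL V(1)])
   show "jac (A + B) U V = 0" if "A \<in> ?L" "B \<in> ?L" "jac A U V = 0" "jac B U V = 0" for A B
    using add[OF that(1,2) UL V(1)] that by simp
  qed
  then show ?thesis using jac_cyclic(2) by metis
 qed
 have "jac (0, snd X) Y Z = 0"
 proof (rule alg_induct_odd[OF fS X', where Q = "%U. jac U Y Z = 0"])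
  show "jac (0, single \<sigma> x) Y Z = 0" if "\<sigma> \<in> S" "\<sigma> ~= {}" "x \<in> tensor_space \<sigma>" for \<sigma> x
   using s1[OF _ Y Z] that by blast
  show "jac 0 Y Z = 0" by (rule zero[OF Y(1) Z(1)])
  show "jac (A + B) Y Z = 0" if "A \<in> ?L" "B \<in> ?L" "jac A Y Z = 0" "jac B Y Z = 0" for A B
   using add[OF that(1,2) Y(1) Z(1)] that by simp
 qed simp
 moreover have "jac (fst X, 0) Y Z = 0" using s1[OF _ Y Z] by blast
 moreover have "X = (fst X, 0) + (0, snd X)" by (simp add: prod_eq_iff)
 ultimately show ?thesis using add[OF XL X' Y(1) Z(1)] by simp
qed

end

text \<open>Counting gives 2 = card ((\<sigma> + \<tau>) \<inter> \<rho>) = 2 + 2 - 2 t with t the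
  number of indices common to all three sets; so t = 1, which is the configuration of
  \<open>contr_jacobi\<close>.\<close>

lemma triple_intersection:
 assumes "card (\<sigma> \<inter> \<tau>) = 2" "card (\<sigma> \<inter> \<rho>) = 2" "card (\<tau> \<inter> \<rho>) = 2" "card (sym_diff \<sigma> \<tau> \<inter> \<rho>) = 2"
 obtains p a b c where "\<sigma> \<inter> \<tau> = {p, a}" "\<sigma> \<inter> \<rho> = {p, b}" "\<tau> \<inter> \<rho> = {p, c}" "a ~: \<rho>" "b ~: \<tau>" "c ~: \<sigma>"
proof -
 have fin: "finite (\<sigma> \<inter> \<tau>)" "finite (\<sigma> \<inter> \<rho>)" "finite (\<tau> \<inter> \<rho>)" using assms(1-3) by (simp_all add: card_ge_0_finite)
 let ?T = "\<sigma> \<inter> \<tau> \<inter> \<rho>"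
 have sub: "?T \<subseteq> \<sigma> \<inter> \<tau>" "?T \<subseteq> \<sigma> \<inter> \<rho>" "?T \<subseteq> \<tau> \<inter> \<rho>" by blast+
 have fT: "finite ?T" using finite_subset[OF sub(1) fin(1)] .
 have "sym_diff \<sigma> \<tau> \<inter> \<rho> = (\<sigma> \<inter> \<rho> - ?T) \<union> (\<tau> \<inter> \<rho> - ?T)" by blast
 moreover have "(\<sigma> \<inter> \<rho> - ?T) \<inter> (\<tau> \<inter> \<rho> - ?T) = {}" by blast
 ultimately have "card (\<sigma> \<inter> \<rho> - ?T) + card (\<tau> \<inter> \<rho> - ?T) = 2"
  using assms(4) fin by (simp add: card_Un_disjoint)
 then have "card ?T = 1"
  using card_Diff_subset[OF fT sub(2)] card_Diff_subset[OF fT sub(3)] card_mono[OF fin(2) sub(2)] card_mono[OF fin(3) sub(3)] assms(2,3) by linarith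
 then obtain p where p: "?T = {p}" by (rule card_1_singletonE)
 have *: "\<exists>q. X = {p, q} \<and> q ~= p" if "card X = 2" "p \<in> X" for X :: "'a set"
  using that by (auto simp: card_2_iff)
 have pm: "p \<in> \<sigma>" "p \<in> \<tau>" "p \<in> \<rho>" using p by blast+
 obtain a where a: "\<sigma> \<inter> \<tau> = {p, a}" "a ~= p" using *[OF assms(1)] pm by blast
 obtain b where b: "\<sigma> \<inter> \<rho> = {p, b}" "b ~= p" using *[OF assms(2)] pm by blast
 obtain c where c: "\<tau> \<inter> \<rho> = {p, c}" "c ~= p" using *[OF assms(3)] pm by blast
 have "a \<in> \<sigma>" "a \<in> \<tau>" "b \<in> \<sigma>" "b \<in> \<rho>" "c \<in> \<tau>" "c \<in> \<rho>" using a b c by blast+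
 then have "a ~: \<rho>" "b ~: \<tau>" "c ~: \<sigma>" using p a(2) b(2) c(2) by blast+
 then show ?thesis by (rule that[OF a(1) b(1) c(1)])
qed

lemma sym_diff_cancel: "sym_diff (sym_diff \<sigma> \<tau>) \<sigma> = \<tau>" "sym_diff (sym_diff \<tau> \<sigma>) \<sigma> = \<tau>"
 "sym_diff \<tau> (sym_diff \<sigma> \<tau>) = \<sigma>" "sym_diff (sym_diff \<sigma> \<tau>) \<tau> = \<sigma>"
 by blast+

lemma sym_diff_cyclic: "sym_diff (sym_diff \<tau> \<rho>) \<sigma> = sym_diff (sym_diff \<sigma> \<tau>) \<rho>" "sym_diff (sym_diff \<rho> \<sigma>) \<tau> = sym_diff (sym_diff \<sigma> \<tau>) \<rho>"
 by blast+

lemma sym_diff_empty: "sym_diff \<sigma> \<tau> = {} \<longleftrightarrow> \<sigma> = \<tau>"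
 by blast

context graded begin

lemma br_fst:
 assumes "\<And>i. g i \<in> sp P" "\<And>i. h i \<in> sp P"
 shows "br (g, 0) (h, 0) = (sp_bracket g h, 0)"
proof -
 have l: "lin (g, 0)" "lin (h, 0)" using assms by (auto simp: lin_def)
 have "br (g, 0) (h, 0) = es P (\<epsilon> {} {}) (phi P {} {} (g, 0) (h, 0))"
 proof (rule br_single)
  fix \<sigma>' \<tau>' :: "nat set" assume m: "\<sigma>' \<in> G" "\<tau>' \<in> G" "(\<sigma>', \<tau>') ~= ({}, {})"
  then show "phi P \<sigma>' \<tau>' (g, 0) (h, 0) = 0"
   by (intro phi_0) (use l in auto)
 qed (use empty_G in auto)
 then show ?thesis using empty_G by (simp add: phi_def eps_empty)
qed

lemma br_0: "lin Y ==> br 0 Y = 0"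
 using br_lin(2)[of Y 0 0] by simp

lemma single_tensor: "x \<in> tensor_space \<sigma> ==> snd (0 :: nat => 'v => 'v, single \<sigma> x) \<rho> \<in> tensor_space \<rho>"
 by (auto simp: single_def tensor_space_def)

lemma br_hom_skew: "x \<in> tensor_space \<sigma> ==> y \<in> tensor_space \<tau> ==> br (0, single \<sigma> x) (0, single \<tau> y) = - br (0, single \<tau> y) (0, single \<sigma> x)"
 by (rule br_skew) (rule single_tensor; assumption)+

text \<open>This expresses that the component V(\<emptyset>) acts by derivations: it reduces to
  \<open>bracket_diag\<close> for equal components and to \<open>act_contr\<close> for different
  ones; if the sum of the components lies outside \<open>G\<close>, all brackets vanish.\<close>

lemma jac_sp:
 assumes g: "\<And>i. g i \<in> sp P" and s: "\<sigma> \<in> G" "\<sigma> ~= {}" and t: "\<tau> \<in> G" "\<tau> ~= {}"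
  and x: "x \<in> tensor_space \<sigma>" "y \<in> tensor_space \<tau>"
 shows "jac (g, 0) (0, single \<sigma> x) (0, single \<tau> y) = 0"
proof -
 have fin: "finite \<sigma>" "finite \<tau>" using s t fin_G by auto
 have lg: "lin (g, 0)" using g by (simp add: lin_def)
 have ay: "- act P \<tau> g y \<in> tensor_space \<tau>"
  using tensor_space_closed by simp
 have A: "br (br (0, single \<tau> y) (g, 0)) (0, single \<sigma> x) = br (0, single \<sigma> x) (0, single \<tau> (act P \<tau> g y))"
  unfolding br_sp_hom(2)[OF t g] br_hom_skew[OF ay x(1)]
  using br_lin(4)[of "(0, single \<sigma> x)" "-1" "(0, single \<tau> (act P \<tau> g y))"]
  by (simp add: es_single single_uminus)
 consider "\<sigma> = \<tau>" | "\<sigma> ~= \<tau>" "sym_diff \<sigma> \<tau> \<in> G" | "\<sigma> ~= \<tau>" "sym_diff \<sigma> \<tau> ~: G" by blast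
 then show ?thesis
 proof cases
  case 1
  have d: "\<And>i. diag P \<tau> x y i \<in> sp P" using diag_sp[OF fin(2)] x 1 by (blast intro: sp_if)
  have "\<And>i. sps P (\<epsilon> \<tau> \<tau>) (diag P \<tau> x y) i \<in> sp P" unfolding sps_def using d by (rule sp_scl)
  then have "br (sps P (\<epsilon> \<tau> \<tau>) (diag P \<tau> x y), 0) (g, 0) = es P (- \<epsilon> \<tau> \<tau>) (sp_bracket g (diag P \<tau> x y), 0)"
   unfolding sps_def[symmetric] by (subst br_fst) (use g d in \<open>simp_all add: sp_bracket_skew[of _ g] sp_bracket_lin es_fst SPS.scale_minus_left\<close>)
  then show ?thesis
   using 1 s t bracket_diag[OF fin(2) g, of x y] x
   unfolding jac_def A br_sp_hom(1)[OF s g]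
   by (simp add: br_hom es_fst SPS.scale_right_distrib zero_prod_def)
 next
  case 2
  have "sym_diff \<sigma> \<tau> ~= {}" using 2(1) by blast
  note b = br_sp_hom(2)[OF 2(2) this g, of "ts (\<epsilon> \<sigma> \<tau>) (contr P \<sigma> \<tau> x y)"]
  show ?thesis
   using s t 2 act_contr[OF fin g x] b
   unfolding jac_def A br_sp_hom(1)[OF s g]
   by (simp add: br_hom act_lin TS.scale_right_distrib zero_prod_def del: Un_iff flip: single_add)
 next
  case 3
  then show ?thesis
   using s t unfolding jac_def A br_sp_hom(1)[OF s g] br_hom[OF s t]
   by (simp only: br_hom[OF s t] if_False br_0[OF lg] add_0)
 qed
qed

context
 fixes \<sigma> \<tau> \<rho> :: "nat set" and x y z :: "'a tensor"
 assumes s: "\<sigma> \<in> G" "\<sigma> ~= {}" and t: "\<tau> \<in> G" "\<tau> ~= {}" and r: "\<rho> \<in> G" "\<rho> ~= {}"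
  and x: "x \<in> tensor_space \<sigma>" "y \<in> tensor_space \<tau>" "z \<in> tensor_space \<rho>"
begin

text \<open>The five shapes that a double bracket of homogeneous elements can take, according to the
  sum of the first two index sets and its sum with the third.\<close>

lemma br_br_same: "\<sigma> = \<tau> ==> br (br (0, single \<sigma> x) (0, single \<tau> y)) (0, single \<rho> z) =
  (0, single \<rho> (ts (\<epsilon> \<sigma> \<sigma>) (act P \<rho> (diag P \<sigma> x y) z)))"
proof -
 assume e: "\<sigma> = \<tau>"
 have "\<And>i. sps P (\<epsilon> \<sigma> \<sigma>) (diag P \<sigma> x y) i \<in> sp P"
  unfolding sps_def using diag_sp[OF fin_G[OF s(1)]] x e by (blast intro: sp_if sp_scl)
 then show ?thesis using e br_hom[OF s t, of x y] r by (simp add: br_sp_hom act_lin_g fin_G)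
qed

lemma br_br_zero: "\<sigma> ~= \<tau> ==> sym_diff \<sigma> \<tau> ~: G ==> br (br (0, single \<sigma> x) (0, single \<tau> y)) (0, single \<rho> z) = 0"
 by (simp only: br_hom[OF s t] if_False br_0 lin_0)

lemma br_br_diag: "\<sigma> ~= \<tau> ==> sym_diff \<sigma> \<tau> = \<rho> ==> br (br (0, single \<sigma> x) (0, single \<tau> y)) (0, single \<rho> z) =
  (sps P (\<epsilon> \<rho> \<rho> * \<epsilon> \<sigma> \<tau>) (diag P \<rho> (contr P \<sigma> \<tau> x y) z), 0)"
 using r by (simp only: br_hom[OF s t] if_False if_True br_hom[OF r r] diag_lin SPS.scale_scale simp_thms)

lemma br_br_contr: "\<sigma> ~= \<tau> ==> sym_diff \<sigma> \<tau> \<in> G ==> sym_diff \<sigma> \<tau> ~= \<rho> ==> sym_diff (sym_diff \<sigma> \<tau>) \<rho> \<in> G ==>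
  br (br (0, single \<sigma> x) (0, single \<tau> y)) (0, single \<rho> z) =
  (0, single (sym_diff (sym_diff \<sigma> \<tau>) \<rho>) (ts (\<epsilon> \<sigma> \<tau> * \<epsilon> (sym_diff \<sigma> \<tau>) \<rho>) (contr P (sym_diff \<sigma> \<tau>) \<rho> (contr P \<sigma> \<tau> x y) z)))"
 using br_hom[of "sym_diff \<sigma> \<tau>" \<rho> "ts (\<epsilon> \<sigma> \<tau>) (contr P \<sigma> \<tau> x y)" z] r sym_diff_empty[of \<sigma> \<tau>]
 by (simp only: br_hom[OF s t] if_False if_True contr_lin ts_ts mult.commute simp_thms not_False_eq_True)

lemma br_br_out: "\<sigma> ~= \<tau> ==> sym_diff \<sigma> \<tau> \<in> G ==> sym_diff \<sigma> \<tau> ~= \<rho> ==> sym_diff (sym_diff \<sigma> \<tau>) \<rho> ~: G ==>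
  br (br (0, single \<sigma> x) (0, single \<tau> y)) (0, single \<rho> z) = 0"
 using br_hom[of "sym_diff \<sigma> \<tau>" \<rho> "ts (\<epsilon> \<sigma> \<tau>) (contr P \<sigma> \<tau> x y)" z] r sym_diff_empty[of \<sigma> \<tau>]
 by (simp only: br_hom[OF s t] if_False if_True simp_thms not_False_eq_True)

end

end

lemma e8_eps_square: "\<sigma> \<in> S_e8 ==> \<tau> \<in> S_e8 ==> eps_e8 \<sigma> \<tau> * eps_e8 \<sigma> \<tau> = (1 :: 'a::field)"
proof -
 assume "\<sigma> \<in> S_e8" "\<tau> \<in> S_e8"
 then obtain x y where xy: "\<sigma> = chi_set x" "\<tau> = chi_set y" unfolding S_e8_bits by blast
 show ?thesis unfolding xy eps_bits by simp
qed

section \<open>The Jacobi identity of \<open>e8\<close> on homogeneous elements\<close>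

context sympl begin

lemma graded_e8: "graded P S_e8 eps_e8"
proof (rule graded.intro[OF sympl_axioms graded_axioms.intro])
 show "finite S_e8" by (rule finite_S_e8)
 show "{} \<in> S_e8" by (rule empty_S_e8)
 fix \<sigma> \<tau> :: "nat set" assume s: "\<sigma> \<in> S_e8"
 show "finite \<sigma>" by (rule S_e8_finite[OF s])
 show "even (card \<sigma>)" using e8_card[OF s] by (cases "\<sigma> = {}") auto
 show "eps_e8 {} \<sigma> = (1 :: 'a)" "eps_e8 \<sigma> {} = (1 :: 'a)" by (rule e8_eps_empty[OF s])+
 assume t: "\<tau> \<in> S_e8" "\<sigma> ~= {}" "\<tau> ~= {}" "\<sigma> ~= \<tau>" "sym_diff \<sigma> \<tau> \<in> S_e8"
 show "eps_e8 \<tau> \<sigma> * (- 1) ^ card (\<sigma> \<inter> \<tau>) = - (eps_e8 \<sigma> \<tau> :: 'a)"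
  unfolding e8_card_int[OF s t(2,1,3-)] e8_eps(1)[OF s t(2,1,3-)] by simp
qed

interpretation E8: graded P S_e8 eps_e8 by (rule graded_e8)

context
 fixes \<sigma> \<tau> \<rho> :: "nat set" and x y z :: "'a tensor"
 assumes s: "\<sigma> \<in> S_e8" "\<sigma> ~= {}" and t: "\<tau> \<in> S_e8" "\<tau> ~= {}" and r: "\<rho> \<in> S_e8" "\<rho> ~= {}"
  and x: "x \<in> tensor_space \<sigma>" "y \<in> tensor_space \<tau>" "z \<in> tensor_space \<rho>"
begin

lemma fin3: "finite \<sigma>" "finite \<tau>" "finite \<rho>"
 using s t r S_e8_finite by auto

lemmas cyc = sym_diff_cyclic(1)[of \<tau> \<rho> \<sigma>] sym_diff_cyclic(2)[of \<rho> \<sigma> \<tau>]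

abbreviation "J8 \<equiv> E8.jac (0, single \<sigma> x) (0, single \<tau> y) (0, single \<rho> z) = 0"

lemma jac_e8_same: assumes e: "\<sigma> = \<tau>" "\<tau> = \<rho>" shows J8
proof -
 have "act P \<rho> (diag P \<rho> x y) z + act P \<rho> (diag P \<rho> y z) x + act P \<rho> (diag P \<rho> z x) y = 0"
  by (rule act_diag_cyclic) (use fin3 e8_card[OF r] x e in auto)
 then show ?thesis
  unfolding E8.jac_def E8.br_br_same[OF s t r x e(1)] E8.br_br_same[OF t r s x(2,3,1) e(2)] E8.br_br_same[OF r s t x(3,1,2) trans[OF e, symmetric]]
  using e by (simp only: add_Pair add_0 flip: single_add TS.scale_right_distrib) (simp add: zero_prod_def)
qed

lemma jac_e8_two: assumes e: "\<sigma> = \<tau>" "\<tau> ~= \<rho>" shows J8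
proof (cases "sym_diff \<tau> \<rho> \<in> S_e8")
 case True
 note x' = x[unfolded e(1)]
 have sr: "sym_diff \<rho> \<tau> = sym_diff \<tau> \<rho>" by blast
 have True': "sym_diff \<rho> \<tau> \<in> S_e8" using True unfolding sr .
 have c: "card (\<tau> \<inter> \<rho>) = 2" by (rule e8_card_int[OF t r e(2) True])
 then obtain p q where pq: "\<tau> \<inter> \<rho> = {p, q}" "p ~= q" by (auto simp: card_2_iff)
 have "card (\<tau> - \<rho>) = 2" using c e8_card[OF t] card_Diff_subset_Int[of \<tau> \<rho>] fin3 by simp
 then obtain a b where ab: "\<tau> - \<rho> = {a, b}" "a ~= b" by (auto simp: card_2_iff)
 have n: "sym_diff \<tau> \<rho> ~= \<tau>" "sym_diff \<rho> \<tau> ~= \<tau>" using r(2) by blast+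
 have sg: "eps_e8 \<tau> \<rho> * eps_e8 (sym_diff \<tau> \<rho>) \<tau> = (1 :: 'a)" "eps_e8 \<rho> \<tau> * eps_e8 (sym_diff \<rho> \<tau>) \<tau> = (- 1 :: 'a)"
  using e8_eps[OF t r e(2) True, where 'a = 'a] e8_eps_square[OF t(1) r(1), where 'a = 'a] unfolding sr by simp_all
 have "act P \<rho> (diag P \<tau> x y) z = contr P (sym_diff \<tau> \<rho>) \<tau> (contr P \<tau> \<rho> y z) x - contr P (sym_diff \<rho> \<tau>) \<tau> (contr P \<rho> \<tau> z x) y"
  by (rule act_diag[OF fin3(2,3) pq ab x'(1,2,3)])
 moreover have "E8.br (E8.br (0, single \<tau> y) (0, single \<rho> z)) (0, single \<tau> x) =
   (0, single \<rho> (contr P (sym_diff \<tau> \<rho>) \<tau> (contr P \<tau> \<rho> y z) x))"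
  using E8.br_br_contr[OF t r t x'(2,3,1) e(2) True n(1)] r(1) unfolding sym_diff_cancel sg by simp
 moreover have "E8.br (E8.br (0, single \<rho> z) (0, single \<tau> x)) (0, single \<tau> y) =
   (0, single \<rho> (- contr P (sym_diff \<rho> \<tau>) \<tau> (contr P \<rho> \<tau> z x) y))"
  using E8.br_br_contr[OF r t t x'(3,1,2) e(2)[symmetric] True' n(2)] r(1) unfolding sym_diff_cancel sg by simp
 ultimately show ?thesis
  unfolding E8.jac_def e(1) E8.br_br_same[OF t t r x' refl] e8_eps_diag[OF t]
  by (simp flip: single_add add: zero_prod_def)
next
 case False
 note x' = x[unfolded e(1)]
 have "\<tau> \<inter> \<rho> = {}" using e8_compl[OF t(1) r(1) False] by blast
 then have "act P \<rho> (diag P \<tau> x y) z = 0"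
  using diag_sp[OF fin3(2) x'(1,2)] by (intro act_zero[OF fin3(3)]) (metis disjoint_iff singletonD)
 moreover have "sym_diff \<rho> \<tau> ~: S_e8" using False by (simp add: Un_commute)
 ultimately show ?thesis
  unfolding E8.jac_def e(1) E8.br_br_same[OF t t r x' refl] E8.br_br_zero[OF t r t x'(2,3,1) e(2) False]
   E8.br_br_zero[OF r t t x'(3,1,2) e(2)[symmetric] \<open>sym_diff \<rho> \<tau> ~: S_e8\<close>]
  by (simp add: zero_prod_def)
qed

lemma jac_e8_compl: assumes e: "sym_diff \<sigma> \<tau> ~: S_e8" "\<rho> ~= \<sigma>" "\<rho> ~= \<tau>" shows J8
proof -
 note c = e8_compl[OF s(1) t(1) e(1)]
 have st: "\<sigma> ~= \<tau>" using e(1) empty_S_e8 by auto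
 have d: "sym_diff \<tau> \<rho> \<in> S_e8" "sym_diff \<rho> \<sigma> \<in> S_e8"
  using e8_compl(1)[OF t(1) r(1)] e8_compl(1)[OF r(1) s(1)] c(1) e by blast+
 have n: "sym_diff \<tau> \<rho> ~= \<sigma>" "sym_diff \<rho> \<sigma> ~= \<tau>" using e(1) r(1) by (metis sym_diff_cancel(2) Un_commute)+
 have out: "sym_diff (sym_diff \<tau> \<rho>) \<sigma> \<in> S_e8"
  using e8_compl(1)[OF d(1) s(1)] c(1) r(2) by blast
 have out': "sym_diff (sym_diff \<rho> \<sigma>) \<tau> \<in> S_e8" using out unfolding cyc .
 obtain a b where ab: "\<sigma> \<inter> \<rho> = {a, b}" "a ~= b"
  using e8_card_int[OF r s e(2) d(2)] by (auto simp: card_2_iff Int_commute)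
 obtain a' b' where ab': "\<tau> \<inter> \<rho> = {a', b'}" "a' ~= b'"
  using e8_card_int[OF t r e(3)[symmetric] d(1)] by (auto simp: card_2_iff)
 have "contr P (sym_diff \<tau> \<rho>) \<sigma> (contr P \<tau> \<rho> y z) x = contr P (sym_diff \<rho> \<sigma>) \<tau> (contr P \<rho> \<sigma> z x) y"
  by (rule contr_disjoint[OF fin3 c(2) ab(1) ab'(1) ab(2) ab'(2) x])
 then show ?thesis
  unfolding E8.jac_def E8.br_br_zero[OF s t r x st e(1)] E8.br_br_contr[OF t r s x(2,3,1) e(3)[symmetric] d(1) n(1) out]
   E8.br_br_contr[OF r s t x(3,1,2) e(2) d(2) n(2) out'] cyc
  by (simp only: add_Pair add_0 flip: single_add TS.scale_left_distrib)
   (simp add: e8_eps_compl[OF s t r e] zero_prod_def del: Un_iff)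
qed

text \<open>Each of the three sets is the sum of the other two, so all three double brackets end in
  V(\<emptyset>) and \<open>diag_contr_cyclic\<close> applies with equal signs.\<close>

lemma jac_e8_sum: assumes e: "\<sigma> ~= \<tau>" "sym_diff \<sigma> \<tau> = \<rho>" shows J8
proof -
 have d: "sym_diff \<tau> \<rho> = \<sigma>" "sym_diff \<rho> \<sigma> = \<tau>" "\<tau> ~= \<rho>" "\<rho> ~= \<sigma>" using e s t by blast+
 have G: "sym_diff \<sigma> \<tau> \<in> S_e8" using e r by simp
 have c: "card (\<sigma> \<inter> \<tau>) = 2" by (rule e8_card_int[OF s t e(1) G])
 then obtain a b where ab: "\<sigma> \<inter> \<tau> = {a, b}" "a ~= b" by (auto simp: card_2_iff)
 have "card (\<sigma> - \<tau>) = 2" using c e8_card[OF s] card_Diff_subset_Int[of \<sigma> \<tau>] fin3 by simp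
 then obtain a1 b1 where ab1: "\<sigma> - \<tau> = {a1, b1}" "a1 ~= b1" by (auto simp: card_2_iff)
 have "card (\<tau> - \<sigma>) = 2" using c e8_card[OF t] card_Diff_subset_Int[of \<tau> \<sigma>] fin3 by (simp add: Int_commute)
 then obtain a2 b2 where ab2: "\<tau> - \<sigma> = {a2, b2}" "a2 ~= b2" by (auto simp: card_2_iff)
 have sg: "eps_e8 \<tau> \<rho> = (eps_e8 \<sigma> \<tau> :: 'a)" "eps_e8 \<rho> \<sigma> = (eps_e8 \<sigma> \<tau> :: 'a)"
  using e8_eps(2,3)[OF s t e(1) G, where 'a = 'a] unfolding e(2) by simp_all
 have "diag P \<rho> (contr P \<sigma> \<tau> x y) z + diag P \<sigma> (contr P \<tau> \<rho> y z) x + diag P \<tau> (contr P \<rho> \<sigma> z x) y = 0"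
  using diag_contr_cyclic[OF fin3(1,2) ab(1) ab1(1) ab2(1) ab(2) ab1(2) ab2(2) x(1,2)] x(3) unfolding e(2) .
 then show ?thesis
  unfolding E8.jac_def E8.br_br_diag[OF s t r x e] E8.br_br_diag[OF t r s x(2,3,1) d(3,1)] E8.br_br_diag[OF r s t x(3,1,2) d(4,2)]
   e8_eps_diag[OF s] e8_eps_diag[OF t] e8_eps_diag[OF r] sg
  by (simp only: add_Pair add_0 flip: SPS.scale_right_distrib) (simp add: zero_prod_def)
qed

text \<open>If the sum of the three sets lies outside \<open>S_e8\<close>, all three double brackets
  vanish. Otherwise all relevant intersections have two elements, exactly one index is common to the
  three sets, and \<open>contr_jacobi\<close> applies.\<close>

lemma jac_e8_generic:
 assumes d: "\<sigma> ~= \<tau>" "\<tau> ~= \<rho>" "\<rho> ~= \<sigma>" "sym_diff \<sigma> \<tau> \<in> S_e8" "sym_diff \<tau> \<rho> \<in> S_e8" "sym_diff \<rho> \<sigma> \<in> S_e8" "sym_diff \<sigma> \<tau> ~= \<rho>"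
 shows J8
proof -
 have n: "sym_diff \<tau> \<rho> ~= \<sigma>" "sym_diff \<rho> \<sigma> ~= \<tau>" using d(7) by blast+
 show ?thesis
 proof (cases "sym_diff (sym_diff \<sigma> \<tau>) \<rho> \<in> S_e8")
  case False
  then show ?thesis
   using E8.br_br_out[OF s t r x d(1,4,7)] E8.br_br_out[OF t r s x(2,3,1) d(2,5) n(1)] E8.br_br_out[OF r s t x(3,1,2) d(3,6) n(2)]
   unfolding cyc E8.jac_def by (simp only: simp_thms add_0)
 next
  case True
  have ne: "sym_diff \<sigma> \<tau> ~= {}" using d(1) by blast
  have c: "card (\<sigma> \<inter> \<tau>) = 2" "card (\<sigma> \<inter> \<rho>) = 2" "card (\<tau> \<inter> \<rho>) = 2" "card (sym_diff \<sigma> \<tau> \<inter> \<rho>) = 2"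
   using e8_card_int[OF s t d(1,4)] e8_card_int[OF t r d(2,5)] e8_card_int[OF r s d(3,6)] e8_card_int[OF d(4) ne r d(7) True]
   by (simp_all only: Int_commute)
  obtain p a b c where I: "\<sigma> \<inter> \<tau> = {p, a}" "\<sigma> \<inter> \<rho> = {p, b}" "\<tau> \<inter> \<rho> = {p, c}" "a ~: \<rho>" "b ~: \<tau>" "c ~: \<sigma>"
   using triple_intersection[OF c] .
  have T': "sym_diff (sym_diff \<tau> \<rho>) \<sigma> \<in> S_e8" "sym_diff (sym_diff \<rho> \<sigma>) \<tau> \<in> S_e8"
   unfolding cyc by (rule True)+
  have sg: "eps_e8 \<tau> \<rho> * eps_e8 (sym_diff \<tau> \<rho>) \<sigma> = (eps_e8 \<sigma> \<tau> * eps_e8 (sym_diff \<sigma> \<tau>) \<rho> :: 'a)"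
   "eps_e8 \<rho> \<sigma> * eps_e8 (sym_diff \<rho> \<sigma>) \<tau> = (eps_e8 \<sigma> \<tau> * eps_e8 (sym_diff \<sigma> \<tau>) \<rho> :: 'a)"
   using e8_eps_cyclic[OF s t r d True, where 'a = 'a] e8_eps_cyclic[OF r s t d(3,1,2,6,4,5) n(2) T'(2), where 'a = 'a] by simp_all
  show ?thesis
   unfolding E8.jac_def E8.br_br_contr[OF s t r x d(1,4,7) True] E8.br_br_contr[OF t r s x(2,3,1) d(2,5) n(1) T'(1)]
    E8.br_br_contr[OF r s t x(3,1,2) d(3,6) n(2) T'(2)] sg cyc
   by (simp only: add_Pair add_0 contr_jacobi[OF fin3 I x] single_0 TS.scale_zero_right zero_prod_def flip: single_add TS.scale_right_distrib)
 qed
qed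

end

text \<open>Up to rotation there are five positions of three index sets: all equal, two equal, two
  complementary, one the sum of the others, generic.\<close>

lemma jac_e8_hom:
 assumes s: "\<sigma> \<in> S_e8" "\<sigma> ~= {}" and t: "\<tau> \<in> S_e8" "\<tau> ~= {}" and r: "\<rho> \<in> S_e8" "\<rho> ~= {}"
  and x: "x \<in> tensor_space \<sigma>" "y \<in> tensor_space \<tau>" "z \<in> tensor_space \<rho>"
 shows "E8.jac (0, single \<sigma> x) (0, single \<tau> y) (0, single \<rho> z) = 0"
proof -
 note c = E8.jac_cyclic[of "(0, single \<sigma> x)" "(0, single \<tau> y)" "(0, single \<rho> z)"]
 note p1 = s t r x and p2 = t r s x(2,3,1) and p3 = r s t x(3,1,2)
 consider "\<sigma> = \<tau>" "\<tau> = \<rho>" | "\<sigma> = \<tau>" "\<tau> ~= \<rho>" | "\<tau> = \<rho>" "\<rho> ~= \<sigma>" | "\<rho> = \<sigma>" "\<sigma> ~= \<tau>"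
  | "\<sigma> ~= \<tau>" "\<tau> ~= \<rho>" "\<rho> ~= \<sigma>" by blast
 then show ?thesis
 proof cases
  case 1 then show ?thesis by (rule jac_e8_same[OF p1])
 next
  case 2 then show ?thesis by (rule jac_e8_two[OF p1])
 next
  case 3 then show ?thesis unfolding c(1) by (rule jac_e8_two[OF p2])
 next
  case 4 then show ?thesis unfolding c(2) by (rule jac_e8_two[OF p3])
 next
  case d: 5
  note d' = d(1)[symmetric] d(2)[symmetric] d(3)[symmetric]
  consider "sym_diff \<sigma> \<tau> ~: S_e8" | "sym_diff \<tau> \<rho> ~: S_e8" | "sym_diff \<rho> \<sigma> ~: S_e8"
   | "sym_diff \<sigma> \<tau> = \<rho>" | "sym_diff \<sigma> \<tau> \<in> S_e8" "sym_diff \<tau> \<rho> \<in> S_e8" "sym_diff \<rho> \<sigma> \<in> S_e8" "sym_diff \<sigma> \<tau> ~= \<rho>"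
   by blast
  then show ?thesis
  proof cases
   case 1 then show ?thesis by (rule jac_e8_compl[OF p1 _ d(3) d'(2)])
  next
   case 2 then show ?thesis unfolding c(1) by (rule jac_e8_compl[OF p2 _ d(1) d'(3)])
  next
   case 3 then show ?thesis unfolding c(2) by (rule jac_e8_compl[OF p3 _ d(2) d'(1)])
  next
   case 4 then show ?thesis by (rule jac_e8_sum[OF p1 d(1)])
  next
   case 5 then show ?thesis by (rule jac_e8_generic[OF p1 d])
  qed
 qed
qed

end

section \<open>Transfer along central extensions\<close>

text \<open>\<open>j\<close> embeds \<open>L'\<close> as a complement of the central subspace \<open>C\<close> in a subalgebra of \<open>L\<close>, and is a
 homomorphism modulo \<open>C\<close>.\<close>

locale odd_transfer = odd_part P s br L S \<iota> sT T t f d a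
 for P :: "('a::field, 'v::ab_group_add) plane" and s :: "'a => 'b => 'b::ab_group_add" and br L S \<iota>
  and sT :: "'a => 't => 't::ab_group_add" and T t f d a +
 fixes C :: "'b set" and s' :: "'a => 'c => 'c::ab_group_add" and br' :: "'c => 'c => 'c" and L' S' :: "'c set"
  and \<iota>' :: "('v => 'v) => 'c" and sT' :: "'a => 'u => 'u::ab_group_add" and T' :: "'u set"
  and t' :: "'u => 'v => 'c" and j :: "'c => 'b" and jT :: "'u => 't"
 assumes vs': "vector_space s'" and vsT': "vector_space sT'"
  and L'_sub: "module.subspace s' L'" and S'_sub: "module.subspace s' S'" and T'_sub: "module.subspace sT' T'"
  and C_sub: "module.subspace s C" and C_S: "C \<subseteq> S"
  and C_br: "c \<in> C ==> X \<in> L' ==> br c (j X) = 0"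
  and S'_L': "S' \<subseteq> L'" and iota'_L': "g \<in> sp P ==> \<iota>' g \<in> L'" and t'_L': "x \<in> T' ==> t' x u \<in> L'"
  and L'_decomp: "X \<in> L' ==> \<exists>p g x y. p \<in> S' \<and> g \<in> sp P \<and> x \<in> T' \<and> y \<in> T' \<and>
   X = p + \<iota>' g + (t' x (bas P False) + t' y (bas P True))"
  and br'_L': "X \<in> L' ==> Y \<in> L' ==> br' X Y \<in> L'"
  and j_add: "X \<in> L' ==> Y \<in> L' ==> j (X + Y) = j X + j Y" and j_scl: "X \<in> L' ==> j (s' k X) = s k (j X)"
  and j_C: "X \<in> L' ==> j X \<in> C ==> X = 0"
  and j_br: "X \<in> L' ==> Y \<in> L' ==> j (br' X Y) - br (j X) (j Y) \<in> C"
  and j_S: "X \<in> S' ==> j X \<in> S" and j_iota: "g \<in> sp P ==> j (\<iota>' g) = \<iota> g"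
  and jT_T: "x \<in> T' ==> jT x \<in> T" and j_t: "x \<in> T' ==> j (t' x u) = t (jT x) u"
  and jT_add: "x \<in> T' ==> y \<in> T' ==> jT (x + y) = jT x + jT y" and jT_scl: "x \<in> T' ==> jT (sT' k x) = sT k (jT x)"
  and jT_inj: "x \<in> T' ==> jT x = 0 ==> x = 0"
  and nontrivial': "\<exists>x\<in>T'. x ~= 0"
  and f_nondeg': "x \<in> T' ==> x ~= 0 ==> \<exists>y\<in>T'. f (jT x) (jT y) ~= 0"
  and regular': "x \<in> T' ==> x ~= 0 ==> \<exists>r\<in>T'. d (jT r) (jT r) = 0 \<and>
   (f (jT r) (jT x) ~= 0 \<or> (\<exists>y\<in>T'. \<exists>z\<in>T'. f (jT r) (tp (jT x) (jT y) (jT z)) ~= 0))"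
begin

sublocale M': vector_space s' by (rule vs')
sublocale N': vector_space sT' by (rule vsT')

lemmas L'_cl = M'.subspace_add[OF L'_sub] M'.subspace_scale[OF L'_sub] M'.subspace_0[OF L'_sub]
 M'.subspace_diff[OF L'_sub] M'.subspace_neg[OF L'_sub]
lemmas T'_cl = N'.subspace_add[OF T'_sub] N'.subspace_scale[OF T'_sub] N'.subspace_0[OF T'_sub] N'.subspace_neg[OF T'_sub]
lemmas C_cl = M.subspace_add[OF C_sub] M.subspace_scale[OF C_sub] M.subspace_0[OF C_sub] M.subspace_diff[OF C_sub] M.subspace_neg[OF C_sub]

lemma S'_L: "X \<in> S' ==> X \<in> L'" using S'_L' by blast

lemma j_diff: "X \<in> L' ==> Y \<in> L' ==> j (X - Y) = j X - j Y"
 using j_add[of "X - Y" Y] L'_cl by simp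

lemma j_0: "j 0 = 0" using j_diff[of 0 0] L'_cl(3) by simp

lemma j_eq: "X \<in> L' ==> Y \<in> L' ==> j X - j Y \<in> C ==> X = Y"
 using j_C[of "X - Y"] j_diff[of X Y] L'_cl(4)[of X Y] by simp

lemma j_inj: "X \<in> L' ==> Y \<in> L' ==> j X = j Y ==> X = Y"
 using j_eq C_cl(3) by simp

lemma j_decomp: "p \<in> S' ==> g \<in> sp P ==> x \<in> T' ==> y \<in> T' ==>
 j (p + \<iota>' g + (t' x b0 + t' y b1)) = j p + \<iota> g + (t (jT x) b0 + t (jT y) b1)"
 using S'_L iota'_L' t'_L' L'_cl(1) by (simp add: j_add j_iota j_t)

lemma j_L: "X \<in> L' ==> j X \<in> L"
 using L'_decomp[of X] j_decomp L_mem[OF j_S _ jT_T jT_T] by auto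

lemma C_L: "c \<in> C ==> c \<in> L" using C_S S_L by blast

text \<open>\<open>W\<close> has a decomposition in \<open>L'\<close>, which \<open>j\<close>
  carries to one of \<open>j W\<close>. Decompositions in \<open>L\<close> are unique, so the
  components of \<open>j W\<close> are the images of those of \<open>W\<close>; in particular they
  lie in the images of \<open>S'\<close> and \<open>T'\<close>.\<close>

lemma split_L:
 assumes W: "W \<in> L'" and e: "j W = p + \<iota> g + (t x b0 + t y b1)" and m: "p \<in> S" "g \<in> sp P" "x \<in> T" "y \<in> T"
 shows "\<exists>p'\<in>S'. \<exists>x'\<in>T'. \<exists>y'\<in>T'. W = p' + \<iota>' g + (t' x' b0 + t' y' b1) \<and> j p' = p \<and> jT x' = x \<and> jT y' = y"
proof -
 obtain p' g' x' y' where W': "p' \<in> S'" "g' \<in> sp P" "x' \<in> T'" "y' \<in> T'" "W = p' + \<iota>' g' + (t' x' b0 + t' y' b1)"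
  using L'_decomp[OF W] by blast
 have m': "j p' \<in> S" "jT x' \<in> T" "jT y' \<in> T" using W' j_S jT_T by blast+
 have n: "(%v. scl P (- 1) (g' v)) = - g'" by (simp add: fun_eq_iff)
 have g: "g - g' \<in> sp P" using sp_add[OF m(2) sp_scl[OF W'(2), of "-1", unfolded n]] by simp
 have ig: "\<iota> (g - g') = \<iota> g - \<iota> g'" using iota_add[OF g(1) W'(2)] by simp
 have e': "(p - j p') + \<iota> (g - g') = t (jT x' - x) b0 + t (jT y' - y) b1"
  using e unfolding W'(5) j_decomp[OF W'(1-4)] ig by (simp add: t_diff m m' algebra_simps)
 have pS: "p - j p' \<in> S" using S_cl(4) m(1) m'(1) by blast
 have z: "(p - j p') + \<iota> (g - g') = 0"
  by (rule L_direct[OF pS g(1) _ _ e']) (use T_closed(4) m m' in blast)+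
 have xy: "jT x' - x = 0 \<and> jT y' - y = 0"
  by (rule t_inj) (use e' z T_closed(4) m m' in auto)
 have "\<iota> (g - g') = - (p - j p')" using z by (simp only: eq_neg_iff_add_eq_0 add.commute)
 then have "\<iota> (g - g') \<in> S" using S_cl(5)[OF pS] by simp
 then have i0: "\<iota> (g - g') = 0" by (rule S_iota[OF g(1)])
 then have "g - g' = 0" by (rule iota_inj[OF g(1)])
 moreover have "j p' = p" using z i0 by simp
 ultimately show ?thesis using W' xy by auto
qed

lemma split_S: "W \<in> L' ==> j W \<in> S ==> W \<in> S'"
proof -
 assume W: "W \<in> L'" "j W \<in> S"
 from split_L[OF W(1), of "j W" 0 0 0] obtain p x y where p: "p \<in> S'" "x \<in> T'" "y \<in> T'" "W = p + \<iota>' 0 + (t' x b0 + t' y b1)" "j p = j W"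
  using W(2) T_closed(3) by auto
 have "W = p" by (rule j_inj[OF W(1) S'_L[OF p(1)] p(5)[symmetric]])
 then show "W \<in> S'" using p(1) by (simp only:)
qed

lemma br'_eq: assumes "X \<in> L'" "Y \<in> L'" "Z \<in> L'" "br (j X) (j Y) - j Z \<in> C" shows "br' X Y = Z"
proof (rule j_eq[OF br'_L'[OF assms(1,2)] assms(3)])
 have "j (br' X Y) - j Z = (j (br' X Y) - br (j X) (j Y)) + (br (j X) (j Y) - j Z)" by simp
 also have "\<dots> \<in> C" by (rule C_cl(1)[OF j_br[OF assms(1,2)] assms(4)])
 finally show "j (br' X Y) - j Z \<in> C" .
qed

text \<open>The bracket of x (x) b0 and y (x) b1 in \<open>L'\<close> is mapped to the bracket in
  \<open>L\<close> up to an element of \<open>C\<close>. As \<open>C\<close> lies in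
  \<open>S\<close>, this changes the \<open>S\<close>-component only, which is \<open>om\<close>
  times d up to \<open>C\<close>; dividing by \<open>om\<close> gives the preimage.\<close>

lemma d'_ex: assumes xy: "x \<in> T'" "y \<in> T'" shows "\<exists>D\<in>S'. j D - d (jT x) (jT y) \<in> C"
proof -
 let ?x = "jT x" and ?y = "jT y"
 note m = jT_T[OF xy(1)] jT_T[OF xy(2)]
 define W where "W = br' (t' x b0) (t' y b1)"
 have WL: "W \<in> L'" unfolding W_def using xy by (intro br'_L' t'_L')
 define c where "c = j W - br (t ?x b0) (t ?y b1)"
 have c: "c \<in> C" unfolding c_def W_def using j_br[OF t'_L' t'_L', OF xy, of b0 b1] xy by (simp add: j_t)
 let ?g = "%v. scl P (f ?x ?y) (gam P b0 b1 v)"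
 have g: "?g \<in> sp P" by (rule sp_scl[OF gam_sp])
 have pS: "s om (d ?x ?y) + c \<in> S" using S_cl(1,2) d_S[OF m] c C_S by blast
 have "j W = (s om (d ?x ?y) + c) + \<iota> ?g + (t 0 b0 + t 0 b1)"
  unfolding d_eq[OF m] iota_scl[OF gam_sp] by (simp add: c_def)
 from split_L[OF WL this pS g T_closed(3) T_closed(3)] obtain p where p: "p \<in> S'" "j p = s om (d ?x ?y) + c" by blast
 have "j (s' (1 / om) p) - d ?x ?y = s (1 / om) c"
  unfolding j_scl[OF S'_L[OF p(1)]] p(2) using om_nz by (simp add: M.scale_right_distrib)
 then show ?thesis using C_cl(2)[OF c] M'.subspace_scale[OF S'_sub p(1)] by metis
qed

text \<open>The error in \<open>C\<close> lies in \<open>S\<close> and leaves the odd component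
  untouched. So the action on \<open>T\<close> is matched exactly and not just modulo
  \<open>C\<close>.\<close>

lemma a'_ex: assumes D: "D \<in> S'" and z: "z \<in> T'" shows "\<exists>w\<in>T'. jT w = a (j D) (jT z)"
proof -
 note m = j_S[OF D] jT_T[OF z]
 define W where "W = br' D (t' z b0)"
 have WL: "W \<in> L'" unfolding W_def by (intro br'_L' t'_L' S'_L D z)
 define c where "c = j W - br (j D) (t (jT z) b0)"
 have c: "c \<in> C" unfolding c_def W_def using j_br[OF S'_L[OF D] t'_L'[OF z], of b0] z by (simp add: j_t)
 have "j W = c + \<iota> 0 + (t (a (j D) (jT z)) b0 + t 0 b1)"
  unfolding c_def S_T[OF m] by simp
 from split_L[OF WL this _ _ a_T[OF m] T_closed(3)] c C_S show ?thesis by auto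
qed

definition "d' x y = (SOME D. D \<in> S' \<and> j D - d (jT x) (jT y) \<in> C)"
definition "a' D z = (SOME w. w \<in> T' \<and> jT w = a (j D) (jT z))"
definition "f' x y = f (jT x) (jT y)"

lemma d': assumes "x \<in> T'" "y \<in> T'" shows "d' x y \<in> S'" "j (d' x y) - d (jT x) (jT y) \<in> C"
 using someI_ex[of "%D. D \<in> S' \<and> j D - d (jT x) (jT y) \<in> C"] d'_ex[OF assms] unfolding d'_def by blast+

lemma a': assumes "D \<in> S'" "z \<in> T'" shows "a' D z \<in> T'" "jT (a' D z) = a (j D) (jT z)"
 using someI_ex[of "%w. w \<in> T' \<and> jT w = a (j D) (jT z)"] a'_ex[OF assms] unfolding a'_def by blast+

lemma jT_diff: "x \<in> T' ==> y \<in> T' ==> jT (x - y) = jT x - jT y"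
 using jT_add[of "x - y" y] N'.subspace_diff[OF T'_sub, of x y] by simp

lemma C_a: assumes c: "c \<in> C" and z: "z \<in> T'" shows "a c (jT z) = 0"
proof -
 have "t (a c (jT z)) b1 = t 0 b1"
  using C_br[OF c t'_L'[OF z], of b1] S_T[of c "jT z" b1] c C_S jT_T[OF z] z by (auto simp: j_t)
 then show ?thesis by (rule t_inj1[rotated 2]) (use a_T c C_S jT_T[OF z] T_closed(3) in auto)
qed

lemma a_d': assumes "x \<in> T'" "y \<in> T'" "z \<in> T'" shows "jT (a' (d' x y) z) = a (d (jT x) (jT y)) (jT z)"
proof -
 note D = d'[OF assms(1,2)] and m = jT_T[OF assms(1)] jT_T[OF assms(2)] jT_T[OF assms(3)]
 have c: "j (d' x y) - d (jT x) (jT y) \<in> S" using D C_S by blast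
 have "a (j (d' x y)) (jT z) = a (d (jT x) (jT y) + (j (d' x y) - d (jT x) (jT y))) (jT z)" by simp
 also have "\<dots> = a (d (jT x) (jT y)) (jT z)"
  unfolding a_lin(1)[OF d_S[OF m(1,2)] c m(3,3)] C_a[OF D(2) assms(3)] by simp
 finally show ?thesis using a'(2)[OF D(1) assms(3)] by simp
qed

lemma jT_tp': assumes "x \<in> T'" "y \<in> T'" "z \<in> T'"
 shows "jT (a' (d' x y) z - sT' (f' x z) y - sT' (f' y z) x) = tp (jT x) (jT y) (jT z)"
proof -
 note w = a'(1)[OF d'(1)[OF assms(1,2)] assms(3)]
 show ?thesis
  unfolding jT_diff[OF N'.subspace_diff[OF T'_sub w T'_cl(2)[OF assms(2)]] T'_cl(2)[OF assms(1)]] jT_diff[OF w T'_cl(2)[OF assms(2)]]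
   jT_scl[OF assms(1)] jT_scl[OF assms(2)] a_d'[OF assms] f'_def tp_def ..
qed

text \<open>Every identity in \<open>L'\<close> is tested after applying \<open>j\<close>. It is
  enough that both sides agree modulo \<open>C\<close>, because \<open>j X\<close> in
  \<open>C\<close> forces X = 0; the corresponding identity in \<open>L\<close> is then
  available.\<close>

lemma odd_part': "odd_part P s' br' L' S' \<iota>' sT' T' t' f' d' a'"
proof (rule odd_part.intro[OF sympl_axioms odd_part_axioms.intro])
 show "vector_space s'" "vector_space sT'" "M'.subspace S'" "N'.subspace T'" by (rule vs' vsT' S'_sub T'_sub)+
 note i = iota'_L' S'_L t'_L' L'_cl
 show "\<iota>' (g + h) = \<iota>' g + \<iota>' h" if "g \<in> sp P" "h \<in> sp P" for g h
  by (rule j_inj) (use that i sp_add in \<open>auto simp: j_add j_iota iota_add\<close>)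
 show "\<iota>' (%v. scl P c (g v)) = s' c (\<iota>' g)" if "g \<in> sp P" for g c
  by (rule j_inj) (use that i sp_scl in \<open>auto simp: j_scl j_iota iota_scl\<close>)
 show "g = 0" if "g \<in> sp P" "\<iota>' g = 0" for g
  using iota_inj[OF that(1)] j_iota[OF that(1)] that(2) j_0 by simp
 show "\<iota>' g = 0" if "g \<in> sp P" "\<iota>' g \<in> S'" for g
  by (rule j_inj) (use that i j_S[OF that(2)] S_iota[OF that(1)] in \<open>auto simp: j_iota j_0\<close>)
 show "t' (x + y) u = t' x u + t' y u" if "x \<in> T'" "y \<in> T'" for x y u
  by (rule j_inj) (use that i T'_cl in \<open>auto simp: j_add j_t jT_add t_add1 jT_T\<close>)
 show "t' (sT' c x) u = s' c (t' x u)" if "x \<in> T'" for x c u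
  by (rule j_inj) (use that i T'_cl in \<open>auto simp: j_scl j_t jT_scl t_scl1 jT_T\<close>)
 show "t' x (u + v) = t' x u + t' x v" if "x \<in> T'" for x u v
  by (rule j_inj) (use that i in \<open>auto simp: j_add j_t t_add2 jT_T\<close>)
 show "t' x (scl P c u) = s' c (t' x u)" if "x \<in> T'" for x c u
  by (rule j_inj) (use that i in \<open>auto simp: j_scl j_t t_scl2 jT_T\<close>)
 show "x = 0 \<and> y = 0" if "x \<in> T'" "y \<in> T'" "t' x b0 + t' y b1 = 0" for x y
 proof -
  have "t (jT x) b0 + t (jT y) b1 = 0" using j_add[OF t'_L' t'_L', OF that(1,2), of b0 b1] that j_0 by (simp add: j_t)
  then show ?thesis using t_inj[OF jT_T jT_T, OF that(1,2)] jT_inj that by blast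
 qed
 have L': "p + \<iota>' g + (t' x b0 + t' y b1) \<in> L'" if "p \<in> S'" "g \<in> sp P" "x \<in> T'" "y \<in> T'" for p g x y
  using that i by auto
 show "L' = {p + \<iota>' g + (t' x b0 + t' y b1) |p g x y. p \<in> S' \<and> g \<in> sp P \<and> x \<in> T' \<and> y \<in> T'}"
  using L'_decomp L' by blast
 show "p + \<iota>' g = 0" if "p \<in> S'" "g \<in> sp P" "x \<in> T'" "y \<in> T'" "p + \<iota>' g = t' x b0 + t' y b1" for p g x y
 proof (rule j_inj)
  have "j p + \<iota> g = t (jT x) b0 + t (jT y) b1"
   using arg_cong[OF that(5), of j] unfolding j_add[OF S'_L[OF that(1)] iota'_L'[OF that(2)]]
    j_add[OF t'_L'[OF that(3)] t'_L'[OF that(4)]] j_iota[OF that(2)] j_t[OF that(3)] j_t[OF that(4)] .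
  then have "j p + \<iota> g = 0" using L_direct j_S jT_T that by blast
  then show "j (p + \<iota>' g) = j 0"
   unfolding j_add[OF S'_L[OF that(1)] iota'_L'[OF that(2)]] j_iota[OF that(2)] j_0 .
 qed (use that i in auto)
 show "br' (X + Y) Z = br' X Z + br' Y Z" if "X \<in> L'" "Y \<in> L'" "Z \<in> L'" for X Y Z
 proof (rule br'_eq)
  have "br (j (X + Y)) (j Z) - j (br' X Z + br' Y Z) = - ((j (br' X Z) - br (j X) (j Z)) + (j (br' Y Z) - br (j Y) (j Z)))"
   using that by (simp add: j_add br_add j_L br'_L')
  also have "\<dots> \<in> C" using C_cl(5) C_cl(1) j_br that by blast
  finally show "br (j (X + Y)) (j Z) - j (br' X Z + br' Y Z) \<in> C" .
 qed (use that i br'_L' in auto)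
 show "br' (s' c X) Y = s' c (br' X Y)" if "X \<in> L'" "Y \<in> L'" for X Y c
 proof (rule br'_eq)
  have "br (j (s' c X)) (j Y) - j (s' c (br' X Y)) = - s c (j (br' X Y) - br (j X) (j Y))"
   using that by (simp add: j_scl br_scl j_L br'_L' M.scale_right_diff_distrib)
  also have "\<dots> \<in> C" using C_cl(5) C_cl(2) j_br that by blast
  finally show "br (j (s' c X)) (j Y) - j (s' c (br' X Y)) \<in> C" .
 qed (use that i br'_L' in auto)
 show "br' X Y = - br' Y X" if "X \<in> L'" "Y \<in> L'" for X Y
 proof (rule br'_eq)
  have "j (- br' Y X) = - j (br' Y X)" using j_diff[of 0 "br' Y X"] that br'_L' i by (simp add: j_0)
  then have "br (j X) (j Y) - j (- br' Y X) = j (br' Y X) - br (j Y) (j X)"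
   using br_anti[OF j_L j_L, OF that] by simp
  also have "\<dots> \<in> C" using j_br that by blast
  finally show "br (j X) (j Y) - j (- br' Y X) \<in> C" .
 qed (use that i br'_L' in auto)
 show "br' D E \<in> S'" if "D \<in> S'" "E \<in> S'" for D E
 proof (rule split_S)
  show "br' D E \<in> L'" using that br'_L' i by blast
  have "j (br' D E) = (j (br' D E) - br (j D) (j E)) + br (j D) (j E)" by simp
  also have "\<dots> \<in> S" using S_cl(1) j_br[OF S'_L S'_L, OF that] C_S S_closed[OF j_S j_S, OF that] by blast
  finally show "j (br' D E) \<in> S" .
 qed
 show "br' D (\<iota>' g) = 0" if "D \<in> S'" "g \<in> sp P" for D g
  by (rule br'_eq) (use that i in \<open>auto simp: j_iota j_0 S_sp j_S C_cl\<close>)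
 show "br' (\<iota>' g) (\<iota>' h) = \<iota>' (%v. g (h v) - h (g v))" if "g \<in> sp P" "h \<in> sp P" for g h
  by (rule br'_eq) (use that i sp_closed in \<open>auto simp: j_iota sp_sp C_cl\<close>)
 show "br' (\<iota>' g) (t' z u) = t' z (g u)" if "g \<in> sp P" "z \<in> T'" for g z u
  by (rule br'_eq) (use that i in \<open>auto simp: j_iota j_t sp_T jT_T C_cl\<close>)
 show "a' D z \<in> T'" if "D \<in> S'" "z \<in> T'" for D z by (rule a'(1)[OF that])
 show "br' D (t' z u) = t' (a' D z) u" if "D \<in> S'" "z \<in> T'" for D z u
  by (rule br'_eq) (use that i a' in \<open>auto simp: j_t S_T j_S jT_T C_cl\<close>)
 show "d' x y \<in> S'" if "x \<in> T'" "y \<in> T'" for x y by (rule d'(1)[OF that])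
 show "br' (t' x u) (t' y v) = s' (form P u v) (d' x y) + s' (f' x y) (\<iota>' (gam P u v))" if "x \<in> T'" "y \<in> T'" for x y u v
 proof (rule br'_eq)
  have "br (j (t' x u)) (j (t' y v)) - j (s' (form P u v) (d' x y) + s' (f' x y) (\<iota>' (gam P u v)))
   = - s (form P u v) (j (d' x y) - d (jT x) (jT y))"
   using that i d' by (simp add: j_t T_T jT_T j_add j_scl j_iota gam_sp f'_def M.scale_right_diff_distrib)
  also have "\<dots> \<in> C" using C_cl(5) C_cl(2) d'[OF that] by blast
  finally show "br (j (t' x u)) (j (t' y v)) - j (s' (form P u v) (d' x y) + s' (f' x y) (\<iota>' (gam P u v))) \<in> C" .
 qed (use that i d' gam_sp in auto)
 show "br' (br' D (t' y v)) (t' z w) + br' (br' (t' y v) (t' z w)) D + br' (br' (t' z w) D) (t' y v) = 0"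
  if D: "D \<in> S' \<or> D \<in> {t' x u |x u. x \<in> T'}" and yz: "y \<in> T'" "z \<in> T'" for D y z v w
 proof -
  define Y Z where YZ: "Y = t' y v" "Z = t' z w"
  have L: "D \<in> L'" "Y \<in> L'" "Z \<in> L'" using D yz i unfolding YZ by auto
  have jD: "j D \<in> S \<or> j D \<in> {t x u | x u. x \<in> T}" using D j_S jT_T j_t by blast
  have jYZ: "j Y = t (jT y) v" "j Z = t (jT z) w" using YZ yz j_t by auto
  \<comment> \<open>Inside a bracket with an element of the image, the central error of the inner
    bracket disappears. Hence a double bracket also has an error in \<open>C\<close> only.\<close>
  have b: "br (j (br' A B)) (j E) = br (br (j A) (j B)) (j E)" if "A \<in> L'" "B \<in> L'" "E \<in> L'" for A B E
  proof -
   have "br (j (br' A B)) (j E) = br (br (j A) (j B) + (j (br' A B) - br (j A) (j B))) (j E)" by simp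
   also have "\<dots> = br (br (j A) (j B)) (j E)"
   proof -
    have c: "j (br' A B) - br (j A) (j B) \<in> C" by (rule j_br[OF that(1,2)])
    have "j (br' A B) - (j (br' A B) - br (j A) (j B)) \<in> L"
     using M.subspace_diff[OF L_sub j_L[OF br'_L'[OF that(1,2)]] C_L[OF c]] .
    then have "br (j A) (j B) \<in> L" by simp
    from br_add[OF this C_L[OF c] j_L[OF that(3)]] show ?thesis using C_br[OF c that(3)] by simp
   qed
   finally show ?thesis .
  qed
  have J: "br (br (j D) (j Y)) (j Z) + br (br (j Y) (j Z)) (j D) + br (br (j Z) (j D)) (j Y) = 0"
   unfolding jYZ by (rule jacobi[OF jD jT_T jT_T, OF yz])
  have c: "j (br' (br' A B) E) - br (br (j A) (j B)) (j E) \<in> C" if "A \<in> L'" "B \<in> L'" "E \<in> L'" for A B E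
   using j_br[OF br'_L'[OF that(1,2)] that(3)] unfolding b[OF that] .
  have L2: "br' (br' D Y) Z \<in> L'" "br' (br' Y Z) D \<in> L'" "br' (br' Z D) Y \<in> L'" using L br'_L' by blast+
  have "j (br' (br' D Y) Z + br' (br' Y Z) D + br' (br' Z D) Y) =
   (j (br' (br' D Y) Z) - br (br (j D) (j Y)) (j Z)) + (j (br' (br' Y Z) D) - br (br (j Y) (j Z)) (j D))
   + (j (br' (br' Z D) Y) - br (br (j Z) (j D)) (j Y))
   + (br (br (j D) (j Y)) (j Z) + br (br (j Y) (j Z)) (j D) + br (br (j Z) (j D)) (j Y))"
   unfolding j_add[OF L'_cl(1)[OF L2(1,2)] L2(3)] j_add[OF L2(1,2)] by (simp only: algebra_simps)
  also have "\<dots> \<in> C" unfolding J add_0_right using c L by (intro C_cl(1)) blast+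
  finally show ?thesis unfolding YZ[symmetric] using j_C L'_cl(1) L2 by blast
 qed
 show "\<exists>y\<in>T'. f' x y ~= 0" if "x \<in> T'" "x ~= 0" for x using f_nondeg'[OF that] unfolding f'_def .
 show "\<exists>x\<in>T'. x ~= 0" by (rule nontrivial')
 show "\<exists>r\<in>T'. d' r r = 0 \<and> (f' r x ~= 0 \<or> (\<exists>y\<in>T'. \<exists>z\<in>T'. f' r (a' (d' x y) z - sT' (f' x z) y - sT' (f' y z) x) ~= 0))"
  if x: "x \<in> T'" "x ~= 0" for x
 proof -
  from regular'[OF x] obtain r where r: "r \<in> T'" "d (jT r) (jT r) = 0"
   "f (jT r) (jT x) ~= 0 \<or> (\<exists>y\<in>T'. \<exists>z\<in>T'. f (jT r) (tp (jT x) (jT y) (jT z)) ~= 0)" by blast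
  have "d' r r = 0" using d'[OF r(1) r(1)] r(2) j_C S'_L by simp
  moreover have "f' r (a' (d' x y) z - sT' (f' x z) y - sT' (f' y z) x) = f (jT r) (tp (jT x) (jT y) (jT z))"
   if "y \<in> T'" "z \<in> T'" for y z unfolding f'_def[of r] jT_tp'[OF x(1) that] ..
  moreover have "f' r x = f (jT r) (jT x)" by (rule f'_def)
  ultimately show ?thesis using r by (intro bexI[of _ r]) auto
 qed
qed

theorem decomposition': "freudenthal_decomposition P s' br' L' S' \<iota>' sT' T' t'"
 by (rule odd_part.decomposition[OF odd_part'])

end

section \<open>The algebras \<open>e\<^sub>8\<close> and \<open>e\<^sub>7\<close>\<close>

lemma chi_e7: "chi_set (False, False, False, False) = {}" "chi_set (True, False, False, False) = {1,2,5,6}"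
 "chi_set (False, True, False, False) = {2,3,6,7}" "chi_set (True, True, False, False) = {1,3,5,7}"
 "chi_set (False, False, True, False) = {1,2,3,4}" "chi_set (True, False, True, False) = {3,4,5,6}"
 "chi_set (False, True, True, False) = {1,4,6,7}" "chi_set (True, True, True, False) = {2,4,5,7}"
 unfolding chi_set_def le8 by auto

text \<open>The last coordinate of \<open>chi4\<close> is x4 alone, so the index 8 occurs exactly
  for quadruples with x4 = 1; the other eight quadruples are listed in
  \<open>chi_e7\<close>.\<close>

lemma S_e7_S_e8: "S_e7 = {\<sigma> \<in> S_e8. 8 ~: \<sigma>}"
proof -
 have 1: "chi_set (p, q, r, False) \<in> S_e7" for p q r
  unfolding S_e7_def by (cases p; cases q; cases r) (simp_all only: chi_e7 insert_iff simp_thms)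
 have 2: "S_e7 \<subseteq> S_e8"
 proof
  fix \<sigma> assume "\<sigma> \<in> S_e7"
  then have "\<exists>p q r. \<sigma> = chi_set (p, q, r, False)" unfolding S_e7_def using chi_e7 by (elim insertE emptyE) metis+
  then show "\<sigma> \<in> S_e8" using chi_S_e8 by auto
 qed
 have 8: "8 \<in> chi_set (p, q, r, s) \<longleftrightarrow> s" for p q r s
  by (simp add: chi_set_def)
 show ?thesis
 proof (intro equalityI subsetI)
  fix \<sigma> assume s: "\<sigma> \<in> S_e7"
  then have "8 ~: \<sigma>" unfolding S_e7_def by auto
  then show "\<sigma> \<in> {\<sigma> \<in> S_e8. 8 ~: \<sigma>}" using 2 s by blast
 next
  fix \<sigma> assume "\<sigma> \<in> {\<sigma> \<in> S_e8. 8 ~: \<sigma>}"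
  then obtain x where x: "\<sigma> = chi_set x" "8 ~: chi_set x" unfolding S_e8_bits by blast
  obtain p q r s where "x = (p, q, r, s)" by (cases x) auto
  then show "\<sigma> \<in> S_e7" using x 8 1 by (cases s) auto
 qed
qed

lemma S_d6_S_e7: "S_d6 = {\<sigma> \<in> S_e7. 4 ~: \<sigma>}"
 unfolding S_d6_def S_e7_def by auto

context sympl begin

interpretation E8: graded P S_e8 eps_e8 by (rule graded_e8)

lemma jac_e8:
 assumes S: "S \<subseteq> S_e8" and cl: "\<And>\<sigma> \<tau>. \<sigma> \<in> S ==> \<tau> \<in> S ==> sym_diff \<sigma> \<tau> \<in> S_e8 ==> sym_diff \<sigma> \<tau> \<in> S"
  and N: "\<And>\<sigma>. \<sigma> \<in> S ==> \<sigma> \<subseteq> N"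
  and X: "X \<in> algebra_space P N S" and Y: "Y \<in> algebra_space P N S" "fst Y = 0"
  and Z: "Z \<in> algebra_space P N S" "fst Z = 0"
 shows "E8.br (E8.br X Y) Z + E8.br (E8.br Y Z) X + E8.br (E8.br Z X) Y = 0"
proof -
 have "E8.jac X Y Z = 0"
  by (rule E8.jac_induct[OF S cl N _ _ X Y Z]; (assumption | rule E8.jac_sp jac_e8_hom subsetD[OF S])+)
 then show ?thesis unfolding E8.jac_def .
qed

lemma graded_odd_e8: "graded_odd P S_e8 eps_e8 S_e8 8 {1..8}"
proof (rule graded_odd.intro[OF graded_e8 graded_odd_axioms.intro])
 show "eps_e8 \<sigma> \<sigma> ~= (0 :: 'a)" if "\<sigma> \<in> S_e8" for \<sigma>
  using e8_eps_square[OF that that, where 'a = 'a] by auto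
 show "\<exists>\<sigma>\<in>S_e8. 8 \<in> \<sigma>"
 proof
  show "chi_set (True, False, False, True) \<in> S_e8" unfolding chi_S_e8 by simp
  show "8 \<in> chi_set (True, False, False, True)" by (simp add: chi_set_def)
 qed
 show "E8.br (E8.br X Y) Z + E8.br (E8.br Y Z) X + E8.br (E8.br Z X) Y = 0"
  if "X \<in> algebra_space P {1..8} S_e8" "Y \<in> algebra_space P {1..8} S_e8" "Z \<in> algebra_space P {1..8} S_e8" "fst Y = 0" "fst Z = 0" for X Y Z
  by (rule jac_e8[OF order_refl _ S_e8_sub that(1,2,4,3,5)])
qed (use S_e8_sub in auto)

lemma graded_odd_e7: "graded_odd P S_e8 eps_e8 S_e7 4 {1..7}"
proof -
 have S: "S_e7 \<subseteq> S_e8" and cl: "\<And>\<sigma> \<tau>. \<sigma> \<in> S_e7 ==> \<tau> \<in> S_e7 ==> sym_diff \<sigma> \<tau> \<in> S_e8 ==> sym_diff \<sigma> \<tau> \<in> S_e7"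
  unfolding S_e7_S_e8 by blast+
 have N: "\<sigma> \<subseteq> {1..7}" if "\<sigma> \<in> S_e7" for \<sigma>
  using that unfolding S_e7_def by (elim insertE emptyE) simp_all
 show ?thesis
 proof (rule graded_odd.intro[OF graded_e8 graded_odd_axioms.intro])
  show "S_e7 \<subseteq> S_e8" by (rule S)
  show "eps_e8 \<sigma> \<sigma> ~= (0 :: 'a)" if "\<sigma> \<in> S_e7" for \<sigma>
   using e8_eps_square[of \<sigma> \<sigma>, where 'a = 'a] S that by auto
  show "\<exists>\<sigma>\<in>S_e7. 4 \<in> \<sigma>" unfolding S_e7_def by simp
  show "E8.br (E8.br X Y) Z + E8.br (E8.br Y Z) X + E8.br (E8.br Z X) Y = 0"
   if "X \<in> algebra_space P {1..7} S_e7" "Y \<in> algebra_space P {1..7} S_e7" "Z \<in> algebra_space P {1..7} S_e7" "fst Y = 0" "fst Z = 0" for X Y Z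
   by (rule jac_e8[OF S cl N that(1,2,4,3,5)])
 qed (use N cl in \<open>simp_all del: Un_iff\<close>)
qed

lemma decomposition_e8: "freudenthal_decomposition P (es P) (bracket_e8 P) (e8 P) (e7 P) (sp_elt 8) fs T_e8_e7 (odd_elt P 8)"
proof -
 interpret O: graded_odd P S_e8 eps_e8 S_e8 8 "{1..8}" by (rule graded_odd_e8)
 have "{\<sigma> \<in> S_e8. 8 ~: \<sigma>} = S_e7" "S_e8 - S_e7 = {\<sigma> \<in> S_e8. 8 \<in> \<sigma>}" unfolding S_e7_S_e8 by blast+
 moreover have "{1..8} - {8 :: nat} = {1..7}" by auto
 ultimately have e: "O.L = e8 P" "O.A = e7 P" "O.T = T_e8_e7"
  by (simp_all only: O.L_def e8_def O.A_def O.S0_def e7_def O.T_def T_e8_e7_def)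
 have "card \<sigma> \<ge> 3" if "\<sigma> \<in> S_e8" "8 \<in> \<sigma>" for \<sigma>
 proof -
  have "\<sigma> ~= {}" using that by blast
  then show ?thesis using e8_card[OF that(1)] by simp
 qed
 then show ?thesis using O.decomposition_card unfolding e bracket_e8_def by blast
qed

lemma e7_eqs:
 shows "graded_odd.L P S_e7 {1..7} = e7 P" "graded_odd.A P S_e7 4 {1..7} = d6 P" "(graded_odd.T S_e7 4 :: (nat set => 'a tensor) set) = T_e7_d6"
proof -
 interpret O: graded_odd P S_e8 eps_e8 S_e7 4 "{1..7}" by (rule graded_odd_e7)
 have "{\<sigma> \<in> S_e7. 4 ~: \<sigma>} = S_d6" "S_e7 - S_d6 = {\<sigma> \<in> S_e7. 4 \<in> \<sigma>}" unfolding S_d6_S_e7 by blast+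
 moreover have "{1..7} - {4 :: nat} = {1,2,3,5,6,7}" by auto
 ultimately show "O.L = e7 P" "O.A = d6 P" "O.T = T_e7_d6"
  by (simp_all only: O.L_def O.A_def O.S0_def e7_def O.T_def d6_def T_e7_d6_def)
qed

lemma e7_card: "\<sigma> \<in> S_e7 ==> 4 \<in> \<sigma> ==> card \<sigma> \<ge> 3"
 unfolding S_e7_def by auto

lemma decomposition_e7: "freudenthal_decomposition P (es P) (bracket_e8 P) (e7 P) (d6 P) (sp_elt 4) fs T_e7_d6 (odd_elt P 4)"
proof -
 interpret O: graded_odd P S_e8 eps_e8 S_e7 4 "{1..7}" by (rule graded_odd_e7)
 show ?thesis using O.decomposition_card[OF e7_card] unfolding e7_eqs bracket_e8_def by simp
qed

end

section \<open>Tensors with two additional factors\<close>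

context sympl begin

lemma join_commute: "k ~= l ==> join P k (join P l x u) v = join P l (join P k x v) u"
proof -
 assume "k ~= l"
 moreover have "\<kappa> - {k} - {l} = \<kappa> - {l} - {k}" for \<kappa> :: "nat set" by blast
 ultimately show ?thesis by (simp add: join_def fun_eq_iff)
qed

context
 fixes k :: nat and \<sigma> \<tau> :: "nat set" and x y :: "'a tensor"
 assumes fin: "finite \<sigma>" "finite \<tau>" and k: "k ~: \<sigma>" "k ~: \<tau>"
  and x: "x \<in> tensor_space \<sigma>" "y \<in> tensor_space \<tau>"
begin

lemma join_insert_in: "join P k x u \<in> tensor_space (insert k \<sigma>)"
 by (rule join_in) (use k x in simp_all)

lemma contr_join_insert: "contr P (insert k \<sigma>) (insert k \<tau>) (join P k x u) (join P k y v) = ts (form P u v) (contr P \<sigma> \<tau> x y)"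
 using contr_join[of "insert k \<sigma>" "insert k \<tau>" k x y u v] fin k x by simp

lemma contr_join_insert_right: "contr P \<sigma> (insert k \<tau>) x (join P k y u) = join P k (contr P \<sigma> \<tau> x y) u"
 using contr_join_right[of \<sigma> "insert k \<tau>" k x y u] fin k x by simp

text \<open>Reduced to the right-hand version by exchanging the arguments twice. The two signs are
  equal, since \<open>k\<close> is not contracted, and cancel.\<close>

lemma contr_join_insert_left: "contr P (insert k \<sigma>) \<tau> (join P k x u) y = join P k (contr P \<sigma> \<tau> x y) u"
proof -
 have "contr P (insert k \<sigma>) \<tau> (join P k x u) y = ts ((- 1) ^ card (\<sigma> \<inter> \<tau>)) (contr P \<tau> (insert k \<sigma>) y (join P k x u))"
  using contr_commute[of \<tau> "insert k \<sigma>" y "join P k x u"] fin k x join_insert_in by (simp add: Int_commute)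
 also have "contr P \<tau> (insert k \<sigma>) y (join P k x u) = join P k (contr P \<tau> \<sigma> y x) u"
  using contr_join_right[of \<tau> "insert k \<sigma>" k y x u] fin k x by simp
 also have "contr P \<tau> \<sigma> y x = ts ((- 1) ^ card (\<sigma> \<inter> \<tau>)) (contr P \<sigma> \<tau> x y)"
  by (rule contr_commute[OF fin x])
 finally show ?thesis by (simp add: join_lin ts_ts power_add[symmetric] flip: mult_2)
qed

end

context
 fixes k :: nat and \<sigma> :: "nat set" and x y :: "'a tensor"
 assumes fin: "finite \<sigma>" and k: "k ~: \<sigma>" and x: "x \<in> tensor_space \<sigma>" "y \<in> tensor_space \<sigma>"
begin

lemma act_join_insert: "(\<And>i. g i \<in> sp P) ==> act P (insert k \<sigma>) g (join P k x u) = join P k (act P \<sigma> g x) u + join P k x (g k u)"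
 using act_join[of "insert k \<sigma>" k g x u] fin k x by simp

lemma diag_join_insert: "diag P (insert k \<sigma>) (join P k x u) (join P k y v) = sps P (form P u v) (diag P \<sigma> x y)
  + sps P (- (1 / 2) * tform P \<sigma> x y) (nu k (gam P u v))"
 using diag_join[of "insert k \<sigma>" k x y u v] fin k x by simp

lemma tform_join_insert: "tform P (insert k \<sigma>) (join P k x u) (join P k y v) = form P u v * tform P \<sigma> x y"
proof -
 let ?\<Phi> = "%x y. tform P (insert k \<sigma>) (join P k x u) (join P k y v) - form P u v * tform P \<sigma> x y"
 have f: "finite (insert k \<sigma>)" using fin by simp
 have d: "insert k \<sigma> - {k} = \<sigma>" using k by simp
 have "?\<Phi> x y = 0"
 proof (rule bilinear_zero[where \<Phi> = ?\<Phi>, OF vs_mult fin fin x])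
  fix w z :: "nat => 'v"
  have j: "join P k (pure P \<sigma> w) u = pure P (insert k \<sigma>) (w(k := u))" for w u
   using join_pure[OF f, of k P w u] d by simp
  have "(\<Prod>i\<in>\<sigma>. form P ((w(k := u)) i) ((z(k := v)) i)) = (\<Prod>i\<in>\<sigma>. form P (w i) (z i))"
   using k by (intro prod.cong) auto
  then show "?\<Phi> (pure P \<sigma> w) (pure P \<sigma> z) = 0"
   unfolding j tform_pure[OF P f] tform_pure[OF P fin] prod.insert[OF fin k] by simp
 qed (simp_all add: tform_lin join_lin algebra_simps)
 then show ?thesis by simp
qed

end

definition join2 where "join2 i j x u v = join P j (join P i x u) v"

lemma join2_lin:
 "join2 i j (x + y) u v = join2 i j x u v + join2 i j y u v" "join2 i j (ts c x) u v = ts c (join2 i j x u v)"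
 by (simp_all add: join2_def join_lin)

lemma join2_0 [simp]: "join2 i j 0 u v = 0" by (simp add: join2_def)

lemma join2_commute: "i ~= j ==> join2 i j x u v = join2 j i x v u"
 unfolding join2_def by (rule join_commute) auto

lemma join_join2: "k ~= i ==> k ~= j ==> join P k (join2 i j x u v) w = join2 i j (join P k x w) u v"
 unfolding join2_def by (simp only: join_commute[of k j "join P i x u" v w] join_commute[of k i x u w] simp_thms)

context
 fixes i j :: nat and \<sigma> \<tau> :: "nat set" and x y :: "'a tensor"
 assumes fin: "finite \<sigma>" "finite \<tau>" and i: "i ~: \<sigma>" "i ~: \<tau>" and j: "j ~: \<sigma>" "j ~: \<tau>" and ij: "i ~= j"
  and x: "x \<in> tensor_space \<sigma>" "y \<in> tensor_space \<tau>"
begin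

lemma join2_in: "join2 i j x u v \<in> tensor_space (insert j (insert i \<sigma>))"
 unfolding join2_def using fin i j ij x by (intro join_insert_in) auto

lemma contr_join2_right: "contr P \<sigma> (insert j (insert i \<tau>)) x (join2 i j y u v) = join2 i j (contr P \<sigma> \<tau> x y) u v"
 unfolding join2_def
 by (subst contr_join_insert_right) (use fin i j ij x in \<open>auto intro: join_insert_in simp: contr_join_insert_right\<close>)

lemma contr_join2_both: "contr P (insert j (insert i \<sigma>)) (insert j (insert i \<tau>)) (join2 i j x u v) (join2 i j y u' v')
  = ts (form P v v' * form P u u') (contr P \<sigma> \<tau> x y)"
 unfolding join2_def
 by (subst contr_join_insert) (use fin i j ij x in \<open>auto intro: join_insert_in simp: contr_join_insert ts_ts\<close>)

text \<open>The two pairs share the index \<open>j\<close>, which is contracted. The surviving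
  factors are recorded as the pair \<open>k\<close>, \<open>i\<close>, so that the tails (5,6) and
  (6,7) produce (7,5) in the cyclic orientation.\<close>

lemma contr_join2_chain:
 assumes k: "k ~: \<sigma>" "k ~: \<tau>" "k ~= i" "k ~= j"
 shows "contr P (insert j (insert i \<sigma>)) (insert k (insert j \<tau>)) (join2 i j x u v) (join2 j k y u' v')
  = ts (form P v u') (join2 k i (contr P \<sigma> \<tau> x y) v' u)"
proof -
 have "contr P (insert j (insert i \<sigma>)) (insert k (insert j \<tau>)) (join2 i j x u v) (join P k (join P j y u') v')
  = join P k (contr P (insert j (insert i \<sigma>)) (insert j \<tau>) (join2 i j x u v) (join P j y u')) v'"
  by (rule contr_join_insert_right) (use fin i j ij x k in \<open>auto intro: join2_in join_insert_in\<close>)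
 also have "contr P (insert j (insert i \<sigma>)) (insert j \<tau>) (join2 i j x u v) (join P j y u')
  = ts (form P v u') (contr P (insert i \<sigma>) \<tau> (join P i x u) y)"
  unfolding join2_def by (rule contr_join_insert) (use fin i j ij x k in \<open>auto intro: join_insert_in\<close>)
 also have "contr P (insert i \<sigma>) \<tau> (join P i x u) y = join P i (contr P \<sigma> \<tau> x y) u"
  by (rule contr_join_insert_left) (use fin i j ij x k in auto)
 finally show ?thesis using k join2_commute[of k i] by (simp add: join2_def join_lin)
qed

end

context
 fixes i j :: nat and \<sigma> :: "nat set" and x y :: "'a tensor"
 assumes fin: "finite \<sigma>" and i: "i ~: \<sigma>" and j: "j ~: \<sigma>" and ij: "i ~= j"
  and x: "x \<in> tensor_space \<sigma>" "y \<in> tensor_space \<sigma>"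
begin

lemma act_join2:
 assumes g: "\<And>i. g i \<in> sp P"
 shows "act P (insert j (insert i \<sigma>)) g (join2 i j x u v)
  = join2 i j (act P \<sigma> g x) u v + join2 i j x (g i u) v + join2 i j x u (g j v)"
proof -
 have "act P (insert j (insert i \<sigma>)) g (join2 i j x u v) = join P j (act P (insert i \<sigma>) g (join P i x u)) v + join P j (join P i x u) (g j v)"
  unfolding join2_def by (rule act_join_insert[OF _ _ _ _ g]) (use fin i j ij x in \<open>auto intro: join_insert_in\<close>)
 also have "act P (insert i \<sigma>) g (join P i x u) = join P i (act P \<sigma> g x) u + join P i x (g i u)"
  by (rule act_join_insert[OF fin i x(1,1) g])
 finally show ?thesis unfolding join2_def join_lin .
qed

lemma diag_join2: "diag P (insert j (insert i \<sigma>)) (join2 i j x u v) (join2 i j y u' v')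
  = sps P (form P v v' * form P u u') (diag P \<sigma> x y)
  + sps P (- (1 / 2) * tform P \<sigma> x y) (sps P (form P v v') (nu i (gam P u u')) + sps P (form P u u') (nu j (gam P v v')))"
proof -
 have "diag P (insert j (insert i \<sigma>)) (join2 i j x u v) (join2 i j y u' v')
  = sps P (form P v v') (diag P (insert i \<sigma>) (join P i x u) (join P i y u'))
  + sps P (- (1 / 2) * tform P (insert i \<sigma>) (join P i x u) (join P i y u')) (nu j (gam P v v'))"
  unfolding join2_def by (rule diag_join_insert) (use fin i j ij x in \<open>auto intro: join_insert_in\<close>)
 then show ?thesis
  unfolding diag_join_insert[OF fin i x] tform_join_insert[OF fin i x]
  by (simp add: SPS.scale_right_distrib SPS.scale_right_diff_distrib mult_ac)
qed

end

end

section \<open>Index sets and signs of \<open>f\<^sub>4\<close> and \<open>e\<^sub>6\<close>\<close>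

text \<open>An element of \<open>S_e7\<close> is determined by its intersection with \<open>I4\<close>. With respect to the basis
 \<open>{1,2,5,6}\<close>, \<open>{2,3,6,7}\<close>, \<open>{1,2,3,4}\<close> of \<open>S_e7\<close>, the intersection is \<open>f_set\<close>, the remainder
 \<open>{tail1, tail2}\<close>; the three ordered pairs of tails are related by the cyclic permutation of 5, 6, 7.\<close>

type_synonym bits3 = "bool \<times> bool \<times> bool"

fun f_set :: "bits3 => nat set" where
 "f_set (p, q, r) = {i. i = 1 \<and> p ~= r \<or> i = 2 \<and> p ~= (q ~= r) \<or> i = 3 \<and> q ~= r \<or> i = 4 \<and> r}"

fun e_set :: "bits3 => nat set" where "e_set (p, q, r) = chi_set (p, q, r, False)"
fun tail1 :: "bits3 => nat" where "tail1 (p, q, r) = (if \<not> q then 5 else if \<not> p then 6 else 7)"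
fun tail2 :: "bits3 => nat" where "tail2 (p, q, r) = (if \<not> q then 6 else if \<not> p then 7 else 5)"
fun long :: "bits3 => bool" where "long (p, q, r) = (p \<or> q)"
fun xor3 :: "bits3 => bits3 => bits3" where "xor3 (p, q, r) (p', q', r') = (p ~= p', q ~= q', r ~= r')"

abbreviation "zero3 \<equiv> (False, False, False)"
abbreviation "full3 \<equiv> (False, False, True)"

lemma f_sets: "f_set zero3 = {}" "f_set (True, False, False) = {1,2}" "f_set (False, True, False) = {2,3}" "f_set (True, True, False) = {1,3}"
 "f_set full3 = I4" "f_set (True, False, True) = {3,4}" "f_set (False, True, True) = {1,4}" "f_set (True, True, True) = {2,4}"
 by (auto simp: I4_def)

lemma f_set_compl: "I4 - f_set (p, q, r) = f_set (p, q, \<not> r)"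
 by (auto simp: I4_def)

lemma f_set_sub: "f_set x \<subseteq> {1..4}"
 by (cases x) auto

lemma fin_f_set [simp]: "finite (f_set x)"
 using f_set_sub finite_subset by blast

lemma f_set_inj: "f_set x = f_set y \<longleftrightarrow> x = y"
proof
 assume "f_set x = f_set y"
 then have m: "i \<in> f_set x \<longleftrightarrow> i \<in> f_set y" for i by simp
 show "x = y" using m[of 1] m[of 2] m[of 3] m[of 4] by (cases x; cases y) (simp, argo)
qed simp

lemma f_set_xor: "sym_diff (f_set x) (f_set y) = f_set (xor3 x y)"
 by (cases x; cases y) auto

declare f_set.simps [simp del]

lemma A4_f_set: "A4 = f_set ` {(True, False, False), (False, True, False), (True, True, False)}"
 unfolding A4_def image_insert f_sets image_empty by auto

lemma UNIV_bits3: "(UNIV :: bits3 set) = {zero3, (True, False, False), (False, True, False), (True, True, False),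
  full3, (True, False, True), (False, True, True), (True, True, True)}"
 by auto

lemma S_f4_f_set: "S_f4 = range f_set"
proof -
 have c: "(%\<alpha>. I4 - \<alpha>) ` A4 = f_set ` {(True, False, True), (False, True, True), (True, True, True)}"
  unfolding A4_f_set by (simp only: image_insert image_empty f_set_compl) simp
 have d: "{{}, I4} = f_set ` {zero3, full3}" by (simp only: image_insert image_empty f_sets)
 show ?thesis unfolding S_f4_def c d unfolding A4_f_set image_Un[symmetric] UNIV_bits3
  by (rule arg_cong[of _ _ "image f_set"]) blast
qed

lemma A4_iff: "f_set (p, q, r) \<in> A4 \<longleftrightarrow> (p \<or> q) \<and> \<not> r"
 unfolding A4_f_set by (auto simp only: image_iff f_set_inj bex_simps insert_iff)

lemma I4_iff: "f_set x = I4 \<longleftrightarrow> x = full3" "f_set x = {} \<longleftrightarrow> x = zero3"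
 by (simp_all only: f_sets(1,5)[symmetric] f_set_inj)

lemma e_set_f_set: "e_set x = (if long x then insert (tail2 x) (insert (tail1 x) (f_set x)) else f_set x)"
proof -
 obtain p q r where x: "x = (p, q, r)" by (cases x)
 show ?thesis unfolding x
  by (cases p; cases q; cases r)
   (simp_all only: e_set.simps chi_e7 f_sets long.simps tail1.simps tail2.simps if_True if_False simp_thms I4_def, auto)
qed

lemma e_set_inj: "e_set x = e_set y \<longleftrightarrow> x = y"
 by (cases x; cases y) (simp add: inj_chi_set)

lemma e_set_xor: "sym_diff (e_set x) (e_set y) = e_set (xor3 x y)"
 by (cases x; cases y) (simp flip: chi_xor)

lemma S_e7_e_set: "S_e7 = range e_set"
 unfolding UNIV_bits3 S_e7_def by (simp only: image_insert image_empty e_set.simps chi_e7)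

lemma tails: "tail1 x ~: f_set y" "tail2 x ~: f_set y" "tail1 x ~= tail2 x" "tail1 x ~= 4" "tail2 x ~= 4"
 using f_set_sub[of y] by (cases x; auto)+

text \<open>The pair of planes of \<open>y\<close> follows that of \<open>x\<close> in the cycle
  (5,6), (6,7), (7,5). Two long sets with long sum have different pairs, and one of them always
  follows the other.\<close>

definition succ3 :: "bits3 => bits3 => bool" where
 "succ3 x y \<longleftrightarrow> long x \<and> long y \<and> tail2 x = tail1 y"

lemma succ3:
 assumes "succ3 x y"
 shows "tail2 x = tail1 y" "tail1 x ~= tail2 y" "tail1 (xor3 x y) = tail2 y" "tail2 (xor3 x y) = tail1 x" "long (xor3 x y)"
 using assms unfolding succ3_def by (cases x; cases y; auto split: if_splits)+

lemma succ3_cases: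
 assumes "long x" "long y" "long (xor3 x y)"
 shows "succ3 x y \<or> succ3 y x"
 using assms unfolding succ3_def by (cases x; cases y) auto

lemma card_le4: "A \<subseteq> {1..4 :: nat} ==> card A = of_bool (1 \<in> A) + of_bool (2 \<in> A) + of_bool (3 \<in> A) + of_bool (4 \<in> A)"
proof -
 assume "A \<subseteq> {1..4}"
 then have "A = {1, 2, 3, 4} \<inter> A" by auto
 then have "card A = (\<Sum>i\<in>{1, 2, 3, 4 :: nat}. of_bool (i \<in> A))"
  by (simp add: of_bool_def sum.If_cases Int_def)
 then show ?thesis by simp
qed

lemma card_f_set: "succ3 x y ==> card (f_set x \<inter> f_set y) = 1" "long x ==> card (f_set x) = 2"
proof -
 have s: "f_set x \<inter> f_set y \<subseteq> {1..4}" using f_set_sub by blast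
 show "succ3 x y ==> card (f_set x \<inter> f_set y) = 1"
  unfolding card_le4[OF s] succ3_def by (cases x; cases y) (auto simp: f_set.simps split: if_splits)
 show "long x ==> card (f_set x) = 2"
  unfolding card_le4[OF f_set_sub] by (cases x) (auto simp: f_set.simps)
qed

lemma eps_f4_bits: "eps_f4 (f_set (p, q, r)) (f_set (p', q', r')) =
 (if (\<not> p \<and> \<not> q \<and> \<not> r) \<or> (\<not> p' \<and> \<not> q' \<and> \<not> r') then 1
  else if (\<not> p \<and> \<not> q \<and> r) \<and> (\<not> p' \<and> \<not> q' \<and> r') then - 1
  else if \<not> p' \<and> \<not> q' \<and> r' then (if (p \<or> q) \<and> \<not> r then 1 else - 1)
  else if \<not> p \<and> \<not> q \<and> r then (if (p' \<or> q') \<and> \<not> r' then - 1 else 1)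
  else if p' = p \<and> q' = q \<and> r' = r then - 2
  else if p' = p \<and> q' = q \<and> r' = (\<not> r) then (if (p \<or> q) \<and> \<not> r then - 2 else 2)
  else if ((p \<or> q) \<and> \<not> r) \<and> ((p' \<or> q') \<and> \<not> r') then 1 else - 1 :: 'a::field)"
 unfolding eps_f4_def f_set_compl A4_iff f_set_inj I4_iff by simp

text \<open>The signs of e8 on \<open>S_e7\<close> are those of f4, corrected by the effect of the
  extra planes. The factor 2 for complementary sets is the 1/2 in \<open>eps_e6\<close>; the minus
  sign for a pair in reverse order belongs to the one additional contraction, in the shared
  plane.\<close>

lemma eps_e7_f4:
 "eps_e8 (e_set full3) (e_set full3) = (- 1 :: 'a::field)"
 "long x ==> eps_e8 (e_set full3) (e_set x) = (eps_f4 I4 (f_set x) :: 'a)"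
 "long x ==> eps_e8 (e_set x) (e_set full3) = (eps_f4 (f_set x) I4 :: 'a)"
 "long x ==> eps_e8 (e_set x) (e_set (xor3 full3 x)) * 2 = (eps_f4 (f_set x) (f_set (xor3 full3 x)) :: 'a)"
 "succ3 x y ==> eps_e8 (e_set x) (e_set y) = (eps_f4 (f_set x) (f_set y) :: 'a)"
 "succ3 x y ==> eps_e8 (e_set y) (e_set x) = (- eps_f4 (f_set y) (f_set x) :: 'a)"
proof -
 obtain p q r p' q' r' where x: "x = (p, q, r)" "y = (p', q', r')" by (cases x; cases y)
 show "eps_e8 (e_set full3) (e_set full3) = (- 1 :: 'a::field)" by (simp add: eps_bits)
 show "long x ==> eps_e8 (e_set full3) (e_set x) = (eps_f4 I4 (f_set x) :: 'a)"
  "long x ==> eps_e8 (e_set x) (e_set full3) = (eps_f4 (f_set x) I4 :: 'a)"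
  "long x ==> eps_e8 (e_set x) (e_set (xor3 full3 x)) * 2 = (eps_f4 (f_set x) (f_set (xor3 full3 x)) :: 'a)"
  unfolding f_sets(5)[symmetric] x xor3.simps eps_f4_bits e_set.simps eps_bits gpar.simps
  by (cases p; cases q; cases r; simp)+
 assume "succ3 x y"
 then have c: "(p \<or> q) \<and> (p' \<or> q') \<and> (p' = q) \<and> (q' = (p ~= q))"
  unfolding succ3_def x by (auto split: if_splits)
 show "eps_e8 (e_set x) (e_set y) = (eps_f4 (f_set x) (f_set y) :: 'a)"
  "eps_e8 (e_set y) (e_set x) = (- eps_f4 (f_set y) (f_set x) :: 'a)"
  unfolding x eps_f4_bits e_set.simps eps_bits gpar.simps
  using c by (cases p; cases q; cases r; cases r'; simp)+
qed

section \<open>The algebra \<open>e\<^sub>6\<close>\<close>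

lemma parts_simps [simp]:
 "sp_part (g, t, x) = g" "t2_part (g, t, x) = t" "tens_part (g, t, x) = x"
 "sp_part (X + Y) = sp_part X + sp_part Y" "t2_part (X + Y) = t2_part X + t2_part Y" "tens_part (X + Y) = tens_part X + tens_part Y"
 "sp_part 0 = 0" "t2_part 0 = 0" "tens_part 0 = 0"
 by (simp_all add: sp_part_def t2_part_def tens_part_def)

lemma parts_eq: "X = Y \<longleftrightarrow> sp_part X = sp_part Y \<and> t2_part X = t2_part Y \<and> tens_part X = tens_part Y"
 by (auto simp: sp_part_def t2_part_def tens_part_def prod_eq_iff)

lemma parts_mem: "X \<in> A \<times> B \<times> C \<longleftrightarrow> sp_part X \<in> A \<and> t2_part X \<in> B \<and> tens_part X \<in> C"
 by (simp add: sp_part_def t2_part_def tens_part_def mem_Times_iff)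

lemma t2s_simps [simp]: "fst (t2s c t) = c * fst t" "fst (snd (t2s c t)) = c * fst (snd t)" "snd (snd (t2s c t)) = c * snd (snd t)"
 by (simp_all add: t2s_def case_prod_beta)

lemma t2_iff: "t \<in> t2 \<longleftrightarrow> fst t + fst (snd t) + snd (snd t) = 0"
 by (simp add: t2_def case_prod_beta)

lemma fs6_apply: "fs6 c x \<sigma> e = ts c (x \<sigma> e)" by (simp add: fs6_def)

lemma vs_fs6: "vector_space (fs6 :: 'a::field => _)"
 by unfold_locales (simp_all add: fs6_def fun_eq_iff ts_def algebra_simps)

lemma family6D: "x \<in> family_space6 S ==> x \<sigma> e \<in> tensor_space \<sigma>" "x \<in> family_space6 S ==> \<sigma> ~: S \<or> e ~: elabels \<sigma> ==> x \<sigma> e = 0"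
 for x :: "nat set => elabel => 'a::field tensor"
proof -
 assume "x \<in> family_space6 S"
 then have "x \<sigma> e \<in> (if \<sigma> \<in> S \<and> e \<in> elabels \<sigma> then tensor_space \<sigma> else {0})" unfolding family_space6_def by blast
 then show "x \<sigma> e \<in> tensor_space \<sigma>" "\<sigma> ~: S \<or> e ~: elabels \<sigma> ==> x \<sigma> e = 0" by (auto split: if_splits)
qed

lemma family6I: "(\<And>\<sigma> e. \<sigma> \<in> S ==> e \<in> elabels \<sigma> ==> x \<sigma> e \<in> tensor_space \<sigma>) ==> (\<And>\<sigma> e. \<sigma> ~: S \<or> e ~: elabels \<sigma> ==> x \<sigma> e = 0) ==> x \<in> family_space6 S"
 unfolding family_space6_def by auto

lemma family6_subspace: "module.subspace fs6 (family_space6 S :: (nat set => elabel => 'a::field tensor) set)"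
proof -
 interpret vector_space "fs6 :: 'a => (nat set => elabel => 'a tensor) => _" by (rule vs_fs6)
 show ?thesis
 proof (rule subspaceI)
  show "0 \<in> family_space6 S" by (rule family6I) simp_all
  show "x + y \<in> family_space6 S" if "x \<in> family_space6 S" "y \<in> family_space6 S" for x y :: "nat set => elabel => 'a tensor"
   by (rule family6I) (simp_all add: family6D[OF that(1)] family6D[OF that(2)])
  show "fs6 c x \<in> family_space6 S" if "x \<in> family_space6 S" for c and x :: "nat set => elabel => 'a tensor"
   by (rule family6I) (simp_all add: family6D[OF that] fs6_apply)
 qed
qed

lemma single_family6: "\<sigma> \<in> S ==> (\<And>e. z e \<in> tensor_space \<sigma>) ==> (\<And>e. e ~: elabels \<sigma> ==> z e = 0) ==> single \<sigma> z \<in> family_space6 S"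
 by (rule family6I) (auto simp: single_def)

lemma elabels_f_set: "elabels (f_set x) = (if x = full3 then {E0} else {EP, EM})"
proof -
 have "f_set x ~= {1, 2, 3}"
 proof
  assume "f_set x = {1, 2, 3}"
  then have m: "i \<in> f_set x \<longleftrightarrow> i \<in> {1, 2, 3}" for i by simp
  show False using m[of 1] m[of 2] m[of 3] m[of 4] by (cases x) (auto simp: f_set.simps)
 qed
 then show ?thesis unfolding elabels_def I4_def[symmetric] I4_iff by simp
qed

lemma f_set_compl3: "I4 - f_set x = f_set (xor3 full3 x)"
 by (cases x) (simp add: f_set_compl)

lemma long_xor: "long (xor3 full3 x) = long x" "tail1 (xor3 full3 x) = tail1 x" "tail2 (xor3 full3 x) = tail2 x"
 by (cases x; simp)+

lemma bits3_cases: obtains "x = zero3" | "x = full3" | "long x" "x ~= zero3" "x ~= full3"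
 by (cases x) auto

lemma e_set_empty: "e_set x = {} \<longleftrightarrow> x = zero3"
 using e_set_inj[of x zero3] by (simp add: chi_e7)

lemma e_set_full: "e_set full3 = I4"
 by (simp add: chi_e7 I4_def)

lemma fin_e_set [simp]: "finite (e_set x)"
 unfolding e_set_f_set by simp

lemma t2_coeff_f_set: "t2_coeff (f_set (p, q, r)) t =
  (if p \<and> \<not> q then fst t else if q \<and> \<not> p then fst (snd t) else if p \<and> q then snd (snd t) else 0)"
 unfolding t2_coeff_def f_sets(2-4,6-8)[symmetric] f_set_inj by (auto simp: case_prod_beta)

lemma a_vec_f_set: "long (p, q, r) ==> a_vec (f_set (p, q, r)) =
  (if p \<and> \<not> q then (1, - (1 / 2), - (1 / 2)) else if q \<and> \<not> p then (- (1 / 2), 1, - (1 / 2)) else (- (1 / 2), - (1 / 2), 1))"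
 unfolding a_vec_def f_sets(2-4,6-8)[symmetric] f_set_inj by auto

context sympl begin

lemma vs_es6: "vector_space (es6 P)"
 by unfold_locales
  (simp_all add: es6_def prod_eq_iff fun_eq_iff t2s_def case_prod_beta sps_def ts_def sp_part_def t2_part_def tens_part_def algebra_simps)

sublocale ES6: vector_space "es6 P" by (rule vs_es6)

lemma es6_parts [simp]: "sp_part (es6 P c X) = sps P c (sp_part X)" "t2_part (es6 P c X) = t2s c (t2_part X)"
 "tens_part (es6 P c X) = fs6 c (tens_part X)"
 by (simp_all add: es6_def fs6_def)

text \<open>Scaling by 1/\<open>om\<close> gives eigenvalue 1 on b1 and -1 on b0, whatever value the
  form takes on the basis.\<close>

definition hh :: "'v => 'v" where "hh = (%v. scl P (1 / om) (gam P b1 b0 v))"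

lemma hh_sp [simp]: "hh \<in> sp P"
 unfolding hh_def by (rule sp_scl[OF gam_sp])

lemma hh_bas: "hh b1 = b1" "hh b0 = scl P (- 1) b0"
 by (rule vec_eqI; unfold hh_def coord_scl; simp add: coord_gam form_bas om_nz)+

lemma nu_gam: "nu k (gam P b1 b0) = sps P om (nu k hh)" "nu k (gam P b0 b1) = sps P om (nu k hh)"
 using om_nz by (simp_all add: nu_def sps_def fun_eq_iff hh_def gam_commute[of b0 b1])

lemma nu_sp_all: "g \<in> sp P ==> nu k g i \<in> sp P" by (simp add: nu_def)

subsection \<open>The embedding of \<open>e\<^sub>6\<close> in \<open>e\<^sub>7\<close>\<close>

text \<open>The two scalings are chosen to respect the products of labels. For e+ with e+ the
  vectors b0 and b1 meet in the shared plane, which asks for omP omP om = omM; for e- with e- the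
  order is reversed, which asks for - omM omM om = omP.\<close>

definition omP :: 'a where "omP = - (1 / om)"
definition omM :: 'a where "omM = 1 / om"

lemma om_inverse: "omP * (omM * (om * om)) = - 1" "omP * (omP * om) = omM" "omM * (omM * om) = omM" "omM = - omP"
 using om_nz by (simp_all add: omP_def omM_def)

definition emb :: "bits3 => (elabel => 'a tensor) => 'a tensor" where
 "emb x z = (if long x then ts omP (join2 (tail1 x) (tail2 x) (z EP) b1 b0) + ts omM (join2 (tail1 x) (tail2 x) (z EM) b0 b1)
  else z E0)"

text \<open>The entries of \<open>t2\<close> prescribe the differences c5 - c6, c6 - c7, c7 - c5 of
  torus coefficients. They determine these up to a common constant; the normalisation c6 = 0 gives
  c5 = \<alpha>0 and c7 = - \<alpha>1.\<close>

definition emb_fst :: "('a, 'v) elt6 => nat => 'v => 'v" where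
 "emb_fst X = sp_part X + sps P (fst (t2_part X)) (nu 5 hh) + sps P (- fst (snd (t2_part X))) (nu 7 hh)"

definition emb6 :: "('a, 'v) elt6 => ('a, 'v) elt" where
 "emb6 X = (emb_fst X, \<Sum>x\<in>UNIV - {zero3}. single (e_set x) (emb x (tens_part X (f_set x))))"

definition center7 :: "('a, 'v) elt set" where
 "center7 = range (%c. (sps P c (nu 5 hh + nu 6 hh + nu 7 hh), 0))"

lemma emb_lin: "emb x (z + z') = emb x z + emb x z'" "emb x (%e. ts c (z e)) = ts c (emb x z)"
 by (simp_all add: emb_def join2_lin TS.scale_right_distrib ts_ts mult.commute)

lemma emb_0 [simp]: "emb x 0 = 0" "emb x (%e. 0) = 0"
 by (simp_all add: emb_def)

lemma emb_uminus: "emb x (- z) = - emb x z"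
proof -
 have "(%e. ts (- 1) (z e)) = - z" by (simp add: fun_eq_iff)
 then show ?thesis using emb_lin(2)[of x "-1" z] by simp
qed

lemma emb_in: "(\<And>e. z e \<in> tensor_space (f_set x)) ==> emb x z \<in> tensor_space (e_set x)"
proof -
 assume z: "\<And>e. z e \<in> tensor_space (f_set x)"
 have "join2 (tail1 x) (tail2 x) (z e) u v \<in> tensor_space (insert (tail2 x) (insert (tail1 x) (f_set x)))" for e u v
  by (rule join2_in[OF fin_f_set fin_f_set tails(1,1,2,2,3) z z])
 then show ?thesis unfolding emb_def e_set_f_set using z by (auto intro!: tensor_space_closed)
qed

lemma snd_emb6:
 "snd (emb6 X) (e_set x) = (if x = zero3 then 0 else emb x (tens_part X (f_set x)))"
 "\<rho> ~: S_e7 ==> snd (emb6 X) \<rho> = 0"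
proof -
 have "snd (emb6 X) \<rho> = (\<Sum>y\<in>UNIV - {zero3}. single (e_set y) (emb y (tens_part X (f_set y))) \<rho>)" for \<rho>
  unfolding emb6_def snd_conv by (rule sum_apply)
 moreover have "single (e_set y) z (e_set x) = (if y = x then z else 0)" for x y and z :: "'a tensor"
  by (auto simp: single_def e_set_inj)
 moreover have "single (e_set y) z \<rho> = 0" if "\<rho> ~: S_e7" for y \<rho> and z :: "'a tensor"
  using that unfolding S_e7_e_set single_def by auto
 ultimately show "snd (emb6 X) (e_set x) = (if x = zero3 then 0 else emb x (tens_part X (f_set x)))" "\<rho> ~: S_e7 ==> snd (emb6 X) \<rho> = 0"
  by (simp_all del: e_set.simps)
qed

lemma fst_emb6: "fst (emb6 X) = emb_fst X" by (simp add: emb6_def)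

lemma elt_eqI:
 assumes "fst U = fst V" "\<And>x. x ~= zero3 ==> snd U (e_set x) = snd V (e_set x)"
  "snd U {} = snd V {}" "\<And>\<rho>. \<rho> ~: S_e7 ==> snd U \<rho> = snd V \<rho>"
 shows "U = V"
proof (rule prod_eqI[OF assms(1)])
 show "snd U = snd V"
 proof
  fix \<rho> show "snd U \<rho> = snd V \<rho>"
   using assms(2-4) chi_e7(1) unfolding S_e7_e_set e_set_empty[symmetric] by (cases "\<rho> \<in> range e_set"; cases "\<rho> = {}") auto
 qed
qed

lemma snd_emb6_empty: "snd (emb6 X) {} = 0"
 using snd_emb6(1)[of X zero3] by (simp add: chi_e7)

lemma emb6_lin: "emb6 (X + Y) = emb6 X + emb6 Y" "emb6 (es6 P c X) = es P c (emb6 X)"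
proof -
 have "emb_fst (X + Y) = emb_fst X + emb_fst Y"
  by (simp add: emb_fst_def SPS.scale_left_distrib SPS.scale_left_diff_distrib SPS.scale_minus_left algebra_simps)
 moreover have "(tens_part X + tens_part Y) (f_set x) = tens_part X (f_set x) + tens_part Y (f_set x)" for x by simp
 ultimately show "emb6 (X + Y) = emb6 X + emb6 Y"
  by (intro elt_eqI) (simp_all add: fst_emb6 snd_emb6 snd_emb6_empty emb_lin del: e_set.simps)
 have "emb_fst (es6 P c X) = sps P c (emb_fst X)"
  by (simp add: emb_fst_def SPS.scale_right_distrib SPS.scale_right_diff_distrib)
 moreover have "fs6 c (tens_part X) (f_set x) = (%e. ts c (tens_part X (f_set x) e))" for x by (simp add: fs6_def)
 ultimately show "emb6 (es6 P c X) = es P c (emb6 X)"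
  by (intro elt_eqI) (simp_all add: fst_emb6 snd_emb6 snd_emb6_empty emb_lin fs_apply del: e_set.simps)
qed

lemma emb6_0: "emb6 0 = 0" using emb6_lin(2)[of 0 0] by simp

lemma emb6_sum: "emb6 (\<Sum>i\<in>I. F i) = (\<Sum>i\<in>I. emb6 (F i))"
 by (induction I rule: infinite_finite_induct) (simp_all only: sum.infinite sum.empty sum.insert emb6_0 emb6_lin not_False_eq_True)

lemma emb6_fst: "emb6 (g, 0, 0) = (g, 0)"
 by (rule elt_eqI) (simp_all add: fst_emb6 snd_emb6 snd_emb6_empty emb_fst_def del: e_set.simps)

lemma emb6_single: "x ~= zero3 ==> emb6 (0, 0, single (f_set x) z) = (0, single (e_set x) (emb x z))"
proof -
 assume x: "x ~= zero3"
 have "single (f_set x) z (f_set y) = (if y = x then z else 0)" for y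
  by (auto simp: single_def f_set_inj)
 moreover have "single (e_set x) w (e_set y) = (if y = x then w else 0)" for y and w :: "'a tensor"
  by (auto simp: single_def e_set_inj)
 moreover have "single (e_set x) w {} = 0" for w :: "'a tensor"
  using x e_set_empty[of x] by (auto simp: single_def)
 moreover have "\<rho> ~: S_e7 ==> single (e_set x) w \<rho> = 0" for \<rho> and w :: "'a tensor"
  unfolding S_e7_e_set by (auto simp: single_def)
 ultimately show ?thesis
  using x by (intro elt_eqI) (auto simp: fst_emb6 snd_emb6 snd_emb6_empty emb_fst_def simp del: e_set.simps)
qed

subsection \<open>Compatibility with the brackets\<close>

lemma join2_scl: "join2 i j x (scl P c u) v = ts c (join2 i j x u v)" "join2 i j x u (scl P c v) = ts c (join2 i j x u v)"
 by (simp_all add: join2_def join_lin)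

lemma join2_diff: "join2 i j (x - y) u v = join2 i j x u v - join2 i j y u v"
 using join2_lin(1)[of i j "x - y" y u v] by simp

lemma join2_uminus: "join2 i j x (- u) v = - join2 i j x u v" "join2 i j x u (- v) = - join2 i j x u v"
 using join2_scl(1)[of i j x "-1" u v] join2_scl(2)[of i j x u "-1" v] by simp_all

context
 fixes X :: "('a, 'v) elt6"
 assumes X: "sp_part X \<in> sp_power P {1..4}" "t2_part X \<in> t2"
begin

lemma sp_part_sp: "sp_part X i \<in> sp P" "i ~: {1..4} ==> sp_part X i = 0"
proof -
 have "sp_part X i \<in> (if i \<in> {1..4} then sp P else {0})" using X(1) unfolding sp_power_def by blast
 then show "sp_part X i \<in> sp P" "i ~: {1..4} ==> sp_part X i = 0" using sp_0 by (auto split: if_splits)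
qed

lemma emb_fst_sp: "emb_fst X i \<in> sp P"
proof -
 have s: "sps P c (nu k hh) i \<in> sp P" for c k
  unfolding sps_def by (rule sp_scl[OF nu_sp_all[OF hh_sp]])
 show ?thesis
  using sp_add[OF sp_add[OF sp_part_sp(1) s] s] by (simp only: emb_fst_def plus_fun_apply[of _ _ i])
qed

lemma emb_fst_f: "i \<in> f_set x ==> emb_fst X i = sp_part X i"
proof -
 assume "i \<in> f_set x"
 then have "i ~= 5" "i ~= 7" using f_set_sub[of x] by auto
 then show ?thesis by (simp add: emb_fst_def nu_def sps_def fun_eq_iff)
qed

lemma emb_fst_tail:
 "emb_fst X 5 = (%v. scl P (fst (t2_part X)) (hh v))" "emb_fst X 6 = (%v. scl P 0 (hh v))"
 "emb_fst X 7 = (%v. scl P (- fst (snd (t2_part X))) (hh v))"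
 using sp_part_sp(2)[of 5] sp_part_sp(2)[of 6] sp_part_sp(2)[of 7] by (simp_all add: emb_fst_def nu_def sps_def fun_eq_iff)

lemma act_emb:
 assumes x: "x ~= zero3" and z: "\<And>e. z e \<in> tensor_space (f_set x)"
 shows "act P (e_set x) (emb_fst X) (emb x z) = emb x (act6 P (f_set x) X z)"
proof (cases "long x")
 case False
 then have "x = full3" using x by (cases rule: bits3_cases[of x]) auto
 moreover have "act P (f_set x) (emb_fst X) = act P (f_set x) (sp_part X)" by (rule act_cong) (rule emb_fst_f)
 ultimately show ?thesis using False by (simp add: emb_def act6_def e_set_f_set del: e_set.simps)
next
 case True
 define c1 c2 where c: "c1 = (if tail1 x = 5 then fst (t2_part X) else if tail1 x = 6 then 0 else - fst (snd (t2_part X)))"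
  "c2 = (if tail2 x = 5 then fst (t2_part X) else if tail2 x = 6 then 0 else - fst (snd (t2_part X)))"
 have t: "emb_fst X (tail1 x) = (%v. scl P c1 (hh v))" "emb_fst X (tail2 x) = (%v. scl P c2 (hh v))"
  unfolding c using emb_fst_tail by (cases x; auto)+
 \<comment> \<open>For the pair (7,5) the difference is - \<alpha>1 - \<alpha>0, which is \<alpha>2
   because the entries of an element of \<open>t2\<close> sum to zero.\<close>
 have cc: "t2_coeff (f_set x) (t2_part X) = c1 - c2"
  unfolding c using True X(2) unfolding t2_iff by (cases x) (auto simp: t2_coeff_f_set eq_neg_iff_add_eq_0 algebra_simps)
 have a: "act P (f_set x) (emb_fst X) = act P (f_set x) (sp_part X)" by (rule act_cong) (rule emb_fst_f)
 have A: "act P (e_set x) (emb_fst X) (join2 (tail1 x) (tail2 x) (z e) u v) =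
   join2 (tail1 x) (tail2 x) (act P (f_set x) (sp_part X) (z e)) u v + join2 (tail1 x) (tail2 x) (z e) (scl P c1 (hh u)) v
   + join2 (tail1 x) (tail2 x) (z e) u (scl P c2 (hh v))" for e u v
  using True act_join2[OF fin_f_set tails(1,2)[of x x] tails(3)[of x] z[of e] z[of e] emb_fst_sp, where u = u and v = v] by (simp add: e_set_f_set a t)
 show ?thesis
  using True unfolding emb_def act6_def if_P[OF True] act_lin A hh_bas cc
  by (simp add: join2_scl join2_uminus join2_diff join2_lin ts_ts TS.scale_right_distrib TS.scale_left_diff_distrib TS.scale_minus_left TS.scale_right_diff_distrib algebra_simps)
qed

end

context
 fixes x :: bits3 and y z :: "elabel => 'a tensor"
 assumes x: "long x"
  and y: "\<And>e. y e \<in> tensor_space (f_set x)" and z: "\<And>e. z e \<in> tensor_space (f_set x)"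
begin

abbreviation "J \<equiv> join2 (tail1 x) (tail2 x)"

lemma contr_full_emb:
 assumes w: "w \<in> tensor_space I4"
 shows "contr P I4 (e_set x) w (emb x z) = emb (xor3 full3 x) (%e. contr P I4 (f_set x) w (z e))"
proof -
 have "contr P I4 (insert (tail2 x) (insert (tail1 x) (f_set x))) w (J (z e) u v) = J (contr P I4 (f_set x) w (z e)) u v" for e u v
  by (rule contr_join2_right) (use tails(1,2)[of x full3] tails(1,2)[of x x] tails(3)[of x] w z in \<open>auto simp: f_sets(5) finite_subset[OF _ fin_f_set[of full3]]\<close>)
 then show ?thesis using x by (simp add: emb_def e_set_f_set long_xor contr_lin del: e_set.simps)
qed

text \<open>Both extra planes are contracted, and b1, b0 must meet b0, b1: a label pairs with the
  opposite one only. The coefficient omP omM om om = -1 is compensated by the reversed form in one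
  of the two planes.\<close>

lemma contr_emb_compl:
 assumes z': "\<And>e. z' e \<in> tensor_space (f_set (xor3 full3 x))"
 shows "contr P (e_set x) (e_set (xor3 full3 x)) (emb x y) (emb (xor3 full3 x) z') =
  contr P (f_set x) (f_set (xor3 full3 x)) (y EP) (z' EM) + contr P (f_set x) (f_set (xor3 full3 x)) (y EM) (z' EP)"
proof -
 have c: "contr P (insert (tail2 x) (insert (tail1 x) (f_set x))) (insert (tail2 x) (insert (tail1 x) (f_set (xor3 full3 x)))) (J (y e) u v) (J (z' e') u' v')
  = ts (form P v v' * form P u u') (contr P (f_set x) (f_set (xor3 full3 x)) (y e) (z' e'))" for e e' u v u' v'
  by (rule contr_join2_both[OF fin_f_set fin_f_set tails(1,1,2,2,3) y z'])
 show ?thesis using x om_inverse(1)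
  by (simp add: emb_def e_set_f_set long_xor contr_lin c form_bas ts_ts mult.commute mult.left_commute del: e_set.simps)
qed

lemma contr_emb_succ:
 assumes s: "succ3 x x'" and z': "\<And>e. z' e \<in> tensor_space (f_set x')"
 shows "contr P (e_set x) (e_set x') (emb x y) (emb x' z') =
  emb (xor3 x x') (%e. if e = E0 then 0 else contr P (f_set x) (f_set x') (y (eneg e)) (z' (eneg e)))"
proof -
 note t = succ3[OF s]
 have c: "contr P (insert (tail2 x) (insert (tail1 x) (f_set x))) (insert (tail2 x') (insert (tail2 x) (f_set x'))) (J (y e) u v) (join2 (tail2 x) (tail2 x') (z' e') u' v')
  = ts (form P v u') (join2 (tail2 x') (tail1 x) (contr P (f_set x) (f_set x') (y e) (z' e')) v' u)" for e e' u v u' v'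
  by (rule contr_join2_chain[OF fin_f_set fin_f_set tails(1,1,2,2,3) y z' tails(2,2) t(2)[symmetric]]) (use t tails(3)[of x'] in auto)
 have l: "long x'" using s by (simp add: succ3_def)
 have q: "- ts omM w = ts omP w" for w by (simp add: om_inverse(4))
 show ?thesis using x l t(5)
  by (simp add: emb_def e_set_f_set t(3,4) t(1)[symmetric] contr_lin c form_bas ts_ts om_inverse(2,3) q del: e_set.simps)
qed

text \<open>In the planes of the two tails \<open>gam P b1 b0\<close> is a multiple of
  \<open>hh\<close>, and the form values of the respective other plane have opposite signs; this
  leaves the difference of \<open>hh\<close> in the two tails, the counterpart of
  a_\<sigma>.\<close>

lemma diag_emb:
 "diag P (e_set x) (emb x y) (emb x z) = diag P (f_set x) (y EP) (z EM) + diag P (f_set x) (y EM) (z EP)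
  + sps P ((tform P (f_set x) (y EP) (z EM) - tform P (f_set x) (y EM) (z EP)) / 2) (nu (tail1 x) hh - nu (tail2 x) hh)"
proof -
 have d: "diag P (insert (tail2 x) (insert (tail1 x) (f_set x))) (J (y e) u v) (J (z e') u' v')
  = sps P (form P v v' * form P u u') (diag P (f_set x) (y e) (z e'))
  + sps P (- (1 / 2) * tform P (f_set x) (y e) (z e')) (sps P (form P v v') (nu (tail1 x) (gam P u u')) + sps P (form P u u') (nu (tail2 x) (gam P v v')))"
  for e e' u v u' v'
  by (rule diag_join2[OF fin_f_set tails(1-3) y z])
 have "diag P (e_set x) (emb x y) (emb x z) =
   sps P (- (omP * (omM * (om * om)))) (diag P (f_set x) (y EP) (z EM))
   + sps P (- (omP * (omM * (om * om)))) (diag P (f_set x) (y EM) (z EP))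
   + sps P (omP * (omM * (om * om)) * (- (1 / 2) * tform P (f_set x) (y EP) (z EM))) (nu (tail1 x) hh - nu (tail2 x) hh)
   + sps P (omP * (omM * (om * om)) * (1 / 2 * tform P (f_set x) (y EM) (z EP))) (nu (tail1 x) hh - nu (tail2 x) hh)"
  using x by (simp add: emb_def e_set_f_set diag_lin d form_bas nu_gam SPS.scale_right_distrib SPS.scale_right_diff_distrib
   mult_ac del: e_set.simps)
 then show ?thesis unfolding om_inverse(1) by (simp add: diff_divide_distrib SPS.scale_left_diff_distrib)
qed

end

end

declare e_set.simps [simp del]

lemma e_set_zero: "e_set zero3 = {}"
 by (simp add: e_set.simps chi_e7)

section \<open>Comparison of the brackets of \<open>e6\<close> and \<open>e7\<close>, one pair of
  components at a time\<close>

context sympl begin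

interpretation E8: graded P S_e8 eps_e8 by (rule graded_e8)

lemma emb6_uminus: "emb6 (- X) = - emb6 X"
 using emb6_lin(2)[of "- 1" X] by simp

lemma e6_iff: "X \<in> e6 P \<longleftrightarrow> sp_part X \<in> sp_power P {1..4} \<and> t2_part X \<in> t2 \<and> tens_part X \<in> family_space6 (S_f4 - {{}})"
 unfolding e6_def by (rule parts_mem)

lemma e6D:
 assumes X: "X \<in> e6 P"
 shows e6_sp: "sp_part X \<in> sp_power P {1..4}" and e6_t2: "t2_part X \<in> t2"
  and e6_ten: "tens_part X \<sigma> e \<in> tensor_space \<sigma>" and e6_ten0: "e ~: elabels \<sigma> ==> tens_part X \<sigma> e = 0"
 using X family6D[of "tens_part X" "S_f4 - {{}}"] unfolding e6_iff by auto

lemma sp_power_iff: "g \<in> sp_power P N \<longleftrightarrow> (\<forall>i. g i \<in> sp P) \<and> (\<forall>i. i ~: N \<longrightarrow> g i = 0)"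
proof
 assume g: "g \<in> sp_power P N"
 then have "g i \<in> (if i \<in> N then sp P else {0})" for i unfolding sp_power_def by blast
 then have "g i \<in> sp P \<and> (i ~: N \<longrightarrow> g i = 0)" for i using sp_0 by (metis singletonD)
 then show "(\<forall>i. g i \<in> sp P) \<and> (\<forall>i. i ~: N \<longrightarrow> g i = 0)" by blast
qed (auto simp: sp_power_def)

lemma sp_power_closed: "g \<in> sp_power P N ==> h \<in> sp_power P N ==> g + h \<in> sp_power P N"
 "g \<in> sp_power P N ==> sps P c g \<in> sp_power P N" "0 \<in> sp_power P N"
 unfolding sp_power_iff by (simp_all add: sp_add sp_0 sps_def sp_scl fun_eq_iff)

lemma t2_closed: "t \<in> t2 ==> t' \<in> t2 ==> t + t' \<in> t2" "t \<in> t2 ==> t2s c t \<in> t2" "0 \<in> t2" for t t' :: "'a \<times> 'a \<times> 'a"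
proof -
 assume "t \<in> t2" "t' \<in> t2"
 then show "t + t' \<in> t2" unfolding t2_iff fst_add snd_add by algebra
next
 assume "t \<in> t2"
 then show "t2s c t \<in> t2" unfolding t2_iff t2s_simps by algebra
qed (simp add: t2_iff)

interpretation F6: vector_space "fs6 :: 'a => (nat set => elabel => 'a tensor) => _" by (rule vs_fs6)

lemma parts_subspace: "ES6.subspace (sp_power P N \<times> t2 \<times> family_space6 S)"
proof (rule ES6.subspaceI)
 show "(0 :: ('a, 'v) elt6) \<in> sp_power P N \<times> t2 \<times> family_space6 S"
  unfolding parts_mem parts_simps by (simp add: sp_power_closed t2_closed F6.subspace_0[OF family6_subspace])
 show "X + Y \<in> sp_power P N \<times> t2 \<times> family_space6 S" if "X \<in> sp_power P N \<times> t2 \<times> family_space6 S" "Y \<in> sp_power P N \<times> t2 \<times> family_space6 S" for X Y :: "('a, 'v) elt6"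
  using that unfolding parts_mem parts_simps by (simp add: sp_power_closed t2_closed F6.subspace_add[OF family6_subspace])
 show "es6 P c X \<in> sp_power P N \<times> t2 \<times> family_space6 S" if "X \<in> sp_power P N \<times> t2 \<times> family_space6 S" for X :: "('a, 'v) elt6" and c
  using that unfolding parts_mem es6_parts by (simp add: sp_power_closed t2_closed F6.subspace_scale[OF family6_subspace])
qed

lemma e6_sub: "ES6.subspace (e6 P)" unfolding e6_def by (rule parts_subspace)
lemma a5_sub: "ES6.subspace (a5 P)" unfolding a5_def by (rule parts_subspace)

lemma center7_sub: "ES.subspace center7"
proof -
 let ?z = "(nu 5 hh + nu 6 hh + nu 7 hh, 0) :: ('a, 'v) elt"
 have z: "(sps P c (nu 5 hh + nu 6 hh + nu 7 hh), 0 :: nat set => 'a tensor) = es P c ?z" for c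
  by (simp add: E8.es_fst)
 show ?thesis unfolding center7_def z
 proof (rule ES.subspaceI)
  show "0 \<in> range (%c. es P c ?z)" by (rule range_eqI[where x = 0]) (simp only: ES.scale_zero_left)
  fix X k assume "X \<in> range (%c. es P c ?z)"
  then obtain c where X: "X = es P c ?z" by blast
  show "es P k X \<in> range (%c. es P c ?z)" by (rule range_eqI[where x = "k * c"]) (simp only: X ES.scale_scale)
  fix Y assume "Y \<in> range (%c. es P c ?z)"
  then obtain d where Y: "Y = es P d ?z" by blast
  show "X + Y \<in> range (%c. es P c ?z)" by (rule range_eqI[where x = "c + d"]) (simp only: X Y ES.scale_left_distrib)
 qed
qed

lemmas center7_cl = ES.subspace_0[OF center7_sub] ES.subspace_add[OF center7_sub] ES.subspace_scale[OF center7_sub] ES.subspace_neg[OF center7_sub]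

lemma sp_bracket_emb_fst:
 assumes X: "X \<in> e6 P" and Y: "Y \<in> e6 P"
 shows "sp_bracket (emb_fst X) (emb_fst Y) = sp_bracket (sp_part X) (sp_part Y)"
proof (intro ext)
 fix i v
 note h = sp_map_scl[OF hh_sp]
 note s = sp_part_sp(2)[OF e6_sp[OF X] e6_t2[OF X], of i] sp_part_sp(2)[OF e6_sp[OF Y] e6_t2[OF Y], of i]
 show "sp_bracket (emb_fst X) (emb_fst Y) i v = sp_bracket (sp_part X) (sp_part Y) i v"
 proof (cases "i = 5 \<or> i = 7")
  case True
  then show ?thesis
   using s emb_fst_tail(1,3)[OF e6_sp[OF X] e6_t2[OF X]] emb_fst_tail(1,3)[OF e6_sp[OF Y] e6_t2[OF Y]]
   by (auto simp: sp_bracket_def h sp_map_minus[OF hh_sp] mult.commute)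
 next
  case False
  then have "emb_fst X i = sp_part X i" "emb_fst Y i = sp_part Y i"
   by (simp_all add: emb_fst_def nu_def sps_def fun_eq_iff)
  then show ?thesis by (simp add: sp_bracket_def)
 qed
qed

text \<open>Both brackets are sums over pairs of components, so the difference can be estimated
  termwise. A nonzero central error can arise in \<open>term_same\<close> only; for all other pairs
  the two terms are equal.\<close>

abbreviation "term_eq x y X Y \<equiv> emb6 (es6 P (eps_e6 (f_set x) (f_set y)) (phi6 P (f_set x) (f_set y) X Y))
  - es P (eps_e8 (e_set x) (e_set y)) (phi P (e_set x) (e_set y) (emb6 X) (emb6 Y)) \<in> center7"

lemma center7_eq: "U = V ==> U - V \<in> center7"
 using center7_cl(1) by simp

text \<open>The image of 2k a_\<sigma> and k times the difference of \<open>hh\<close> in the two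
  tails have the same differences of torus coefficients, so they agree up to h5 + h6 + h7. The
  multiple is k, -k, 0 for the pairs (5,6), (6,7), (7,5), an effect of the normalisation at
  6.\<close>

lemma tform_sum_center:
 assumes "long x"
 shows "\<exists>c. sps P (fst (t2s (k + k) (a_vec (f_set x)))) (nu 5 hh) + sps P (- fst (snd (t2s (k + k) (a_vec (f_set x))))) (nu 7 hh)
  - sps P k (nu (tail1 x) hh - nu (tail2 x) hh) = sps P c (nu 5 hh + nu 6 hh + nu 7 hh)"
proof -
 obtain p q r where x: "x = (p, q, r)" by (cases x)
 consider "p" "\<not> q" | "\<not> p" "q" | "p" "q" using assms x by auto
 then show ?thesis
 proof cases
  case 1
  have "fst (t2s (k + k) (a_vec (f_set x))) = k + k" "- fst (snd (t2s (k + k) (a_vec (f_set x)))) = k" "tail1 x = 5" "tail2 x = 6"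
   using 1 two unfolding x a_vec_f_set[OF assms[unfolded x]] by (simp_all add: field_simps)
  moreover have "sps P (k + k) (nu 5 hh) + sps P (k) (nu 7 hh) - sps P k (nu 5 hh - nu 6 hh) = sps P (k) (nu 5 hh + nu 6 hh + nu 7 hh)"
   unfolding SPS.scale_minus_left SPS.scale_left_distrib SPS.scale_right_distrib SPS.scale_right_diff_distrib by simp
  ultimately show ?thesis by (intro exI) (simp only:)
 next
  case 2
  have "fst (t2s (k + k) (a_vec (f_set x))) = - k" "- fst (snd (t2s (k + k) (a_vec (f_set x)))) = - (k + k)" "tail1 x = 6" "tail2 x = 7"
   using 2 two unfolding x a_vec_f_set[OF assms[unfolded x]] by (simp_all add: field_simps)
  moreover have "sps P (- k) (nu 5 hh) + sps P (- (k + k)) (nu 7 hh) - sps P k (nu 6 hh - nu 7 hh) = sps P (- k) (nu 5 hh + nu 6 hh + nu 7 hh)"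
   unfolding SPS.scale_minus_left SPS.scale_left_distrib SPS.scale_right_distrib SPS.scale_right_diff_distrib by simp
  ultimately show ?thesis by (intro exI) (simp only:)
 next
  case 3
  have "fst (t2s (k + k) (a_vec (f_set x))) = - k" "- fst (snd (t2s (k + k) (a_vec (f_set x)))) = k" "tail1 x = 7" "tail2 x = 5"
   using 3 two unfolding x a_vec_f_set[OF assms[unfolded x]] by (simp_all add: field_simps)
  moreover have "sps P (- k) (nu 5 hh) + sps P (k) (nu 7 hh) - sps P k (nu 7 hh - nu 5 hh) = sps P (0) (nu 5 hh + nu 6 hh + nu 7 hh)"
   unfolding SPS.scale_minus_left SPS.scale_left_distrib SPS.scale_right_distrib SPS.scale_right_diff_distrib by simp
  ultimately show ?thesis by (intro exI) (simp only:)
 qed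
qed

lemma bits3_pair_cases:
 obtains "x = zero3" "y = zero3" | "x = zero3" "y ~= zero3" | "x ~= zero3" "y = zero3" | "x = full3" "y = full3" | "x = full3" "long y"
  | "long x" "y = full3" | "long x" "y = x" | "long x" "y = xor3 full3 x" | "long x" "long y" "long (xor3 x y)"
proof -
 have d: "u = zero3 \<or> u = full3 \<or> long u" for u by (cases u) auto
 have xor: "y = x \<or> y = xor3 full3 x \<or> long (xor3 x y)" if "long x" "long y"
  using that by (cases x; cases y) auto
 show ?thesis using that d[of x] d[of y] xor by argo
qed

text \<open>Normal forms of \<open>phi6\<close>, numbered in parallel with the nine cases of
  \<open>bits3_pair_cases\<close>.\<close>

lemma phi6_forms:
 "phi6 P {} {} X Y = (sp_bracket (sp_part X) (sp_part Y), 0, 0)"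
 "y ~= zero3 ==> phi6 P {} (f_set y) X Y = (0, 0, single (f_set y) (act6 P (f_set y) X (tens_part Y (f_set y))))"
 "x ~= zero3 ==> phi6 P (f_set x) {} X Y = (0, 0, single (f_set x) (- act6 P (f_set x) Y (tens_part X (f_set x))))"
 "phi6 P I4 I4 X Y = (diag P I4 (tens_part X I4 E0) (tens_part Y I4 E0), 0, 0)"
 "long y ==> phi6 P I4 (f_set y) X Y = (0, 0, single (f_set (xor3 full3 y)) (%e. contr P I4 (f_set y) (tens_part X I4 E0) (tens_part Y (f_set y) e)))"
 "long x ==> phi6 P (f_set x) I4 X Y = (0, 0, single (f_set (xor3 full3 x)) (%e. contr P I4 (f_set x) (tens_part Y I4 E0) (tens_part X (f_set x) e)))"
 "long x ==> phi6 P (f_set x) (f_set x) X Y =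
  (diag P (f_set x) (tens_part X (f_set x) EP) (tens_part Y (f_set x) EM) + diag P (f_set x) (tens_part X (f_set x) EM) (tens_part Y (f_set x) EP),
   t2s (tform P (f_set x) (tens_part X (f_set x) EP) (tens_part Y (f_set x) EM) - tform P (f_set x) (tens_part X (f_set x) EM) (tens_part Y (f_set x) EP)) (a_vec (f_set x)), 0)"
 "long x ==> phi6 P (f_set x) (f_set (xor3 full3 x)) X Y = (0, 0, single I4 (%e. if e = E0 then
   contr P (f_set x) (f_set (xor3 full3 x)) (tens_part X (f_set x) EP) (tens_part Y (f_set (xor3 full3 x)) EM)
   + contr P (f_set x) (f_set (xor3 full3 x)) (tens_part X (f_set x) EM) (tens_part Y (f_set (xor3 full3 x)) EP) else 0))"
 "long x ==> long y ==> long (xor3 x y) ==> phi6 P (f_set x) (f_set y) X Y = (0, 0, single (f_set (xor3 x y))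
   (%e. if e = E0 then 0 else contr P (f_set x) (f_set y) (tens_part X (f_set x) (eneg e)) (tens_part Y (f_set y) (eneg e))))"
proof -
 have n: "I4 ~= {}" by (simp add: I4_def)
 have l: "long u ==> f_set u ~= {} \<and> f_set u ~= I4" for u by (auto simp: I4_iff)
 have c: "f_set (xor3 full3 u) ~= f_set u" for u by (cases u) (simp add: f_set_inj)
 have lc: "f_set y ~= f_set x" "f_set y ~= f_set (xor3 full3 x)" if "long (xor3 x y)"
  using that by (cases x; cases y; auto simp: f_set_inj)+
 show "phi6 P {} {} X Y = (sp_bracket (sp_part X) (sp_part Y), 0, 0)"
  by (simp add: phi6_def Let_def)
 show "y ~= zero3 ==> phi6 P {} (f_set y) X Y = (0, 0, single (f_set y) (act6 P (f_set y) X (tens_part Y (f_set y))))"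
  using I4_iff(2)[of y] by (simp add: phi6_def Let_def)
 show "x ~= zero3 ==> phi6 P (f_set x) {} X Y = (0, 0, single (f_set x) (- act6 P (f_set x) Y (tens_part X (f_set x))))"
  using I4_iff(2)[of x] by (simp add: phi6_def Let_def)
 show "phi6 P I4 I4 X Y = (diag P I4 (tens_part X I4 E0) (tens_part Y I4 E0), 0, 0)"
  using n by (simp add: phi6_def Let_def)
 show "long y ==> phi6 P I4 (f_set y) X Y = (0, 0, single (f_set (xor3 full3 y)) (%e. contr P I4 (f_set y) (tens_part X I4 E0) (tens_part Y (f_set y) e)))"
  using n l[of y] by (simp add: phi6_def Let_def f_set_compl3)
 show "long x ==> phi6 P (f_set x) I4 X Y = (0, 0, single (f_set (xor3 full3 x)) (%e. contr P I4 (f_set x) (tens_part Y I4 E0) (tens_part X (f_set x) e)))"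
  using n l[of x] by (simp add: phi6_def Let_def f_set_compl3)
 have t: "t2s a v + t2s (- b) v = t2s (a - b) v" for a b :: 'a and v
  by (simp add: prod_eq_iff algebra_simps)
 show "long x ==> phi6 P (f_set x) (f_set x) X Y =
  (diag P (f_set x) (tens_part X (f_set x) EP) (tens_part Y (f_set x) EM) + diag P (f_set x) (tens_part X (f_set x) EM) (tens_part Y (f_set x) EP),
   t2s (tform P (f_set x) (tens_part X (f_set x) EP) (tens_part Y (f_set x) EM) - tform P (f_set x) (tens_part X (f_set x) EM) (tens_part Y (f_set x) EP)) (a_vec (f_set x)), 0)"
  using n l[of x] by (simp add: phi6_def Let_def t)
 show "long x ==> phi6 P (f_set x) (f_set (xor3 full3 x)) X Y = (0, 0, single I4 (%e. if e = E0 then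
   contr P (f_set x) (f_set (xor3 full3 x)) (tens_part X (f_set x) EP) (tens_part Y (f_set (xor3 full3 x)) EM)
   + contr P (f_set x) (f_set (xor3 full3 x)) (tens_part X (f_set x) EM) (tens_part Y (f_set (xor3 full3 x)) EP) else 0))"
  using n l[of x] l[of "xor3 full3 x"] c[of x] by (simp add: phi6_def Let_def f_set_compl3 long_xor cong: if_cong)
 show "long x ==> long y ==> long (xor3 x y) ==> phi6 P (f_set x) (f_set y) X Y = (0, 0, single (f_set (xor3 x y))
   (%e. if e = E0 then 0 else contr P (f_set x) (f_set y) (tens_part X (f_set x) (eneg e)) (tens_part Y (f_set y) (eneg e))))"
  using n l[of x] l[of y] lc f_set_xor[of x y] by (simp add: phi6_def Let_def f_set_compl3 del: Un_iff)
qed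

lemma a_vec_t2: "long x ==> a_vec (f_set x) \<in> (t2 :: ('a \<times> 'a \<times> 'a) set)"
 using two by (cases x) (auto simp: a_vec_f_set t2_iff field_simps simp del: long.simps)

lemma single_e6: "x ~= zero3 ==> (\<And>e. z e \<in> tensor_space (f_set x)) ==> (\<And>e. e ~: elabels (f_set x) ==> z e = 0) ==>
  (0, 0, single (f_set x) z) \<in> e6 P"
 unfolding e6_iff parts_simps S_f4_f_set
 by (intro conjI sp_power_closed t2_closed single_family6) (auto simp: I4_iff)

lemma fst_e6: "g \<in> sp_power P {1..4} ==> t \<in> t2 ==> (g, t, 0) \<in> e6 P"
 unfolding e6_iff parts_simps by (simp add: F6.subspace_0[OF family6_subspace])

lemma diag_power: "y \<in> tensor_space (f_set x) ==> z \<in> tensor_space (f_set x) ==> diag P (f_set x) y z \<in> sp_power P {1..4}"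
 unfolding sp_power_iff
proof (intro conjI allI impI)
 assume yz: "y \<in> tensor_space (f_set x)" "z \<in> tensor_space (f_set x)"
 show "diag P (f_set x) y z i \<in> sp P" for i using diag_sp[OF fin_f_set yz] by (rule sp_if)
 show "diag P (f_set x) y z i = 0" if "i ~: {1..4}" for i
 proof -
  have "i ~: f_set x" using that f_set_sub by blast
  then show ?thesis using diag_sp[OF fin_f_set yz, of i] by simp
 qed
qed

lemma lin_emb6: "Z \<in> e6 P ==> lin (emb6 Z)"
 by (simp add: lin_def fst_emb6 emb_fst_sp[OF e6_sp e6_t2])

lemma e_set_S_e8: "e_set x \<in> S_e8"
 using S_e7_S_e8 S_e7_e_set by blast

context
 fixes X Y assumes X: "X \<in> e6 P" and Y: "Y \<in> e6 P"
begin

lemma term_0: "term_eq zero3 zero3 X Y"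
proof -
 note phi6_forms(1)[of X Y]
 moreover have "phi P {} {} (emb6 X) (emb6 Y) = (sp_bracket (sp_part X) (sp_part Y), 0)"
  by (simp add: phi_def fst_emb6 sp_bracket_emb_fst[OF X Y])
 ultimately show ?thesis
  by (intro center7_eq) (simp add: f_sets(1) e_set_zero emb6_lin emb6_fst eps_e6_def eps_f4_def e8_eps_empty[OF empty_S_e8])
qed

lemma term_left:
 assumes y: "y ~= zero3" shows "term_eq zero3 y X Y"
proof -
 note phi6_forms(2)[OF y, of X Y]
 moreover have "phi P {} (e_set y) (emb6 X) (emb6 Y) = (0, single (e_set y) (emb y (act6 P (f_set y) X (tens_part Y (f_set y)))))"
  using y e_set_empty[of y] by (simp add: phi_def fst_emb6 snd_emb6 act_emb[OF e6_sp[OF X] e6_t2[OF X] y e6_ten[OF Y]])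
 ultimately show ?thesis
  using y by (intro center7_eq) (simp add: f_sets(1) e_set_zero emb6_lin emb6_single eps_e6_def eps_f4_def e8_eps_empty[OF e_set_S_e8])
qed

lemma term_right:
 assumes x: "x ~= zero3" shows "term_eq x zero3 X Y"
proof -
 note phi6_forms(3)[OF x, of X Y]
 moreover have "phi P (e_set x) {} (emb6 X) (emb6 Y) = (0, single (e_set x) (emb x (- act6 P (f_set x) Y (tens_part X (f_set x)))))"
  using x e_set_empty[of x] by (simp add: phi_def fst_emb6 snd_emb6 emb_uminus act_emb[OF e6_sp[OF Y] e6_t2[OF Y] x e6_ten[OF X]])
 ultimately show ?thesis
  using x by (intro center7_eq) (simp add: f_sets(1) e_set_zero emb6_lin emb6_single eps_e6_def eps_f4_def e8_eps_empty[OF e_set_S_e8])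
qed

lemma term_full: "term_eq full3 full3 X Y"
proof -
 have n: "I4 ~= {}" by (simp add: I4_def)
 note phi6_forms(4)[of X Y]
 moreover have "phi P I4 I4 (emb6 X) (emb6 Y) = (diag P I4 (tens_part X I4 E0) (tens_part Y I4 E0), 0)"
  using n snd_emb6(1)[of X full3] snd_emb6(1)[of Y full3] by (simp add: phi_def emb_def f_sets(5) e_set_full)
 ultimately show ?thesis
  using n eps_e7_f4(1)[where 'a = 'a] by (intro center7_eq) (simp add: f_sets(5) e_set_full emb6_lin emb6_fst eps_e6_def eps_f4_def)
qed

lemma term_full_left:
 assumes y: "long y" shows "term_eq full3 y X Y"
proof -
 have n: "I4 ~= {}" by (simp add: I4_def)
 have yn: "y ~= zero3" "y ~= full3" "f_set y ~= {}" "f_set y ~= I4" "xor3 full3 y ~= zero3" using y by (cases y; auto simp: I4_iff)+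
 note phi6_forms(5)[OF y, of X Y]
 moreover have "phi P I4 (e_set y) (emb6 X) (emb6 Y) = (0, single (e_set (xor3 full3 y)) (emb (xor3 full3 y) (%e. contr P I4 (f_set y) (tens_part X I4 E0) (tens_part Y (f_set y) e))))"
  using n yn e_set_empty[of y] e_set_inj[of full3 y] snd_emb6(1)[of X full3] snd_emb6(1)[of Y y] e_set_xor[of full3 y]
  unfolding phi_def
  by (simp add: emb_def[of full3] f_sets(5) e_set_full contr_full_emb[OF y e6_ten[OF Y] e6_ten[OF Y] e6_ten[OF X]] del: Un_iff)
 ultimately show ?thesis
  using n yn eps_e7_f4(2)[OF y, where 'a = 'a] by (intro center7_eq) (simp add: f_sets(5) e_set_full emb6_lin emb6_single eps_e6_def)
qed

lemma term_full_right:
 assumes x: "long x" shows "term_eq x full3 X Y"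
proof -
 have n: "I4 ~= {}" by (simp add: I4_def)
 have xn: "x ~= zero3" "x ~= full3" "f_set x ~= {}" "f_set x ~= I4" "xor3 full3 x ~= zero3" using x by (cases x; auto simp: I4_iff)+
 \<comment> \<open>The bracket of e6 contracts with the element of V(I) on the left even when it is
   the second argument. Two indices are contracted, so this reversal costs no sign.\<close>
 have "I4 \<inter> e_set x = f_set x"
 proof -
  have "f_set x \<subseteq> I4" by (cases x) (auto simp: f_set.simps I4_def)
  moreover have "tail1 x ~: I4" "tail2 x ~: I4" using tails(1,2)[of x full3] by (simp_all add: f_sets(5))
  ultimately show ?thesis using x unfolding e_set_f_set by auto
 qed
 then have card: "card (I4 \<inter> e_set x) = 2" using card_f_set(2)[OF x] by simp
 have fI: "finite I4" by (simp add: I4_def)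
 have "emb x (tens_part X (f_set x)) \<in> tensor_space (e_set x)" by (rule emb_in, rule e6_ten[OF X])
 note c = contr_commute[OF fI fin_e_set e6_ten[OF Y, of I4 E0] this, unfolded card]
 have xx: "sym_diff (e_set x) I4 = e_set (xor3 full3 x)"
  unfolding e_set_full[symmetric] e_set_xor by (cases x) simp
 note phi6_forms(6)[OF x, of X Y]
 moreover have "phi P (e_set x) I4 (emb6 X) (emb6 Y) = (0, single (e_set (xor3 full3 x)) (emb (xor3 full3 x) (%e. contr P I4 (f_set x) (tens_part Y I4 E0) (tens_part X (f_set x) e))))"
  using n xn e_set_empty[of x] e_set_inj[of x full3] snd_emb6(1)[of Y full3] snd_emb6(1)[of X x] c xx
  unfolding phi_def
  by (simp add: emb_def[of full3] f_sets(5) e_set_full contr_full_emb[OF x e6_ten[OF X] e6_ten[OF X] e6_ten[OF Y]] del: Un_iff)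
 ultimately show ?thesis
  using n xn eps_e7_f4(3)[OF x, where 'a = 'a] by (intro center7_eq) (simp add: f_sets(5) e_set_full emb6_lin emb6_single eps_e6_def)
qed

lemma term_same:
 assumes x: "long x" shows "term_eq x x X Y"
proof -
 have xn: "x ~= zero3" "f_set x ~= {}" "f_set x ~= I4" using x by (auto simp: I4_iff)
 define D where "D = diag P (f_set x) (tens_part X (f_set x) EP) (tens_part Y (f_set x) EM) + diag P (f_set x) (tens_part X (f_set x) EM) (tens_part Y (f_set x) EP)"
 define k where "k = (tform P (f_set x) (tens_part X (f_set x) EP) (tens_part Y (f_set x) EM) - tform P (f_set x) (tens_part X (f_set x) EM) (tens_part Y (f_set x) EP)) / 2"
 have kk: "tform P (f_set x) (tens_part X (f_set x) EP) (tens_part Y (f_set x) EM) - tform P (f_set x) (tens_part X (f_set x) EM) (tens_part Y (f_set x) EP) = k + k"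
  unfolding k_def mult_2[symmetric] using two by simp
 have e: "eps_e6 (f_set x) (f_set x) = (- 1 :: 'a)" "eps_e8 (e_set x) (e_set x) = (- 1 :: 'a)"
  using xn two e8_eps_diag[OF e_set_S_e8, of x] e_set_empty[of x] by (simp_all add: eps_e6_def eps_f4_def)
 have a: "emb6 (D, t2s (k + k) (a_vec (f_set x)), 0) =
   (D + sps P (fst (t2s (k + k) (a_vec (f_set x)))) (nu 5 hh) + sps P (- fst (snd (t2s (k + k) (a_vec (f_set x))))) (nu 7 hh), 0)"
  by (rule elt_eqI) (simp_all add: fst_emb6 snd_emb6 snd_emb6_empty emb_fst_def)
 have b: "phi P (e_set x) (e_set x) (emb6 X) (emb6 Y) = (D + sps P k (nu (tail1 x) hh - nu (tail2 x) hh), 0)"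
  using xn e_set_empty[of x] snd_emb6(1)[of Y x] snd_emb6(1)[of X x] diag_emb[OF x e6_ten[OF X] e6_ten[OF Y]]
  by (simp add: phi_def D_def k_def)
 obtain c where c: "sps P (fst (t2s (k + k) (a_vec (f_set x)))) (nu 5 hh) + sps P (- fst (snd (t2s (k + k) (a_vec (f_set x))))) (nu 7 hh)
  - sps P k (nu (tail1 x) hh - nu (tail2 x) hh) = sps P c (nu 5 hh + nu 6 hh + nu 7 hh)" using tform_sum_center[OF x] by blast
 have "emb6 (D, t2s (k + k) (a_vec (f_set x)), 0) - phi P (e_set x) (e_set x) (emb6 X) (emb6 Y) = (sps P c (nu 5 hh + nu 6 hh + nu 7 hh), 0)"
  unfolding a b c[symmetric] by (simp add: prod_eq_iff)
 then have "emb6 (D, t2s (k + k) (a_vec (f_set x)), 0) - phi P (e_set x) (e_set x) (emb6 X) (emb6 Y) \<in> center7"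
  unfolding center7_def by (metis rangeI)
 from center7_cl(3)[OF this, of "- 1"] show ?thesis
  unfolding phi6_forms(7)[OF x] kk D_def[symmetric] emb6_lin e ES.scale_right_diff_distrib .
qed

lemma term_compl:
 assumes x: "long x" shows "term_eq x (xor3 full3 x) X Y"
proof -
 let ?y = "xor3 full3 x"
 have y: "long ?y" using x by (simp add: long_xor)
 have n: "?y ~= x" "xor3 x ?y = full3" by (cases x; simp)+
 have xn: "x ~= zero3" "f_set x ~= {}" "f_set x ~= I4" "?y ~= zero3" "f_set ?y ~= {}" "f_set ?y ~= I4" using x y by (auto simp: I4_iff)
 have e: "eps_e6 (f_set x) (f_set ?y) = (eps_e8 (e_set x) (e_set ?y) :: 'a)"
  using xn two eps_e7_f4(4)[OF x, where 'a = 'a] by (simp add: eps_e6_def f_set_compl3 field_simps)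
 have b: "phi P (e_set x) (e_set ?y) (emb6 X) (emb6 Y) = (0, single I4 (
   contr P (f_set x) (f_set ?y) (tens_part X (f_set x) EP) (tens_part Y (f_set ?y) EM)
   + contr P (f_set x) (f_set ?y) (tens_part X (f_set x) EM) (tens_part Y (f_set ?y) EP)))"
  using xn n e_set_inj[of x ?y] e_set_empty[of x] e_set_empty[of ?y] snd_emb6(1)[of Y ?y] snd_emb6(1)[of X x] e_set_xor[of x ?y] e_set_full
   contr_emb_compl[OF x e6_ten[OF X] e6_ten[OF X] e6_ten[OF Y]]
  by (simp add: phi_def del: Un_iff xor3.simps)
 have a: "emb6 (0, 0, single I4 z) = (0, single I4 (z E0))" for z
  using emb6_single[of full3 z] by (simp add: f_sets(5) e_set_full emb_def)
 show ?thesis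
  by (rule center7_eq) (simp add: phi6_forms(8)[OF x] emb6_lin e b a)
qed

lemma term_succ:
 assumes s: "succ3 x y" shows "term_eq x y X Y"
proof -
 have x: "long x" and y: "long y" using s by (simp_all add: succ3_def)
 have xy: "long (xor3 x y)" by (rule succ3[OF s])
 have xn: "x ~= zero3" "f_set x ~= {}" "f_set x ~= I4" "y ~= zero3" "xor3 x y ~= zero3" using x y xy by auto (auto simp: I4_iff)
 have n: "x ~= y" "f_set y ~= f_set x" "f_set y ~= f_set (xor3 full3 x)" using xy by (cases x; cases y; auto simp: f_set_inj)+
 have b: "phi P (e_set x) (e_set y) (emb6 X) (emb6 Y) = (0, single (e_set (xor3 x y)) (emb (xor3 x y) (%e. if e = E0 then 0 else
   contr P (f_set x) (f_set y) (tens_part X (f_set x) (eneg e)) (tens_part Y (f_set y) (eneg e)))))"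
  using xn n e_set_inj[of x y] e_set_empty[of x] e_set_empty[of y] snd_emb6(1)[of Y y] snd_emb6(1)[of X x] e_set_xor[of x y]
   contr_emb_succ[OF x e6_ten[OF X] e6_ten[OF X] s e6_ten[OF Y]]
  by (simp add: phi_def del: Un_iff)
 have e: "eps_e6 (f_set x) (f_set y) = (eps_e8 (e_set x) (e_set y) :: 'a)"
  using n eps_e7_f4(5)[OF s, where 'a = 'a] by (simp add: eps_e6_def f_set_compl3)
 show ?thesis
  by (rule center7_eq) (simp add: phi6_forms(9)[OF x y xy] emb6_lin e b emb6_single[OF xn(5)])
qed

lemma xor3_commute: "xor3 x y = xor3 y x"
 by (cases x; cases y) auto

text \<open>Reduced to \<open>contr_emb_succ\<close> with the arguments exchanged. In e7 two indices
  are contracted and the exchange is free; in e6 only one is, and the resulting -1 is the sign in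
  the last clause of \<open>eps_e7_f4\<close>.\<close>

lemma term_pred:
 assumes s: "succ3 y x" shows "term_eq x y X Y"
proof -
 have x: "long x" and y: "long y" using s by (simp_all add: succ3_def)
 have xy: "long (xor3 x y)" using succ3(5)[OF s] xor3_commute[of x y] by simp
 have xn: "x ~= zero3" "f_set x ~= {}" "f_set x ~= I4" "y ~= zero3" "xor3 x y ~= zero3" using x y xy by auto (auto simp: I4_iff)
 have n: "x ~= y" "f_set y ~= f_set x" "f_set y ~= f_set (xor3 full3 x)" using xy by (cases x; cases y; auto simp: f_set_inj)+
 have "card (e_set y \<inter> e_set x) = 2"
  by (rule e8_card_int) (use xn n e_set_S_e8 e_set_inj e_set_empty e_set_xor in \<open>auto simp del: Un_iff\<close>)
 note card = this
 have "emb y (tens_part Y (f_set y)) \<in> tensor_space (e_set y)" "emb x (tens_part X (f_set x)) \<in> tensor_space (e_set x)"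
  by (rule emb_in, rule e6_ten[OF Y] e6_ten[OF X])+
 note c = contr_commute[OF fin_e_set fin_e_set this, unfolded card]
 have c': "contr P (f_set y) (f_set x) (tens_part Y (f_set y) e) (tens_part X (f_set x) e) = ts (- 1) (contr P (f_set x) (f_set y) (tens_part X (f_set x) e) (tens_part Y (f_set y) e))" for e
  using contr_commute[OF fin_f_set fin_f_set e6_ten[OF X, of "f_set x" e] e6_ten[OF Y, of "f_set y" e]] card_f_set(1)[OF s] by (simp add: Int_commute)
 have m: "(%e. if e = E0 then 0 else contr P (f_set y) (f_set x) (tens_part Y (f_set y) (eneg e)) (tens_part X (f_set x) (eneg e)))
   = (%e. ts (- 1) ((%e. if e = E0 then 0 else contr P (f_set x) (f_set y) (tens_part X (f_set x) (eneg e)) (tens_part Y (f_set y) (eneg e))) e))"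
  unfolding c' by (simp add: fun_eq_iff)
 have "contr P (e_set y) (e_set x) (emb y (tens_part Y (f_set y))) (emb x (tens_part X (f_set x))) = ts (- 1) (emb (xor3 x y)
   (%e. if e = E0 then 0 else contr P (f_set x) (f_set y) (tens_part X (f_set x) (eneg e)) (tens_part Y (f_set y) (eneg e))))"
  unfolding contr_emb_succ[OF y e6_ten[OF Y] e6_ten[OF Y] s e6_ten[OF X]] m emb_lin(2) xor3_commute[of y x] ..
 then have b: "phi P (e_set x) (e_set y) (emb6 X) (emb6 Y) = (0, single (e_set (xor3 x y)) (ts (- 1) (emb (xor3 x y) (%e. if e = E0 then 0 else
   contr P (f_set x) (f_set y) (tens_part X (f_set x) (eneg e)) (tens_part Y (f_set y) (eneg e))))))"
  using xn n e_set_inj[of x y] e_set_empty[of x] e_set_empty[of y] snd_emb6(1)[of Y y] snd_emb6(1)[of X x] e_set_xor[of x y] c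
  by (simp add: phi_def del: Un_iff)
 have e: "eps_e6 (f_set x) (f_set y) = (- eps_e8 (e_set x) (e_set y) :: 'a)"
  using n eps_e7_f4(6)[OF s, where 'a = 'a] by (simp add: eps_e6_def f_set_compl3)
 show ?thesis
  by (rule center7_eq) (simp add: phi6_forms(9)[OF x y xy] emb6_lin emb6_uminus e b emb6_single[OF xn(5)] E8.es_single ts_ts flip: single_uminus)
qed

lemma term_all: "term_eq x y X Y"
proof (cases rule: bits3_pair_cases[of x y])
 case 1 then show ?thesis using term_0 by (simp only:)
next
 case 2 then show ?thesis using term_left by (simp only:)
next
 case 3 then show ?thesis using term_right by (simp only:)
next
 case 4 then show ?thesis using term_full by (simp only:)
next
 case 5 then show ?thesis using term_full_left by (simp only:)
next
 case 6 then show ?thesis using term_full_right by (simp only:)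
next
 case 7 then show ?thesis using term_same by (simp only:)
next
 case 8 then show ?thesis using term_compl by (simp only:)
next
 case 9
 from succ3_cases[OF this] show ?thesis by (rule disjE) (rule term_succ term_pred; assumption)+
qed

lemma phi6_e6: "phi6 P (f_set x) (f_set y) X Y \<in> e6 P"
proof -
 have l0: "tens_part X \<sigma> e = 0" "tens_part Y \<sigma> e = 0" if "e ~: elabels \<sigma>" for \<sigma> e
  using that e6_ten0[OF X] e6_ten0[OF Y] by auto
 have a6: "act6 P (f_set u) Z (tens_part Z' (f_set u)) e \<in> tensor_space (f_set u)"
  "e ~: elabels (f_set u) ==> act6 P (f_set u) Z (tens_part Z' (f_set u)) e = 0" if "Z' \<in> e6 P" for u Z Z' e
  using e6_ten[OF that] e6_ten0[OF that] by (simp_all add: act6_def)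
 have ci: "contr P (f_set u) (f_set w) a b \<in> tensor_space (f_set (xor3 u w))" for u w a b
  using contr_in[of P "f_set u" "f_set w" a b] unfolding f_set_xor .
 show ?thesis
 proof (cases rule: bits3_pair_cases[of x y])
  case 1
  have "sp_bracket (sp_part X) (sp_part Y) \<in> sp_power P {1..4}"
   using e6_sp[OF X] e6_sp[OF Y] unfolding sp_power_iff by (auto simp: sp_bracket_def sp_closed fun_eq_iff)
  then show ?thesis using 1 by (simp add: f_sets(1) phi6_forms(1) fst_e6 t2_closed)
 next
  case 2
  show ?thesis unfolding 2(1) f_sets(1) phi6_forms(2)[OF 2(2)]
   by (rule single_e6[OF 2(2)]) (rule a6[OF Y]; assumption?)+
 next
  case 3
  show ?thesis unfolding 3(2) f_sets(1) phi6_forms(3)[OF 3(1)]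
   by (rule single_e6[OF 3(1)]) (simp_all add: a6[OF X])
 next
  case 4
  show ?thesis unfolding 4 f_sets(5) phi6_forms(4)
   using diag_power[of _ full3] e6_ten[OF X] e6_ten[OF Y] by (intro fst_e6 t2_closed) (simp add: f_sets(5))
 next
  case 5
  have n: "xor3 full3 y ~= zero3" using 5 by (cases y) auto
  have "elabels (f_set (xor3 full3 y)) = elabels (f_set y)" using 5 unfolding elabels_f_set by (cases y) auto
  then show ?thesis unfolding 5(1) f_sets(5) phi6_forms(5)[OF 5(2)]
   by (intro single_e6[OF n]) (use ci[of full3 y] in \<open>auto simp: f_sets(5) l0\<close>)
 next
  case 6
  have n: "xor3 full3 x ~= zero3" using 6 by (cases x) auto
  have "elabels (f_set (xor3 full3 x)) = elabels (f_set x)" using 6 unfolding elabels_f_set by (cases x) auto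
  then show ?thesis unfolding 6(2) f_sets(5) phi6_forms(6)[OF 6(1)]
   by (intro single_e6[OF n]) (use ci[of full3 x] in \<open>auto simp: f_sets(5) l0\<close>)
 next
  case 7
  show ?thesis unfolding 7(2) phi6_forms(7)[OF 7(1)]
   by (intro fst_e6 t2_closed a_vec_t2 7 sp_power_closed(1) diag_power e6_ten[OF X] e6_ten[OF Y])
 next
  case 8
  have "xor3 x (xor3 full3 x) = full3" by (cases x) simp
  then have "contr P (f_set x) (f_set (xor3 full3 x)) a b \<in> tensor_space I4" for a b
   using ci[of x "xor3 full3 x" a b] by (simp add: f_sets(5))
  then show ?thesis unfolding 8(2) phi6_forms(8)[OF 8(1)]
   using single_e6[of full3] by (auto simp: f_sets(5) elabels_f_set[of full3, unfolded f_sets(5)])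
 next
  case 9
  have n: "xor3 x y ~= zero3" "xor3 x y ~= full3" using 9(3) by auto
  show ?thesis unfolding phi6_forms(9)[OF 9]
  proof (rule single_e6[OF n(1)])
   show "(if e = E0 then 0 else contr P (f_set x) (f_set y) (tens_part X (f_set x) (eneg e)) (tens_part Y (f_set y) (eneg e))) = 0"
    if "e ~: elabels (f_set (xor3 x y))" for e
    using that n unfolding elabels_f_set by (cases e) auto
  qed (simp add: ci)
 qed
qed

lemma bracket_e6_sum: "bracket_e6 P X Y = (\<Sum>x\<in>UNIV. \<Sum>y\<in>UNIV. es6 P (eps_e6 (f_set x) (f_set y)) (phi6 P (f_set x) (f_set y) X Y))"
proof -
 have "inj f_set" using f_set_inj by (simp add: inj_def)
 then show ?thesis unfolding bracket_e6_def S_f4_f_set by (simp add: sum.reindex)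
qed

lemma bracket_e6_in: "bracket_e6 P X Y \<in> e6 P"
 unfolding bracket_e6_sum by (intro ES6.subspace_sum[OF e6_sub] ES6.subspace_scale[OF e6_sub] phi6_e6)

lemma bracket_e8_emb6: "E8.br (emb6 X) (emb6 Y) = (\<Sum>x\<in>UNIV. \<Sum>y\<in>UNIV. es P (eps_e8 (e_set x) (e_set y)) (phi P (e_set x) (e_set y) (emb6 X) (emb6 Y)))"
proof -
 let ?F = "%\<sigma> \<tau>. if sym_diff \<sigma> \<tau> \<in> S_e8 then es P (eps_e8 \<sigma> \<tau>) (phi P \<sigma> \<tau> (emb6 X) (emb6 Y)) else 0"
 have S: "S_e7 \<subseteq> S_e8" unfolding S_e7_S_e8 by blast
 have inj: "inj e_set" using e_set_inj by (simp add: inj_def)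
 have z: "phi P \<sigma> \<tau> (emb6 X) (emb6 Y) = 0" if "\<sigma> \<in> S_e8" "\<tau> \<in> S_e8" "\<sigma> ~: S_e7 \<or> \<tau> ~: S_e7" for \<sigma> \<tau>
 proof -
  have n: "\<rho> ~: S_e7 ==> \<rho> ~= {}" for \<rho> unfolding S_e7_def by blast
  have "(\<sigma> ~= {} \<and> snd (emb6 X) \<sigma> = 0) \<or> (\<tau> ~= {} \<and> snd (emb6 Y) \<tau> = 0)"
   using that(3) n snd_emb6(2) by blast
  then show ?thesis using lin_emb6[OF X] lin_emb6[OF Y] that by (intro E8.phi_0) blast+
 qed
 have "E8.br (emb6 X) (emb6 Y) = (\<Sum>(\<sigma>, \<tau>)\<in>S_e8 \<times> S_e8. ?F \<sigma> \<tau>)" by (rule E8.br_sum)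
 also have "\<dots> = (\<Sum>(\<sigma>, \<tau>)\<in>S_e7 \<times> S_e7. ?F \<sigma> \<tau>)"
 proof (rule sum.mono_neutral_right)
  show "\<forall>q\<in>S_e8 \<times> S_e8 - S_e7 \<times> S_e7. (case q of (\<sigma>, \<tau>) => ?F \<sigma> \<tau>) = 0"
  proof
   fix q assume q: "q \<in> S_e8 \<times> S_e8 - S_e7 \<times> S_e7"
   obtain \<sigma> \<tau> where st: "q = (\<sigma>, \<tau>)" by (cases q)
   have "phi P \<sigma> \<tau> (emb6 X) (emb6 Y) = 0" by (rule z) (use q st in auto)
   then show "(case q of (\<sigma>, \<tau>) => ?F \<sigma> \<tau>) = 0" unfolding st by simp
  qed
 qed (use S finite_S_e8 in auto)
 also have "\<dots> = (\<Sum>\<sigma>\<in>S_e7. \<Sum>\<tau>\<in>S_e7. ?F \<sigma> \<tau>)" by (rule sum.cartesian_product[symmetric])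
 also have "\<dots> = (\<Sum>x\<in>UNIV. \<Sum>y\<in>UNIV. ?F (e_set x) (e_set y))"
  unfolding S_e7_e_set by (simp only: sum.reindex[OF inj] o_def)
 also have "\<dots> = (\<Sum>x\<in>UNIV. \<Sum>y\<in>UNIV. es P (eps_e8 (e_set x) (e_set y)) (phi P (e_set x) (e_set y) (emb6 X) (emb6 Y)))"
  unfolding e_set_xor by (simp only: e_set_S_e8 if_True)
 finally show ?thesis .
qed

lemma bracket_emb6: "emb6 (bracket_e6 P X Y) - E8.br (emb6 X) (emb6 Y) \<in> center7"
 unfolding bracket_e6_sum bracket_e8_emb6 emb6_sum sum_subtractf[symmetric]
 by (intro ES.subspace_sum[OF center7_sub] term_all)

end

end

section \<open>The embedding of \<open>e6\<close> on odd parts, and the central elements\<close>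

context sympl begin

interpretation E8: graded P S_e8 eps_e8 by (rule graded_e8)
interpretation E7: graded_odd P S_e8 eps_e8 S_e7 4 "{1..7}" by (rule graded_odd_e7)
interpretation F6: vector_space "fs6 :: 'a => (nat set => elabel => 'a tensor) => _" by (rule vs_fs6)

lemma emb_coord:
 "long x ==> emb x z \<kappa> = (if tail1 x \<in> \<kappa> \<and> tail2 x ~: \<kappa> then omP * z EP (\<kappa> - {tail1 x})
   else if tail2 x \<in> \<kappa> \<and> tail1 x ~: \<kappa> then omM * z EM (\<kappa> - {tail2 x}) else 0)"
 using tails(3)[of x] by (auto simp: emb_def join2_def join_def ts_apply)

lemma om_nz': "omP ~= 0" "omM ~= 0"
 using om_nz by (simp_all add: omP_def omM_def)

text \<open>The two summands of \<open>emb\<close> live on disjoint sets of coordinates,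
  distinguished by which tail the subset contains. The set \<open>\<sigma>\<close> may be smaller
  than \<open>f_set x\<close>, so that the lemma serves components of e6 as well as components of
  the triple system, where the index 4 is removed.\<close>

lemma emb_inj:
 assumes z: "\<And>e. z e \<in> tensor_space \<sigma>" "\<And>e. e ~: elabels (f_set x) ==> z e = 0" and s: "\<sigma> \<subseteq> f_set x" and e: "emb x z = 0" and x: "x = full3 \<or> long x"
 shows "z = 0"
proof (cases "x = full3")
 case True
 then have "z e = 0" for e using z(2)[of e] e by (cases e) (auto simp: elabels_f_set emb_def)
 then show ?thesis by auto
next
 case False
 then have l: "long x" using x by blast
 have "z EP \<kappa> = 0 \<and> z EM \<kappa> = 0" for \<kappa>
 proof (cases "\<kappa> \<subseteq> \<sigma>")
  case True
  then have n: "tail1 x ~: \<kappa>" "tail2 x ~: \<kappa>" using tails(1,2)[of x x] s by blast+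
  have "emb x z (insert (tail1 x) \<kappa>) = 0" "emb x z (insert (tail2 x) \<kappa>) = 0" using e by simp_all
  then show ?thesis using n tails(3)[of x] om_nz' by (auto simp: emb_coord[OF l] split: if_splits)
 qed (simp add: tensor_zero[OF z(1)])
 moreover have "z E0 = 0" using z(2)[of E0] False by (simp add: elabels_f_set)
 ultimately have "z e = 0" for e by (cases e) (auto simp: fun_eq_iff)
 then show ?thesis by auto
qed

lemma join_emb: "join P 4 (emb x z) u = emb x (%e. join P 4 (z e) u)"
 using tails(4,5)[of x] by (simp add: emb_def join_lin join_join2)

definition odd4 :: "bits3 set" where "odd4 = {x. 4 \<in> f_set x}"

lemma odd4_iff: "(p, q, r) \<in> odd4 \<longleftrightarrow> r" "x \<in> odd4 \<longleftrightarrow> 4 \<in> f_set x" "x \<in> odd4 \<longleftrightarrow> 4 \<in> e_set x"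
 using tails(4,5)[of x] by (auto simp: odd4_def f_set.simps e_set_f_set)

lemma odd4_long: "x \<in> odd4 ==> x = full3 \<or> long x"
 by (cases x) (auto simp: odd4_iff(1))

lemma odd4_nz: "x \<in> odd4 ==> x ~= zero3"
 by (auto simp: odd4_iff(1))

lemma S_c3_f_set: "S_f4 - S_c3 = f_set ` odd4" "A4 = f_set ` {x. x ~: odd4 \<and> x ~= zero3}"
proof -
 have c3: "S_c3 = f_set ` {x. x ~: odd4}"
 proof (rule set_eqI)
  fix \<sigma>
  have "f_set y \<in> S_c3 \<longleftrightarrow> y ~: odd4" for y
   by (cases y) (auto simp: S_c3_def I4_iff A4_iff odd4_iff(1))
  moreover have "S_c3 \<subseteq> range f_set" unfolding S_f4_f_set[symmetric] S_c3_def S_f4_def by blast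
  ultimately show "\<sigma> \<in> S_c3 \<longleftrightarrow> \<sigma> \<in> f_set ` {x. x ~: odd4}" by blast
 qed
 have "inj f_set" using f_set_inj by (simp add: inj_def)
 then show "S_f4 - S_c3 = f_set ` odd4" unfolding S_f4_f_set c3
  by (subst image_set_diff[symmetric]) (auto intro!: arg_cong[of _ _ "image f_set"])
 show "A4 = f_set ` {x. x ~: odd4 \<and> x ~= zero3}"
  unfolding A4_f_set by (rule arg_cong[of _ _ "image f_set"]) (auto simp: odd4_iff(1))
qed

lemma T_e6_iff: "z \<in> T_e6_a5 \<longleftrightarrow> (\<forall>x\<in>odd4. \<forall>e. z (f_set x - {4}) e \<in> tensor_space (f_set x - {4}) \<and> (e ~: elabels (f_set x) \<longrightarrow> z (f_set x - {4}) e = 0))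
  \<and> (\<forall>\<rho>. \<rho> ~: (%x. f_set x - {4}) ` odd4 \<longrightarrow> z \<rho> = 0)"
 for z :: "nat set => elabel => 'a tensor"
proof -
 \<comment> \<open>Removing 4 turns I4 into {1,2,3}, the other set to which \<open>elabels\<close>
   assigns \<open>E0\<close>; the remaining odd sets become singletons and keep both labels.\<close>
 have el: "elabels (f_set x - {4}) = elabels (f_set x)" if "x \<in> odd4" for x
 proof -
  obtain p q r where x': "x = (p, q, r)" by (cases x)
  then have x: "x = (p, q, True)" using that by (simp add: odd4_iff(1))
  have i: "f_set x - {4} = {i. i = 1 \<and> \<not> p \<or> i = 2 \<and> p = q \<or> i = 3 \<and> \<not> q}" unfolding x by (auto simp: f_set.simps)
  have "f_set x - {4} ~= {1, 2, 3, 4}" by blast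
  moreover have "f_set x - {4} = {1, 2, 3} \<longleftrightarrow> \<not> p \<and> \<not> q"
  proof
   assume "f_set x - {4} = {1, 2, 3}"
   then have m: "j \<in> {i. i = 1 \<and> \<not> p \<or> i = 2 \<and> p = q \<or> i = 3 \<and> \<not> q} \<longleftrightarrow> j \<in> {1, 2, 3 :: nat}" for j unfolding i by simp
   show "\<not> p \<and> \<not> q" using m[of 1] m[of 3] by simp
  qed (auto simp: i)
  ultimately show ?thesis unfolding elabels_f_set unfolding elabels_def x by simp
 qed
 let ?K = "(%x. f_set x - {4}) ` odd4"
 have T: "T_e6_a5 = (family_space6 ?K :: (nat set => elabel => 'a tensor) set)"
  unfolding T_e6_a5_def S_c3_f_set image_image ..
 show ?thesis (is "_ \<longleftrightarrow> ?R")
 proof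
  assume "z \<in> T_e6_a5"
  note F = family6D[OF this[unfolded T]]
  have "z \<rho> = 0" if "\<rho> ~: ?K" for \<rho>
  proof
   show "z \<rho> e = 0 e" for e using F(2)[OF disjI1, OF that, of e] by simp
  qed
  moreover have "z (f_set x - {4}) e = 0" if "x \<in> odd4" "e ~: elabels (f_set x)" for x e
   by (rule F(2)) (simp only: el[OF that(1)] that(2) not_False_eq_True simp_thms)
  ultimately show ?R using F(1) by blast
 next
  assume R: ?R
  show "z \<in> T_e6_a5" unfolding T
  proof (rule family6I)
   fix \<rho> e
   show "z \<rho> e \<in> tensor_space \<rho>" if "\<rho> \<in> ?K" "e \<in> elabels \<rho>" using that(1) R by blast
   assume a: "\<rho> ~: ?K \<or> e ~: elabels \<rho>"
   show "z \<rho> e = 0"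
   proof (cases "\<rho> \<in> ?K")
    case True
    then obtain x where x: "x \<in> odd4" "\<rho> = f_set x - {4}" by blast
    have "e ~: elabels (f_set x)" using a True el[OF x(1)] x(2) by simp
    then show ?thesis using R x by blast
   next
    case False
    then have "z \<rho> = 0" using R by blast
    then show ?thesis by simp
   qed
  qed
 qed
qed

lemma T_e6_sub: "F6.subspace (T_e6_a5 :: (nat set => elabel => 'a tensor) set)"
 unfolding T_e6_a5_def by (rule family6_subspace)

definition emb_odd :: "(nat set => elabel => 'a tensor) => nat set => 'a tensor" where
 "emb_odd z = (\<Sum>x\<in>odd4. single (e_set x - {4}) (emb x (z (f_set x - {4}))))"

lemma odd_inj: "x \<in> odd4 ==> y \<in> odd4 ==> f_set x - {4} = f_set y - {4} \<longleftrightarrow> x = y"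
 "x \<in> odd4 ==> y \<in> odd4 ==> e_set x - {4} = e_set y - {4} \<longleftrightarrow> x = y"
 using E7.Diff_eq f_set_inj e_set_inj odd4_iff(2,3) by metis+

lemma emb_odd_apply:
 "x \<in> odd4 ==> emb_odd z (e_set x - {4}) = emb x (z (f_set x - {4}))"
 "\<rho> ~: (%x. e_set x - {4}) ` odd4 ==> emb_odd z \<rho> = 0"
proof -
 have e: "emb_odd z \<rho> = (\<Sum>y\<in>odd4. single (e_set y - {4}) (emb y (z (f_set y - {4}))) \<rho>)" for \<rho>
  unfolding emb_odd_def by (rule sum_apply)
 show "emb_odd z (e_set x - {4}) = emb x (z (f_set x - {4}))" if x: "x \<in> odd4"
 proof -
  have "emb_odd z (e_set x - {4}) = (\<Sum>y\<in>odd4. if y = x then emb x (z (f_set x - {4})) else 0)"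
   unfolding e by (rule sum.cong) (use odd_inj(2)[OF x] in \<open>auto simp: single_def\<close>)
  then show ?thesis using x by simp
 qed
 show "emb_odd z \<rho> = 0" if "\<rho> ~: (%x. e_set x - {4}) ` odd4"
  unfolding e by (rule sum.neutral) (use that in \<open>auto simp: single_def\<close>)
qed

lemma emb_odd_eqI:
 assumes "\<And>x. x \<in> odd4 ==> F (e_set x - {4}) = G (e_set x - {4})" "\<And>\<rho>. \<rho> ~: (%x. e_set x - {4}) ` odd4 ==> F \<rho> = G \<rho>"
 shows "F = G"
proof
 fix \<rho> show "F \<rho> = G \<rho>" using assms by (cases "\<rho> \<in> (%x. e_set x - {4}) ` odd4") auto
qed

lemma emb_odd_lin: "emb_odd (z + z') = emb_odd z + emb_odd z'" "emb_odd (fs6 c z) = fs c (emb_odd z)"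
proof -
 have "fs6 c z \<rho> = (%e. ts c (z \<rho> e))" for \<rho> by (simp add: fs6_def)
 then show "emb_odd (z + z') = emb_odd z + emb_odd z'" "emb_odd (fs6 c z) = fs c (emb_odd z)"
  by (intro emb_odd_eqI; simp add: emb_odd_apply emb_lin fs_apply)+
qed

lemma T_e7_odd: "T_e7_d6 = (family_space ((%x. e_set x - {4}) ` odd4) :: (nat set => 'a tensor) set)"
proof -
 have "S_e7 - S_d6 = e_set ` odd4" unfolding S_d6_S_e7 S_e7_e_set using odd4_iff(3) by blast
 then show ?thesis unfolding T_e7_d6_def by (simp add: image_image)
qed

lemma emb_in_Diff: "x \<in> odd4 ==> (\<And>e. z e \<in> tensor_space (f_set x - {4})) ==> emb x z \<in> tensor_space (e_set x - {4})"
proof -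
 assume x: "x \<in> odd4" and z: "\<And>e. z e \<in> tensor_space (f_set x - {4})"
 have "emb x z \<kappa> = 0" if "\<not> \<kappa> \<subseteq> e_set x - {4}" for \<kappa>
 proof (cases "long x")
  case True
  have "\<not> \<kappa> - {tail1 x} \<subseteq> f_set x - {4}" if "tail1 x \<in> \<kappa>" "tail2 x ~: \<kappa>"
   using that True \<open>\<not> \<kappa> \<subseteq> e_set x - {4}\<close> tails(4,5)[of x] unfolding e_set_f_set by auto
  moreover have "\<not> \<kappa> - {tail2 x} \<subseteq> f_set x - {4}" if "tail2 x \<in> \<kappa>" "tail1 x ~: \<kappa>"
   using that True \<open>\<not> \<kappa> \<subseteq> e_set x - {4}\<close> tails(4,5)[of x] unfolding e_set_f_set by auto
  ultimately show ?thesis using True by (simp add: emb_coord tensor_zero[OF z])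
 next
  case False
  then show ?thesis using that tensor_zero[OF z] by (simp add: emb_def e_set_f_set)
 qed
 then show ?thesis by (simp add: tensor_space_def)
qed

lemma emb_odd_T: "z \<in> T_e6_a5 ==> emb_odd z \<in> T_e7_d6"
 unfolding T_e7_odd T_e6_iff by (rule family_spaceI) (auto simp: emb_odd_apply intro!: emb_in_Diff)

lemma emb_odd_inj:
 assumes z: "z \<in> T_e6_a5" and e: "emb_odd z = 0" shows "z = 0"
proof
 fix \<rho>
 note z' = z[unfolded T_e6_iff]
 show "z \<rho> = 0 \<rho>"
 proof (cases "\<rho> \<in> (%x. f_set x - {4}) ` odd4")
  case True
  then obtain x where x: "x \<in> odd4" "\<rho> = f_set x - {4}" by blast
  have "emb x (z \<rho>) = 0" using emb_odd_apply(1)[OF x(1), of z] e x by simp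
  then have "z \<rho> = 0" by (intro emb_inj[of "z \<rho>" \<rho> x]) (use x z' odd4_long in auto)
  then show ?thesis by simp
 qed (use z' in simp)
qed

lemma emb6_odd: "emb6 (odd_elt6 P 4 z u) = odd_elt P 4 (emb_odd z) u"
proof (rule elt_eqI)
 show "fst (emb6 (odd_elt6 P 4 z u)) = fst (odd_elt P 4 (emb_odd z) u)"
  by (simp add: fst_emb6 emb_fst_def odd_elt6_def odd_elt_def)
 show "snd (emb6 (odd_elt6 P 4 z u)) (e_set x) = snd (odd_elt P 4 (emb_odd z) u) (e_set x)" if "x ~= zero3" for x
  using that emb_odd_apply(1)[of x z] odd4_iff(2,3)[of x]
  by (cases "x \<in> odd4") (simp_all add: snd_emb6 odd_elt6_def odd_elt_def join_emb)
 show "snd (emb6 (odd_elt6 P 4 z u)) {} = snd (odd_elt P 4 (emb_odd z) u) {}"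
  by (simp add: snd_emb6_empty odd_elt_def)
 show "snd (emb6 (odd_elt6 P 4 z u)) \<rho> = snd (odd_elt P 4 (emb_odd z) u) \<rho>" if "\<rho> ~: S_e7" for \<rho>
 proof (cases "4 \<in> \<rho>")
  case True
  have "\<rho> - {4} ~: (%x. e_set x - {4}) ` odd4"
  proof
   assume "\<rho> - {4} \<in> (%x. e_set x - {4}) ` odd4"
   then obtain x where "x \<in> odd4" "\<rho> - {4} = e_set x - {4}" by blast
   then have "\<rho> = e_set x" using E7.Diff_eq[OF True] odd4_iff(3) by blast
   then show False using that S_e7_e_set by blast
  qed
  then show ?thesis by (simp add: snd_emb6(2)[OF that] odd_elt_def emb_odd_apply(2))
 qed (simp add: snd_emb6(2)[OF that] odd_elt_def)
qed

lemma emb6_in: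
 assumes X: "X \<in> e6 P" shows "emb6 X \<in> e7 P" "sp_part X 4 = 0 ==> (\<And>x. x \<in> odd4 ==> tens_part X (f_set x) = 0) ==> emb6 X \<in> d6 P"
proof -
 have f: "emb_fst X i \<in> sp P" "i ~: {1..7} ==> emb_fst X i = 0" "sp_part X 4 = 0 ==> emb_fst X 4 = 0" for i
  using emb_fst_sp[OF e6_sp[OF X] e6_t2[OF X]] sp_part_sp(2)[OF e6_sp[OF X] e6_t2[OF X], of i]
  by (auto simp: emb_fst_def nu_def sps_def fun_eq_iff)
 have s: "snd (emb6 X) \<sigma> \<in> tensor_space \<sigma>" for \<sigma>
 proof (cases "\<sigma> \<in> S_e7")
  case True
  then obtain x where x: "\<sigma> = e_set x" unfolding S_e7_e_set by blast
  show ?thesis unfolding x snd_emb6(1) using emb_in[OF e6_ten[OF X], of x] by simp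
 qed (simp add: snd_emb6)
 have z: "snd (emb6 X) \<sigma> = 0" if "\<sigma> ~: S_e7 - {{}}" for \<sigma>
  using that snd_emb6(2) snd_emb6_empty by (cases "\<sigma> = {}") auto
 have g7: "emb_fst X i \<in> (if i \<in> {1..7} then sp P else {0})" for i
  using f(1,2)[of i] by (cases "i \<in> {1..7}") (simp_all only: if_True if_False singleton_iff simp_thms)
 show "emb6 X \<in> e7 P"
 proof -
  have "snd (emb6 X) \<in> family_space (S_e7 - {{}})"
   by (rule family_spaceI) (rule s, rule z, assumption)
  moreover have "\<forall>i. fst (emb6 X) i \<in> (if i \<in> {1..7} then sp P else {0})"
   unfolding fst_emb6 by (rule allI) (rule g7)
  ultimately show ?thesis unfolding e7_def alg_iff by (rule conjI[rotated])
 qed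
 assume a: "sp_part X 4 = 0" "\<And>x. x \<in> odd4 ==> tens_part X (f_set x) = 0"
 have z': "snd (emb6 X) \<sigma> = 0" if "\<sigma> ~: S_d6 - {{}}" for \<sigma>
 proof (cases "\<sigma> \<in> S_e7 - {{}}")
  case True
  then have s7: "\<sigma> \<in> S_e7" "4 \<in> \<sigma>" using that unfolding S_d6_S_e7 by simp_all
  then obtain x where x: "\<sigma> = e_set x" using S_e7_e_set by (metis rangeE)
  then have "x \<in> odd4" using s7(2) odd4_iff(3)[of x] by simp
  then show ?thesis unfolding x(1) snd_emb6(1) using a(2) by simp
 qed (rule z)
 have g: "emb_fst X i \<in> (if i \<in> {1,2,3,5,6,7} then sp P else {0})" for i
 proof (cases "i \<in> {1,2,3,5,6,7}")
  case False
  then have "i = 4 \<or> i ~: {1..7}" by auto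
  then have "emb_fst X i = 0" using f(2)[of i] f(3)[OF a(1)] by blast
  then show ?thesis using False by (simp only: if_False singleton_iff simp_thms)
 qed (simp only: f(1) if_True simp_thms)
 show "emb6 X \<in> d6 P"
 proof -
  have "snd (emb6 X) \<in> family_space (S_d6 - {{}})"
   by (rule family_spaceI) (rule s, rule z', assumption)
  moreover have "\<forall>i. fst (emb6 X) i \<in> (if i \<in> {1,2,3,5,6,7} then sp P else {0})"
   unfolding fst_emb6 by (rule allI) (rule g)
  ultimately show ?thesis unfolding d6_def alg_iff by (rule conjI[rotated])
 qed
qed

lemma center7_d6: "center7 \<subseteq> d6 P"
proof
 fix c assume "c \<in> center7"
 then obtain k where c: "c = (sps P k (nu 5 hh + nu 6 hh + nu 7 hh), 0)" unfolding center7_def by blast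
 have "sps P k (nu 5 hh + nu 6 hh + nu 7 hh) i \<in> (if i \<in> {1,2,3,5,6,7} then sp P else {0})" for i
  using sp_scl[OF hh_sp, of k] by (cases "i = 5 \<or> i = 6 \<or> i = 7") (auto simp: nu_def sps_def sp_0 fun_eq_iff zero_fun_def[symmetric])
 then show "c \<in> d6 P" unfolding c d6_def by (rule alg_fst_mem)
qed

text \<open>Every long component of the image contains b1 in one of the planes 5, 6, 7 and b0 in
  another, so h5 + h6 + h7 acts on it with weight 1 - 1 = 0.\<close>

lemma center7_br:
 assumes c: "c \<in> center7" and X: "X \<in> e6 P" shows "E8.br c (emb6 X) = 0"
proof -
 obtain k where ck: "c = (sps P k (nu 5 hh + nu 6 hh + nu 7 hh), 0)" using c unfolding center7_def by blast
 define g where "g = sps P k (nu 5 hh + nu 6 hh + nu 7 hh)"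
 have g567: "i \<in> {5, 6, 7} ==> g i = (%v. scl P k (hh v))" "i ~: {5, 6, 7} ==> g i = 0" for i
  by (auto simp: g_def sps_def nu_def fun_eq_iff)
 have gs: "g i \<in> sp P" for i
  using g567[of i] sp_scl[OF hh_sp, of k] sp_0 by (cases "i \<in> {5, 6, 7}") simp_all
 have lc: "lin c" unfolding ck lin_def fst_conv using gs unfolding g_def by blast
 note sp6 = e6_sp[OF X] e6_t2[OF X]
 show ?thesis
 proof (rule E8.br_zero)
  fix \<sigma> \<tau> assume m: "\<sigma> \<in> S_e8" "\<tau> \<in> S_e8"
  show "phi P \<sigma> \<tau> c (emb6 X) = 0"
  proof (cases "\<sigma> = {}")
   case False
   then show ?thesis by (intro E8.phi_0 m lc lin_emb6[OF X]) (simp_all add: ck)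
  next
   case s: True
   show ?thesis
   proof (cases "\<tau> = {}")
    case True
    have "sp_bracket g (emb_fst X) i v = 0" for i v
    proof (cases "i \<in> {5, 6, 7}")
     case True
     then obtain w where "emb_fst X i = (%v. scl P w (hh v))" using emb_fst_tail[OF sp6] by blast
     then show ?thesis using g567(1)[OF True] by (simp add: sp_bracket_def sp_map_scl[OF hh_sp] mult.commute)
    next
     case False
     then show ?thesis using g567(2)[OF False] sp_map_0[OF emb_fst_sp[OF sp6]] by (simp add: sp_bracket_def)
    qed
    then have "sp_bracket g (emb_fst X) = 0" by (intro ext) simp
    then show ?thesis using s True by (simp add: phi_def ck g_def fst_emb6 zero_prod_def)
   next
    case t: False
    have "act P \<tau> g (snd (emb6 X) \<tau>) = 0"
    proof (cases "\<tau> \<in> S_e7")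
     case True
     then obtain x where x: "\<tau> = e_set x" unfolding S_e7_e_set by blast
     have xn: "x ~= zero3" using t x e_set_zero by auto
     have f0: "act P (f_set x) g w = 0" for w
      by (rule act_zero[OF fin_f_set g567(2)]) (use f_set_sub[of x] in auto)
     show ?thesis
     proof (cases "long x")
      case False
      then have "e_set x = f_set x" unfolding e_set_f_set by simp
      then show ?thesis using f0 x by simp
     next
      case l: True
      have tl: "tail1 x \<in> {5, 6, 7}" "tail2 x \<in> {5, 6, 7}" by (cases x; auto)+
      define z where "z = tens_part X (f_set x)"
      have zt: "z e \<in> tensor_space (f_set x)" for e unfolding z_def by (rule e6_ten[OF X])
      have "act P (e_set x) g (join2 (tail1 x) (tail2 x) (z e) u v) = join2 (tail1 x) (tail2 x) (z e) (scl P k (hh u)) v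
       + join2 (tail1 x) (tail2 x) (z e) u (scl P k (hh v))" for e u v
       using l act_join2[OF fin_f_set tails(1,2)[of x x] tails(3)[of x] zt[of e] zt[of e] gs, where u = u and v = v]
       by (simp add: e_set_f_set f0 g567(1)[OF tl(1)] g567(1)[OF tl(2)])
      then show ?thesis unfolding x snd_emb6(1) z_def[symmetric]
       using l xn by (simp add: emb_def act_lin hh_bas join2_scl join2_uminus)
     qed
    qed (simp add: snd_emb6)
    then show ?thesis using s t by (simp add: phi_def ck g_def zero_prod_def)
   qed
  qed
 qed
qed

lemma hh_nz: "scl P c (hh b1) = 0 ==> c = 0"
proof -
 assume "scl P c (hh b1) = 0"
 then have "scl P c b1 = 0" by (simp only: hh_bas)
 from arg_cong[OF this, of "%u. coord P u True"] show "c = 0" unfolding coord_scl by simp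
qed

text \<open>By the normalisation of \<open>emb_fst\<close>, the component at 6 of an image is 0,
  whereas a nonzero multiple of h5 + h6 + h7 is nonzero there. So the image is 0, and the parts at 5
  and 7, the sp-part and the tensors vanish in turn.\<close>

lemma emb6_center:
 assumes X: "X \<in> e6 P" and c: "emb6 X \<in> center7" shows "X = 0"
proof -
 obtain k where ck: "emb6 X = (sps P k (nu 5 hh + nu 6 hh + nu 7 hh), 0)" using c unfolding center7_def by blast
 note sp6 = e6_sp[OF X] e6_t2[OF X]
 have f: "emb_fst X = sps P k (nu 5 hh + nu 6 hh + nu 7 hh)" using arg_cong[OF ck, of fst] by (simp add: fst_emb6)
 have p: "emb_fst X i b1 = sps P k (nu 5 hh + nu 6 hh + nu 7 hh) i b1" for i unfolding f ..
 have "scl P 0 (hh b1) = scl P k (hh b1)" using p[of 6] unfolding emb_fst_tail[OF sp6] by (simp add: sps_def nu_def)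
 then have k0: "k = 0" by (intro hh_nz) simp
 have f0: "emb_fst X i v = 0" for i v unfolding f k0 by (simp add: sps_def)
 have t5: "fst (t2_part X) = 0" using f0[of 5 b1] unfolding emb_fst_tail[OF sp6] by (rule hh_nz)
 have "- fst (snd (t2_part X)) = 0" using f0[of 7 b1] unfolding emb_fst_tail[OF sp6] by (rule hh_nz)
 then have t2: "t2_part X = 0" using t5 sp6(2) unfolding t2_iff by (simp add: prod_eq_iff)
 then have "sp_part X = emb_fst X" by (simp add: emb_fst_def)
 then have s: "sp_part X = 0" using f0 by (simp add: fun_eq_iff)
 have "tens_part X \<sigma> = 0" for \<sigma>
 proof (cases "\<sigma> \<in> S_f4 - {{}}")
  case True
  then obtain x where x: "\<sigma> = f_set x" "x ~= zero3" unfolding S_f4_f_set using f_sets(1) by blast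
  have "emb x (tens_part X \<sigma>) = 0" using snd_emb6(1)[of X x] x ck by simp
  then show ?thesis
   by (intro emb_inj[of "tens_part X \<sigma>" \<sigma> x]) (use x bits3_cases[of x] e6_ten[OF X] e6_ten0[OF X] in auto)
 next
  case False
  have "tens_part X \<in> family_space6 (S_f4 - {{}})" using X unfolding e6_iff by blast
  then have "tens_part X \<sigma> e = 0" for e by (rule family6D(2)) (use False in blast)
  then show ?thesis by (auto simp: fun_eq_iff)
 qed
 then show ?thesis unfolding parts_eq parts_simps using s t2 by auto
qed

end

section \<open>Transfer of the decomposition from \<open>e7\<close> to \<open>e6\<close>\<close>

context sympl begin

interpretation E8: graded P S_e8 eps_e8 by (rule graded_e8)
interpretation E7: graded_odd P S_e8 eps_e8 S_e7 4 "{1..7}" by (rule graded_odd_e7)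
interpretation F6: vector_space "fs6 :: 'a => (nat set => elabel => 'a tensor) => _" by (rule vs_fs6)

lemma odd_part_e7: "odd_part P (es P) E8.br (e7 P) (d6 P) (sp_elt 4) fs T_e7_d6 (odd_elt P 4) E7.fT E7.dT E7.aT"
proof -
 have "odd_part P (es P) E8.br E7.L E7.A (sp_elt 4) fs E7.T (odd_elt P 4) E7.fT E7.dT E7.aT"
 proof (rule E7.odd_part)
  fix x assume x: "x \<in> E7.T" "x ~= 0"
  from E7.T_coord[OF x] obtain \<sigma> \<kappa> where "\<sigma> \<in> S_e7" "4 \<in> \<sigma>" "\<kappa> \<subseteq> \<sigma> - {4}" "x (\<sigma> - {4}) \<kappa> ~= 0" .
  then show "\<exists>r\<in>E7.T. E7.dT r r = 0 \<and> (E7.fT r x ~= 0 \<or> (\<exists>y\<in>E7.T. \<exists>z\<in>E7.T. E7.fT r (E7.aT (E7.dT x y) z - fs (E7.fT x z) y - fs (E7.fT y z) x) ~= 0))"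
   using E7.regular_pure[OF x(1)] e7_card by blast
 qed
 then show ?thesis unfolding e7_eqs .
qed

lemma A4_sub: "A4 \<subseteq> S_f4 - {{}}"
 unfolding S_f4_def A4_def by auto

lemma a5_e6: "a5 P \<subseteq> e6 P"
proof
 fix X assume "X \<in> a5 P"
 then have X: "sp_part X \<in> sp_power P {1..3}" "t2_part X \<in> t2" "tens_part X \<in> family_space6 A4"
  unfolding a5_def parts_mem by blast+
 have "sp_part X \<in> sp_power P {1..4}" using X(1) unfolding sp_power_iff by auto
 moreover have "tens_part X \<in> family_space6 (S_f4 - {{}})"
 proof (rule family6I)
  show "tens_part X \<sigma> e \<in> tensor_space \<sigma>" for \<sigma> e by (rule family6D(1)[OF X(3)])
  show "tens_part X \<sigma> e = 0" if "\<sigma> ~: S_f4 - {{}} \<or> e ~: elabels \<sigma>" for \<sigma> e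
   by (rule family6D(2)[OF X(3)]) (use that A4_sub in blast)
 qed
 ultimately show "X \<in> e6 P" unfolding e6_iff using X(2) by blast
qed

lemma odd_elt6_in: assumes z: "z \<in> T_e6_a5" shows "odd_elt6 P 4 z u \<in> e6 P"
proof -
 note z' = z[unfolded T_e6_iff]
 have "(%\<sigma> e. if 4 \<in> \<sigma> then join P 4 (z (\<sigma> - {4}) e) u else 0) \<in> family_space6 (S_f4 - {{}})"
 proof (rule family6I)
  fix \<sigma> e
  show "(if 4 \<in> \<sigma> then join P 4 (z (\<sigma> - {4}) e) u else 0) \<in> tensor_space \<sigma>" if "\<sigma> \<in> S_f4 - {{}}"
  proof (cases "4 \<in> \<sigma>")
   case True
   obtain x where x: "\<sigma> = f_set x" using \<open>\<sigma> \<in> S_f4 - {{}}\<close> S_f4_f_set by (metis DiffE rangeE)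
   then have "x \<in> odd4" using True odd4_iff(2) by simp
   then show ?thesis using True z' x by (simp add: join_in)
  qed simp
  assume a: "\<sigma> ~: S_f4 - {{}} \<or> e ~: elabels \<sigma>"
  show "(if 4 \<in> \<sigma> then join P 4 (z (\<sigma> - {4}) e) u else 0) = 0"
  proof (cases "4 \<in> \<sigma>")
   case True
   show ?thesis
   proof (cases "\<sigma> - {4} \<in> (%x. f_set x - {4}) ` odd4")
    case True
    then obtain x where x: "x \<in> odd4" "\<sigma> - {4} = f_set x - {4}" by blast
    then have s: "\<sigma> = f_set x" using E7.Diff_eq[OF \<open>4 \<in> \<sigma>\<close>] odd4_iff(2) by blast
    then have "\<sigma> \<in> S_f4 - {{}}" using \<open>4 \<in> \<sigma>\<close> S_f4_f_set by blast
    then have "z (\<sigma> - {4}) e = 0" using a z' x s by simp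
    then show ?thesis by simp
   qed (use z' in simp)
  qed simp
 qed
 then show ?thesis unfolding e6_iff odd_elt6_def parts_simps using sp_power_closed(3) t2_closed(3) by blast
qed

lemma sp_elt6_in: "g \<in> sp P ==> sp_elt6 4 g \<in> e6 P"
 unfolding sp_elt6_def by (rule fst_e6) (auto simp: sp_power_iff nu_def sp_0 t2_closed)

lemma e6_decomp:
 assumes X: "X \<in> e6 P"
 shows "\<exists>p g x y. p \<in> a5 P \<and> g \<in> sp P \<and> x \<in> T_e6_a5 \<and> y \<in> T_e6_a5 \<and>
  X = p + sp_elt6 4 g + (odd_elt6 P 4 x b0 + odd_elt6 P 4 y b1)"
proof -
 define p :: "('a, 'v) elt6" where "p = ((sp_part X)(4 := 0), t2_part X, %\<sigma> e. if 4 \<in> \<sigma> then 0 else tens_part X \<sigma> e)"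
 \<comment> \<open>\<open>c b\<close> collects the coordinates of the odd components whose factor at
   4 is \<open>bas P b\<close>: inserting 4 into the subset selects b1.\<close>
 define c where "c b \<rho> e = (if 4 ~: \<rho> then (%\<kappa>. if 4 \<in> \<kappa> then 0 else tens_part X (insert 4 \<rho>) e (if b then insert 4 \<kappa> else \<kappa>)) else 0)" for b \<rho> e
 have F: "tens_part X \<in> family_space6 (S_f4 - {{}})" using X unfolding e6_iff by blast
 have cT: "c b \<in> T_e6_a5" for b
  unfolding T_e6_iff
 proof (intro conjI ballI allI impI)
  fix x e assume x: "x \<in> odd4"
  have i: "insert 4 (f_set x - {4}) = f_set x" using x odd4_iff(2) by blast
  show "c b (f_set x - {4}) e \<in> tensor_space (f_set x - {4})"
  proof -
   have "c b (f_set x - {4}) e \<kappa> = 0" if k: "\<not> \<kappa> \<subseteq> f_set x - {4}" for \<kappa>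
   proof (cases "4 \<in> \<kappa>")
    case False
    then have "\<not> (if b then insert 4 \<kappa> else \<kappa>) \<subseteq> f_set x" using k by auto
    from tensor_zero[OF e6_ten[OF X] this] show ?thesis using False unfolding c_def i by simp
   qed (simp add: c_def)
   then show ?thesis by (simp add: tensor_space_def)
  qed
  show "c b (f_set x - {4}) e = 0" if "e ~: elabels (f_set x)"
   using e6_ten0[OF X that] unfolding c_def i by (auto simp: fun_eq_iff)
 next
  fix \<rho> assume r: "\<rho> ~: (%x. f_set x - {4}) ` odd4"
  show "c b \<rho> = 0"
  proof (cases "4 \<in> \<rho>")
   case False
   have "insert 4 \<rho> ~: S_f4 - {{}}"
   proof
    assume "insert 4 \<rho> \<in> S_f4 - {{}}"
    then obtain x where x: "insert 4 \<rho> = f_set x" using S_f4_f_set by (metis DiffE rangeE)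
    have "4 \<in> f_set x" unfolding x[symmetric] by (rule insertI1)
    then have "x \<in> odd4" unfolding odd4_iff(2) .
    moreover have "\<rho> = f_set x - {4}" unfolding x[symmetric] using False by (rule Diff_insert_absorb[symmetric])
    ultimately show False using r by blast
   qed
   then have "tens_part X (insert 4 \<rho>) e = 0" for e by (intro family6D(2)[OF F]) blast
   then show ?thesis by (auto simp: c_def fun_eq_iff)
  qed (auto simp: c_def fun_eq_iff)
 qed
 have pa: "p \<in> a5 P"
  unfolding a5_def parts_mem p_def parts_simps
 proof (intro conjI e6_t2[OF X] family6I)
  show "(sp_part X)(4 := 0) \<in> sp_power P {1..3}" using e6_sp[OF X] unfolding sp_power_iff
  proof (intro conjI allI impI)
   assume a: "(\<forall>i. sp_part X i \<in> sp P) \<and> (\<forall>i. i ~: {1..4} \<longrightarrow> sp_part X i = 0)"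
   show "((sp_part X)(4 := 0)) i \<in> sp P" for i using a sp_0 by simp
   show "((sp_part X)(4 := 0)) i = 0" if "i ~: {1..3}" for i
   proof (cases "i = 4")
    case False
    then have "i ~: {1..4}" using that by auto
    then show ?thesis using a False by simp
   qed simp
  qed
  fix \<sigma> e
  show "(if 4 \<in> \<sigma> then 0 else tens_part X \<sigma> e) \<in> tensor_space \<sigma>" using e6_ten[OF X] by simp
  assume s: "\<sigma> ~: A4 \<or> e ~: elabels \<sigma>"
  show "(if 4 \<in> \<sigma> then 0 else tens_part X \<sigma> e) = 0"
  proof (cases "4 \<in> \<sigma> \<or> e ~: elabels \<sigma>")
   case False
   have "\<sigma> ~: S_f4 - {{}}"
   proof
    assume "\<sigma> \<in> S_f4 - {{}}"
    then obtain x where x: "\<sigma> = f_set x" "f_set x ~= {}" using S_f4_f_set by (metis DiffE rangeE insertI1)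
    have "x ~: odd4 \<and> x ~= zero3" using x(2) odd4_iff(2)[of x] False x(1) I4_iff(2)[of x] by blast
    then have "\<sigma> \<in> A4" unfolding S_c3_f_set(2) x(1) by blast
    then show False using s False by blast
   qed
   then have "tens_part X \<sigma> e = 0" by (intro family6D(2)[OF F]) blast
   then show ?thesis by simp
  qed (use e6_ten0[OF X] in auto)
 qed
 have "X = p + sp_elt6 4 (sp_part X 4) + (odd_elt6 P 4 (c False) b0 + odd_elt6 P 4 (c True) b1)"
  unfolding parts_eq
 proof (intro conjI)
  show "sp_part X = sp_part (p + sp_elt6 4 (sp_part X 4) + (odd_elt6 P 4 (c False) b0 + odd_elt6 P 4 (c True) b1))"
   by (auto simp: p_def sp_elt6_def odd_elt6_def nu_def fun_eq_iff)
  show "t2_part X = t2_part (p + sp_elt6 4 (sp_part X 4) + (odd_elt6 P 4 (c False) b0 + odd_elt6 P 4 (c True) b1))"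
   by (simp add: p_def sp_elt6_def odd_elt6_def)
  have "tens_part X \<sigma> e \<kappa> = tens_part (p + sp_elt6 4 (sp_part X 4) + (odd_elt6 P 4 (c False) b0 + odd_elt6 P 4 (c True) b1)) \<sigma> e \<kappa>" for \<sigma> e \<kappa>
  proof (cases "4 \<in> \<sigma>")
   case True
   then have i: "insert 4 (\<sigma> - {4}) = \<sigma>" by blast
   have k: "4 \<in> \<kappa> ==> insert 4 (\<kappa> - {4}) = \<kappa>" by blast
   show ?thesis using True by (cases "4 \<in> \<kappa>") (simp_all add: p_def sp_elt6_def odd_elt6_def join_def c_def i k insert_absorb)
  qed (simp add: p_def sp_elt6_def odd_elt6_def)
  then show "tens_part X = tens_part (p + sp_elt6 4 (sp_part X 4) + (odd_elt6 P 4 (c False) b0 + odd_elt6 P 4 (c True) b1))"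
   by (intro ext)
 qed
 then show ?thesis using pa cT sp_part_sp(1)[OF e6_sp[OF X] e6_t2[OF X], of 4] by blast
qed

lemma emb_delta:
 assumes u: "long u" and A: "A \<subseteq> f_set u"
 shows "emb u (%e. if e = EM then ts (1 / omM) (single A 1) else 0) = single (insert (tail2 u) A) 1"
  "emb u (%e. if e = EP then ts (1 / omP) (single A 1) else 0) = single (insert (tail1 u) A) 1"
proof -
 have t: "tail1 u ~: A" "tail2 u ~: A" "tail1 u ~= tail2 u" using tails(1,2)[of u u] tails(3)[of u] A by auto
 have m: "\<mu> - {b} = A \<longleftrightarrow> \<mu> = insert b A" if "b \<in> \<mu>" "b ~: A" for b and \<mu> :: "nat set" using that by blast
 show "emb u (%e. if e = EM then ts (1 / omM) (single A 1) else 0) = single (insert (tail2 u) A) 1"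
  "emb u (%e. if e = EP then ts (1 / omP) (single A 1) else 0) = single (insert (tail1 u) A) 1"
  using t om_nz' m[OF _ t(1)] m[OF _ t(2)] by (auto simp: fun_eq_iff emb_coord[OF u] single_def ts_apply)
qed

lemma emb_odd_single:
 assumes u: "u \<in> odd4" and w: "\<And>e. w e \<in> tensor_space (f_set u - {4})" "\<And>e. e ~: elabels (f_set u) ==> w e = 0"
 shows "single (f_set u - {4}) w \<in> T_e6_a5" "emb_odd (single (f_set u - {4}) w) = single (e_set u - {4}) (emb u w)"
proof -
 have s: "single (f_set u - {4}) w (f_set x - {4}) = (if x = u then w else 0)" if "x \<in> odd4" for x
  using odd_inj(1)[OF that u] by (simp add: single_def)
 show "single (f_set u - {4}) w \<in> T_e6_a5"
  unfolding T_e6_iff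
 proof (intro conjI ballI allI impI)
  show "single (f_set u - {4}) w (f_set x - {4}) e \<in> tensor_space (f_set x - {4})" if "x \<in> odd4" for x e
   unfolding s[OF that] using w(1) by simp
  show "single (f_set u - {4}) w (f_set x - {4}) e = 0" if "x \<in> odd4" "e ~: elabels (f_set x)" for x e
   unfolding s[OF that(1)] using w(2)[of e] that by (cases "x = u") simp_all
  show "single (f_set u - {4}) w \<rho> = 0" if "\<rho> ~: (%x. f_set x - {4}) ` odd4" for \<rho>
   using that u by (auto simp: single_def)
 qed
 show "emb_odd (single (f_set u - {4}) w) = single (e_set u - {4}) (emb u w)"
 proof (rule emb_odd_eqI)
  show "emb_odd (single (f_set u - {4}) w) (e_set x - {4}) = single (e_set u - {4}) (emb u w) (e_set x - {4})" if "x \<in> odd4" for x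
   unfolding emb_odd_apply(1)[OF that] s[OF that] using odd_inj(2)[OF that u] by (simp add: single_def)
  show "emb_odd (single (f_set u - {4}) w) \<rho> = single (e_set u - {4}) (emb u w) \<rho>" if "\<rho> ~: (%x. e_set x - {4}) ` odd4" for \<rho>
   unfolding emb_odd_apply(2)[OF that] using that u by (auto simp: single_def)
 qed
qed

text \<open>In a long component, a nonzero coordinate of the image sits at a subset containing
  exactly one of the two tails. The complementary subset contains exactly the other tail, so its
  basis tensor, the strictly regular element found in e7, lies in the image as well by
  \<open>emb_delta\<close>.\<close>

lemma e6_regular:
 assumes x: "x \<in> T_e6_a5" "x ~= 0"
 shows "\<exists>r\<in>T_e6_a5. E7.dT (emb_odd r) (emb_odd r) = 0 \<and> E7.fT (emb_odd r) (emb_odd x) ~= 0"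
proof -
 have jx: "emb_odd x \<in> E7.T" "emb_odd x ~= 0" using emb_odd_T[OF x(1)] emb_odd_inj[OF x(1)] x(2) unfolding e7_eqs by blast+
 from E7.T_coord[OF jx] obtain \<sigma> \<kappa> where s: "\<sigma> \<in> S_e7" "4 \<in> \<sigma>" "\<kappa> \<subseteq> \<sigma> - {4}" "emb_odd x (\<sigma> - {4}) \<kappa> ~= 0" .
 obtain u where u: "\<sigma> = e_set u" using s(1) S_e7_e_set by (metis rangeE)
 have uo: "u \<in> odd4" using s(2) u odd4_iff(3) by simp
 note reg = E7.delta_regular[OF jx(1) s(1,2) e7_card[OF s(1,2)] s(3,4)]
 have n: "emb u (x (f_set u - {4})) \<kappa> ~= 0" using s(4) emb_odd_apply(1)[OF uo] u by simp
 have "\<exists>w. (\<forall>e. w e \<in> tensor_space (f_set u - {4})) \<and> (\<forall>e. e ~: elabels (f_set u) \<longrightarrow> w e = 0) \<and> emb u w = single (e_set u - {4} - \<kappa>) 1"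
 proof (cases "long u")
  case False
  then have f: "u = full3" using odd4_long[OF uo] by blast
  have "emb u (%e. if e = E0 then single (f_set u - {4} - \<kappa>) 1 else 0) = single (e_set u - {4} - \<kappa>) 1"
   using False by (simp add: emb_def e_set_f_set)
  then show ?thesis using f E7.delta_in[of "f_set u - {4} - \<kappa>" "f_set u - {4}"]
   by (intro exI[of _ "%e. if e = E0 then single (f_set u - {4} - \<kappa>) 1 else 0"]) (auto simp: elabels_f_set)
 next
  case True
  note t = tails(1,2)[of u u] tails(3,4,5)[of u]
  have el: "elabels (f_set u) = {EP, EM}" using True by (auto simp: elabels_f_set)
  have e: "e_set u = insert (tail2 u) (insert (tail1 u) (f_set u))" using True by (simp add: e_set_f_set)
  have A: "f_set u - {4} - \<kappa> \<subseteq> f_set u" by blast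
  have d: "single (f_set u - {4} - \<kappa>) 1 \<in> tensor_space (f_set u - {4})" by (rule E7.delta_in) blast
  consider "tail1 u \<in> \<kappa>" "tail2 u ~: \<kappa>" | "tail2 u \<in> \<kappa>" "tail1 u ~: \<kappa>" using n unfolding emb_coord[OF True] by (auto split: if_splits)
  then show ?thesis
  proof cases
   case 1
   have eq: "e_set u - {4} - \<kappa> = insert (tail2 u) (f_set u - {4} - \<kappa>)" unfolding e using 1 t by auto
   let ?w = "%e. if e = EM then ts (1 / omM) (single (f_set u - {4} - \<kappa>) 1) else 0"
   show ?thesis
   proof (intro exI[of _ ?w] conjI allI impI)
    show "?w e \<in> tensor_space (f_set u - {4})" for e using tensor_space_closed(3)[OF d] by (cases "e = EM") simp_all
    show "?w e = 0" if "e ~: elabels (f_set u)" for e using that unfolding el by (cases e) simp_all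
    show "emb u ?w = single (e_set u - {4} - \<kappa>) 1" unfolding eq by (rule emb_delta(1)[OF True A])
   qed
  next
   case 2
   have eq: "e_set u - {4} - \<kappa> = insert (tail1 u) (f_set u - {4} - \<kappa>)" unfolding e using 2 t by auto
   let ?w = "%e. if e = EP then ts (1 / omP) (single (f_set u - {4} - \<kappa>) 1) else 0"
   show ?thesis
   proof (intro exI[of _ ?w] conjI allI impI)
    show "?w e \<in> tensor_space (f_set u - {4})" for e using tensor_space_closed(3)[OF d] by (cases "e = EP") simp_all
    show "?w e = 0" if "e ~: elabels (f_set u)" for e using that unfolding el by (cases e) simp_all
    show "emb u ?w = single (e_set u - {4} - \<kappa>) 1" unfolding eq by (rule emb_delta(2)[OF True A])
   qed
  qed
 qed
 then obtain w where w: "\<And>e. w e \<in> tensor_space (f_set u - {4})" "\<And>e. e ~: elabels (f_set u) ==> w e = 0" "emb u w = single (e_set u - {4} - \<kappa>) 1" by blast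
 have eo: "single (f_set u - {4}) w \<in> T_e6_a5" "emb_odd (single (f_set u - {4}) w) = single (e_set u - {4}) (emb u w)"
  by (rule emb_odd_single; rule uo w; assumption?)+
 have e: "emb_odd (single (f_set u - {4}) w) = single (\<sigma> - {4}) (single (\<sigma> - {4} - \<kappa>) 1)"
  using eo(2) unfolding w(3) u .
 show ?thesis
  by (rule bexI[OF _ eo(1)]) (unfold e, rule conjI[OF reg])
qed

lemma a5_d6: assumes "X \<in> a5 P" shows "emb6 X \<in> d6 P"
proof -
 have X: "sp_part X \<in> sp_power P {1..3}" "tens_part X \<in> family_space6 A4"
  using assms unfolding a5_def parts_mem by blast+
 have "sp_part X 4 = 0" using X(1) unfolding sp_power_iff by simp
 moreover have "tens_part X (f_set x) = 0" if "x \<in> odd4" for x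
 proof -
  have "f_set x \<in> S_f4 - S_c3" unfolding S_c3_f_set(1) using that by (rule imageI)
  then have "f_set x ~: A4" by (simp add: S_c3_def)
  then have "tens_part X (f_set x) e = 0" for e by (intro family6D(2)[OF X(2)]) blast
  then show ?thesis by (auto simp: fun_eq_iff)
 qed
 ultimately show ?thesis using a5_e6 assms by (intro emb6_in(2)) blast+
qed

lemma decomposition_e6: "freudenthal_decomposition P (es6 P) (bracket_e6 P) (e6 P) (a5 P) (sp_elt6 4) fs6 T_e6_a5 (odd_elt6 P 4)"
proof (rule odd_transfer.decomposition'[OF odd_transfer.intro[OF odd_part_e7 odd_transfer_axioms.intro]])
 interpret OP: odd_part P "es P" E8.br "e7 P" "d6 P" "sp_elt 4" fs T_e7_d6 "odd_elt P 4" E7.fT E7.dT E7.aT by (rule odd_part_e7)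
 show "vector_space (es6 P)" "vector_space (fs6 :: 'a => _)" by (rule vs_es6 vs_fs6)+
 show "ES6.subspace (e6 P)" "ES6.subspace (a5 P)" by (rule e6_sub a5_sub)+
 show "F6.subspace T_e6_a5" by (rule T_e6_sub)
 show "ES.subspace center7" "center7 \<subseteq> d6 P" by (rule center7_sub center7_d6)+
 show "E8.br c (emb6 X) = 0" if "c \<in> center7" "X \<in> e6 P" for c X by (rule center7_br[OF that])
 show "a5 P \<subseteq> e6 P" by (rule a5_e6)
 show "sp_elt6 4 g \<in> e6 P" if "g \<in> sp P" for g by (rule sp_elt6_in[OF that])
 show "odd_elt6 P 4 x u \<in> e6 P" if "x \<in> T_e6_a5" for x u by (rule odd_elt6_in[OF that])
 show "\<exists>p g x y. p \<in> a5 P \<and> g \<in> sp P \<and> x \<in> T_e6_a5 \<and> y \<in> T_e6_a5 \<and> X = p + sp_elt6 4 g + (odd_elt6 P 4 x b0 + odd_elt6 P 4 y b1)"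
  if "X \<in> e6 P" for X by (rule e6_decomp[OF that])
 show "bracket_e6 P X Y \<in> e6 P" if "X \<in> e6 P" "Y \<in> e6 P" for X Y by (rule bracket_e6_in[OF that])
 show "emb6 (X + Y) = emb6 X + emb6 Y" for X Y by (rule emb6_lin)
 show "emb6 (es6 P k X) = es P k (emb6 X)" for X k by (rule emb6_lin)
 show "X = 0" if "X \<in> e6 P" "emb6 X \<in> center7" for X by (rule emb6_center[OF that])
 show "emb6 (bracket_e6 P X Y) - E8.br (emb6 X) (emb6 Y) \<in> center7" if "X \<in> e6 P" "Y \<in> e6 P" for X Y by (rule bracket_emb6[OF that])
 show "emb6 X \<in> d6 P" if "X \<in> a5 P" for X by (rule a5_d6[OF that])
 show "emb6 (sp_elt6 4 g) = sp_elt 4 g" for g by (simp only: sp_elt6_def sp_elt_def emb6_fst)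
 show "emb_odd x \<in> T_e7_d6" if "x \<in> T_e6_a5" for x by (rule emb_odd_T[OF that])
 show "emb6 (odd_elt6 P 4 x u) = odd_elt P 4 (emb_odd x) u" for x u by (rule emb6_odd)
 show "emb_odd (x + y) = emb_odd x + emb_odd y" for x y by (rule emb_odd_lin)
 show "emb_odd (fs6 k x) = fs k (emb_odd x)" for x k by (rule emb_odd_lin)
 show "x = 0" if "x \<in> T_e6_a5" "emb_odd x = 0" for x by (rule emb_odd_inj[OF that])
 show "\<exists>x\<in>T_e6_a5. x ~= (0 :: nat set => elabel => 'a tensor)"
 proof
  define w where "w = (%e. if e = E0 then single {} (1::'a) else 0)"
  have u: "full3 \<in> odd4" by (simp add: odd4_iff(1))
  show "single (f_set full3 - {4}) w \<in> T_e6_a5"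
   by (rule emb_odd_single(1)[OF u]) (auto simp: w_def elabels_f_set intro: E7.delta_in)
  have "single (f_set full3 - {4}) w (f_set full3 - {4}) E0 {} ~= 0" by (simp add: w_def single_def)
  then show "single (f_set full3 - {4}) w ~= 0" by (metis zero_fun_apply)
 qed
 show "\<exists>y\<in>T_e6_a5. E7.fT (emb_odd x) (emb_odd y) ~= 0" if "x \<in> T_e6_a5" "x ~= 0" for x
 proof -
  from e6_regular[OF that] obtain r where r: "r \<in> T_e6_a5" "E7.fT (emb_odd r) (emb_odd x) ~= 0" by blast
  have "E7.fT (emb_odd x) (emb_odd r) ~= 0"
   using OP.f_skew[OF emb_odd_T[OF r(1)] emb_odd_T[OF that(1)]] r(2) by simp
  then show ?thesis using r(1) by blast
 qed
 show "\<exists>r\<in>T_e6_a5. E7.dT (emb_odd r) (emb_odd r) = 0 \<and>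
   (E7.fT (emb_odd r) (emb_odd x) ~= 0 \<or> (\<exists>y\<in>T_e6_a5. \<exists>z\<in>T_e6_a5. E7.fT (emb_odd r) (OP.tp (emb_odd x) (emb_odd y) (emb_odd z)) ~= 0))"
  if "x \<in> T_e6_a5" "x ~= 0" for x using e6_regular[OF that] by blast
qed

end

section \<open>The algebra \<open>f\<^sub>4\<close>\<close>

context sympl begin

interpretation E8: graded P S_e8 eps_e8 by (rule graded_e8)

lemma f_set_int_sub: "f_set x \<inter> f_set y \<subseteq> {1..4}" using f_set_sub by blast

lemma eps_f4_skew:
 assumes "x ~= zero3" "y ~= zero3" "x ~= y"
 shows "eps_f4 (f_set y) (f_set x) * (- 1) ^ card (f_set x \<inter> f_set y) = - (eps_f4 (f_set x) (f_set y) :: 'a)"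
proof -
 obtain p q r p' q' r' where x: "x = (p, q, r)" "y = (p', q', r')" by (cases x; cases y)
 show ?thesis
  using assms unfolding card_le4[OF f_set_int_sub] unfolding x eps_f4_bits
  by (cases p; cases q; cases r; cases p'; cases q'; cases r'; simp add: f_set.simps)
qed

lemma graded_f4: "graded P S_f4 eps_f4"
proof (rule graded.intro[OF sympl_axioms graded_axioms.intro])
 show "finite S_f4" unfolding S_f4_f_set by simp
 show "{} \<in> S_f4" by (simp add: S_f4_def)
 fix \<sigma> \<tau> :: "nat set" assume "\<sigma> \<in> S_f4"
 then obtain x where x: "\<sigma> = f_set x" using S_f4_f_set by (metis rangeE)
 show "finite \<sigma>" unfolding x by simp
 show "eps_f4 {} \<sigma> = (1 :: 'a)" "eps_f4 \<sigma> {} = (1 :: 'a)" by (simp_all add: eps_f4_def)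
 show "even (card \<sigma>)"
  unfolding x card_le4[OF f_set_sub] by (cases x) (auto simp: f_set.simps)
 assume t: "\<tau> \<in> S_f4" "\<sigma> ~= {}" "\<tau> ~= {}" "\<sigma> ~= \<tau>"
 obtain y where y: "\<tau> = f_set y" using t(1) S_f4_f_set by (metis rangeE)
 show "eps_f4 \<tau> \<sigma> * (- 1) ^ card (\<sigma> \<inter> \<tau>) = - (eps_f4 \<sigma> \<tau> :: 'a)"
  unfolding x y by (rule eps_f4_skew) (use t(2-4) I4_iff(2) in \<open>unfold x y, blast+\<close>)
qed

interpretation F4: graded P S_f4 eps_f4 by (rule graded_f4)

subsection \<open>The embedding of \<open>f\<^sub>4\<close> in \<open>e\<^sub>6\<close>\<close>

text \<open>Storing the tensor under every label of its component means x (x) (e+ + e-) for the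
  components with the factor E and x itself for V(I).\<close>

definition f4_e6 :: "('a, 'v) elt => ('a, 'v) elt6" where
 "f4_e6 X = (fst X, 0, %\<sigma> e. if e \<in> elabels \<sigma> then snd X \<sigma> else 0)"

lemma f4_e6_parts [simp]: "sp_part (f4_e6 X) = fst X" "t2_part (f4_e6 X) = 0"
 "tens_part (f4_e6 X) \<sigma> e = (if e \<in> elabels \<sigma> then snd X \<sigma> else 0)"
 by (simp_all add: f4_e6_def)

lemma f4_e6_lin: "f4_e6 (X + Y) = f4_e6 X + f4_e6 Y" "f4_e6 (es P c X) = es6 P c (f4_e6 X)"
 by (simp_all add: parts_eq fun_eq_iff[of "tens_part _"] fun_eq_iff[of "tens_part _ _"] fs_apply fs6_apply prod_eq_iff)

lemma f4_e6_0: "f4_e6 0 = 0" using f4_e6_lin(2)[of 0 0] by simp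

lemma f4_e6_sum: "f4_e6 (\<Sum>i\<in>I. F i) = (\<Sum>i\<in>I. f4_e6 (F i))"
 by (induction I rule: infinite_finite_induct) (simp_all only: sum.infinite sum.empty sum.insert f4_e6_0 f4_e6_lin not_False_eq_True)

lemma f4_e6_fst: "f4_e6 (g, 0) = (g, 0, 0)"
 by (simp add: f4_e6_def fun_eq_iff)

lemma f4_e6_single: "f4_e6 (0, single \<sigma> z) = (0, 0, single \<sigma> (%e. if e \<in> elabels \<sigma> then z else 0))"
 by (auto simp: f4_e6_def single_def fun_eq_iff)

lemma f4D:
 assumes X: "X \<in> f4 P" shows f4_lin: "lin X" and f4_ten: "snd X \<sigma> \<in> tensor_space \<sigma>" and f4_e6_in: "f4_e6 X \<in> e6 P"
proof -
 note X' = X[unfolded f4_def]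
 show "lin X" "snd X \<sigma> \<in> tensor_space \<sigma>" by (rule alg_lin[OF X'] alg_snd[OF X'])+
 have "fst X \<in> sp_power P {1..4}" unfolding sp_power_iff using alg_fst[OF X'] alg_fst0[OF X'] by blast
 moreover have "tens_part (f4_e6 X) \<in> family_space6 (S_f4 - {{}})"
 proof (rule family6I)
  show "tens_part (f4_e6 X) \<sigma> e \<in> tensor_space \<sigma>" for \<sigma> e using alg_snd[OF X'] by simp
  show "tens_part (f4_e6 X) \<sigma> e = 0" if "\<sigma> ~: S_f4 - {{}} \<or> e ~: elabels \<sigma>" for \<sigma> e
   using that alg_snd0[OF X', of \<sigma>] alg_snd_empty[OF X'] by (cases "\<sigma> = {}") auto
 qed
 ultimately show "f4_e6 X \<in> e6 P" unfolding e6_iff by (simp add: t2_closed)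
qed

lemma f4_e6_inj: "f4_e6 X = 0 ==> X = 0"
proof -
 assume e: "f4_e6 X = 0"
 have "fst X = 0" using e f4_e6_parts(1)[of X] by simp
 moreover have "snd X \<sigma> = 0" for \<sigma>
 proof -
  have "\<exists>e. e \<in> elabels \<sigma>" by (simp add: elabels_def) (metis insertI1)
  then obtain l where "l \<in> elabels \<sigma>" by blast
  then show ?thesis using e f4_e6_parts(3)[of X \<sigma> l] by simp
 qed
 ultimately show ?thesis by (simp add: prod_eq_iff fun_eq_iff)
qed

context
 fixes X Y assumes X: "X \<in> f4 P" and Y: "Y \<in> f4 P"
begin

text \<open>For equal and for complementary sets of two elements the two labels contribute equally;
  this doubling is the factor 1/2 between \<open>eps_e6\<close> and \<open>eps_f4\<close>. For equal
  sets the two multiples of a_\<sigma> cancel, so the image has no part in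
  \<open>t2\<close>.\<close>

lemma f4_e6_term: "f4_e6 (es P (eps_f4 (f_set x) (f_set y)) (phi P (f_set x) (f_set y) X Y))
 = es6 P (eps_e6 (f_set x) (f_set y)) (phi6 P (f_set x) (f_set y) (f4_e6 X) (f4_e6 Y))"
proof -
 note phi_forms = phi_def
 have nI: "I4 ~= {}" by (simp add: I4_def)
 have t0: "t2_coeff \<sigma> (0 :: 'a \<times> 'a \<times> 'a) = 0" for \<sigma> by (simp add: t2_coeff_def zero_prod_def)
 have l: "long u ==> f_set u ~= {} \<and> f_set u ~= I4" for u by (auto simp: I4_iff)
 have el: "elabels (f_set u) = {EP, EM}" if "u ~= full3" for u using that by (simp add: elabels_f_set)
 have el4: "elabels I4 = {E0}" using elabels_f_set[of full3] by (simp add: f_sets(5))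
 have a6: "act6 P (f_set u) (f4_e6 U) (tens_part (f4_e6 W) (f_set u)) = (%e. if e \<in> elabels (f_set u) then act P (f_set u) (fst U) (snd W (f_set u)) else 0)" for u U W
  by (auto simp: act6_def t0 fun_eq_iff)
 show ?thesis
 proof (cases rule: bits3_pair_cases[of x y])
  case 1
  then show ?thesis by (simp add: f_sets(1) phi6_forms(1) phi_def f4_e6_lin f4_e6_fst eps_e6_def)
 next
  case 2
  then have "f_set y ~= {}" by (simp add: I4_iff)
  then show ?thesis using 2 by (simp add: f_sets(1) phi6_forms(2) phi_def f4_e6_lin f4_e6_single a6 eps_e6_def)
 next
  case 3
  then have "f_set x ~= {}" by (simp add: I4_iff)
  moreover have "(%e. if e \<in> elabels (f_set x) then - w else 0) = - (%e. if e \<in> elabels (f_set x) then w else (0 :: 'a tensor))" for w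
   by (auto simp: fun_eq_iff)
  ultimately show ?thesis using 3 by (simp add: f_sets(1) phi6_forms(3) phi_def f4_e6_lin f4_e6_single a6 eps_e6_def)
 next
  case 4
  then show ?thesis using nI by (simp add: f_sets(5) phi6_forms(4) phi_def f4_e6_lin f4_e6_fst eps_e6_def el4)
 next
  case 5
  have n: "I4 ~= f_set y" "f_set y ~= {}" using l[OF 5(2)] by auto
  have s: "sym_diff I4 (f_set y) = f_set (xor3 full3 y)" using f_set_xor[of full3 y] by (simp only: f_sets(5))
  have e: "elabels (f_set (xor3 full3 y)) = elabels (f_set y)" using 5(2) unfolding elabels_f_set by (cases y) auto
  have c: "(%e. contr P I4 (f_set y) w (if e \<in> elabels (f_set y) then w' else 0)) = (%e. if e \<in> elabels (f_set y) then contr P I4 (f_set y) w w' else 0)" for w w'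
   by (auto simp: fun_eq_iff)
  show ?thesis unfolding 5(1) f_sets(5) phi6_forms(5)[OF 5(2)]
   using nI n by (simp add: phi_def s f4_e6_lin f4_e6_single eps_e6_def e c el4 del: Un_iff)
 next
  case 6
  have n: "f_set x ~= I4" "f_set x ~= {}" using l[OF 6(1)] by auto
  have s: "sym_diff (f_set x) I4 = f_set (xor3 full3 x)" using f_set_xor[of full3 x] by (auto simp only: f_sets(5))
  have e: "elabels (f_set (xor3 full3 x)) = elabels (f_set x)" using 6(1) unfolding elabels_f_set by (cases x) auto
  have "I4 \<inter> f_set x = f_set x" by (cases x) (auto simp: f_set.simps I4_def)
  then have card: "card (I4 \<inter> f_set x) = 2" using card_f_set(2)[OF 6(1)] by simp
  have fI: "finite I4" by (simp add: I4_def)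
  have com: "contr P (f_set x) I4 (snd X (f_set x)) (snd Y I4) = contr P I4 (f_set x) (snd Y I4) (snd X (f_set x))"
   using contr_commute[OF fI fin_f_set f4_ten[OF Y] f4_ten[OF X], of x] card by simp
  have c: "(%e. contr P I4 (f_set x) w (if e \<in> elabels (f_set x) then w' else 0)) = (%e. if e \<in> elabels (f_set x) then contr P I4 (f_set x) w w' else 0)" for w w'
   by (auto simp: fun_eq_iff)
  show ?thesis unfolding 6(2) f_sets(5) phi6_forms(6)[OF 6(1)]
   using nI n by (simp add: phi_def s com f4_e6_lin f4_e6_single eps_e6_def e c el4 del: Un_iff)
 next
  case 7
  have n: "f_set x ~= I4" "f_set x ~= {}" using l[OF 7(1)] by auto
  have f: "x ~= full3" using 7(1) by auto
  have h: "sps P (1 / 2 * k) (g + g) = sps P k g" for k g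
   unfolding SPS.scale_right_distrib SPS.scale_left_distrib[symmetric] using two by (simp flip: mult_2)
  have "t2s 0 v = (0 :: 'a \<times> 'a \<times> 'a)" "t2s c 0 = (0 :: 'a \<times> 'a \<times> 'a)" for v c by (simp_all add: prod_eq_iff)
  moreover have e: "eps_e6 (f_set x) (f_set x) = 1 / 2 * (eps_f4 (f_set x) (f_set x) :: 'a)" using n by (simp add: eps_e6_def)
  ultimately show ?thesis unfolding 7(2) phi6_forms(7)[OF 7(1)] e f4_e6_lin
   using n by (simp add: phi_def f4_e6_fst el[OF f] parts_eq h[simplified] fs6_def fun_eq_iff)
 next
  case 8
  let ?y = "xor3 full3 x"
  have n: "f_set x ~= I4" "f_set x ~= {}" "f_set ?y ~= {}" using l[OF 8(1)] l[of ?y] 8(1) long_xor(1)[of x] by auto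
  have f: "x ~= full3" "?y ~= full3" using 8(1) long_xor(1)[of x] by auto
  have xy: "f_set x ~= f_set ?y" by (cases x) (simp add: f_set_inj)
  have "xor3 x ?y = full3" by (cases x) simp
  then have s: "sym_diff (f_set x) (f_set ?y) = I4" unfolding f_set_xor by (simp only: f_sets(5))
  have h: "ts (1 / 2 * k) (w + w) = ts k w" for k :: 'a and w
   unfolding TS.scale_right_distrib TS.scale_left_distrib[symmetric] using two by (simp flip: mult_2)
  have e: "eps_e6 (f_set x) (f_set ?y) = 1 / 2 * (eps_f4 (f_set x) (f_set ?y) :: 'a)"
   using n l[of ?y] 8(1) long_xor(1)[of x] by (simp add: eps_e6_def f_set_compl3)
  have i: "single I4 (%e. if e \<in> elabels I4 then w else 0) = single I4 (%e. if e = E0 then w else (0 :: 'a tensor))" for w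
   by (simp add: el4)
  have es: "es6 P k (0, 0, single I4 (%e. if e = E0 then w else 0)) = (0, 0, single I4 (%e. if e = E0 then ts k w else 0))" for k w
   by (auto simp: parts_eq fs6_def single_def fun_eq_iff prod_eq_iff ts_def)
  show ?thesis unfolding 8(2) phi6_forms(8)[OF 8(1)] e
   using n xy by (simp add: phi_def s F4.es_single f4_e6_single i es el[OF f(1)] el[OF f(2)] h[simplified] del: Un_iff cong: if_cong)
 next
  case 9
  have n: "f_set x ~= I4" "f_set x ~= {}" "f_set y ~= {}" using l[OF 9(1)] l[OF 9(2)] by auto
  have f: "x ~= full3" "y ~= full3" "xor3 x y ~= full3" using 9 by auto
  have xy: "f_set y ~= f_set x" "f_set y ~= f_set (xor3 full3 x)" using 9(3) by (cases x; cases y; auto simp: f_set_inj)+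
  have e: "eps_e6 (f_set x) (f_set y) = (eps_f4 (f_set x) (f_set y) :: 'a)"
   using xy by (simp add: eps_e6_def f_set_compl3)
  have c: "(%e. if e = E0 then 0 else contr P (f_set x) (f_set y) (if eneg e \<in> {EP, EM} then w else 0) (if eneg e \<in> {EP, EM} then w' else 0))
    = (%e. if e \<in> {EP, EM} then contr P (f_set x) (f_set y) w w' else 0)" for w w'
  proof
   show "(if e = E0 then 0 else contr P (f_set x) (f_set y) (if eneg e \<in> {EP, EM} then w else 0) (if eneg e \<in> {EP, EM} then w' else 0))
    = (if e \<in> {EP, EM} then contr P (f_set x) (f_set y) w w' else 0)" for e by (cases e) simp_all
  qed
  show ?thesis unfolding phi6_forms(9)[OF 9] e f4_e6_lin f4_e6_parts el[OF f(1)] el[OF f(2)] c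
   using n xy by (simp add: phi_def f_set_xor f4_e6_single el[OF f(3)] del: Un_iff insert_iff)
 qed
qed

lemma f4_e6_br: "f4_e6 (F4.br X Y) = bracket_e6 P (f4_e6 X) (f4_e6 Y)"
proof -
 have inj: "inj f_set" using f_set_inj by (simp add: inj_def)
 have "F4.br X Y = (\<Sum>\<sigma>\<in>S_f4. \<Sum>\<tau>\<in>S_f4. if sym_diff \<sigma> \<tau> \<in> S_f4 then es P (eps_f4 \<sigma> \<tau>) (phi P \<sigma> \<tau> X Y) else 0)"
  by (rule graded_bracket_def)
 also have "\<dots> = (\<Sum>x\<in>UNIV. \<Sum>y\<in>UNIV. es P (eps_f4 (f_set x) (f_set y)) (phi P (f_set x) (f_set y) X Y))"
  unfolding S_f4_f_set sum.reindex[OF inj] o_def f_set_xor by (simp only: rangeI if_True)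
 finally have e: "F4.br X Y = (\<Sum>x\<in>UNIV. \<Sum>y\<in>UNIV. es P (eps_f4 (f_set x) (f_set y)) (phi P (f_set x) (f_set y) X Y))" .
 show ?thesis
  unfolding e bracket_e6_sum[OF f4_e6_in[OF X] f4_e6_in[OF Y]] f4_e6_sum by (intro sum.cong refl f4_e6_term)
qed

lemma f4_br_in: "F4.br X Y \<in> f4 P"
 unfolding f4_def
proof (rule F4.br_closed[OF alg_sub], rule F4.phi_in)
 show "X \<in> algebra_space P {1..4} S_f4" "Y \<in> algebra_space P {1..4} S_f4" using X Y unfolding f4_def by auto
 show "\<sigma> \<subseteq> {1..4}" if "\<sigma> \<in> S_f4" for \<sigma> using that f_set_sub S_f4_f_set by (metis rangeE)
qed auto

end

text \<open>The map from f4 to e6 is a homomorphism and the one from e6 to e7 is so modulo the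
  centre. Central errors of inner brackets vanish in the outer bracket, so the Jacobi sum of f4 is
  mapped into the centre and must be 0.\<close>

lemma jac_f4:
 assumes X: "X \<in> f4 P" and Y: "Y \<in> f4 P" "fst Y = 0" and Z: "Z \<in> f4 P" "fst Z = 0"
 shows "F4.br (F4.br X Y) Z + F4.br (F4.br Y Z) X + F4.br (F4.br Z X) Y = 0"
proof -
 let ?e = "%X. emb6 (f4_e6 X)"
 have b: "?e (F4.br (F4.br U V) W) - E8.br (E8.br (?e U) (?e V)) (?e W) \<in> center7"
  if "U \<in> f4 P" "V \<in> f4 P" "W \<in> f4 P" for U V W
 proof -
  note i = f4_e6_in[OF that(1)] f4_e6_in[OF that(2)] f4_e6_in[OF that(3)]
  note UV = f4_br_in[OF that(1,2)]
  define c where "c = ?e (F4.br U V) - E8.br (?e U) (?e V)"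
  have c: "c \<in> center7" unfolding c_def f4_e6_br[OF that(1,2)] by (rule bracket_emb6[OF i(1,2)])
  have l: "lin (?e W)" by (rule lin_emb6[OF i(3)])
  have "E8.br (?e (F4.br U V)) (?e W) = E8.br (E8.br (?e U) (?e V) + c) (?e W)" by (simp add: c_def)
  also have "\<dots> = E8.br (E8.br (?e U) (?e V)) (?e W)" unfolding E8.br_lin(1)[OF l] center7_br[OF c i(3)] by simp
  finally have "E8.br (?e (F4.br U V)) (?e W) = E8.br (E8.br (?e U) (?e V)) (?e W)" .
  then show ?thesis
   using bracket_emb6[OF f4_e6_in[OF UV] i(3)] unfolding f4_e6_br[OF UV that(3)] by simp
 qed
 have e0: "fst (?e U) = 0" if "fst U = 0" for U using that by (simp add: fst_emb6 emb_fst_def)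
 have in7: "?e U \<in> algebra_space P {1..7} S_e7" if "U \<in> f4 P" for U
  using emb6_in(1)[OF f4_e6_in[OF that]] unfolding e7_def .
 interpret E7: graded_odd P S_e8 eps_e8 S_e7 4 "{1..7}" by (rule graded_odd_e7)
 have J: "E8.br (E8.br (?e X) (?e Y)) (?e Z) + E8.br (E8.br (?e Y) (?e Z)) (?e X) + E8.br (E8.br (?e Z) (?e X)) (?e Y) = 0"
  by (rule E7.jac[OF in7[OF X] in7[OF Y(1)] in7[OF Z(1)] e0[OF Y(2)] e0[OF Z(2)]])
 let ?J = "F4.br (F4.br X Y) Z + F4.br (F4.br Y Z) X + F4.br (F4.br Z X) Y"
 have "?e ?J = (?e (F4.br (F4.br X Y) Z) - E8.br (E8.br (?e X) (?e Y)) (?e Z)) + (?e (F4.br (F4.br Y Z) X) - E8.br (E8.br (?e Y) (?e Z)) (?e X))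
  + (?e (F4.br (F4.br Z X) Y) - E8.br (E8.br (?e Z) (?e X)) (?e Y))
  + (E8.br (E8.br (?e X) (?e Y)) (?e Z) + E8.br (E8.br (?e Y) (?e Z)) (?e X) + E8.br (E8.br (?e Z) (?e X)) (?e Y))"
  unfolding f4_e6_lin emb6_lin by (simp only: algebra_simps)
 also have "\<dots> \<in> center7"
  unfolding J add_0_right by (intro center7_cl(2) b X Y(1) Z(1))
 finally have "?e ?J \<in> center7" .
 moreover have "?J \<in> f4 P" unfolding f4_def
  by (intro ES.subspace_add[OF alg_sub]) (fold f4_def, (intro f4_br_in X Y(1) Z(1))+)
 ultimately have "f4_e6 ?J = 0" using emb6_center f4_e6_in by blast
 then show ?thesis by (rule f4_e6_inj)
qed

lemma graded_odd_f4: "graded_odd P S_f4 eps_f4 S_f4 4 {1..4}"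
proof (rule graded_odd.intro[OF graded_f4 graded_odd_axioms.intro])
 show "\<sigma> \<subseteq> {1..4}" if "\<sigma> \<in> S_f4" for \<sigma> using that f_set_sub S_f4_f_set by (metis rangeE)
 show "eps_f4 \<sigma> \<sigma> ~= (0 :: 'a)" if "\<sigma> \<in> S_f4" for \<sigma> using two by (simp add: eps_f4_def)
 show "\<exists>\<sigma>\<in>S_f4. 4 \<in> \<sigma>" by (rule bexI[of _ I4]) (simp_all add: I4_def S_f4_def)
 show "F4.br (F4.br X Y) Z + F4.br (F4.br Y Z) X + F4.br (F4.br Z X) Y = 0"
  if "X \<in> algebra_space P {1..4} S_f4" "Y \<in> algebra_space P {1..4} S_f4" "Z \<in> algebra_space P {1..4} S_f4" "fst Y = 0" "fst Z = 0" for X Y Z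
  using jac_f4 that unfolding f4_def by blast
qed simp_all

end

section \<open>The odd part of \<open>f4\<close> and its strictly regular elements\<close>

context sympl begin

interpretation F4: graded_odd P S_f4 eps_f4 S_f4 4 "{1..4}" by (rule graded_odd_f4)

lemma f4_eqs:
 shows "F4.L = f4 P" "F4.A = c3 P" "F4.T = T_f4_c3"
proof -
 have "{\<sigma> \<in> S_f4. 4 ~: \<sigma>} = S_c3"
 proof (rule set_eqI)
  fix \<sigma>
  have sub: "S_c3 \<subseteq> S_f4" unfolding S_c3_def S_f4_def by blast
  have inj: "inj f_set" using f_set_inj by (simp add: inj_def)
  show "\<sigma> \<in> {\<sigma> \<in> S_f4. 4 ~: \<sigma>} \<longleftrightarrow> \<sigma> \<in> S_c3"
  proof (cases "\<sigma> \<in> S_f4")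
   case True
   then obtain u where u: "\<sigma> = f_set u" using S_f4_f_set by (metis rangeE)
   have "\<sigma> \<in> S_f4 - S_c3 \<longleftrightarrow> 4 \<in> \<sigma>"
    unfolding S_c3_f_set(1) u inj_image_mem_iff[OF inj] by (rule odd4_iff(2))
   then show ?thesis using True by blast
  next
   case False
   then show ?thesis using sub by blast
  qed
 qed
 moreover from this have "S_f4 - S_c3 = {\<sigma> \<in> S_f4. 4 \<in> \<sigma>}" by blast
 moreover have "{1..4} - {4 :: nat} = {1..3}" by auto
 ultimately show "F4.L = f4 P" "F4.A = c3 P" "F4.T = T_f4_c3"
  by (simp_all only: F4.L_def F4.A_def F4.S0_def f4_def F4.T_def c3_def T_f4_c3_def)
qed

lemma tensor_singleton:
 assumes "x \<in> tensor_space {i}"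
 shows "x = pure P {i} (%_. scl P (x {}) b0 + scl P (x {i}) b1)"
proof
 fix \<kappa>
 have e: "\<kappa> \<subseteq> {i} \<longleftrightarrow> \<kappa> = {} \<or> \<kappa> = {i}" by blast
 show "x \<kappa> = pure P {i} (%_. scl P (x {}) b0 + scl P (x {i}) b1) \<kappa>"
 proof (cases "\<kappa> = {} \<or> \<kappa> = {i}")
  case True
  then show ?thesis by (elim disjE) (simp_all add: pure_def coord_add coord_scl)
 next
  case False
  then have "x \<kappa> = 0" using tensor_zero[OF assms, of \<kappa>] e by blast
  then show ?thesis using False unfolding pure_def e by (simp only: if_False)
 qed
qed

context
 fixes \<sigma> :: "nat set" and i :: nat
 assumes s: "\<sigma> \<in> S_f4" "4 \<in> \<sigma>" "\<sigma> - {4} = {i}"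
begin

lemma odd_pair: "\<sigma> = {i, 4}" "i \<in> {1, 2, 3}" "I4 - \<sigma> \<in> S_f4" "I4 - \<sigma> ~= {}" "sym_diff \<sigma> I4 = I4 - \<sigma>" "sym_diff (I4 - \<sigma>) \<sigma> = I4"
 "I4 - {4} = {1, 2, 3}" "sym_diff {i} (I4 - {4}) = I4 - \<sigma>" "sym_diff (I4 - \<sigma>) {i} = I4 - {4}" "I4 \<in> S_f4" "4 \<in> I4" "\<sigma> ~= I4"
proof -
 show e: "\<sigma> = {i, 4}" using s(2,3) by blast
 obtain x where x: "\<sigma> = f_set x" using s(1) S_f4_f_set by (metis rangeE)
 have sub: "\<sigma> \<subseteq> {1..4}" unfolding x by (rule f_set_sub)
 have "i \<in> \<sigma> - {4}" unfolding s(3) by (rule insertI1)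
 then have "i \<in> {1..4}" "i ~= 4" using sub by blast+
 then show i: "i \<in> {1, 2, 3}" by auto
 have I: "I4 = {1, 2, 3, 4}" by (rule I4_def)
 show "I4 - \<sigma> \<in> S_f4" unfolding x f_set_compl3 S_f4_f_set by (rule rangeI)
 have c: "i = 1 \<or> i = 2 \<or> i = 3" using i by blast
 have m: "j \<in> \<sigma> \<longleftrightarrow> j = i \<or> j = 4" "j \<in> I4 \<longleftrightarrow> j = 1 \<or> j = 2 \<or> j = 3 \<or> j = 4" for j
  unfolding e I by simp_all
 have iI: "i \<in> I4" "i ~= 4" "4 \<in> I4" using c unfolding m(2) by auto
 have sub: "\<sigma> \<subseteq> I4" unfolding e using iI by blast
 show "I4 - {4} = {1, 2, 3}" unfolding I by auto
 show n: "I4 - \<sigma> ~= {}"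
 proof (cases "i = 1")
  case True
  then have "2 \<in> I4 - \<sigma>" by (simp add: m)
  then show ?thesis by blast
 next
  case False
  then have "1 \<in> I4 - \<sigma>" by (simp add: m)
  then show ?thesis by blast
 qed
 show "sym_diff \<sigma> I4 = I4 - \<sigma>" "sym_diff (I4 - \<sigma>) \<sigma> = I4" using sub by blast+
 show "sym_diff {i} (I4 - {4}) = I4 - \<sigma>" "sym_diff (I4 - \<sigma>) {i} = I4 - {4}" unfolding e using iI by blast+
 show "4 \<in> I4" by (rule iI)
 show "\<sigma> ~= I4" using n by blast
 show "I4 \<in> S_f4" unfolding S_f4_def by blast
qed

text \<open>The second argument lives in the component I4 only, so the target I4 - \<sigma>
  determines the first index set: a single pair of components contributes.\<close>

lemma snd_dT_single:
 "snd (F4.dT x (single (I4 - {4}) y)) (I4 - \<sigma>) = ts (eps_f4 \<sigma> I4) (contr P {i} (I4 - {4}) (x {i}) y)"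
proof -
 note p = odd_pair
 let ?y = "single (I4 - {4}) y"
 let ?v = "ts (eps_f4 \<sigma> I4) (contr P {i} (I4 - {4}) (x {i}) y)"
 have t: "snd (F4.dterm x ?y a b) (I4 - \<sigma>) = (if (a, b) = (\<sigma>, I4) then ?v else 0)" for a b
 proof (cases "sym_diff a b \<in> S_f4 \<and> 4 \<in> a \<and> 4 \<in> b")
  case False
  have "(a, b) ~= (\<sigma>, I4)"
  proof
   assume "(a, b) = (\<sigma>, I4)"
   then have "a = \<sigma>" "b = I4" by simp_all
   then have "sym_diff a b \<in> S_f4 \<and> 4 \<in> a \<and> 4 \<in> b" using p(3,11) s(2) by (simp only: p(5) simp_thms)
   then show False using False by contradiction
  qed
  then show ?thesis using False by (simp only: F4.dterm_def if_False snd_zero zero_fun_apply)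
 next
  case True
  have y: "?y (b - {4}) = (if b = I4 then y else 0)"
   using F4.Diff_eq[of b I4] True p(11) by (simp add: single_def)
  show ?thesis
  proof (cases "a = b")
   case ab: True
   have "(a, b) ~= (\<sigma>, I4)" using ab p(12) by blast
   then show ?thesis using True ab by (simp only: F4.dterm_def if_True if_False simp_thms es_simps snd_conv fs_apply zero_fun_apply TS.scale_zero_right)
  next
   case ab: False
   have "snd (F4.dterm x ?y a b) (I4 - \<sigma>) = ts (eps_f4 a b) (single (sym_diff a b) (contr P (a - {4}) (b - {4}) (x (a - {4})) (?y (b - {4}))) (I4 - \<sigma>))"
    using True ab by (simp add: F4.dterm_def fs_apply del: Un_iff)
   also have "\<dots> = (if (a, b) = (\<sigma>, I4) then ?v else 0)"
   proof (cases "b = I4")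
    case bI: True
    show ?thesis
    proof (cases "a = \<sigma>")
     case True
     have "single (sym_diff \<sigma> I4) w' (I4 - \<sigma>) = w'" for w' :: "'a tensor" by (simp only: p(5) single_def simp_thms if_True)
     moreover have "?y (I4 - {4}) = y" by (simp only: single_def simp_thms if_True)
     ultimately show ?thesis unfolding True bI s(3) by (simp only: if_True simp_thms)
    next
     case False
     have "sym_diff a I4 ~= I4 - \<sigma>"
     proof
      assume "sym_diff a I4 = I4 - \<sigma>"
      then have "sym_diff a I4 = sym_diff \<sigma> I4" by (simp only: p(5))
      then have "sym_diff (sym_diff a I4) I4 = sym_diff (sym_diff \<sigma> I4) I4" by (rule arg_cong)
      then show False using False by (simp only: sym_diff_cancel)
     qed
     then have "I4 - \<sigma> ~= sym_diff a I4" by (rule not_sym)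
     moreover have "(a, b) ~= (\<sigma>, I4)" using False by blast
     ultimately show ?thesis unfolding bI by (simp only: single_def if_False TS.scale_zero_right)
    qed
   qed (simp add: y)
   finally show ?thesis .
  qed
 qed
 have "finite S_f4" unfolding S_f4_f_set by simp
 have "snd (F4.dT x ?y) (I4 - \<sigma>) = (\<Sum>q\<in>S_f4 \<times> S_f4. snd (case q of (a, b) => F4.dterm x ?y a b) (I4 - \<sigma>))"
  unfolding F4.dT_def snd_sum by (rule sum_apply)
 also have "\<dots> = (\<Sum>q\<in>S_f4 \<times> S_f4. if q = (\<sigma>, I4) then ?v else 0)"
  by (rule sum.cong[OF refl]) (simp only: t case_prod_beta prod.collapse)
 also have "\<dots> = ?v" using \<open>finite S_f4\<close> s(1) p(10) by simp
 finally show ?thesis .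
qed

lemma aT_single:
 "F4.aT D (single {i} z) (I4 - {4}) = ts (eps_f4 (I4 - \<sigma>) \<sigma>) (contr P (I4 - \<sigma>) {i} (snd D (I4 - \<sigma>)) z)"
proof -
 note p = odd_pair
 let ?z = "single {i} z"
 let ?v = "ts (eps_f4 (I4 - \<sigma>) \<sigma>) (contr P (I4 - \<sigma>) {i} (snd D (I4 - \<sigma>)) z)"
 have n4: "{i} ~= I4 - {4}" unfolding p(7) by auto
 have t: "F4.aterm D ?z a b (I4 - {4}) = (if (a, b) = (I4 - \<sigma>, \<sigma>) then ?v else 0)" for a b
 proof (cases "sym_diff a b \<in> S_f4 \<and> 4 ~: a \<and> 4 \<in> b")
  case False
  have "(a, b) ~= (I4 - \<sigma>, \<sigma>)"
  proof
   assume "(a, b) = (I4 - \<sigma>, \<sigma>)"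
   then have "a = I4 - \<sigma>" "b = \<sigma>" by simp_all
   then have "sym_diff a b \<in> S_f4 \<and> 4 ~: a \<and> 4 \<in> b" using p(10) s(2) by (simp only: p(6) simp_thms Diff_iff)
   then show False using False by contradiction
  qed
  then show ?thesis using False by (simp only: F4.aterm_def if_False zero_fun_apply)
 next
  case True
  have z: "?z (b - {4}) = (if b = \<sigma> then z else 0)"
   using F4.Diff_eq[of b \<sigma>] True s(2,3) by (simp add: single_def)
  show ?thesis
  proof (cases "b = \<sigma>")
   case b: False
   then have z0: "?z (b - {4}) = 0" using z by (simp only: if_False)
   have "(a, b) ~= (I4 - \<sigma>, \<sigma>)" using b by blast
   then show ?thesis unfolding F4.aterm_def if_P[OF True] z0 zero_lin single_0 if_not_P[OF \<open>(a, b) ~= (I4 - \<sigma>, \<sigma>)\<close>]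
    by (cases "a = {}") (simp_all only: if_True if_False simp_thms if_cancel fs_apply zero_fun_apply TS.scale_zero_right)
  next
   case b: True
   show ?thesis
   proof (cases "a = {}")
    case True
    have "(a, b) ~= (I4 - \<sigma>, \<sigma>)" using True p(4) by blast
    moreover have "single (b - {4}) w' (I4 - {4}) = 0" for w' :: "'a tensor" unfolding b s(3) single_def by (rule if_not_P[OF not_sym[OF n4]])
    ultimately show ?thesis unfolding F4.aterm_def if_P[OF \<open>sym_diff a b \<in> S_f4 \<and> 4 ~: a \<and> 4 \<in> b\<close>] if_P[OF True]
     by (simp only: fs_apply TS.scale_zero_right if_False)
   next
    case a: False
    have zs: "?z (\<sigma> - {4}) = z" unfolding s(3) by (simp only: single_def simp_thms if_True)
    have at: "F4.aterm D ?z a b = fs (eps_f4 a \<sigma>) (single (sym_diff a \<sigma> - {4}) (contr P a {i} (snd D a) z))"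
     unfolding F4.aterm_def if_P[OF True] if_not_P[OF a] unfolding b zs unfolding s(3) ..
    show ?thesis
    proof (cases "a = I4 - \<sigma>")
     case eq: True
     have "single (sym_diff (I4 - \<sigma>) \<sigma> - {4}) w' (I4 - {4}) = w'" for w' :: "'a tensor" by (simp only: p(6) single_def simp_thms if_True)
     then show ?thesis unfolding at fs_apply unfolding eq b by (simp only: if_True simp_thms)
    next
     case False
     have "sym_diff a \<sigma> - {4} ~= I4 - {4}"
     proof
      assume "sym_diff a \<sigma> - {4} = I4 - {4}"
      moreover have "4 \<in> sym_diff a \<sigma>" using True b by blast
      ultimately have "sym_diff a \<sigma> = I4" using p(11) F4.Diff_eq by blast
      then have "sym_diff (sym_diff a \<sigma>) \<sigma> = sym_diff I4 \<sigma>" by (rule arg_cong)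
      then have "a = sym_diff I4 \<sigma>" by (simp only: sym_diff_cancel)
      moreover have "sym_diff I4 \<sigma> = I4 - \<sigma>" using p(5) by (simp only: Un_commute)
      ultimately show False using False by (simp only: simp_thms)
     qed
     then have "I4 - {4} ~= sym_diff a \<sigma> - {4}" by (rule not_sym)
     moreover have "(a, b) ~= (I4 - \<sigma>, \<sigma>)" using False by blast
     ultimately show ?thesis unfolding at fs_apply by (simp only: single_def if_False TS.scale_zero_right)
    qed
   qed
  qed
 qed
 have "finite S_f4" unfolding S_f4_f_set by simp
 have "F4.aT D ?z (I4 - {4}) = (\<Sum>q\<in>S_f4 \<times> S_f4. (case q of (a, b) => F4.aterm D ?z a b) (I4 - {4}))"
  unfolding F4.aT_def by (rule sum_apply)
 also have "\<dots> = (\<Sum>q\<in>S_f4 \<times> S_f4. if q = (I4 - \<sigma>, \<sigma>) then ?v else 0)"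
  by (rule sum.cong[OF refl]) (simp only: t case_prod_beta prod.collapse)
 also have "\<dots> = ?v" using \<open>finite S_f4\<close> s(1) p(3) by simp
 finally show ?thesis .
qed

text \<open>The component V_i has one factor, and \<open>gam P e e\<close> is nonzero for nonzero e,
  so V_i offers no nonzero element with d_{r,r} = 0. Instead r is a pure tensor in the component of
  I4: d_{x,y} with y in this component lies, in part, in V(I4 - \<sigma>), and its action on z in
  V_i leads back to three factors, where r can detect it.\<close>

lemma f4_regular_pair:
 assumes x: "x \<in> F4.T" "x {i} ~= 0" and x0: "x (I4 - {4}) = 0"
 shows "\<exists>r\<in>F4.T. F4.dT r r = 0 \<and>
  (\<exists>y\<in>F4.T. \<exists>z\<in>F4.T. F4.fT r (F4.aT (F4.dT x y) z - fs (F4.fT x z) y - fs (F4.fT y z) x) ~= 0)"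
proof -
 note p = odd_pair
 have xi: "x {i} \<in> tensor_space {i}" using F4.T_mem(1)[OF x(1) s(2)] unfolding s(3) .
 define e where "e = scl P (x {i} {}) b0 + scl P (x {i} {i}) b1"
 have xe: "x {i} = pure P {i} (%_. e)" unfolding e_def by (rule tensor_singleton[OF xi])
 have "e ~= 0"
 proof
  assume "e = 0"
  then have "x {i} = 0" unfolding xe by (auto simp: pure_def fun_eq_iff)
  then show False using x(2) by blast
 qed
 then obtain \<beta> where b: "form P e (bas P \<beta>) ~= 0" using form_nondeg by blast
 let ?I = "I4 - {4}"
 \<comment> \<open>The vector at \<open>i\<close> of y is \<beta>, which pairs nontrivially with e.
   r has the same vector at \<open>i\<close>, so that (r|y) = 0 removes the correction term in y,
   and z has the other basis vector, so that it pairs with r. At the remaining indices r has b0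
   against b1 in y.\<close>
 define v where "v l = (if l = i then bas P \<beta> else b0)" for l
 define w where "w l = (if l = i then bas P \<beta> else b1)" for l
 define r where "r = single ?I (pure P ?I v)"
 define y where "y = single ?I (pure P ?I w)"
 define z where "z = single {i} (pure P {i} (%_. bas P (\<not> \<beta>)))"
 have fin: "finite ?I" "finite (I4 - \<sigma>)" "finite {i}" by (simp_all add: I4_def)
 have rT: "r \<in> F4.T" "y \<in> F4.T" unfolding r_def y_def by (rule F4.T_single[OF p(10,11) pure_in])+
 have zT: "z \<in> F4.T" using F4.T_single[OF s(1,2), of "pure P {i} (%_. bas P (\<not> \<beta>))"] unfolding s(3) z_def by simp
 have "card I4 \<ge> 3" by (simp add: I4_def)
 then have "F4.dT r r = 0" unfolding r_def by (rule F4.dT_pure[OF p(10,11)])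
 have iI: "i \<in> ?I" "i ~: I4 - \<sigma>" unfolding p(7) using p(1,2) by auto
 have zI: "z ?I = 0" using p(2) unfolding z_def single_def p(7) by auto
 have fyz: "F4.fT y z = 0" unfolding y_def F4.fT_single(1)[OF p(10,11)] zI by simp
 have "(\<Prod>l\<in>?I. form P (v l) (w l)) = 0"
  by (rule prod_zero[OF fin(1)]) (use iI in \<open>auto simp: v_def w_def\<close>)
 then have fry: "tform P ?I (pure P ?I v) (y ?I) = 0" unfolding y_def by (simp add: tform_pure[OF P fin(1)])
 have c1: "contr P {i} ?I (x {i}) (pure P ?I w) = ts (form P e (bas P \<beta>)) (pure P (I4 - \<sigma>) (%l. if l \<in> {i} then e else w l))"
 proof -
  have "{i} \<inter> ?I = {i}" using iI by blast
  then show ?thesis unfolding xe contr_pure[OF P fin(3,1)] p(8) by (simp add: w_def)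
 qed
 have c2: "contr P (I4 - \<sigma>) {i} (pure P (I4 - \<sigma>) u) (pure P {i} u') = pure P ?I (%l. if l \<in> I4 - \<sigma> then u l else u' l)" for u u'
 proof -
  have "(I4 - \<sigma>) \<inter> {i} = {}" using iI(2) by blast
  then show ?thesis unfolding contr_pure[OF P fin(2,3)] p(9) by simp
 qed
 have az: "F4.aT (F4.dT x y) z ?I = ts (eps_f4 (I4 - \<sigma>) \<sigma> * (eps_f4 \<sigma> I4 * form P e (bas P \<beta>)))
   (pure P ?I (%l. if l \<in> I4 - \<sigma> then (if l \<in> {i} then e else w l) else bas P (\<not> \<beta>)))"
  unfolding z_def aT_single y_def snd_dT_single c1 contr_lin c2 ts_ts ..
 have pr: "(\<Prod>l\<in>?I. form P (v l) (if l \<in> I4 - \<sigma> then (if l \<in> {i} then e else w l) else bas P (\<not> \<beta>))) ~= 0"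
 proof (subst prod_zero_iff[OF fin(1)], rule notI, elim bexE)
  fix l assume l: "l \<in> ?I" and e0: "form P (v l) (if l \<in> I4 - \<sigma> then (if l \<in> {i} then e else w l) else bas P (\<not> \<beta>)) = 0"
  show False
  proof (cases "l = i")
   case True
   then show False using e0 iI(2) om_nz by (simp add: v_def form_bas split: if_splits)
  next
   case False
   then have "l \<in> I4 - \<sigma>" using l p(1) by auto
   then show False using e0 False om_nz by (simp add: v_def w_def form_bas)
  qed
 qed
 have ne: "eps_f4 (I4 - \<sigma>) \<sigma> ~= (0 :: 'a)" "eps_f4 \<sigma> I4 ~= (0 :: 'a)" "eps_f4 I4 I4 ~= (0 :: 'a)"
  using two by (simp_all add: eps_f4_def)
 have "F4.fT r (F4.aT (F4.dT x y) z - fs (F4.fT x z) y - fs (F4.fT y z) x) ~= 0"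
 proof -
  have m: "(F4.aT (F4.dT x y) z - fs (F4.fT x z) y - fs (F4.fT y z) x) ?I = F4.aT (F4.dT x y) z ?I + ts (- F4.fT x z) (y ?I)"
   unfolding fyz by (simp add: fs_apply)
  show ?thesis
   unfolding r_def F4.fT_single(1)[OF p(10,11)] m tform_lin fry az tform_pure[OF P fin(1)]
   using two ne b pr by simp
 qed
 then show ?thesis using rT zT \<open>F4.dT r r = 0\<close> by blast
qed

end

lemma decomposition_f4: "freudenthal_decomposition P (es P) (bracket_f4 P) (f4 P) (c3 P) (sp_elt 4) fs T_f4_c3 (odd_elt P 4)"
proof -
 have "freudenthal_decomposition P (es P) (graded_bracket P S_f4 eps_f4) F4.L F4.A (sp_elt 4) fs F4.T (odd_elt P 4)"
 proof (rule odd_part.decomposition[OF F4.odd_part])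
  fix x assume x: "x \<in> F4.T" "x ~= 0"
  have I: "I4 \<in> S_f4" "4 \<in> I4" "card I4 \<ge> 3" by (simp_all add: S_f4_def I4_def)
  show "\<exists>r\<in>F4.T. F4.dT r r = 0 \<and>
   (F4.fT r x ~= 0 \<or> (\<exists>y\<in>F4.T. \<exists>z\<in>F4.T. F4.fT r (F4.aT (F4.dT x y) z - fs (F4.fT x z) y - fs (F4.fT y z) x) ~= 0))"
  proof (cases "x (I4 - {4}) = 0")
   case False
   then obtain \<kappa> where k: "x (I4 - {4}) \<kappa> ~= 0" by (auto simp: fun_eq_iff)
   then have "\<kappa> \<subseteq> I4 - {4}" using tensor_zero[OF F4.T_mem(1)[OF x(1) I(2)]] by blast
   then show ?thesis using F4.regular_pure[OF x(1) I _ k] by blast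
  next
   case True
   from F4.T_coord[OF x] obtain \<sigma> \<kappa> where s: "\<sigma> \<in> S_f4" "4 \<in> \<sigma>" "\<kappa> \<subseteq> \<sigma> - {4}" "x (\<sigma> - {4}) \<kappa> ~= 0" .
   obtain u where u: "\<sigma> = f_set u" using s(1) S_f4_f_set by (metis rangeE)
   have "u ~= full3" using s(4) True by (auto simp: u f_sets(5))
   then have "long u" using odd4_long[of u] s(2) unfolding u odd4_iff(2) by blast
   then have "card (\<sigma> - {4}) = 1" using card_f_set(2)[of u] s(2) unfolding u by simp
   then obtain i where i: "\<sigma> - {4} = {i}" by (rule card_1_singletonE)
   have "x {i} ~= 0" using s(4) unfolding i by auto
   from f4_regular_pair[OF s(1,2) i x(1) this True] show ?thesis by blast
  qed
 qed
 then show ?thesis unfolding f4_eqs bracket_f4_def .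
qed

end

section \<open>Dimensions\<close>

text \<open>The functionals \<open>c i\<close> are dual to the \<open>b i\<close>, so applying them
  to a vanishing combination reads off its coefficients. For families of tensors the coordinates
  play this role.\<close>

lemma dim_dual_basis:
 fixes s :: "'a::field => 'b::ab_group_add => 'b"
 assumes s: "vector_space s" and I: "finite I"
  and c_add: "\<And>i x y. c i (x + y) = c i x + c i y" and c_scl: "\<And>i k x. c i (s k x) = k * c i x"
  and c_b: "\<And>i j. i \<in> I ==> j \<in> I ==> c i (b j) = (if i = j then 1 else (0::'a))"
  and b: "\<And>i. i \<in> I ==> b i \<in> V" and V: "\<And>x. x \<in> V ==> x = (\<Sum>i\<in>I. s (c i x) (b i))"
 shows "vector_space.dim s V = card I"
proof -
 interpret vector_space s by (rule s)
 have inj: "inj_on b I"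
  by (rule inj_onI) (metis c_b zero_neq_one)
 have c0: "c i 0 = 0" for i using c_scl[of i 0 0] by simp
 have c_sum: "c i (\<Sum>j\<in>J. F j) = (\<Sum>j\<in>J. c i (F j))" for i J and F :: "_ => 'b"
  by (induction J rule: infinite_finite_induct) (simp_all add: c0 c_add)
 have "independent (b ` I)"
 proof (rule independent_if_scalars_zero)
  show "finite (b ` I)" using I by simp
  fix f x assume e: "(\<Sum>x\<in>b ` I. s (f x) x) = 0" and "x \<in> b ` I"
  then obtain i where i: "i \<in> I" "x = b i" by blast
  have "0 = c i (\<Sum>j\<in>I. s (f (b j)) (b j))" using e c0 by (simp add: sum.reindex[OF inj])
  also have "\<dots> = (\<Sum>j\<in>I. if j = i then f (b i) else 0)"
   unfolding c_sum by (rule sum.cong) (use i c_b c_scl in auto)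
  finally show "f x = 0" using i I by simp
 qed
 moreover have "V \<subseteq> span (b ` I)"
 proof
  fix x assume "x \<in> V"
  note e = V[OF this]
  have "(\<Sum>i\<in>I. s (c i x) (b i)) \<in> span (b ` I)"
   by (intro span_sum span_scale span_base imageI)
  then show "x \<in> span (b ` I)" unfolding e[symmetric] .
 qed
 moreover have "b ` I \<subseteq> V" using b by blast
 ultimately show ?thesis using dim_unique card_image[OF inj] by metis
qed

lemma dim_family_space:
 assumes S: "finite S" "\<And>\<sigma>. \<sigma> \<in> S ==> finite \<sigma>"
 shows "vector_space.dim fs (family_space S :: (nat set => 'a::field tensor) set) = (\<Sum>\<sigma>\<in>S. 2 ^ card \<sigma>)"
proof -
 let ?I = "SIGMA \<sigma>:S. Pow \<sigma>"
 let ?c = "%(\<sigma>, \<kappa>) x. x \<sigma> \<kappa> :: 'a"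
 let ?b = "%(\<sigma>, \<kappa>). single \<sigma> (single \<kappa> (1::'a))"
 have "vector_space.dim fs (family_space S :: (nat set => 'a tensor) set) = card ?I"
 proof (rule dim_dual_basis[where c = ?c and b = ?b, OF vs_fs])
  show "finite ?I" using S by (intro finite_SigmaI) simp_all
  show "(?b i) \<in> family_space S" if "i \<in> ?I" for i
  proof -
   obtain \<sigma> \<kappa> where i1: "i = (\<sigma>, \<kappa>)" by (cases i)
   then have i: "i = (\<sigma>, \<kappa>)" "\<sigma> \<in> S" "\<kappa> \<subseteq> \<sigma>" using that by auto
   have "single \<sigma> (single \<kappa> (1::'a)) \<in> family_space S"
    by (rule single_family[OF i(2)]) (use i(3) in \<open>auto simp: tensor_space_def single_def\<close>)
   then show ?thesis unfolding i by simp
  qed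
  fix x :: "nat set => 'a tensor" assume x: "x \<in> family_space S"
  have "x \<rho> \<mu> = (\<Sum>i\<in>?I. fs (?c i x) (?b i)) \<rho> \<mu>" for \<rho> \<mu>
  proof -
   have "(\<Sum>i\<in>?I. fs (?c i x) (?b i)) \<rho> \<mu> =
    (\<Sum>i\<in>?I. if i = (\<rho>, \<mu>) then x \<rho> \<mu> else 0)"
    unfolding sum_apply by (rule sum.cong) (auto simp: fs_def ts_def single_def split: if_splits)
   also have "\<dots> = x \<rho> \<mu>"
   proof (cases "(\<rho>, \<mu>) \<in> ?I")
    case False
    then have "x \<rho> \<mu> = 0"
     using family_spaceD[OF x, of \<rho>] tensor_zero[OF family_spaceD(1)[OF x], of \<mu> \<rho>] by (cases "\<rho> \<in> S") auto
    then show ?thesis by (simp add: sum.neutral)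
   qed (use \<open>finite ?I\<close> in simp)
   finally show ?thesis ..
  qed
  then show "x = (\<Sum>i\<in>?I. fs (?c i x) (?b i))"
   by (intro ext)
 qed (auto simp: fs_def ts_def single_def split: if_splits)
 also have "card ?I = (\<Sum>\<sigma>\<in>S. 2 ^ card \<sigma>)"
  using S by (simp add: card_SigmaI card_Pow)
 finally show ?thesis .
qed

lemma finite_elabels: "finite (elabels \<sigma>)" by (simp add: elabels_def)

lemma dim_family_space6:
 assumes S: "finite S" "\<And>\<sigma>. \<sigma> \<in> S ==> finite \<sigma>"
 shows "vector_space.dim fs6 (family_space6 S :: (nat set => elabel => 'a::field tensor) set) = (\<Sum>\<sigma>\<in>S. card (elabels \<sigma>) * 2 ^ card \<sigma>)"
proof -
 let ?I = "SIGMA \<sigma>:S. elabels \<sigma> \<times> Pow \<sigma>"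
 let ?c = "%(\<sigma>, e, \<kappa>) x. x \<sigma> e \<kappa> :: 'a"
 let ?b = "%(\<sigma>, e, \<kappa>). single \<sigma> (%e'. if e' = e then single \<kappa> (1::'a) else 0)"
 have fI: "finite ?I" using S finite_elabels by (intro finite_SigmaI finite_cartesian_product) simp_all
 have "vector_space.dim fs6 (family_space6 S :: (nat set => elabel => 'a tensor) set) = card ?I"
 proof (rule dim_dual_basis[where c = ?c and b = ?b, OF vs_fs6 fI])
  show "?b i \<in> family_space6 S" if "i \<in> ?I" for i
  proof -
   obtain \<sigma> e \<kappa> where i1: "i = (\<sigma>, e, \<kappa>)" by (cases i)
   then have i: "i = (\<sigma>, e, \<kappa>)" "\<sigma> \<in> S" "e \<in> elabels \<sigma>" "\<kappa> \<subseteq> \<sigma>" using that by auto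
   have "single \<sigma> (%e'. if e' = e then single \<kappa> (1::'a) else 0) \<in> family_space6 S"
    by (rule single_family6[OF i(2)]) (use i(3,4) in \<open>auto simp: tensor_space_def single_def\<close>)
   then show ?thesis unfolding i by simp
  qed
  fix x :: "nat set => elabel => 'a tensor" assume x: "x \<in> family_space6 S"
  have "x \<rho> e \<mu> = (\<Sum>i\<in>?I. fs6 (?c i x) (?b i)) \<rho> e \<mu>" for \<rho> e \<mu>
  proof -
   have "(\<Sum>i\<in>?I. fs6 (?c i x) (?b i)) \<rho> e \<mu> = (\<Sum>i\<in>?I. if i = (\<rho>, e, \<mu>) then x \<rho> e \<mu> else 0)"
    unfolding sum_apply by (rule sum.cong) (auto simp: fs6_def ts_def single_def split: if_splits)
   also have "\<dots> = x \<rho> e \<mu>"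
   proof (cases "(\<rho>, e, \<mu>) \<in> ?I")
    case False
    then have "x \<rho> e \<mu> = 0"
     using family6D(2)[OF x, of \<rho> e] tensor_zero[OF family6D(1)[OF x], of \<mu> \<rho> e] by (cases "\<rho> \<in> S \<and> e \<in> elabels \<rho>") auto
    then show ?thesis by (simp add: sum.neutral)
   qed (use fI in simp)
   finally show ?thesis ..
  qed
  then show "x = (\<Sum>i\<in>?I. fs6 (?c i x) (?b i))"
   by (intro ext)
 qed (auto simp: fs6_def ts_def single_def split: if_splits)
 also have "card ?I = (\<Sum>\<sigma>\<in>S. card (elabels \<sigma>) * 2 ^ card \<sigma>)"
  using S finite_elabels by (simp add: card_SigmaI card_cartesian_product card_Pow)
 finally show ?thesis .
qed

context sympl begin

lemma odd4_list: "odd4 = {full3, (True, False, True), (False, True, True), (True, True, True)}"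
proof (rule set_eqI)
 fix x :: bits3
 obtain p q r where x: "x = (p, q, r)" by (cases x)
 show "x \<in> odd4 \<longleftrightarrow> x \<in> {full3, (True, False, True), (False, True, True), (True, True, True)}"
  unfolding x odd4_iff(1) by (cases p; cases q) simp_all
qed

lemma card_f_set_odd: "x \<in> odd4 ==> card (f_set x - {4}) = (if x = full3 then 3 else 1)"
 using odd4_long[of x] card_f_set(2)[of x] odd4_iff(2)[of x] by (auto simp: f_sets(5) I4_def)

lemma inj_odd: "inj_on (%x. f_set x - {4}) odd4" "inj_on (%x. e_set x - {4}) odd4"
 using odd_inj by (auto simp: inj_on_def)

lemma dim_T_f4: "vector_space.dim fs (T_f4_c3 :: (nat set => 'a tensor) set) = 14"
proof -
 have "vector_space.dim fs (T_f4_c3 :: (nat set => 'a tensor) set) = (\<Sum>\<sigma>\<in>(%x. f_set x - {4}) ` odd4. 2 ^ card \<sigma>)"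
  unfolding T_f4_c3_def S_c3_f_set image_image by (rule dim_family_space) (auto simp: odd4_list)
 also have "\<dots> = (\<Sum>x\<in>odd4. 2 ^ (if x = full3 then 3 else 1))"
  unfolding sum.reindex[OF inj_odd(1)] o_def by (rule sum.cong) (simp_all only: card_f_set_odd)
 also have "\<dots> = 14" by (simp add: odd4_list)
 finally show ?thesis .
qed

lemma dim_T_e6: "vector_space.dim fs6 (T_e6_a5 :: (nat set => elabel => 'a tensor) set) = 20"
proof -
 have "vector_space.dim fs6 (T_e6_a5 :: (nat set => elabel => 'a tensor) set) =
   (\<Sum>\<sigma>\<in>(%x. f_set x - {4}) ` odd4. card (elabels \<sigma>) * 2 ^ card \<sigma>)"
  unfolding T_e6_a5_def S_c3_f_set image_image by (rule dim_family_space6) (auto simp: odd4_list)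
 also have "\<dots> = (\<Sum>x\<in>odd4. card (elabels (f_set x - {4})) * 2 ^ (if x = full3 then 3 else 1))"
  unfolding sum.reindex[OF inj_odd(1)] o_def by (rule sum.cong) (simp_all only: card_f_set_odd)
 also have "\<dots> = (\<Sum>x\<in>odd4. (if x = full3 then 1 else 2) * 2 ^ (if x = full3 then 3 else 1))"
 proof (rule sum.cong[OF refl])
  fix x assume x: "x \<in> odd4"
  have "card (elabels (f_set x - {4})) = (if x = full3 then 1 else 2)"
  proof (cases "x = full3")
   case True
   have "I4 - {4} = {1, 2, 3}" by (auto simp: I4_def)
   then show ?thesis using True by (simp add: f_sets(5) elabels_def)
  next
   case False
   then have c: "card (f_set x - {4}) = 1" using card_f_set_odd[OF x] by simp
   have "f_set x - {4} ~= A" if "card A ~= 1" for A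
   proof
    assume "f_set x - {4} = A"
    then show False using c that by simp
   qed
   from this[of "{1, 2, 3}"] this[of "{1, 2, 3, 4}"]
   have "f_set x - {4} ~= {1, 2, 3}" "f_set x - {4} ~= {1, 2, 3, 4}" by simp_all
   then show ?thesis using False by (simp add: elabels_def)
  qed
  then show "card (elabels (f_set x - {4})) * 2 ^ (if x = full3 then 3 else 1) = (if x = full3 then 1 else 2) * 2 ^ (if x = full3 then 3 else (1::nat))" by simp
 qed
 also have "\<dots> = 20" by (simp add: odd4_list)
 finally show ?thesis .
qed

lemma dim_T_e7: "vector_space.dim fs (T_e7_d6 :: (nat set => 'a tensor) set) = 32"
proof -
 have "vector_space.dim fs (T_e7_d6 :: (nat set => 'a tensor) set) = (\<Sum>\<sigma>\<in>(%x. e_set x - {4}) ` odd4. 2 ^ card \<sigma>)"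
  unfolding T_e7_odd by (rule dim_family_space) (auto simp: odd4_list)
 also have "\<dots> = (\<Sum>x\<in>odd4. 2 ^ 3)"
  unfolding sum.reindex[OF inj_odd(2)] o_def
 proof (rule sum.cong[OF refl])
  fix x assume x: "x \<in> odd4"
  have "card (e_set x) = 4" by (rule e8_card) (use e_set_S_e8 odd4_nz[OF x] e_set_empty in auto)
  then show "2 ^ card (e_set x - {4}) = (2 ^ 3 :: nat)" using x odd4_iff(3)[of x] by simp
 qed
 also have "\<dots> = 32" by (simp add: odd4_list)
 finally show ?thesis .
qed

lemma dim_T_e8: "vector_space.dim fs (T_e8_e7 :: (nat set => 'a tensor) set) = 56"
proof -
 \<comment> \<open>The sets containing 8 are the quadruples with x4 = 1 other than (0,0,0,1). There
   are seven, and removing 8 leaves three factors in each: 7 times 8 is 56.\<close>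
 define B :: "bits set" where "B = (%x. (fst x, fst (snd x), snd (snd x), True)) ` (UNIV - {zero3})"
 have m8: "8 \<in> chi_set (p, q, r, s) \<longleftrightarrow> s" for p q r s by (simp add: chi_set_def)
 have inB: "x \<in> B \<longleftrightarrow> 8 \<in> chi_set x \<and> x ~= one8" for x
 proof -
  obtain p q r s where x: "x = (p, q, r, s)" by (cases x)
  show ?thesis unfolding x m8 by (auto simp: B_def image_iff intro!: bexI[of _ "(p, q, r)"])
 qed
 have S: "S_e8 - S_e7 = chi_set ` B"
 proof (rule set_eqI)
  fix \<sigma>
  show "\<sigma> \<in> S_e8 - S_e7 \<longleftrightarrow> \<sigma> \<in> chi_set ` B"
   unfolding S_e7_S_e8 using inB by (auto simp: S_e8_bits)
 qed
 have inj: "inj_on (%x. chi_set x - {8}) B"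
 proof (rule inj_onI)
  fix x y assume "x \<in> B" "y \<in> B" "chi_set x - {8} = chi_set y - {8}"
  then have "chi_set x = chi_set y" using inB by (metis insert_Diff)
  then show "x = y" unfolding inj_chi_set .
 qed
 have fB: "finite B" by (simp add: B_def)
 have card: "card (chi_set x - {8}) = 3" if "x \<in> B" for x
 proof -
  have "chi_set x \<in> S_e8" "8 \<in> chi_set x" using that inB chi_S_e8 by auto
  moreover have "chi_set x ~= {}" using \<open>8 \<in> chi_set x\<close> by blast
  ultimately show ?thesis using e8_card by simp
 qed
 have "vector_space.dim fs (T_e8_e7 :: (nat set => 'a tensor) set) = (\<Sum>\<sigma>\<in>(%x. chi_set x - {8}) ` B. 2 ^ card \<sigma>)"
  unfolding T_e8_e7_def S image_image by (rule dim_family_space) (use fB in \<open>auto simp: chi_set_def\<close>)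
 also have "\<dots> = (\<Sum>x\<in>B. 2 ^ 3)"
  unfolding sum.reindex[OF inj] o_def by (rule sum.cong) (simp_all only: card)
 also have "card B = card (UNIV - {zero3})"
  unfolding B_def by (rule card_image) (auto simp: inj_on_def)
 then have "(\<Sum>x\<in>B. 2 ^ 3) = (56 :: nat)"
  by (simp add: card_Diff_singleton UNIV_bits3)
 finally show ?thesis .
qed

end

theorem mainTheorem9:
  fixes P :: "('a::field, 'v::ab_group_add) plane"
  assumes "(2::'a) \<noteq> 0"
    and "symplectic_plane P"
  shows "freudenthal_decomposition P (es P) (bracket_e8 P) (e8 P) (e7 P) (sp_elt 8) fs T_e8_e7 (odd_elt P 8) \<and>
    freudenthal_decomposition P (es P) (bracket_e8 P) (e7 P) (d6 P) (sp_elt 4) fs T_e7_d6 (odd_elt P 4) \<and>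
    freudenthal_decomposition P (es6 P) (bracket_e6 P) (e6 P) (a5 P) (sp_elt6 4) fs6 T_e6_a5 (odd_elt6 P 4) \<and>
    freudenthal_decomposition P (es P) (bracket_f4 P) (f4 P) (c3 P) (sp_elt 4) fs T_f4_c3 (odd_elt P 4) \<and>
    (vector_space.dim fs (T_e8_e7 :: (nat set \<Rightarrow> 'a tensor) set) = 56) \<and>
    (vector_space.dim fs (T_e7_d6 :: (nat set \<Rightarrow> 'a tensor) set) = 32) \<and>
    (vector_space.dim fs6 (T_e6_a5 :: (nat set \<Rightarrow> elabel \<Rightarrow> 'a tensor) set) = 20) \<and>
    (vector_space.dim fs (T_f4_c3 :: (nat set \<Rightarrow> 'a tensor) set) = 14)"
proof -
  interpret sympl P by (rule sympl.intro[OF assms])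
  show ?thesis
    by (intro conjI decomposition_e8 decomposition_e7 decomposition_e6 decomposition_f4 dim_T_e8 dim_T_e7 dim_T_e6 dim_T_f4)
qed

end
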